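(* Let $T>0$ and work in the setting of the context. Let $g:\Omega\times[0,T]\times\mathbb{R}\times\mathbb{R}^d\to\mathbb{R}^\ell$ and, for $i=1,2$, let $(\xi^i,f^i,S^i)$ be data such that $(\xi^i,f^i,g,S^i)$ satisfy: (H1) $\xi^i$ is $\mathcal{F}_T$-measurable with $\mathbb{E}|\xi^i|^2<\infty$; (H2) $S^i\in\mathcal{S}^2(\mathbb{R})$ with $S^i_T\le\xi^i$; (H4) $f^i(\cdot,y,z)$, $g(\cdot,y,z)$ jointly measurable, $f^i(\cdot,0,0)\in\mathcal{M}^2(\mathbb{R})$, $g(\cdot,0,0)\in\mathcal{M}^2(\mathbb{R}^\ell)$, and for all $t,y_1,y_2,z_1,z_2$: $|f^i(t,y_1,z_1)-f^i(t,y_2,z_2)|^2\le\rho(t,|y_1-y_2|^2)+C\|z_1-z_2\|^2$, $\|g(t,y_1,z_1)-g(t,y_2,z_2)\|^2\le\rho(t,|y_1-y_2|^2)+\alpha\|z_1-z_2\|^2$, with constants $C>0$, $0<\alpha<1$ and $\rho$ non-random satisfying Condition A. Let $(Y^i,Z^i,K^i)\in\mathcal{S}^2(\mathbb{R})\times\mathcal{M}^2(\mathbb{R}^d)\times\mathcal{A}^2(\mathbb{R})$ be the solution of $$Y^i_t=\xi^i+\int_t^T f^i(s,Y^i_s,Z^i_s)ds+\int_t^T g(s,Y^i_s,Z^i_s)\overleftarrow{dB}_s+K^i_T-K^i_t-\int_t^T Z^i_sdW_s,\quad Y^i_t\ge S^i_t,\quad\int_0^T(Y^i_t-S^i_t)dK^i_t=0.$$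 Assume moreover (H6): (i) $\xi^1\le\xi^2$ a.s.; (ii) $f^1(t,Y^1_t,Z^1_t)\le f^2(t,Y^1_t,Z^1_t)$ a.s. for a.e. $t\in[0,T]$, or $f^1(t,Y^2_t,Z^2_t)\le f^2(t,Y^2_t,Z^2_t)$ a.s. for a.e. $t\in[0,T]$; (iii) $S^1_t\le S^2_t$ a.s. for a.e. $t\in[0,T]$. Then $Y^1_t\le Y^2_t$ a.s. for all $t\in[0,T]$.
   Context: $(\Omega_1,\mathcal{F}_1,\mathbb{P}_1)$, $(\Omega_2,\mathcal{F}_2,\mathbb{P}_2)$ are complete probability spaces carrying a $d$-dimensional Brownian motion $W$ and an $\ell$-dimensional Brownian motion $B$; $\Omega=\Omega_1\times\Omega_2$, $\mathbb{P}=\mathbb{P}_1\otimes\mathbb{P}_2$, $\mathcal{F}_t=\mathcal{F}^W_{t}\otimes\mathcal{F}^B_{t,T}$ where $\mathcal{F}^W_t=\sigma\{W_r:r\le t\}$ and $\mathcal{F}^B_{t,T}=\sigma\{B_r-B_t: t\le r\le T\}$. $\overleftarrow{dB}$ is the backward Itô integral. $\mathcal{M}^2(\mathbb{R}^k)$: jointly measurable $\mathbb{R}^k$-valued processes, $\mathcal{F}_t$-measurable for a.e. $t$, with $\mathbb{E}\int_0^T\|\varphi_t\|^2dt<\infty$; $\mathcal{S}^2(\mathbb{R})$: continuous, $\mathcal{F}_t$-measurable for each $t$, $\mathbb{E}\sup_t|\varphi_t|^2<\infty$; $\mathcal{A}^2(\mathbb{R})$: continuous increasing, $\mathcal{F}_t$-measurable,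 $\mathbb{E}|\varphi_T|^2<\infty$. Condition A on $\rho:[0,T]\times\mathbb{R}_+\to\mathbb{R}_+$: for each $t$, $\rho(t,\cdot)$ is continuous, concave, non-decreasing, $\rho(t,0)=0$; for each $u$, $\int_0^T\rho(t,u)dt<\infty$; for every $M>0$, any solution $u:[0,T]\to\mathbb{R}_+$ of $u'=-M\rho(t,u)$, $u(T)=0$ is unique and identically $0$. Under these hypotheses each of the two reflected equations has a unique solution. *)

theory Defs
  imports "HOL-Probability.Probability"
begin

definition brownian_motion :: "'w measure \<Rightarrow> (real \<Rightarrow> 'w \<Rightarrow> real^'d) \<Rightarrow> bool" where
  "brownian_motion P W \<longleftrightarrow>
     prob_space P \<and>
     (\<forall>t. W t \<in> borel_measurable P) \<and>
     (AE \<omega> in P. W 0 \<omega> = 0) \<and>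
     (AE \<omega> in P. continuous_on {0..} (\<lambda>t. W t \<omega>)) \<and>
     (\<forall>(n::nat) (ts::nat \<Rightarrow> real). 0 \<le> ts 0 \<and> (\<forall>k<n. ts k < ts (Suc k)) \<longrightarrow>
        prob_space.indep_vars P (\<lambda>_. borel)
          (\<lambda>(k, i) \<omega>. (W (ts (Suc k)) \<omega> - W (ts k) \<omega>) $ i) ({..<n} \<times> UNIV) \<and>
        (\<forall>k<n. \<forall>i. distributed P lborel (\<lambda>\<omega>. (W (ts (Suc k)) \<omega> - W (ts k) \<omega>) $ i)
                     (\<lambda>x. ennreal (normal_density 0 (sqrt (ts (Suc k) - ts k)) x))))"

section \<open>The (non-monotone) family of sigma-algebras F_t = F^W_t \<or> F^B_{t,T}, augmented by null sets\<close>

definition filt :: "'w measure \<Rightarrow> (real \<Rightarrow> 'w \<Rightarrow> real^'d) \<Rightarrow> (real \<Rightarrow> 'w \<Rightarrow> real^'l)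
    \<Rightarrow> real \<Rightarrow> real \<Rightarrow> 'w measure" where
  "filt P W B T t = sigma (space P)
     ({W r -` A \<inter> space P | r A. 0 \<le> r \<and> r \<le> t \<and> A \<in> sets borel}
      \<union> {(\<lambda>\<omega>. B r \<omega> - B t \<omega>) -` A \<inter> space P | r A. t \<le> r \<and> r \<le> T \<and> A \<in> sets borel}
      \<union> null_sets P)"

definition M2sp :: "'w measure \<Rightarrow> (real \<Rightarrow> 'w measure) \<Rightarrow> real \<Rightarrow> (real \<Rightarrow> 'w \<Rightarrow> 'v::euclidean_space) \<Rightarrow> bool" where
  "M2sp P F T \<phi> \<longleftrightarrow>
     (\<lambda>(t, \<omega>). \<phi> t \<omega>) \<in> borel_measurable (restrict_space lborel {0..T} \<Otimes>\<^sub>M P) \<and>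
     (AE t in lborel. t \<in> {0..T} \<longrightarrow> \<phi> t \<in> borel_measurable (F t)) \<and>
     integrable (restrict_space lborel {0..T} \<Otimes>\<^sub>M P) (\<lambda>(t, \<omega>). (norm (\<phi> t \<omega>))\<^sup>2)"

definition S2sp :: "'w measure \<Rightarrow> (real \<Rightarrow> 'w measure) \<Rightarrow> real \<Rightarrow> (real \<Rightarrow> 'w \<Rightarrow> real) \<Rightarrow> bool" where
  "S2sp P F T \<phi> \<longleftrightarrow>
     (\<forall>\<omega>\<in>space P. continuous_on {0..T} (\<lambda>t. \<phi> t \<omega>)) \<and>
     (\<forall>t\<in>{0..T}. \<phi> t \<in> borel_measurable (F t)) \<and>
     integrable P (\<lambda>\<omega>. (SUP t\<in>{0..T}. \<bar>\<phi> t \<omega>\<bar>)\<^sup>2)"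

definition A2sp :: "'w measure \<Rightarrow> (real \<Rightarrow> 'w measure) \<Rightarrow> real \<Rightarrow> (real \<Rightarrow> 'w \<Rightarrow> real) \<Rightarrow> bool" where
  "A2sp P F T \<phi> \<longleftrightarrow>
     (\<forall>\<omega>\<in>space P. continuous_on {0..T} (\<lambda>t. \<phi> t \<omega>) \<and> mono_on {0..T} (\<lambda>t. \<phi> t \<omega>)) \<and>
     (\<forall>t\<in>{0..T}. \<phi> t \<in> borel_measurable (F t)) \<and>
     integrable P (\<lambda>\<omega>. (\<phi> T \<omega>)\<^sup>2)"

definition partition_on :: "real \<Rightarrow> real \<Rightarrow> nat \<Rightarrow> (nat \<Rightarrow> real) \<Rightarrow> bool" where
  "partition_on a b m tt \<longleftrightarrow> tt 0 = a \<and> tt m = b \<and> (\<forall>k<m. tt k < tt (Suc k))"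

definition simple_proc :: "nat \<Rightarrow> (nat \<Rightarrow> real) \<Rightarrow> (nat \<Rightarrow> 'w \<Rightarrow> 'v::real_vector) \<Rightarrow> real \<Rightarrow> 'w \<Rightarrow> 'v" where
  "simple_proc m tt h s \<omega> = (\<Sum>k<m. indicator {tt k<..tt (Suc k)} s *\<^sub>R h k \<omega>)"

definition ito_fwd :: "'w measure \<Rightarrow> (real \<Rightarrow> 'w measure) \<Rightarrow> (real \<Rightarrow> 'w \<Rightarrow> 'v::euclidean_space)
    \<Rightarrow> real \<Rightarrow> real \<Rightarrow> (real \<Rightarrow> 'w \<Rightarrow> 'v) \<Rightarrow> ('w \<Rightarrow> real) \<Rightarrow> bool" where
  "ito_fwd P F W a b Z X \<longleftrightarrow> X \<in> borel_measurable P \<and>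
     (\<exists>(m::nat \<Rightarrow> nat) (tt::nat \<Rightarrow> nat \<Rightarrow> real) (h::nat \<Rightarrow> nat \<Rightarrow> 'w \<Rightarrow> 'v).
        (\<forall>n. partition_on a b (m n) (tt n) \<and>
             (\<forall>k<m n. h n k \<in> borel_measurable (F (tt n k)) \<and>
                       integrable P (\<lambda>\<omega>. (norm (h n k \<omega>))\<^sup>2))) \<and>
        (\<lambda>n. \<integral>\<^sup>+\<omega>. (\<integral>\<^sup>+s\<in>{a..b}. ennreal ((norm (simple_proc (m n) (tt n) (h n) s \<omega> - Z s \<omega>))\<^sup>2) \<partial>lborel) \<partial>P)
          \<longlonglongrightarrow> 0 \<and>
        (\<lambda>n. \<integral>\<^sup>+\<omega>. ennreal ((X \<omega> - (\<Sum>k<m n. h n k \<omega> \<bullet> (W (tt n (Suc k)) \<omega> - W (tt n k) \<omega>)))\<^sup>2) \<partial>P)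
          \<longlonglongrightarrow> 0)"

text \<open>Backward Ito integral: simple integrands on (t_k, t_(k+1)] are measurable w.r.t. F at the
  RIGHT endpoint (i.e. adapted to the backward filtration of B).\<close>
definition ito_bwd :: "'w measure \<Rightarrow> (real \<Rightarrow> 'w measure) \<Rightarrow> (real \<Rightarrow> 'w \<Rightarrow> 'v::euclidean_space)
    \<Rightarrow> real \<Rightarrow> real \<Rightarrow> (real \<Rightarrow> 'w \<Rightarrow> 'v) \<Rightarrow> ('w \<Rightarrow> real) \<Rightarrow> bool" where
  "ito_bwd P F B a b G X \<longleftrightarrow> X \<in> borel_measurable P \<and>
     (\<exists>(m::nat \<Rightarrow> nat) (tt::nat \<Rightarrow> nat \<Rightarrow> real) (h::nat \<Rightarrow> nat \<Rightarrow> 'w \<Rightarrow> 'v).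
        (\<forall>n. partition_on a b (m n) (tt n) \<and>
             (\<forall>k<m n. h n k \<in> borel_measurable (F (tt n (Suc k))) \<and>
                       integrable P (\<lambda>\<omega>. (norm (h n k \<omega>))\<^sup>2))) \<and>
        (\<lambda>n. \<integral>\<^sup>+\<omega>. (\<integral>\<^sup>+s\<in>{a..b}. ennreal ((norm (simple_proc (m n) (tt n) (h n) s \<omega> - G s \<omega>))\<^sup>2) \<partial>lborel) \<partial>P)
          \<longlonglongrightarrow> 0 \<and>
        (\<lambda>n. \<integral>\<^sup>+\<omega>. ennreal ((X \<omega> - (\<Sum>k<m n. h n k \<omega> \<bullet> (B (tt n (Suc k)) \<omega> - B (tt n k) \<omega>)))\<^sup>2) \<partial>P)
          \<longlonglongrightarrow> 0)"

definition condA :: "real \<Rightarrow> (real \<Rightarrow> real \<Rightarrow> real) \<Rightarrow> bool" where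
  "condA T \<rho> \<longleftrightarrow>
     (\<forall>t\<in>{0..T}. (\<forall>u\<ge>0. \<rho> t u \<ge> 0) \<and> continuous_on {0..} (\<rho> t) \<and> concave_on {0..} (\<rho> t)
                 \<and> mono_on {0..} (\<rho> t) \<and> \<rho> t 0 = 0) \<and>
     (\<forall>u\<ge>0. set_integrable lborel {0..T} (\<lambda>t. \<rho> t u)) \<and>
     (\<forall>M>0. \<forall>u::real \<Rightarrow> real.
        (\<forall>t\<in>{0..T}. u t \<ge> 0) \<and> continuous_on {0..T} u \<and>
        set_integrable lborel {0..T} (\<lambda>s. \<rho> s (u s)) \<and>
        (\<forall>t\<in>{0..T}. u t = (\<integral>s\<in>{t..T}. M * \<rho> s (u s) \<partial>lborel))
        \<longrightarrow> (\<forall>t\<in>{0..T}. u t = 0))"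

definition data_hyps :: "'w measure \<Rightarrow> (real \<Rightarrow> 'w measure) \<Rightarrow> real \<Rightarrow> (real \<Rightarrow> real \<Rightarrow> real)
    \<Rightarrow> real \<Rightarrow> real \<Rightarrow> ('w \<Rightarrow> real) \<Rightarrow> (real \<Rightarrow> 'w \<Rightarrow> real \<Rightarrow> real^'d \<Rightarrow> real)
    \<Rightarrow> (real \<Rightarrow> 'w \<Rightarrow> real \<Rightarrow> real^'d \<Rightarrow> real^'l) \<Rightarrow> (real \<Rightarrow> 'w \<Rightarrow> real) \<Rightarrow> bool" where
  "data_hyps P F T \<rho> C \<alpha> \<xi> f g S \<longleftrightarrow>
     \<comment> \<open>(H1)\<close>
     \<xi> \<in> borel_measurable (F T) \<and> integrable P (\<lambda>\<omega>. (\<xi> \<omega>)\<^sup>2) \<and>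
     \<comment> \<open>(H2)\<close>
     S2sp P F T S \<and> (AE \<omega> in P. S T \<omega> \<le> \<xi> \<omega>) \<and>
     \<comment> \<open>(H4)\<close>
     (\<forall>y z. (\<lambda>(t, \<omega>). f t \<omega> y z) \<in> borel_measurable (restrict_space lborel {0..T} \<Otimes>\<^sub>M P)) \<and>
     (\<forall>y z. (\<lambda>(t, \<omega>). g t \<omega> y z) \<in> borel_measurable (restrict_space lborel {0..T} \<Otimes>\<^sub>M P)) \<and>
     M2sp P F T (\<lambda>t \<omega>. f t \<omega> 0 0) \<and> M2sp P F T (\<lambda>t \<omega>. g t \<omega> 0 0) \<and>
     C > 0 \<and> 0 < \<alpha> \<and> \<alpha> < 1 \<and> condA T \<rho> \<and>
     (\<forall>t\<in>{0..T}. \<forall>\<omega>\<in>space P. \<forall>y1 y2 z1 z2.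
        (f t \<omega> y1 z1 - f t \<omega> y2 z2)\<^sup>2 \<le> \<rho> t ((y1 - y2)\<^sup>2) + C * (norm (z1 - z2))\<^sup>2 \<and>
        (norm (g t \<omega> y1 z1 - g t \<omega> y2 z2))\<^sup>2 \<le> \<rho> t ((y1 - y2)\<^sup>2) + \<alpha> * (norm (z1 - z2))\<^sup>2)"

definition rbdsde_solution :: "'w measure \<Rightarrow> (real \<Rightarrow> 'w \<Rightarrow> real^'d) \<Rightarrow> (real \<Rightarrow> 'w \<Rightarrow> real^'l) \<Rightarrow> real
    \<Rightarrow> ('w \<Rightarrow> real) \<Rightarrow> (real \<Rightarrow> 'w \<Rightarrow> real \<Rightarrow> real^'d \<Rightarrow> real)
    \<Rightarrow> (real \<Rightarrow> 'w \<Rightarrow> real \<Rightarrow> real^'d \<Rightarrow> real^'l) \<Rightarrow> (real \<Rightarrow> 'w \<Rightarrow> real)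
    \<Rightarrow> (real \<Rightarrow> 'w \<Rightarrow> real) \<Rightarrow> (real \<Rightarrow> 'w \<Rightarrow> real^'d) \<Rightarrow> (real \<Rightarrow> 'w \<Rightarrow> real) \<Rightarrow> bool" where
  "rbdsde_solution P W B T \<xi> f g S Y Z K \<longleftrightarrow>
     S2sp P (filt P W B T) T Y \<and> M2sp P (filt P W B T) T Z \<and> A2sp P (filt P W B T) T K \<and>
     (\<forall>t\<in>{0..T}. \<exists>IB IW.
        ito_bwd P (filt P W B T) B t T (\<lambda>s \<omega>. g s \<omega> (Y s \<omega>) (Z s \<omega>)) IB \<and>
        ito_fwd P (filt P W B T) W t T Z IW \<and>
        (AE \<omega> in P. Y t \<omega> = \<xi> \<omega> + (\<integral>s\<in>{t..T}. f s \<omega> (Y s \<omega>) (Z s \<omega>) \<partial>lborel)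
                            + IB \<omega> + K T \<omega> - K t \<omega> - IW \<omega>)) \<and>
     (\<forall>t\<in>{0..T}. AE \<omega> in P. Y t \<omega> \<ge> S t \<omega>) \<and>
     (AE \<omega> in P. (\<integral>s\<in>{0..T}. (Y s \<omega> - S s \<omega>)
                    \<partial>interval_measure (\<lambda>s. K (max 0 (min T s)) \<omega>)) = 0)"

definition prodP :: "'a measure \<Rightarrow> 'b measure \<Rightarrow> ('a \<times> 'b) measure" where
  "prodP M1 M2 = completion (M1 \<Otimes>\<^sub>M M2)"

definition liftW :: "(real \<Rightarrow> 'a \<Rightarrow> 'v) \<Rightarrow> real \<Rightarrow> 'a \<times> 'b \<Rightarrow> 'v" where
  "liftW W t \<omega> = W t (fst \<omega>)"

definition liftB :: "(real \<Rightarrow> 'b \<Rightarrow> 'v) \<Rightarrow> real \<Rightarrow> 'a \<times> 'b \<Rightarrow> 'v" where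
  "liftB B t \<omega> = B t (snd \<omega>)"

end

theory Submission
  imports Defs
begin

text \<open>
  Let \<open>Y\<close> be the difference of the two solutions. On a short interval from \<open>u\<close> to \<open>v\<close> the equation reads
  \<open>Y u + dZ = Y v + dG + dF + dK1 - dK2\<close>, where \<open>dZ\<close> is centred given the past of \<open>W\<close> up to \<open>u\<close> and \<open>dG\<close> is
  centred given the future of \<open>B\<close> from \<open>v\<close> on. A second order expansion of a convex approximation \<open>\<Phi>\<close> of the
  squared positive part, at \<open>Y u\<close> on the left and at \<open>Y v\<close> on the right, together with convexity for the finite
  variation terms, conditional isometry and summation over a grid yields
  \<open>E \<Phi>(Y t) + 1/2 E \<integral> \<Phi>''(Y) |Z|\<^sup>2 \<le> 1/2 E \<integral> \<Phi>''(Y) |G|\<^sup>2 + E \<integral> \<Phi>'(Y) f\<close>. The \<open>K1\<close> contribution vanishes by the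
  Skorokhod condition: where \<open>Y\<close> is positive the first solution lies above the second obstacle, hence above its own.
  The growth conditions absorb the \<open>Z\<close> terms since \<open>\<alpha> < 1\<close>, and Jensen's and Gronwall's inequalities give
  \<open>\<phi> t \<le> M \<integral> \<rho>(s, \<phi> s) ds\<close> for \<open>\<phi> t = E (Y t)\<^sub>+\<^sup>2\<close>. Condition A forces \<open>\<phi> = 0\<close>.
\<close>

text \<open>The sigma-algebras \<open>filt\<close> are not monotone in time: their \<open>W\<close>
  part grows while their \<open>B\<close> part shrinks, so an adapted process lives in no single
  filtration. Each of them is embedded into two monotone families, the past of \<open>W\<close>
  joined with all of \<open>B\<close> and the future of \<open>B\<close> joined with all of
  \<open>W\<close>. A value at one time belongs to both, and this dictates the two expansion points:
  the weight of the forward increment must be known at its left end, that of the backward increment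
  at its right end. It also fixes the signs: the \<open>Z\<close> square lands on the favourable
  side, the \<open>G\<close> square on the other, and the gap \<open>1 - \<alpha>\<close> pays for
  the dependence of the generator on \<open>z\<close>. The integrands are only square integrable, so
  their increments have no third moments to control a cubic Taylor remainder. The remainder is kept
  as a truncated square, and fourth moments are used only for simple approximations. Condition A
  speaks about solutions of an equation, whereas the estimate yields an inequality; a monotone
  iteration started at the subsolution closes this gap.\<close>

text \<open>Approximating \<open>Y\<close> by simple functions leaves finitely many values of the
  second argument at a time, and continuity in that argument carries measurability to the limit. It
  is needed because coefficients and \<open>\<rho>\<close> are measurable only with their remaining
  arguments frozen.\<close>

lemma caratheodory_measurable:
  fixes F :: "'x \<Rightarrow> 'y::{metric_space,second_countable_topology} \<Rightarrow> 'z::{metric_space}"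
  assumes F: "\<And>y. (\<lambda>x. F x y) \<in> borel_measurable M"
    and cont: "\<And>x. x \<in> space M \<Longrightarrow> continuous_on UNIV (F x)"
    and Y: "Y \<in> borel_measurable M"
  shows "(\<lambda>x. F x (Y x)) \<in> borel_measurable M"
proof -
  obtain s where s: "\<And>i::nat. simple_function M (s i)"
    and lim: "\<And>x. x \<in> space M \<Longrightarrow> (\<lambda>i. s i x) \<longlonglongrightarrow> Y x"
    using borel_measurable_implies_sequence_metric[OF Y, of undefined] by blast
  have "(\<lambda>x. F x (s i x)) \<in> borel_measurable M" for i
  proof -
    have "(\<lambda>x. (\<lambda>y x. F x y) (s i x) x) \<in> borel_measurable M"
    proof (rule measurable_compose_countable'[where I="s i ` space M"])
      show "s i \<in> measurable M (count_space (s i ` space M))"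
        using measurable_simple_function[OF s[of i]]
        by (auto simp: measurable_def)
      show "countable (s i ` space M)"
        using s[of i] by (auto simp: simple_function_def intro: countable_finite)
    qed (use F in auto)
    then show ?thesis by simp
  qed
  moreover have "(\<lambda>i. F x (s i x)) \<longlonglongrightarrow> F x (Y x)" if "x \<in> space M" for x
    using continuous_on_tendsto_compose[OF cont[OF that] lim[OF that]] by simp
  ultimately show ?thesis
    by (rule borel_measurable_LIMSEQ_metric)
qed

section \<open>Step approximations on equidistant grids\<close>

text \<open>For \<open>n = 0\<close> the division yields step \<open>0\<close>, so every point is
  \<open>a\<close>; statements about the end point \<open>b\<close> therefore ask for
  \<open>n > 0\<close>.\<close>

definition grid :: "real \<Rightarrow> real \<Rightarrow> nat \<Rightarrow> nat \<Rightarrow> real" where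
  "grid a b n k = a + real k * ((b - a) / real n)"

lemma grid_0 [simp]: "grid a b n 0 = a"
  by (simp add: grid_def)

lemma grid_n [simp]: "n > 0 \<Longrightarrow> grid a b n n = b"
  by (simp add: grid_def)

lemma grid_Suc: "grid a b n (Suc k) = grid a b n k + (b - a) / real n"
  by (simp add: grid_def distrib_right add_divide_distrib)

lemma grid_mono: "a \<le> b \<Longrightarrow> k \<le> l \<Longrightarrow> grid a b n k \<le> grid a b n l"
  by (simp add: grid_def mult_right_mono divide_right_mono)

lemma grid_bounds:
  assumes "a \<le> b" "k \<le> n" shows "grid a b n k \<in> {a..b}"
proof (cases "n = 0")
  case True then show ?thesis using assms by (simp add: grid_def)
next
  case False
  then show ?thesis using grid_mono[OF assms(1), of 0 k n] grid_mono[OF assms, of n] by simp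
qed

lemma sum_indicator_blocks:
  fixes g :: "nat \<Rightarrow> real"
  assumes "\<And>k. k < n \<Longrightarrow> g k \<le> g (Suc k)"
  shows "(\<Sum>k<n. indicator {g k<..g (Suc k)} x) = (indicator {g 0<..g n} x :: real)"
proof -
  have "(\<Sum>k<n. indicator {g k<..g (Suc k)} x) = (indicator {g 0<..g n} x :: real) \<and> g 0 \<le> g n"
    using assms
  proof (induction n)
    case (Suc n)
    then have "(\<Sum>k<n. indicator {g k<..g (Suc k)} x) = (indicator {g 0<..g n} x :: real)" "g 0 \<le> g n"
      "g n \<le> g (Suc n)" by auto
    then show ?case by (auto simp: indicator_def)
  qed simp
  then show ?thesis by simp
qed

lemma sum_indicator_grid:
  assumes "a \<le> b" "n > 0"
  shows "(\<Sum>k<n. indicator {grid a b n k<..grid a b n (Suc k)} x) = (indicator {a<..b} x :: real)"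
  using sum_indicator_blocks[of n "grid a b n" x] grid_mono[OF assms(1)] assms by simp

text \<open>The half-open blocks are disjoint, so at most one summand is nonzero at
  \<open>x\<close>.\<close>

lemma step_sum_abs_le:
  fixes y :: "nat \<Rightarrow> real"
  assumes "a \<le> b" "\<And>k. k < n \<Longrightarrow> x \<in> {grid a b n k<..grid a b n (Suc k)} \<Longrightarrow> \<bar>y k\<bar> \<le> D" "0 \<le> D"
  shows "\<bar>\<Sum>k<n. indicator {grid a b n k<..grid a b n (Suc k)} x * y k\<bar> \<le> D"
proof (cases "n > 0")
  case True
  have "\<bar>\<Sum>k<n. indicator {grid a b n k<..grid a b n (Suc k)} x * y k\<bar>
      \<le> (\<Sum>k<n. indicator {grid a b n k<..grid a b n (Suc k)} x * D)"
    by (rule order_trans[OF sum_abs], rule sum_mono) (use assms(2) in \<open>auto simp: indicator_def\<close>)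
  also have "\<dots> = indicator {a<..b} x * D"
    by (simp add: sum_distrib_right[symmetric] sum_indicator_grid[OF assms(1) True])
  also have "\<dots> \<le> D" using assms(3) by (auto simp: indicator_def)
  finally show ?thesis .
qed (use assms(3) in simp)

text \<open>Continuity at \<open>x\<close> makes the evaluation point inside the block immaterial.
  Leaving \<open>tau\<close> free lets forward sums (left end points) and backward sums (right end
  points) share one limit theorem.\<close>

lemma step_tendsto:
  fixes c :: "real \<Rightarrow> real"
  assumes ab: "a \<le> b" and cont: "continuous_on {a..b} c"
    and tau: "\<And>n k. k < n \<Longrightarrow> grid a b n k \<le> tau n k \<and> tau n k \<le> grid a b n (Suc k)"
  shows "(\<lambda>n. \<Sum>k<n. indicator {grid a b n k<..grid a b n (Suc k)} x * c (tau n k))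
    \<longlonglongrightarrow> indicator {a<..b} x * c x"
proof (cases "x \<in> {a<..b}")
  case False
  then have "indicator {grid a b n k<..grid a b n (Suc k)} x = (0::real)" if "k < n" for n k
    using grid_bounds[OF ab, of k n] grid_bounds[OF ab, of "Suc k" n] that by (auto simp: indicator_def)
  then have "(\<Sum>k<n. indicator {grid a b n k<..grid a b n (Suc k)} x * c (tau n k)) = 0" for n
    by simp
  then show ?thesis using False by simp
next
  case x: True
  show ?thesis
  proof (rule LIMSEQ_I)
    fix e :: real assume "e > 0"
    then obtain d where d: "d > 0" "\<And>y. y \<in> {a..b} \<Longrightarrow> dist y x < d \<Longrightarrow> dist (c y) (c x) < e/2"
      using cont x unfolding continuous_on_iff
      by (metis half_gt_zero greaterThanAtMost_iff atLeastAtMost_iff less_imp_le)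
    obtain n0 where n0: "(b - a) / d < real n0" using reals_Archimedean2 by blast
    show "\<exists>no. \<forall>n\<ge>no. norm ((\<Sum>k<n. indicator {grid a b n k<..grid a b n (Suc k)} x * c (tau n k)) -
            indicator {a<..b} x * c x) < e"
    proof (intro exI[of _ "Suc n0"] allI impI)
      fix n assume n: "Suc n0 \<le> n"
      then have np: "n > 0" by simp
      have mesh: "(b - a) / real n < d"
      proof -
        have "(b - a) / d < real n" using n0 n by linarith
        then show ?thesis using d np by (simp add: field_simps)
      qed
      have "(\<Sum>k<n. indicator {grid a b n k<..grid a b n (Suc k)} x * c (tau n k)) - indicator {a<..b} x * c x
        = (\<Sum>k<n. indicator {grid a b n k<..grid a b n (Suc k)} x * (c (tau n k) - c x))"
        unfolding sum_indicator_grid[OF ab np, symmetric]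
        by (simp only: sum_distrib_right sum_subtractf[symmetric] right_diff_distrib)
      moreover have "\<bar>\<Sum>k<n. indicator {grid a b n k<..grid a b n (Suc k)} x * (c (tau n k) - c x)\<bar> \<le> e/2"
      proof (rule step_sum_abs_le[OF ab])
        fix k assume k: "k < n" and xk: "x \<in> {grid a b n k<..grid a b n (Suc k)}"
        have "tau n k \<in> {a..b}"
          using tau[OF k] grid_bounds[OF ab, of k n] grid_bounds[OF ab, of "Suc k" n] k by auto
        moreover have "dist (tau n k) x < d"
          using tau[OF k] xk mesh by (auto simp: grid_Suc dist_real_def)
        ultimately show "\<bar>c (tau n k) - c x\<bar> \<le> e/2"
          using d(2)[of "tau n k"] by (simp add: dist_real_def)
      qed (use \<open>e > 0\<close> in simp)
      ultimately show "norm ((\<Sum>k<n. indicator {grid a b n k<..grid a b n (Suc k)} x * c (tau n k)) -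
            indicator {a<..b} x * c x) < e" using \<open>e > 0\<close> by simp
    qed
  qed
qed

text \<open>Dominated convergence for step approximations, with \<open>\<sigma>\<close> reading off
  the time coordinate: the identity for Lebesgue and Stieltjes integrals on the line,
  \<open>fst\<close> for integrals over time and probability. The second conclusion also provides
  joint measurability of continuous processes.\<close>

lemma step_integral_tendsto:
  fixes c :: "real \<Rightarrow> 'n \<Rightarrow> real" and H \<sigma> D :: "'n \<Rightarrow> real"
  assumes ab: "a \<le> b"
    and m [measurable]: "\<sigma> \<in> borel_measurable N" "H \<in> borel_measurable N"
    and cm: "\<And>r. r \<in> {a..b} \<Longrightarrow> c r \<in> borel_measurable N"
    and cont: "\<And>x. x \<in> space N \<Longrightarrow> continuous_on {a..b} (\<lambda>r. c r x)"
    and bd: "\<And>r x. r \<in> {a..b} \<Longrightarrow> x \<in> space N \<Longrightarrow> \<bar>c r x * H x\<bar> \<le> D x"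
    and D: "integrable N D"
    and tau: "\<And>n k. k < n \<Longrightarrow> grid a b n k \<le> tau n k \<and> tau n k \<le> grid a b n (Suc k)"
  shows "(\<lambda>n. \<Sum>k<n. \<integral>x. indicator {grid a b n k<..grid a b n (Suc k)} (\<sigma> x) * (c (tau n k) x * H x) \<partial>N)
    \<longlonglongrightarrow> (\<integral>x. indicator {a<..b} (\<sigma> x) * (c (\<sigma> x) x * H x) \<partial>N)" (is "?L \<longlonglongrightarrow> ?R")
    and "integrable N (\<lambda>x. indicator {a<..b} (\<sigma> x) * (c (\<sigma> x) x * H x))"
    and "k < n \<Longrightarrow> integrable N (\<lambda>x. indicator {grid a b n k<..grid a b n (Suc k)} (\<sigma> x) * (c (tau n k) x * H x))"
proof -
  have tin: "tau n k \<in> {a..b}" if "k < n" for n k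
    using tau[OF that] grid_bounds[OF ab, of k n] grid_bounds[OF ab, of "Suc k" n] that by auto
  define S where "S = (\<lambda>n x. \<Sum>k<n. indicator {grid a b n k<..grid a b n (Suc k)} (\<sigma> x) * (c (tau n k) x * H x))"
  have Sm: "S n \<in> borel_measurable N" for n
    unfolding S_def using cm[OF tin] by (intro borel_measurable_sum borel_measurable_times) auto
  have lim: "(\<lambda>n. S n x) \<longlonglongrightarrow> indicator {a<..b} (\<sigma> x) * (c (\<sigma> x) x * H x)" if "x \<in> space N" for x
    using tendsto_mult[OF step_tendsto[OF ab cont[OF that] tau] tendsto_const[of "H x"]]
    by (simp add: S_def sum_distrib_right mult.assoc)
  have limm: "(\<lambda>x. indicator {a<..b} (\<sigma> x) * (c (\<sigma> x) x * H x)) \<in> borel_measurable N"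
    by (rule borel_measurable_LIMSEQ_metric[OF Sm lim])
  have Sb: "norm (S n x) \<le> D x" if "x \<in> space N" for n x
    unfolding S_def real_norm_def
  proof (rule step_sum_abs_le[OF ab])
    show "0 \<le> D x" using bd[OF _ that, of a] ab by (smt (verit) atLeastAtMost_iff)
  qed (use bd[OF tin that] in auto)
  show int: "k < n \<Longrightarrow> integrable N (\<lambda>x. indicator {grid a b n k<..grid a b n (Suc k)} (\<sigma> x) * (c (tau n k) x * H x))" for k n
  proof (rule Bochner_Integration.integrable_bound[OF D])
    assume k: "k < n"
    show "(\<lambda>x. indicator {grid a b n k<..grid a b n (Suc k)} (\<sigma> x) * (c (tau n k) x * H x)) \<in> borel_measurable N"
      using cm[OF tin[OF k]] by measurable
    show "AE x in N. norm (indicator {grid a b n k<..grid a b n (Suc k)} (\<sigma> x) * (c (tau n k) x * H x)) \<le> norm (D x)"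
      using bd[OF tin[OF k]] by (intro AE_I2) (force simp: indicator_def)
  qed
  have "(\<lambda>n. integral\<^sup>L N (S n)) \<longlonglongrightarrow> ?R"
    by (rule integral_dominated_convergence[OF limm Sm D]) (use lim Sb in auto)
  moreover have "integral\<^sup>L N (S n) = ?L n" for n
    unfolding S_def by (rule Bochner_Integration.integral_sum) (use int in auto)
  ultimately show "?L \<longlonglongrightarrow> ?R" by simp
  show "integrable N (\<lambda>x. indicator {a<..b} (\<sigma> x) * (c (\<sigma> x) x * H x))"
    by (rule integrable_dominated_convergence[OF limm Sm D, of "\<lambda>n. n"]) (use lim Sb in auto)
qed

lemma set_integral_singleton_zero: "(LINT s:{T..T::real}|lborel. f s :: real) = 0"
  unfolding set_lebesgue_integral_def
proof (rule integral_eq_zero_AE)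
  show "AE s in lborel. indicator {T..T} s *\<^sub>R f s = 0"
    using AE_lborel_singleton[of T] by eventually_elim (auto simp: indicator_def)
qed

section \<open>Gronwall and Osgood type inequalities backwards in time\<close>

lemma continuous_on_tail_integral:
  fixes r :: "real \<Rightarrow> real"
  assumes "set_integrable lborel {a..b} r"
  shows "continuous_on {a..b} (\<lambda>t. LINT s:{t..b}|lborel. r s)"
proof -
  have *: "set_integrable lborel {t..b} r" if "t \<in> {a..b}" for t
    by (rule set_integrable_subset[OF assms]) (use that in auto)
  have "continuous_on {a..b} (\<lambda>t. integral {t..b} r)"
    by (rule indefinite_integral_continuous_1') (rule set_borel_integral_eq_integral(1)[OF assms])
  then show ?thesis
    by (rule continuous_on_eq) (simp add: set_borel_integral_eq_integral(2)[OF *])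
qed

lemma tail_integral_split:
  fixes r :: "real \<Rightarrow> real"
  assumes "set_integrable lborel {a..c} r" "a \<le> b" "b \<le> c"
  shows "(LINT s:{a..c}|lborel. r s) - (LINT s:{b..c}|lborel. r s) = (LINT s:{a<..b}|lborel. r s)"
proof -
  have i: "set_integrable lborel {a<..b} r" "set_integrable lborel {b..c} r" "set_integrable lborel {b<..c} r"
    "set_integrable lborel {a<..c} r"
    by (rule set_integrable_subset[OF assms(1)]; use assms in auto)+
  have "AE s in lborel. s \<noteq> a" "AE s in lborel. s \<noteq> b"
    by (rule AE_lborel_singleton)+
  then have "AE s in lborel. indicator {a..c} s *\<^sub>R r s - indicator {b..c} s *\<^sub>R r s = indicator {a<..b} s *\<^sub>R r s"
    by eventually_elim (use assms in \<open>auto simp: indicator_def\<close>)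
  then have "(LBINT s. indicator {a..c} s *\<^sub>R r s - indicator {b..c} s *\<^sub>R r s) = (LBINT s. indicator {a<..b} s *\<^sub>R r s)"
    using assms(1) i unfolding set_integrable_def by (intro integral_cong_AE) auto
  then show ?thesis
    using assms(1) i unfolding set_lebesgue_integral_def set_integrable_def
    by (subst (asm) Bochner_Integration.integral_diff) auto
qed

text \<open>Formally \<open>r * exp (2 * R)\<close> is minus half the derivative of
  \<open>exp (2 * R)\<close>. As \<open>r\<close> is merely integrable, the bound is read off
  Riemann sums instead: on each block \<open>1 + x \<le> exp x\<close> bounds the term by half the
  drop of \<open>exp (2 * R)\<close>, and the drops telescope. Right end points give the inequality
  the required direction because \<open>R\<close> decreases.\<close>

lemma exp_tail_integral_le:
  fixes r :: "real \<Rightarrow> real"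
  assumes r: "set_integrable lborel {a..b} r" and r0: "\<And>s. s \<in> {a..b} \<Longrightarrow> 0 \<le> r s" and t: "t \<in> {a..b}"
  defines "R \<equiv> \<lambda>t. LINT s:{t..b}|lborel. r s"
  shows "set_integrable lborel {t..b} (\<lambda>s. r s * exp (2 * R s))"
    and "(LINT s:{t..b}|lborel. r s * exp (2 * R s)) \<le> (exp (2 * R t) - 1) / 2"
proof -
  have tb: "t \<le> b" using t by simp
  have rt: "set_integrable lborel {t..b} r"
    by (rule set_integrable_subset[OF r]) (use t in auto)
  have Rc: "continuous_on {t..b} R"
    unfolding R_def by (rule continuous_on_tail_integral[OF rt])
  have Rb: "0 \<le> R s" "R s \<le> R t" if "s \<in> {t..b}" for s
  proof -
    show "0 \<le> R s" unfolding R_def set_lebesgue_integral_def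
      by (rule Bochner_Integration.integral_nonneg) (use r0 that t in \<open>auto simp: indicator_def\<close>)
    have "R t - R s = (LINT s:{t<..s}|lborel. r s)"
      unfolding R_def by (rule tail_integral_split[OF rt]) (use that in auto)
    also have "\<dots> \<ge> 0" unfolding set_lebesgue_integral_def
      by (rule Bochner_Integration.integral_nonneg) (use r0 that t in \<open>auto simp: indicator_def\<close>)
    finally show "R s \<le> R t" by simp
  qed
  let ?c = "\<lambda>u (x::real). exp (2 * R u)"
  let ?H = "\<lambda>x. indicator {t..b} x * r x"
  have Hi: "integrable lborel ?H" using rt by (simp add: set_integrable_def)
  note st = step_integral_tendsto[where N=lborel and \<sigma>="\<lambda>x. x" and c="?c" and H="?H" and a=t and b=b
     and D="\<lambda>x. exp (2 * R t) * ?H x" and tau="\<lambda>n k. grid t b n (Suc k)", OF tb _ _ _ _ _ _ conjI]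
  have bd: "\<bar>?c u x * ?H x\<bar> \<le> exp (2 * R t) * ?H x" if "u \<in> {t..b}" for u x
    using Rb(2)[OF that] r0[of x] t by (auto simp: indicator_def abs_mult intro!: mult_right_mono)
  have lim: "(\<lambda>n. \<Sum>k<n. \<integral>x. indicator {grid t b n k<..grid t b n (Suc k)} x * (?c (grid t b n (Suc k)) x * ?H x) \<partial>lborel)
    \<longlonglongrightarrow> (\<integral>x. indicator {t<..b} x * (?c x x * ?H x) \<partial>lborel)"
    by (rule st(1)) (use Hi Rc bd grid_mono[OF tb] in \<open>auto intro!: continuous_intros borel_measurable_integrable\<close>)
  have int: "integrable lborel (\<lambda>x. indicator {t<..b} x * (?c x x * ?H x))"
    by (rule st(2)) (use Hi Rc bd grid_mono[OF tb] in \<open>auto intro!: continuous_intros borel_measurable_integrable\<close>)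
  have ae: "AE x in lborel. indicator {t<..b} x * (?c x x * ?H x) = indicator {t..b} x *\<^sub>R (r x * exp (2 * R x))"
    using AE_lborel_singleton[of t] by eventually_elim (auto simp: indicator_def)
  have cm: "set_borel_measurable lborel {t..b} (\<lambda>s. exp (2 * R s))"
  proof -
    have "continuous_on {t..b} (\<lambda>s. exp (2 * R s))" by (intro continuous_intros Rc)
    then have "(\<lambda>x. indicator {t..b} x *\<^sub>R exp (2 * R x)) \<in> borel_measurable borel"
      by (intro borel_measurable_continuous_on_indicator) auto
    then show ?thesis by (simp add: set_borel_measurable_def)
  qed
  have mm: "(\<lambda>x. indicator {t..b} x *\<^sub>R (r x * exp (2 * R x))) \<in> borel_measurable lborel"
  proof -
    have "(\<lambda>x. (indicator {t..b} x *\<^sub>R r x) * (indicator {t..b} x *\<^sub>R exp (2 * R x))) \<in> borel_measurable lborel"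
      using rt cm unfolding set_integrable_def set_borel_measurable_def by measurable
    also have "(\<lambda>x. (indicator {t..b} x *\<^sub>R r x) * (indicator {t..b} x *\<^sub>R exp (2 * R x)))
      = (\<lambda>x. indicator {t..b} x *\<^sub>R (r x * exp (2 * R x)))" by (auto simp: indicator_def)
    finally show ?thesis .
  qed
  have "integrable lborel (\<lambda>x. indicator {t..b} x *\<^sub>R (r x * exp (2 * R x)))"
    by (rule integrable_cong_AE_imp[OF int mm]) (use ae in eventually_elim, simp)
  then show "set_integrable lborel {t..b} (\<lambda>s. r s * exp (2 * R s))" by (simp add: set_integrable_def)
  have lim2: "(\<integral>x. indicator {t<..b} x * (?c x x * ?H x) \<partial>lborel) = (LINT s:{t..b}|lborel. r s * exp (2 * R s))"
    unfolding set_lebesgue_integral_def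
    by (rule integral_cong_AE) (use ae mm int in auto)
  have block: "(\<integral>x. indicator {grid t b n k<..grid t b n (Suc k)} x * (?c (grid t b n (Suc k)) x * ?H x) \<partial>lborel)
      \<le> (exp (2 * R (grid t b n k)) - exp (2 * R (grid t b n (Suc k)))) / 2" if k: "k < n" for n k
  proof -
    let ?u = "grid t b n k" and ?v = "grid t b n (Suc k)"
    have uv: "?u \<in> {t..b}" "?v \<in> {t..b}" "?u \<le> ?v"
      using grid_bounds[OF tb, of k n] grid_bounds[OF tb, of "Suc k" n] grid_mono[OF tb, of k "Suc k" n] k by auto
    have "(\<integral>x. indicator {?u<..?v} x * (?c ?v x * ?H x) \<partial>lborel) = (\<integral>x. exp (2 * R ?v) * (indicator {?u<..?v} x *\<^sub>R r x) \<partial>lborel)"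
      by (rule Bochner_Integration.integral_cong) (use uv in \<open>auto simp: indicator_def\<close>)
    also have "\<dots> = exp (2 * R ?v) * (R ?u - R ?v)"
      unfolding R_def
      by (subst tail_integral_split) (use uv in \<open>auto intro!: set_integrable_subset[OF rt] simp: set_lebesgue_integral_def\<close>)
    also have "\<dots> \<le> (exp (2 * R ?u) - exp (2 * R ?v)) / 2"
    proof -
      have "1 + 2 * (R ?u - R ?v) \<le> exp (2 * (R ?u - R ?v))" by (rule exp_ge_add_one_self)
      then have "exp (2 * R ?v) * (1 + 2 * (R ?u - R ?v)) \<le> exp (2 * R ?v) * exp (2 * (R ?u - R ?v))"
        by (rule mult_left_mono) simp
      also have "\<dots> = exp (2 * R ?u)" by (simp add: exp_add[symmetric] algebra_simps)
      finally show ?thesis by (simp add: algebra_simps)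
    qed
    finally show ?thesis .
  qed
  have Rend: "R b = 0"
    unfolding R_def set_lebesgue_integral_def
  proof (rule integral_eq_zero_AE)
    show "AE s in lborel. indicator {b..b} s *\<^sub>R r s = 0"
      using AE_lborel_singleton[of b] by eventually_elim (auto simp: indicator_def)
  qed
  have "(\<Sum>k<n. \<integral>x. indicator {grid t b n k<..grid t b n (Suc k)} x * (?c (grid t b n (Suc k)) x * ?H x) \<partial>lborel)
     \<le> (exp (2 * R t) - 1) / 2" if "n > 0" for n
  proof -
    have "(\<Sum>k<n. \<integral>x. indicator {grid t b n k<..grid t b n (Suc k)} x * (?c (grid t b n (Suc k)) x * ?H x) \<partial>lborel)
      \<le> (\<Sum>k<n. (exp (2 * R (grid t b n k)) - exp (2 * R (grid t b n (Suc k)))) / 2)"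
      by (rule sum_mono) (use block in auto)
    also have "\<dots> = (exp (2 * R t) - 1) / 2"
      using sum_lessThan_telescope'[of "\<lambda>k. exp (2 * R (grid t b n k))" n] that Rend
      by (simp add: sum_divide_distrib[symmetric])
    finally show ?thesis .
  qed
  then show "(LINT s:{t..b}|lborel. r s * exp (2 * R s)) \<le> (exp (2 * R t) - 1) / 2"
    by (intro LIMSEQ_le_const2[OF lim[unfolded lim2]] exI[of _ "Suc 0"]) auto
qed

text \<open>In the supremum weighted by \<open>exp (- (2 * R t))\<close> the integral operator
  contracts by the factor \<open>1 / 2\<close>, which is the purpose of the \<open>2\<close> in the
  exponent. Hence the weighted supremum \<open>c\<close> satisfies \<open>c \<le> A + c / 2\<close>,
  and the bound \<open>D\<close> on \<open>v\<close> makes \<open>c\<close> finite, so that it can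
  be absorbed.\<close>

lemma gronwall_tail:
  fixes r v :: "real \<Rightarrow> real"
  assumes r: "set_integrable lborel {a..b} r" and r0: "\<And>s. s \<in> {a..b} \<Longrightarrow> 0 \<le> r s"
    and ab: "a \<le> b" and A: "0 \<le> A"
    and v: "set_integrable lborel {a..b} (\<lambda>s. r s * v s)" "\<And>t. t \<in> {a..b} \<Longrightarrow> 0 \<le> v t \<and> v t \<le> D"
    and le: "\<And>t. t \<in> {a..b} \<Longrightarrow> v t \<le> A + (LINT s:{t..b}|lborel. r s * v s)"
  shows "v a \<le> 2 * A * exp (2 * (LINT s:{a..b}|lborel. r s))"
proof -
  define R where "R = (\<lambda>t. LINT s:{t..b}|lborel. r s)"
  have Rpos: "0 \<le> R s" if "s \<in> {a..b}" for s
    unfolding R_def set_lebesgue_integral_def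
      by (rule Bochner_Integration.integral_nonneg) (use r0 that in \<open>auto simp: indicator_def\<close>)
  define c where "c = (SUP t\<in>{a..b}. v t * exp (- (2 * R t)))"
  have bd: "v t * exp (- (2 * R t)) \<le> D" if "t \<in> {a..b}" for t
  proof -
    have "v t * exp (- (2 * R t)) \<le> v t * 1"
      by (rule mult_left_mono) (use v(2)[OF that] Rpos[OF that] in auto)
    then show ?thesis using v(2)[OF that] by simp
  qed
  have up: "v t * exp (- (2 * R t)) \<le> c" if "t \<in> {a..b}" for t
    unfolding c_def by (rule cSUP_upper[OF that]) (use bd in \<open>auto intro!: bdd_aboveI2[where M=D]\<close>)
  have c0: "0 \<le> c" using up[of a] v(2)[of a] ab by (smt (verit) atLeastAtMost_iff exp_ge_zero mult_nonneg_nonneg)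
  have "v t * exp (- (2 * R t)) \<le> A + c / 2" if t: "t \<in> {a..b}" for t
  proof -
    have Rt: "(LINT s:{t..b}|lborel. r s) = R t" for t by (simp add: R_def)
    note E = exp_tail_integral_le[OF r r0 t, unfolded Rt]
    have "(LINT s:{t..b}|lborel. r s * v s) \<le> (LINT s:{t..b}|lborel. c * (r s * exp (2 * R s)))"
    proof (rule set_integral_mono)
      show "set_integrable lborel {t..b} (\<lambda>s. r s * v s)" by (rule set_integrable_subset[OF v(1)]) (use t in auto)
      show "set_integrable lborel {t..b} (\<lambda>s. c * (r s * exp (2 * R s)))" using E(1) by simp
      fix s assume s: "s \<in> {t..b}"
      then have s': "s \<in> {a..b}" using t by auto
      have "v s = (v s * exp (- (2 * R s))) * exp (2 * R s)" by (simp add: exp_minus)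
      also have "\<dots> \<le> c * exp (2 * R s)" by (rule mult_right_mono[OF up[OF s']]) simp
      finally have "r s * v s \<le> r s * (c * exp (2 * R s))" by (rule mult_left_mono) (use r0[OF s'] in simp)
      then show "r s * v s \<le> c * (r s * exp (2 * R s))" by (simp add: mult_ac)
    qed
    also have "\<dots> = c * (LINT s:{t..b}|lborel. r s * exp (2 * R s))" by simp
    also have "\<dots> \<le> c * ((exp (2 * R t) - 1) / 2)" by (rule mult_left_mono[OF E(2) c0])
    finally have "v t \<le> A + c * ((exp (2 * R t) - 1) / 2)" using le[OF t] by simp
    also have "\<dots> \<le> (A + c / 2) * exp (2 * R t)"
    proof -
      have "A * 1 \<le> A * exp (2 * R t)" by (rule mult_left_mono) (use A Rpos[OF t] in auto)
      then show ?thesis using c0 by (simp add: field_simps)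
    qed
    finally have "v t * exp (- (2 * R t)) \<le> (A + c / 2) * exp (2 * R t) * exp (- (2 * R t))"
      by (rule mult_right_mono) simp
    then show ?thesis by (simp add: mult.assoc exp_add[symmetric])
  qed
  then have "c \<le> A + c / 2" unfolding c_def[symmetric]
    by (subst c_def, intro cSUP_least) (use ab in auto)
  then have "v a * exp (- (2 * R a)) \<le> 2 * A" using up[of a] ab by simp
  then have "v a * exp (- (2 * R a)) * exp (2 * R a) \<le> 2 * A * exp (2 * R a)"
    by (rule mult_right_mono) simp
  then show ?thesis by (simp add: mult.assoc exp_add[symmetric] R_def)
qed

section \<open>Consequences of Condition A\<close>

text \<open>The linear growth bound comes from concavity: by \<open>\<rho> t 0 = 0\<close> the slope
  \<open>\<rho> t u / u\<close> decreases, so beyond \<open>1\<close> it is at most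
  \<open>\<rho> t 1\<close>; below \<open>1\<close> monotonicity suffices. With
  \<open>\<rho> t 1\<close> integrable in time, this supplies every integrable majorant for
  \<open>\<rho>\<close>.\<close>

lemma condA_D:
  assumes "condA T \<rho>" "t \<in> {0..T}"
  shows condA_nonneg: "u \<ge> 0 \<Longrightarrow> \<rho> t u \<ge> 0"
    and condA_cont: "continuous_on {0..} (\<rho> t)"
    and condA_mono: "0 \<le> u \<Longrightarrow> u \<le> v \<Longrightarrow> \<rho> t u \<le> \<rho> t v"
    and condA_zero: "\<rho> t 0 = 0"
    and condA_concave: "concave_on {0..} (\<rho> t)"
    and condA_growth: "u \<ge> 0 \<Longrightarrow> \<rho> t u \<le> \<rho> t 1 * (1 + u)"
proof -
  show nn: "u \<ge> 0 \<Longrightarrow> \<rho> t u \<ge> 0" for u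
    using assms unfolding condA_def by auto
  show mono: "0 \<le> u \<Longrightarrow> u \<le> v \<Longrightarrow> \<rho> t u \<le> \<rho> t v" for u v
    using assms unfolding condA_def by (auto simp: mono_on_def)
  show "continuous_on {0..} (\<rho> t)" and z: "\<rho> t 0 = 0" and cc: "concave_on {0..} (\<rho> t)"
    using assms unfolding condA_def by auto
  assume u: "u \<ge> 0"
  show "\<rho> t u \<le> \<rho> t 1 * (1 + u)"
  proof (cases "u \<le> 1")
    case True
    then have "\<rho> t u \<le> \<rho> t 1 * 1" using mono[of u 1] u by simp
    also have "\<dots> \<le> \<rho> t 1 * (1 + u)" using nn[of 1] u by (intro mult_left_mono) auto
    finally show ?thesis .
  next
    case False
    have "(1 - 1/u) * \<rho> t 0 + (1/u) * \<rho> t u \<le> \<rho> t ((1 - 1/u) *\<^sub>R 0 + (1/u) *\<^sub>R u)"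
      using concave_onD[OF cc, of "1/u" 0 u] False by auto
    then have "\<rho> t u \<le> u * \<rho> t 1" using False z by (simp add: field_simps)
    then show ?thesis using nn[of 1] by (simp add: algebra_simps)
  qed
qed

text \<open>Condition A gives measurability in time only for each fixed \<open>u\<close>, through
  integrability; continuity in \<open>u\<close> makes \<open>\<rho>\<close> a Caratheodory function.
  Composing with \<open>max 0\<close> extends it continuously to negative arguments.\<close>

lemma condA_measurable:
  assumes "condA T \<rho>"
    and s: "s \<in> borel_measurable N" "\<And>x. x \<in> space N \<Longrightarrow> s x \<in> {0..T}"
    and v: "v \<in> borel_measurable N" "\<And>x. x \<in> space N \<Longrightarrow> 0 \<le> v x"
  shows "(\<lambda>x. \<rho> (s x) (v x)) \<in> borel_measurable N"
proof -
  have "(\<lambda>x. (\<lambda>x u. \<rho> (s x) (max 0 u)) x (v x)) \<in> borel_measurable N"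
  proof (rule caratheodory_measurable[where F="\<lambda>x u. \<rho> (s x) (max 0 u)"])
    fix u :: real
    have "set_integrable lborel {0..T} (\<lambda>t. \<rho> t (max 0 u))" using assms(1) unfolding condA_def by simp
    then have "(\<lambda>t. indicator {0..T} t *\<^sub>R \<rho> t (max 0 u)) \<in> borel_measurable borel"
      unfolding set_integrable_def using borel_measurable_integrable by fastforce
    from measurable_compose[OF s(1) this]
    show "(\<lambda>x. \<rho> (s x) (max 0 u)) \<in> borel_measurable N"
      by (rule measurable_cong[THEN iffD1, rotated]) (use s(2) in auto)
  next
    fix x assume "x \<in> space N"
    then show "continuous_on UNIV (\<lambda>u. \<rho> (s x) (max 0 u))"
      by (intro continuous_on_compose2[OF condA_cont[OF assms(1) s(2)]] continuous_intros) auto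
  qed (rule v)
  then show ?thesis
    by (rule measurable_cong[THEN iffD1, rotated]) (use v(2) in \<open>auto simp: max_def\<close>)
qed

lemma condA_set_integrable:
  assumes A: "condA T \<rho>" and t: "t \<in> {0..T}"
    and v: "v \<in> borel_measurable (restrict_space lborel {0..T})" "\<And>s. s \<in> {0..T} \<Longrightarrow> 0 \<le> v s \<and> v s \<le> D"
  shows "set_integrable lborel {t..T} (\<lambda>s. \<rho> s (v s))"
proof -
  have "(\<lambda>s. \<rho> s (v s)) \<in> borel_measurable (restrict_space lborel {0..T})"
    by (rule condA_measurable[OF A]) (use v in \<open>auto simp: space_restrict_space intro!: measurable_restrict_space1\<close>)
  then have m: "(\<lambda>s. indicator {0..T} s *\<^sub>R \<rho> s (v s)) \<in> borel_measurable lborel"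
    by (subst (asm) borel_measurable_restrict_space_iff) auto
  have i1: "integrable lborel (\<lambda>s. indicator {0..T} s *\<^sub>R \<rho> s 1)"
    using A unfolding condA_def set_integrable_def by simp
  have i: "integrable lborel (\<lambda>s. (1 + D) * (indicator {0..T} s *\<^sub>R \<rho> s 1))"
    using i1 by (rule Bochner_Integration.integrable_mult_right)
  have "set_integrable lborel {0..T} (\<lambda>s. \<rho> s (v s))"
    unfolding set_integrable_def
  proof (rule Bochner_Integration.integrable_bound[OF i m], rule AE_I2)
    fix s
    show "norm (indicator {0..T} s *\<^sub>R \<rho> s (v s)) \<le> norm ((1 + D) * (indicator {0..T} s *\<^sub>R \<rho> s 1))"
    proof (cases "s \<in> {0..T}")
      case True
      have "\<rho> s (v s) \<le> \<rho> s 1 * (1 + v s)" by (rule condA_growth[OF A True]) (use v(2)[OF True] in simp)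
      also have "\<dots> \<le> \<rho> s 1 * (1 + D)"
        by (rule mult_left_mono) (use v(2)[OF True] condA_nonneg[OF A True, of 1] in auto)
      finally show ?thesis using True condA_nonneg[OF A True, of "v s"] v(2)[OF True] by (simp add: mult.commute)
    qed simp
  qed
  then show ?thesis by (rule set_integrable_subset) (use t in auto)
qed

text \<open>Condition A excludes nonzero solutions of the equation, while \<open>\<phi>\<close> only
  satisfies an inequality. The iterates \<open>U n\<close> of the integral operator started at
  \<open>\<phi>\<close> increase because \<open>\<rho>\<close> is monotone, stay below a fixed bound
  because \<open>\<rho>\<close> grows at most linearly, and converge to a genuine solution. That
  solution vanishes and dominates \<open>\<phi>\<close>.\<close>

lemma osgood_zero:
  assumes A: "condA T \<rho>" and M: "M > 0"
    and v: "\<phi> \<in> borel_measurable (restrict_space lborel {0..T})" "\<And>s. s \<in> {0..T} \<Longrightarrow> 0 \<le> \<phi> s \<and> \<phi> s \<le> D"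
    and le: "\<And>t. t \<in> {0..T} \<Longrightarrow> \<phi> t \<le> M * (LINT s:{t..T}|lborel. \<rho> s (\<phi> s))"
    and t0: "t \<in> {0..T}"
  shows "\<phi> t = 0"
proof -
  define r where "r = (\<lambda>s. M * \<rho> s 1)"
  have r: "set_integrable lborel {0..T} r"
    using A unfolding condA_def r_def by simp
  have r0: "0 \<le> r s" if "s \<in> {0..T}" for s using condA_nonneg[OF A that, of 1] M by (simp add: r_def)
  define R where "R = (\<lambda>t. LINT s:{t..T}|lborel. r s)"
  have Rpos: "0 \<le> R s" if "s \<in> {0..T}" for s
    unfolding R_def set_lebesgue_integral_def
      by (rule Bochner_Integration.integral_nonneg) (use r0 that in \<open>auto simp: indicator_def\<close>)
  have R0: "R s \<le> R 0" if "s \<in> {0..T}" for s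
  proof -
    have "R 0 - R s = (LINT s:{0<..s}|lborel. r s)"
      unfolding R_def by (rule tail_integral_split[OF r]) (use that in auto)
    also have "\<dots> \<ge> 0" unfolding set_lebesgue_integral_def
      by (rule Bochner_Integration.integral_nonneg) (use r0 that in \<open>auto simp: indicator_def\<close>)
    finally show ?thesis by simp
  qed
  \<comment> \<open>At least \<open>1 + D\<close>, so that the bound holds for the first iterate,
    and at least \<open>2\<close>, so that \<open>1 - A' / 2 \<le> 0\<close> closes the induction
    step.\<close>
  define A' where "A' = max 2 (1 + D)"
  have A'2: "2 \<le> A'" by (simp add: A'_def)
  define D' where "D' = A' * exp (2 * R 0)"
  define U where "U = rec_nat \<phi> (\<lambda>_ u t. M * (LINT s:{t..T}|lborel. \<rho> s (u s)))"
  have U0: "U 0 = \<phi>" and US: "U (Suc n) t = M * (LINT s:{t..T}|lborel. \<rho> s (U n s))" for n t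
    by (auto simp: U_def)
  \<comment> \<open>The invariant bounds \<open>1 + U n s\<close> because the growth bound of
    \<open>\<rho>\<close> is linear in exactly this quantity. The weight
    \<open>exp (2 * R s)\<close> reproduces itself under integration against \<open>r\<close> with a
    factor \<open>1 / 2\<close> to spare.\<close>
  have inv: "U n \<in> borel_measurable (restrict_space lborel {0..T}) \<and>
      (\<forall>s\<in>{0..T}. 0 \<le> U n s \<and> 1 + U n s \<le> A' * exp (2 * R s))" for n
  proof (induction n)
    case 0
    have "1 + \<phi> s \<le> A' * exp (2 * R s)" if "s \<in> {0..T}" for s
    proof -
      have "1 + D \<le> A'" by (simp add: A'_def)
      then have "1 + \<phi> s \<le> A' * 1" using v(2)[OF that] by simp
      also have "\<dots> \<le> A' * exp (2 * R s)" by (rule mult_left_mono) (use Rpos[OF that] in \<open>auto simp: A'_def\<close>)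
      finally show ?thesis .
    qed
    then show ?case using v by (auto simp: U0)
  next
    case (Suc n)
    have UD: "0 \<le> U n s \<and> U n s \<le> D'" if "s \<in> {0..T}" for s
    proof -
      have "A' * exp (2 * R s) \<le> D'" unfolding D'_def
        by (rule mult_left_mono) (use R0[OF that] in \<open>auto simp: A'_def\<close>)
      then show ?thesis using Suc that by force
    qed
    have Um: "U n \<in> borel_measurable (restrict_space lborel {0..T})" using Suc by simp
    have I: "set_integrable lborel {t..T} (\<lambda>s. \<rho> s (U n s))" if "t \<in> {0..T}" for t
      by (rule condA_set_integrable[OF A that Um UD])
    have cont: "continuous_on {0..T} (U (Suc n))" if "0 \<le> T"
      unfolding US by (intro continuous_intros continuous_on_tail_integral I) (use that in auto)
    have m: "U (Suc n) \<in> borel_measurable (restrict_space lborel {0..T})"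
    proof (cases "0 \<le> T")
      case True
      have "U (Suc n) \<in> borel_measurable (restrict_space borel {0..T})"
        by (rule borel_measurable_continuous_on_restrict[OF cont[OF True]])
      then show ?thesis
        by (subst measurable_cong_sets[OF _ refl, of _ "restrict_space borel {0..T}"])
           (auto simp: sets_restrict_space)
    next
      case False
      then show ?thesis by (auto simp: measurable_def space_restrict_space)
    qed
    have "0 \<le> U (Suc n) t \<and> 1 + U (Suc n) t \<le> A' * exp (2 * R t)" if t: "t \<in> {0..T}" for t
    proof -
      have Rt: "(LINT s:{t..T}|lborel. r s) = R t" for t by (simp add: R_def)
      note E = exp_tail_integral_le[OF r r0 t, unfolded Rt]
      have "(LINT s:{t..T}|lborel. \<rho> s (U n s)) \<ge> 0"
        unfolding set_lebesgue_integral_def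
        by (rule Bochner_Integration.integral_nonneg)
           (use t UD condA_nonneg[OF A] in \<open>auto simp: indicator_def\<close>)
      then have U0: "0 \<le> U (Suc n) t" using M by (simp add: US)
      have "(LINT s:{t..T}|lborel. M * \<rho> s (U n s)) \<le> (LINT s:{t..T}|lborel. A' * (r s * exp (2 * R s)))"
      proof (rule set_integral_mono)
        show "set_integrable lborel {t..T} (\<lambda>s. M * \<rho> s (U n s))" using I[OF t] by simp
        show "set_integrable lborel {t..T} (\<lambda>s. A' * (r s * exp (2 * R s)))" using E(1) by simp
        fix s assume "s \<in> {t..T}"
        then have s: "s \<in> {0..T}" using t by auto
        have "\<rho> s (U n s) \<le> \<rho> s 1 * (1 + U n s)"
          by (rule condA_growth[OF A s]) (use UD[OF s] in simp)
        also have "\<dots> \<le> \<rho> s 1 * (A' * exp (2 * R s))"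
          by (rule mult_left_mono) (use Suc s condA_nonneg[OF A s, of 1] in auto)
        finally have "M * \<rho> s (U n s) \<le> M * (\<rho> s 1 * (A' * exp (2 * R s)))"
          by (rule mult_left_mono) (use M in simp)
        then show "M * \<rho> s (U n s) \<le> A' * (r s * exp (2 * R s))" by (simp add: r_def mult_ac)
      qed
      then have "U (Suc n) t \<le> A' * (LINT s:{t..T}|lborel. r s * exp (2 * R s))" by (simp add: US)
      also have "\<dots> \<le> A' * ((exp (2 * R t) - 1) / 2)" 
        by (rule mult_left_mono[OF E(2)]) (use A'2 in auto)
      finally have "1 + U (Suc n) t \<le> 1 + A' * ((exp (2 * R t) - 1) / 2)" by simp
      also have "\<dots> \<le> A' * exp (2 * R t)"
      proof -
        have "0 \<le> A' * exp (2 * R t)" using A'2 by (intro mult_nonneg_nonneg) auto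
        moreover have "1 + A' * ((exp (2 * R t) - 1) / 2) = 1 + (A' * exp (2 * R t)) / 2 - A' / 2"
          by (simp add: field_simps)
        ultimately show ?thesis using A'2 by linarith
      qed
      finally show ?thesis using U0 by simp
    qed
    then show ?case using m by blast
  qed
  have UD: "0 \<le> U n s \<and> U n s \<le> D'" if "s \<in> {0..T}" for n s
  proof -
    have "A' * exp (2 * R s) \<le> D'" unfolding D'_def
      by (rule mult_left_mono) (use R0[OF that] in \<open>auto simp: A'_def\<close>)
    then show ?thesis using inv[of n] that by force
  qed
  have Um: "U n \<in> borel_measurable (restrict_space lborel {0..T})" for n using inv by simp
  have I: "set_integrable lborel {t..T} (\<lambda>s. \<rho> s (U n s))" if "t \<in> {0..T}" for t n
    by (rule condA_set_integrable[OF A that Um UD])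
  have step: "\<forall>s\<in>{0..T}. U n s \<le> U (Suc n) s" for n
  proof (induction n)
    case 0 then show ?case using le by (simp add: US U0)
  next
    case (Suc n)
    show ?case
    proof
      fix t assume t: "t \<in> {0..T}"
      have "(LINT s:{t..T}|lborel. \<rho> s (U n s)) \<le> (LINT s:{t..T}|lborel. \<rho> s (U (Suc n) s))"
        by (rule set_integral_mono[OF I[OF t] I[OF t]])
           (use Suc t UD in \<open>auto intro!: condA_mono[OF A]\<close>)
      then show "U (Suc n) t \<le> U (Suc (Suc n)) t" using M by (simp add: US)
    qed
  qed
  define u where "u = (\<lambda>s. lim (\<lambda>n. U n s))"
  have conv: "(\<lambda>n. U n s) \<longlonglongrightarrow> u s" and ge: "\<And>n. U n s \<le> u s" if sT: "s \<in> {0..T}" for s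
  proof -
    have inc: "incseq (\<lambda>n. U n s)" using step sT by (auto intro!: incseq_SucI)
    obtain L where "(\<lambda>n. U n s) \<longlonglongrightarrow> L" "\<forall>n. U n s \<le> L"
      using incseq_convergent[OF inc, of D'] UD[OF sT] by blast
    then show "(\<lambda>n. U n s) \<longlonglongrightarrow> u s" "\<And>n. U n s \<le> u s" unfolding u_def
      by (auto simp: limI convergent_LIMSEQ_iff convergentI)
  qed
  have ub: "0 \<le> u s \<and> u s \<le> D'" if "s \<in> {0..T}" for s
    using ge[OF that, of 0] UD[OF that, of 0] LIMSEQ_le_const2[OF conv[OF that], of D'] UD[OF that]
    by (auto intro: order_trans)
  have um: "u \<in> borel_measurable (restrict_space lborel {0..T})"
    by (rule borel_measurable_LIMSEQ_metric[of U, OF Um]) (use conv in \<open>auto simp: space_restrict_space\<close>)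
  have Iu: "set_integrable lborel {t..T} (\<lambda>s. \<rho> s (u s))" if "t \<in> {0..T}" for t
    by (rule condA_set_integrable[OF A that um ub])
  have eq: "u t = (LINT s:{t..T}|lborel. M * \<rho> s (u s))" if t: "t \<in> {0..T}" for t
  proof -
    \<comment> \<open>Monotonicity of \<open>\<rho>\<close> and \<open>U n s \<le> u s\<close> make
      the limit integrand itself the majorant.\<close>
    have "(\<lambda>n. LINT s:{t..T}|lborel. \<rho> s (U n s)) \<longlonglongrightarrow> (LINT s:{t..T}|lborel. \<rho> s (u s))"
      unfolding set_lebesgue_integral_def
    proof (rule integral_dominated_convergence[where w="\<lambda>s. indicator {t..T} s *\<^sub>R \<rho> s (u s)"])
      show "integrable lborel (\<lambda>s. indicator {t..T} s *\<^sub>R \<rho> s (u s))"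
        "(\<lambda>s. indicator {t..T} s *\<^sub>R \<rho> s (u s)) \<in> borel_measurable lborel"
        using Iu[OF t] by (auto simp: set_integrable_def)
      show "(\<lambda>s. indicator {t..T} s *\<^sub>R \<rho> s (U n s)) \<in> borel_measurable lborel" for n
        using I[OF t] by (auto simp: set_integrable_def)
      show "AE s in lborel. (\<lambda>n. indicator {t..T} s *\<^sub>R \<rho> s (U n s)) \<longlonglongrightarrow> indicator {t..T} s *\<^sub>R \<rho> s (u s)"
      proof (rule AE_I2)
        fix s :: real
        show "(\<lambda>n. indicator {t..T} s *\<^sub>R \<rho> s (U n s)) \<longlonglongrightarrow> indicator {t..T} s *\<^sub>R \<rho> s (u s)"
        proof (cases "s \<in> {t..T}")
          case True
          then have s: "s \<in> {0..T}" using t by auto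
          have "(\<lambda>n. \<rho> s (U n s)) \<longlonglongrightarrow> \<rho> s (u s)"
            by (rule continuous_on_tendsto_compose[OF condA_cont[OF A s] conv[OF s]])
               (use ub[OF s] UD[OF s] in auto)
          then show ?thesis by (intro tendsto_intros)
        qed simp
      qed
      show "AE s in lborel. norm (indicator {t..T} s *\<^sub>R \<rho> s (U n s)) \<le> indicator {t..T} s *\<^sub>R \<rho> s (u s)" for n
      proof (rule AE_I2)
        fix s :: real
        show "norm (indicator {t..T} s *\<^sub>R \<rho> s (U n s)) \<le> indicator {t..T} s *\<^sub>R \<rho> s (u s)"
        proof (cases "s \<in> {t..T}")
          case True
          then have s: "s \<in> {0..T}" using t by auto
          show ?thesis using True UD[OF s, of n] ge[OF s] condA_mono[OF A s, of "U n s" "u s"] condA_nonneg[OF A s, of "U n s"]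
            by simp
        qed simp
      qed
    qed
    then have "(\<lambda>n. U (Suc n) t) \<longlonglongrightarrow> M * (LINT s:{t..T}|lborel. \<rho> s (u s))"
      unfolding US by (intro tendsto_intros)
    moreover have "(\<lambda>n. U (Suc n) t) \<longlonglongrightarrow> u t" by (rule LIMSEQ_Suc[OF conv[OF t]])
    ultimately show ?thesis using LIMSEQ_unique by fastforce
  qed
  have T0: "0 \<in> {0..T}" using t0 by simp
  have "continuous_on {0..T} (\<lambda>t. LINT s:{t..T}|lborel. M * \<rho> s (u s))"
    by (intro continuous_on_tail_integral) (use Iu[OF T0] in simp)
  then have cu: "continuous_on {0..T} u"
    by (rule continuous_on_eq) (use eq in auto)
  have "\<forall>t\<in>{0..T}. u t = 0"
    using A[unfolded condA_def, THEN conjunct2, THEN conjunct2, rule_format, OF M, of u] ub cu Iu[OF T0] eq by blast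
  then show ?thesis using ge[OF t0, of 0] v(2)[OF t0] t0 by (auto simp: U0)
qed

section \<open>A smooth convex approximation of the squared positive part\<close>

definition pp :: "real \<Rightarrow> real" where "pp y = max 0 y"

lemma pp_simps [simp]: "0 \<le> pp y" "y \<le> pp y" "pp y \<le> \<bar>y\<bar>"
  by (auto simp: pp_def)

lemma pp_Lipschitz: "\<bar>pp x - pp y\<bar> \<le> \<bar>x - y\<bar>"
  by (auto simp: pp_def)

text \<open>The only delicate point is the kink at \<open>0\<close>, where the difference quotient
  is at most \<open>\<bar>h\<bar> ^ n\<close> and hence vanishes for
  \<open>n \<ge> 1\<close>.\<close>

lemma DERIV_pp_power:
  assumes "n \<ge> 1"
  shows "((\<lambda>y. pp y ^ Suc n) has_real_derivative real (Suc n) * pp y ^ n) (at y)"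
proof -
  consider "y > 0" | "y < 0" | "y = 0" by linarith
  then show ?thesis
  proof cases
    case 1
    have "((\<lambda>y. y ^ Suc n) has_real_derivative real (Suc n) * y ^ n) (at y)"
      using DERIV_pow[of "Suc n" y] by simp
    then have "((\<lambda>y. y ^ Suc n) has_real_derivative real (Suc n) * pp y ^ n) (at y)"
      using 1 by (simp add: pp_def)
    then show ?thesis
      by (rule has_field_derivative_transform_within_open[where S="{0<..}"])
         (use 1 in \<open>auto simp: pp_def\<close>)
  next
    case 2
    have "((\<lambda>y. 0) has_real_derivative real (Suc n) * pp y ^ n) (at y)"
      using 2 assms by (simp add: pp_def power_0_left)
    then show ?thesis
      by (rule has_field_derivative_transform_within_open[where S="{..<0}"])
         (use 2 in \<open>auto simp: pp_def\<close>)
  next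
    case 3
    have "((\<lambda>h. pp h ^ Suc n / h) \<longlongrightarrow> 0) (at 0)"
    proof (rule Lim_null_comparison[where g="\<lambda>h. \<bar>h\<bar> ^ n"])
      show "\<forall>\<^sub>F h in at 0. norm (pp h ^ Suc n / h) \<le> \<bar>h\<bar> ^ n"
        by (rule always_eventually) (auto simp: pp_def max_def abs_mult power_abs)
      have "((\<lambda>h::real. \<bar>h\<bar> ^ n) \<longlongrightarrow> \<bar>0\<bar> ^ n) (at 0)" by (intro tendsto_intros)
      then show "((\<lambda>h::real. \<bar>h\<bar> ^ n) \<longlongrightarrow> 0) (at 0)" using assms by (simp only: abs_zero power_0_left) simp
    qed
    then show ?thesis using 3 assms by (simp add: DERIV_def pp_def power_0_left)
  qed
qed

lemma DERIV_pp:
  shows DERIV_pp3: "((\<lambda>y. pp y ^ 3) has_real_derivative 3 * pp y ^ 2) (at y)"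
    and DERIV_pp2: "((\<lambda>y. pp y ^ 2) has_real_derivative 2 * pp y) (at y)"
  using DERIV_pp_power[of 2 y] DERIV_pp_power[of 1 y] by (simp_all add: numeral_3_eq_3 numeral_2_eq_2)

text \<open>\<open>Phi d y\<close> tends to \<open>(pp y)\<^sup>2\<close> as \<open>d\<close> decreases to \<open>0\<close>; it is the mean of \<open>z \<mapsto> (pp z)\<^sup>2\<close> over the interval from
  \<open>y - d\<close> to \<open>y\<close>, which makes its second derivative Lipschitz.\<close>

definition Phi :: "real \<Rightarrow> real \<Rightarrow> real" where
  "Phi d y = (pp y ^ 3 - pp (y - d) ^ 3) / (3 * d)"

definition Phi1 :: "real \<Rightarrow> real \<Rightarrow> real" where
  "Phi1 d y = (pp y ^ 2 - pp (y - d) ^ 2) / d"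

definition Phi2 :: "real \<Rightarrow> real \<Rightarrow> real" where
  "Phi2 d y = 2 * (pp y - pp (y - d)) / d"

context
  fixes d :: real
  assumes d: "d > 0"
begin

lemma DERIV_Phi: "(Phi d has_real_derivative Phi1 d y) (at y)"
proof -
  have "((\<lambda>y. (pp y ^ 3 - pp (y - d) ^ 3) / (3 * d)) has_real_derivative
     (3 * pp y ^ 2 - 3 * pp (y - d) ^ 2 * (1 - 0)) / (3 * d)) (at y)"
    by (intro DERIV_cdivide DERIV_diff DERIV_pp3 DERIV_chain2[OF DERIV_pp3] DERIV_ident DERIV_const)
  then show ?thesis unfolding Phi_def[abs_def] Phi1_def by (rule DERIV_cong) (use d in \<open>simp add: field_simps\<close>)
qed

lemma DERIV_Phi1: "(Phi1 d has_real_derivative Phi2 d y) (at y)"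
proof -
  have "((\<lambda>y. (pp y ^ 2 - pp (y - d) ^ 2) / d) has_real_derivative
     (2 * pp y - 2 * pp (y - d) * (1 - 0)) / d) (at y)"
    by (intro DERIV_cdivide DERIV_diff DERIV_pp2 DERIV_chain2[OF DERIV_pp2] DERIV_ident DERIV_const)
  then show ?thesis unfolding Phi1_def[abs_def] Phi2_def by (rule DERIV_cong) (use d in \<open>simp add: field_simps\<close>)
qed

lemma pp_shift: "pp (y - d) \<le> pp y" "pp y - pp (y - d) \<le> d"
  using d by (auto simp: pp_def)

lemma Phi2_bounds: "0 \<le> Phi2 d y" "Phi2 d y \<le> 2"
  using pp_shift[of y] d by (auto simp: Phi2_def field_simps)

lemma Phi2_Lipschitz: "\<bar>Phi2 d x - Phi2 d y\<bar> \<le> 4 / d * \<bar>x - y\<bar>"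
proof -
  have "\<bar>Phi2 d x - Phi2 d y\<bar> = 2 / d * \<bar>(pp x - pp y) - (pp (x - d) - pp (y - d))\<bar>"
  proof -
    have "Phi2 d x - Phi2 d y = 2 / d * ((pp x - pp y) - (pp (x - d) - pp (y - d)))"
      using d by (simp add: Phi2_def field_simps)
    then show ?thesis using d by (simp only: abs_mult) simp
  qed
  also have "\<dots> \<le> 2 / d * (2 * \<bar>x - y\<bar>)"
    by (rule mult_left_mono) (use pp_Lipschitz[of x y] pp_Lipschitz[of "x - d" "y - d"] d in \<open>auto simp: abs_le_iff\<close>)
  finally show ?thesis by simp
qed

lemma Phi2_nonpos: "y \<le> 0 \<Longrightarrow> Phi2 d y = 0"
  using d by (simp add: Phi2_def pp_def)

lemma Phi1_nonneg: "0 \<le> Phi1 d y"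
  using pp_shift[of y] d by (auto simp: Phi1_def intro!: divide_nonneg_pos power_mono)

text \<open>The first order weight of the drift is tied to the second order weight carried by
  \<open>Z\<close> and \<open>G\<close>, so that the part of the drift depending on \<open>Z\<close>
  can be absorbed under one common weight. The difference of squares factors, and the second factor
  is at most \<open>2 * pp y\<close>.\<close>

lemma Phi1_le_Phi2: "Phi1 d y \<le> pp y * Phi2 d y"
proof -
  have "pp y ^ 2 - pp (y - d) ^ 2 = (pp y - pp (y - d)) * (pp y + pp (y - d))"
    by (simp add: power2_eq_square algebra_simps)
  also have "\<dots> \<le> (pp y - pp (y - d)) * (2 * pp y)"
    using pp_shift[of y] by (intro mult_left_mono) auto
  finally show ?thesis using d by (simp add: Phi1_def Phi2_def divide_right_mono mult_ac)
qed

lemma Phi1_le: "Phi1 d y \<le> 2 * pp y"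
proof -
  have "Phi1 d y \<le> pp y * Phi2 d y" by (rule Phi1_le_Phi2)
  also have "\<dots> \<le> pp y * 2" by (rule mult_left_mono) (use Phi2_bounds in auto)
  finally show ?thesis by simp
qed

lemma Phi_nonpos: "y \<le> 0 \<Longrightarrow> Phi d y = 0"
  using d by (simp add: Phi_def pp_def)

lemma Phi_le: "Phi d y \<le> pp y ^ 2"
proof -
  have "pp y ^ 3 - pp (y - d) ^ 3 = (pp y - pp (y - d)) * (pp y ^ 2 + pp y * pp (y - d) + pp (y - d) ^ 2)"
    by (simp add: power2_eq_square power3_eq_cube algebra_simps)
  also have "\<dots> \<le> d * (pp y ^ 2 + pp y * pp y + pp y ^ 2)"
    using pp_shift[of y] d by (intro mult_mono add_mono power_mono) auto
  finally show ?thesis using d by (simp add: Phi_def field_simps power2_eq_square)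
qed

lemma Phi_nonneg: "0 \<le> Phi d y"
  using pp_shift[of y] d by (auto simp: Phi_def intro!: divide_nonneg_pos power_mono)

text \<open>An explicit rate of convergence with an integrable error, which replaces a limit theorem
  when \<open>d\<close> tends to \<open>0\<close>. On the middle range the left side is already
  nonpositive.\<close>

lemma Phi_ge: "pp y ^ 2 - d * pp y \<le> Phi d y"
proof -
  consider "y \<le> 0" | "0 \<le> y" "y \<le> d" | "d \<le> y" by linarith
  then show ?thesis
  proof cases
    case 1 then show ?thesis by (simp add: Phi_nonpos pp_def)
  next
    case 2
    then have "pp y ^ 2 - d * pp y \<le> 0" by (simp add: pp_def power2_eq_square mult_right_mono)
    then show ?thesis using Phi_nonneg[of y] by linarith
  next
    case 3
    then have "Phi d y = y ^ 2 - d * y + d ^ 2 / 3" using d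
      by (simp add: Phi_def pp_def field_simps power2_eq_square power3_eq_cube)
    then show ?thesis using 3 d by (simp add: pp_def)
  qed
qed

lemma Phi1_Lipschitz: "\<bar>Phi1 d x - Phi1 d y\<bar> \<le> 2 * \<bar>x - y\<bar>"
proof -
  have *: "\<bar>Phi1 d x - Phi1 d y\<bar> \<le> 2 * \<bar>x - y\<bar>" if xy: "x < y" for x y
  proof -
    obtain z where "Phi1 d y - Phi1 d x = (y - x) * Phi2 d z"
      using MVT2[OF xy, of "Phi1 d" "Phi2 d"] DERIV_Phi1 by auto
    then have "\<bar>Phi1 d y - Phi1 d x\<bar> = \<bar>y - x\<bar> * Phi2 d z"
      using Phi2_bounds(1)[of z] by (simp add: abs_mult)
    then have "\<bar>Phi1 d x - Phi1 d y\<bar> = \<bar>y - x\<bar> * Phi2 d z" by linarith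
    also have "\<dots> \<le> \<bar>y - x\<bar> * 2" by (rule mult_left_mono) (use Phi2_bounds in auto)
    finally show ?thesis by (simp add: abs_minus_commute)
  qed
  then show ?thesis using *[of x y] *[of y x] by (cases x y rule: linorder_cases) (auto simp: abs_minus_commute)
qed

lemma Phi_convex: "Phi d x - Phi d y \<le> Phi1 d x * (x - y)"
proof -
  have mono: "Phi1 d u \<le> Phi1 d v" if "u \<le> v" for u v
    by (rule DERIV_nonneg_imp_nondecreasing[OF that]) (use DERIV_Phi1 Phi2_bounds in blast)
  consider "x < y" | "x = y" | "y < x" by linarith
  then show ?thesis
  proof cases
    case 1
    obtain z where z: "x < z" "z < y" "Phi d y - Phi d x = (y - x) * Phi1 d z"
      using MVT2[OF 1, of "Phi d" "Phi1 d"] DERIV_Phi by auto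
    have "(y - x) * Phi1 d x \<le> (y - x) * Phi1 d z" using mono[of x z] z 1 by (intro mult_left_mono) auto
    then show ?thesis using z by (simp add: algebra_simps)
  next
    case 3
    obtain z where z: "y < z" "z < x" "Phi d x - Phi d y = (x - y) * Phi1 d z"
      using MVT2[OF 3, of "Phi d" "Phi1 d"] DERIV_Phi by auto
    have "(x - y) * Phi1 d z \<le> (x - y) * Phi1 d x" using mono[of z x] z 3 by (intro mult_left_mono) auto
    then show ?thesis using z by (simp add: algebra_simps)
  qed simp
qed

text \<open>The remainder is half the oscillation of \<open>Phi2\<close> times the square: the bound
  \<open>2\<close> on \<open>Phi2\<close> gives the constant \<open>1\<close>, its Lipschitz
  constant \<open>4 / d\<close> gives \<open>2 / d\<close>. The minimum keeps the remainder
  integrable for increments with second moments only and still makes it of smaller order for small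
  increments.\<close>

lemma Phi_Taylor:
  "\<bar>Phi d (a + x) - (Phi d a + Phi1 d a * x + Phi2 d a / 2 * x\<^sup>2)\<bar> \<le> min 1 (2 / d * \<bar>x\<bar>) * x\<^sup>2"
proof (cases "x = 0")
  case False
  define diff where "diff = (\<lambda>m::nat. if m = 0 then Phi d else if m = 1 then Phi1 d else Phi2 d)"
  have "\<exists>t. (if a + x < a then a + x < t \<and> t < a else a < t \<and> t < a + x) \<and>
      Phi d (a + x) = (\<Sum>m<2. diff m a / fact m * (a + x - a) ^ m) + diff 2 t / fact 2 * (a + x - a) ^ 2"
    by (rule Taylor[where a="min a (a + x)" and b="max a (a + x)"])
       (use False DERIV_Phi DERIV_Phi1 in \<open>auto simp: diff_def less_2_cases_iff\<close>)
  then obtain t where t': "if a + x < a then a + x < t \<and> t < a else a < t \<and> t < a + x"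
    and e: "Phi d (a + x) = (\<Sum>m<2. diff m a / fact m * (a + x - a) ^ m) + diff 2 t / fact 2 * (a + x - a) ^ 2"
    by blast
  have t: "\<bar>t - a\<bar> \<le> \<bar>x\<bar>" using t' by (auto split: if_splits)
  have "Phi d (a + x) - (Phi d a + Phi1 d a * x + Phi2 d a / 2 * x\<^sup>2) = (Phi2 d t - Phi2 d a) / 2 * x\<^sup>2"
    using e by (simp add: diff_def numeral_2_eq_2 field_simps)
  moreover have "\<bar>(Phi2 d t - Phi2 d a) / 2\<bar> \<le> min 1 (2 / d * \<bar>x\<bar>)"
  proof -
    have "\<bar>Phi2 d t - Phi2 d a\<bar> \<le> 4 / d * \<bar>x\<bar>"
      by (rule order_trans[OF Phi2_Lipschitz mult_left_mono[OF t]]) (use d in simp)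
    moreover have "\<bar>Phi2 d t - Phi2 d a\<bar> \<le> 2" using Phi2_bounds[of t] Phi2_bounds[of a] by linarith
    ultimately show ?thesis by simp
  qed
  ultimately show ?thesis
    by (simp only: abs_mult abs_power2) (rule mult_right_mono, auto)
qed simp

end

text \<open>Jensen's inequality is applied to the convex function \<open>- \<rho> t\<close> on the
  open half line, into which the shift by \<open>e\<close> moves \<open>X\<close>. Continuity of
  \<open>\<rho> t\<close> removes the shift.\<close>

lemma condA_jensen:
  assumes P: "prob_space P" and A: "condA T \<rho>" and t: "t \<in> {0..T}"
    and X: "integrable P X" and X0: "\<And>\<omega>. \<omega> \<in> space P \<Longrightarrow> 0 \<le> X \<omega>"
  shows "integrable P (\<lambda>\<omega>. \<rho> t (X \<omega>))" "(\<integral>\<omega>. \<rho> t (X \<omega>) \<partial>P) \<le> \<rho> t (\<integral>\<omega>. X \<omega> \<partial>P)"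
proof -
  interpret prob_space P by fact
  have m: "(\<lambda>\<omega>. \<rho> t (X \<omega> + e)) \<in> borel_measurable P" if "0 \<le> e" for e
    by (rule condA_measurable[OF A]) (use X t X0 that in \<open>auto intro!: add_nonneg_nonneg\<close>)
  have I: "integrable P (\<lambda>\<omega>. \<rho> t (X \<omega> + e))" if "0 \<le> e" for e
  proof (rule Bochner_Integration.integrable_bound[OF _ m[OF that]])
    show "integrable P (\<lambda>\<omega>. \<rho> t 1 * (1 + (X \<omega> + e)))" using X by auto
    show "AE \<omega> in P. norm (\<rho> t (X \<omega> + e)) \<le> norm (\<rho> t 1 * (1 + (X \<omega> + e)))"
    proof (rule AE_I2)
      fix \<omega> assume "\<omega> \<in> space P"
      then have "0 \<le> X \<omega> + e" using X0 that by simp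
      from condA_growth[OF A t this] condA_nonneg[OF A t this] condA_nonneg[OF A t, of 1]
      show "norm (\<rho> t (X \<omega> + e)) \<le> norm (\<rho> t 1 * (1 + (X \<omega> + e)))" by simp
    qed
  qed
  show I0: "integrable P (\<lambda>\<omega>. \<rho> t (X \<omega>))" using I[of 0] by simp
  have EX: "0 \<le> expectation X" by (rule Bochner_Integration.integral_nonneg) (use X0 in auto)
  have le: "(\<integral>\<omega>. \<rho> t (X \<omega>) \<partial>P) \<le> \<rho> t (expectation X + e)" if e: "0 < e" for e
  proof -
    have "(\<integral>\<omega>. \<rho> t (X \<omega>) \<partial>P) \<le> (\<integral>\<omega>. \<rho> t (X \<omega> + e) \<partial>P)"
      by (rule integral_mono[OF I0 I]) (use X0 e in \<open>auto intro!: condA_mono[OF A t]\<close>)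
    moreover have "(\<lambda>u. - \<rho> t u) (expectation (\<lambda>\<omega>. X \<omega> + e)) \<le> expectation (\<lambda>\<omega>. (\<lambda>u. - \<rho> t u) (X \<omega> + e))"
    proof (rule jensens_inequality[where I="{0<..}"])
      show "AE \<omega> in P. X \<omega> + e \<in> {0<..}" by (rule AE_I2) (use X0 e in \<open>auto intro: add_nonneg_pos\<close>)
      show "convex_on {0<..} (\<lambda>u. - \<rho> t u)"
        using condA_concave[OF A t] unfolding concave_on_def by (rule convex_on_subset) auto
    qed (use X I e in auto)
    moreover have "expectation (\<lambda>\<omega>. X \<omega> + e) = expectation X + e" using X by (simp add: prob_space)
    ultimately show ?thesis by simp
  qed
  have "((\<lambda>e. \<rho> t (expectation X + e)) \<longlongrightarrow> \<rho> t (expectation X)) (at_right 0)"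
  proof (rule continuous_on_tendsto_compose[OF condA_cont[OF A t]])
    have "((\<lambda>e. expectation X + e) \<longlongrightarrow> expectation X + 0) (at_right 0)" by (intro tendsto_intros)
    then show "((\<lambda>e. expectation X + e) \<longlongrightarrow> expectation X) (at_right 0)" by simp
    show "\<forall>\<^sub>F e in at_right 0. expectation X + e \<in> {0..}"
      using EX by (auto simp: eventually_at_filter intro!: always_eventually)
  qed (use EX in auto)
  then show "(\<integral>\<omega>. \<rho> t (X \<omega>) \<partial>P) \<le> \<rho> t (\<integral>\<omega>. X \<omega> \<partial>P)"
    by (rule tendsto_lowerbound) (use le in \<open>auto simp: eventually_at_filter\<close>)
qed

section \<open>Increments of Brownian motion are independent of both augmented filtrations\<close>

text \<open>Events generated by \<open>h\<close> lie in \<open>N\<close>, those generated by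
  \<open>\<phi> (X \<omega>)\<close> are preimages under \<open>X\<close>; independence of sets
  therefore becomes independence of the two random variables, and the expectation factors.\<close>

lemma (in prob_space) indep_algebra_integral:
  fixes X :: "'a \<Rightarrow> 'c::topological_space" and \<phi> :: "'c \<Rightarrow> real"
  assumes N: "space N = space M" "sets N \<subseteq> sets M"
    and X: "X \<in> borel_measurable M"
    and ind: "\<And>A C. A \<in> sets N \<Longrightarrow> C \<in> sets borel \<Longrightarrow> prob (A \<inter> (X -` C \<inter> space M)) = prob A * prob (X -` C \<inter> space M)"
    and h: "h \<in> borel_measurable N" "integrable M h"
    and \<phi>: "\<phi> \<in> borel_measurable borel" "integrable M (\<lambda>\<omega>. \<phi> (X \<omega>))"
  shows "integrable M (\<lambda>\<omega>. h \<omega> * \<phi> (X \<omega>))"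
    and "(\<integral>\<omega>. h \<omega> * \<phi> (X \<omega>) \<partial>M) = (\<integral>\<omega>. h \<omega> \<partial>M) * (\<integral>\<omega>. \<phi> (X \<omega>) \<partial>M)"
proof -
  have hM: "h \<in> borel_measurable M" using h by auto
  let ?X = "\<lambda>\<omega>. \<phi> (X \<omega>)"
  have 1: "sigma_sets (space M) {h -` A \<inter> space M |A. A \<in> sets borel} \<subseteq> sets N"
    using sets.sigma_sets_subset[of "{h -` A \<inter> space M |A. A \<in> sets borel}" N] measurable_sets[OF h(1)] N by auto
  have 2: "sigma_sets (space M) {?X -` A \<inter> space M |A. A \<in> sets borel} \<subseteq> {X -` C \<inter> space M |C. C \<in> sets borel}"
  proof -
    have eq: "{X -` C \<inter> space M |C. C \<in> sets borel} = sets (vimage_algebra (space M) X borel)"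
      by (simp add: sets_vimage_algebra2)
    have "?X -` A \<inter> space M = X -` (\<phi> -` A) \<inter> space M" for A by auto
    moreover have "\<phi> -` A \<in> sets borel" if "A \<in> sets borel" for A
      using measurable_sets[OF \<phi>(1) that] by simp
    ultimately have "{?X -` A \<inter> space M |A. A \<in> sets borel} \<subseteq> sets (vimage_algebra (space M) X borel)"
      unfolding eq[symmetric] by blast
    then show ?thesis unfolding eq
      using sets.sigma_sets_subset[of _ "vimage_algebra (space M) X borel"] by simp
  qed
  have "indep_var borel h borel ?X"
    unfolding indep_var_eq indep_sets2_eq
  proof (intro conjI ballI)
    show "random_variable borel h" by (rule hM)
    show "random_variable borel ?X" using measurable_compose[OF X \<phi>(1)] by simp
    show "sigma_sets (space M) {h -` A \<inter> space M |A. A \<in> sets borel} \<subseteq> events" using 1 N by blast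
    show "sigma_sets (space M) {?X -` A \<inter> space M |A. A \<in> sets borel} \<subseteq> events"
      using 2 measurable_sets[OF X] by blast
    fix a b assume "a \<in> sigma_sets (space M) {h -` A \<inter> space M |A. A \<in> sets borel}"
      "b \<in> sigma_sets (space M) {?X -` A \<inter> space M |A. A \<in> sets borel}"
    then obtain C where "a \<in> sets N" "b = X -` C \<inter> space M" "C \<in> sets borel" using 1 2 by blast
    then show "prob (a \<inter> b) = prob a * prob b" using ind by simp
  qed
  from indep_var_integrable[OF this h(2) \<phi>(2)] indep_var_lebesgue_integral[OF this h(2) \<phi>(2)]
  show "integrable M (\<lambda>\<omega>. h \<omega> * \<phi> (X \<omega>))"
    "(\<integral>\<omega>. h \<omega> * \<phi> (X \<omega>) \<partial>M) = (\<integral>\<omega>. h \<omega> \<partial>M) * (\<integral>\<omega>. \<phi> (X \<omega>) \<partial>M)" by auto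
qed

lemma brownian_motionD:
  assumes "brownian_motion P W" "0 \<le> ts 0" "\<And>k. k < n \<Longrightarrow> ts k < ts (Suc k)"
  shows "prob_space.indep_vars P (\<lambda>_. borel) (\<lambda>(k, i) \<omega>. (W (ts (Suc k)) \<omega> - W (ts k) \<omega>) $ i) ({..<n} \<times> UNIV)"
    and "k < n \<Longrightarrow> distributed P lborel (\<lambda>\<omega>. (W (ts (Suc k)) \<omega> - W (ts k) \<omega>) $ i)
                     (\<lambda>x. ennreal (normal_density 0 (sqrt (ts (Suc k) - ts k)) x))"
proof -
  have *: "\<forall>(n::nat) ts. 0 \<le> ts 0 \<and> (\<forall>k<n. ts k < ts (Suc k)) \<longrightarrow>
        prob_space.indep_vars P (\<lambda>_. borel) (\<lambda>(k, i) \<omega>. (W (ts (Suc k)) \<omega> - W (ts k) \<omega>) $ i) ({..<n} \<times> UNIV) \<and>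
        (\<forall>k<n. \<forall>i. distributed P lborel (\<lambda>\<omega>. (W (ts (Suc k)) \<omega> - W (ts k) \<omega>) $ i)
                     (\<lambda>x. ennreal (normal_density 0 (sqrt (ts (Suc k) - ts k)) x)))"
    using assms(1) unfolding brownian_motion_def by (elim conjE)
  note ** = *[rule_format, of ts n, OF conjI[OF assms(2)], OF allI[OF impI[OF assms(3)]]]
  show "prob_space.indep_vars P (\<lambda>_. borel) (\<lambda>(k, i) \<omega>. (W (ts (Suc k)) \<omega> - W (ts k) \<omega>) $ i) ({..<n} \<times> UNIV)"
    using ** by blast
  show "k < n \<Longrightarrow> distributed P lborel (\<lambda>\<omega>. (W (ts (Suc k)) \<omega> - W (ts k) \<omega>) $ i)
                     (\<lambda>x. ennreal (normal_density 0 (sqrt (ts (Suc k) - ts k)) x))"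
    using ** by blast
qed

text \<open>Enumerating the finitely many times in increasing order, \<open>a\<close> and \<open>b\<close> become neighbours, so
  \<open>W b - W a\<close> is one of the independent increments and every other variable is a sum of the rest.\<close>

lemma bm_increment_indep:
  fixes W :: "real \<Rightarrow> 'a \<Rightarrow> real^'d"
  assumes bm: "brownian_motion M W" and ab: "0 \<le> a" "a < b"
    and J: "finite J" "J \<subseteq> {0..a} \<union> {b..}"
    and A: "\<And>r. r \<in> J \<Longrightarrow> A r \<in> sets borel" and C: "C \<in> sets borel"
  defines "E1 \<equiv> {\<omega>\<in>space M. \<forall>r\<in>J. W r \<omega> - W (if r \<le> a then 0 else b) \<omega> \<in> A r}"
    and "E2 \<equiv> {\<omega>\<in>space M. W b \<omega> - W a \<omega> \<in> C}"
  shows "measure M (E1 \<inter> E2) = measure M E1 * measure M E2"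
proof -
  interpret prob_space M using bm by (simp add: brownian_motion_def)
  \<comment> \<open>With \<open>0\<close>, \<open>a\<close> and \<open>b\<close> added, every
    reference time of a difference is itself one of the enumerated times.\<close>
  define S where "S = {0, a, b} \<union> J"
  have S: "finite S" "S \<subseteq> {0..a} \<union> {b..}" using J ab by (auto simp: S_def)
  define L where "L = sorted_list_of_set S"
  have L: "set L = S" "sorted_wrt (<) L" using S by (auto simp: L_def)
  define ts where "ts = (\<lambda>k. L ! k)"
  define n where "n = length L - 1"
  have "length L > 0" using L S_def by (cases L) auto
  then have len: "length L = Suc n" by (simp add: n_def)
  have mono: "ts i < ts j" if "i < j" "j \<le> n" for i j
    using sorted_wrt_nth_less[OF L(2), of i j] that by (simp add: ts_def len)
  have surj: "\<exists>k\<le>n. ts k = x" if "x \<in> S" for x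
    using that unfolding L(1)[symmetric] by (auto simp: in_set_conv_nth ts_def len less_Suc_eq_le)
  have inS: "ts k \<in> S" if "k \<le> n" for k
    unfolding L(1)[symmetric] ts_def using that len by simp
  have mono_iff: "ts i < ts j \<longleftrightarrow> i < j" if "i \<le> n" "j \<le> n" for i j
    using mono[of i j] mono[of j i] that by (metis linorder_neqE_nat order_less_asym order_less_irrefl)
  have le_iff: "ts i \<le> ts j \<longleftrightarrow> i \<le> j" if "i \<le> n" "j \<le> n" for i j
    using mono_iff[of j i] that by (simp add: not_less[symmetric])
  obtain z where z: "z \<le> n" "ts z = 0" using surj[of 0] by (auto simp: S_def)
  have z0: "z = 0"
    using mono[of 0 z] z inS[of 0] S ab by force
  obtain ka where ka: "ka \<le> n" "ts ka = a" using surj[of a] by (auto simp: S_def)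
  obtain kb where kb: "kb \<le> n" "ts kb = b" using surj[of b] by (auto simp: S_def)
  have kab: "ka < kb" using mono_iff[of ka kb] ka kb ab by simp
  \<comment> \<open>No time of \<open>S\<close> lies strictly between \<open>a\<close> and
    \<open>b\<close>, so \<open>W b - W a\<close> is the single increment with index
    \<open>ka\<close>.\<close>
  have kb_eq: "kb = Suc ka"
  proof (rule ccontr)
    assume "kb \<noteq> Suc ka"
    then have "Suc ka < kb" using kab by simp
    then have "a < ts (Suc ka)" "ts (Suc ka) < b" "ts (Suc ka) \<in> S"
      using mono[of ka "Suc ka"] mono[of "Suc ka" kb] inS[of "Suc ka"] ka kb by auto
    then show False using S by auto
  qed
  define D where "D = (\<lambda>(k, i) \<omega>. (W (ts (Suc k)) \<omega> - W (ts k) \<omega>) $ i)"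
  have ind: "indep_vars (\<lambda>_. borel) D ({..<n} \<times> UNIV)"
    unfolding D_def by (rule brownian_motionD(1)[OF bm]) (use mono z z0 in auto)
  define G1 where "G1 = ({..<n} - {ka}) \<times> (UNIV :: 'd set)"
  define G2 where "G2 = {ka} \<times> (UNIV :: 'd set)"
  have ind2: "indep_var (PiM G1 (\<lambda>_. borel)) (\<lambda>\<omega>. restrict (\<lambda>i. D i \<omega>) G1) (PiM G2 (\<lambda>_. borel)) (\<lambda>\<omega>. restrict (\<lambda>i. D i \<omega>) G2)"
    by (rule indep_var_restrict[OF ind]) (use kab kb kb_eq in \<open>auto simp: G1_def G2_def\<close>)
  \<comment> \<open>The indices of the consecutive increments whose sum is \<open>W r - W 0\<close>
    or \<open>W r - W b\<close>. Since they avoid \<open>ka\<close>, every such sum is a function of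
    the group \<open>G1\<close>.\<close>
  define K where "K = (\<lambda>r. {k. k < n \<and> (if r \<le> a then ts (Suc k) \<le> r else b \<le> ts k \<and> ts (Suc k) \<le> r)})"
  define F where "F = (\<lambda>r (x :: nat \<times> 'd \<Rightarrow> real). \<chi> i. \<Sum>k\<in>K r. x (k, i))"
  have KG: "(k, i) \<in> G1" if "k \<in> K r" for k r i
    using that ka ab kb kb_eq by (auto simp: K_def G1_def split: if_splits)
  have vec_meas: "(\<lambda>x. \<chi> i. f i x) \<in> borel_measurable N"
    if "\<And>i. f i \<in> borel_measurable N" for f :: "'d \<Rightarrow> 'z \<Rightarrow> real" and N :: "'z measure"
    by (subst borel_measurable_euclidean_space)
       (auto simp: Basis_vec_def inner_axis intro: that)
  have FJ: "F r (\<lambda>i\<in>G1. D i \<omega>) = W r \<omega> - W (if r \<le> a then 0 else b) \<omega>" if r: "r \<in> J" for r \<omega>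
  proof -
    have tele: "(\<Sum>k\<in>{i..<j}. D (k, l) \<omega>) = (W (ts j) \<omega> - W (ts i) \<omega>) $ l" if "i \<le> j" for i j l
      using that
    proof (induction j)
      case (Suc j)
      then show ?case by (cases "i = Suc j") (auto simp: D_def)
    qed simp
    obtain j where j: "j \<le> n" "ts j = r" using surj[of r] r by (auto simp: S_def)
    have "K r = (if r \<le> a then {0..<j} else {kb..<j})"
    proof (cases "r \<le> a")
      case True
      have iff: "k < n \<and> ts (Suc k) \<le> r \<longleftrightarrow> k < j" for k
        using le_iff[of "Suc k" j] j by (auto simp: Suc_le_eq)
      have "K r = {k. k < n \<and> ts (Suc k) \<le> r}" using True by (simp add: K_def)
      then have "K r = {0..<j}" by (simp only: iff lessThan_def[symmetric] lessThan_atLeast0)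
      then show ?thesis using True by simp
    next
      case False
      have iff: "k < n \<and> b \<le> ts k \<and> ts (Suc k) \<le> r \<longleftrightarrow> kb \<le> k \<and> k < j" for k
        using le_iff[of "Suc k" j] le_iff[of kb k] j kb by (auto simp: Suc_le_eq)
      have "K r = {k. k < n \<and> b \<le> ts k \<and> ts (Suc k) \<le> r}" using False by (simp add: K_def)
      then have "K r = {kb..<j}" by (simp only: iff) (simp add: atLeastLessThan_def atLeast_def lessThan_def Collect_conj_eq)
      then show ?thesis using False by simp
    qed
    moreover have "r > a \<Longrightarrow> kb \<le> j"
      using mono_iff[of j kb] j kb J r ab by force
    ultimately have sumD: "(\<Sum>k\<in>K r. D (k, i) \<omega>) = (W r \<omega> - W (if r \<le> a then 0 else b) \<omega>) $ i" for i
      using tele[of 0 j i] tele[of kb j i] j kb z z0 by auto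
    have "(\<Sum>k\<in>K r. (\<lambda>i\<in>G1. D i \<omega>) (k, i)) = (W r \<omega> - W (if r \<le> a then 0 else b) \<omega>) $ i" for i
      unfolding sumD[symmetric] by (rule sum.cong) (use KG[of _ r i] in auto)
    then show ?thesis by (simp add: F_def vec_eq_iff)
  qed
  define S1 where "S1 = {x\<in>space (PiM G1 (\<lambda>_. borel)). \<forall>r\<in>J. F r x \<in> A r}"
  define S2 where "S2 = {x\<in>space (PiM G2 (\<lambda>_. borel)). (\<chi> i. x (ka, i)) \<in> C}"
  have Fm: "F r \<in> borel_measurable (PiM G1 (\<lambda>_. borel))" for r
    unfolding F_def by (intro vec_meas borel_measurable_sum measurable_component_singleton KG)
  have "S1 \<in> sets (PiM G1 (\<lambda>_. borel))"
    unfolding S1_def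
  proof (rule sets.sets_Collect_finite_All[OF _ J(1)])
    fix r assume "r \<in> J"
    from measurable_sets[OF Fm A[OF this]]
    show "{x \<in> space (PiM G1 (\<lambda>_. borel)). F r x \<in> A r} \<in> sets (PiM G1 (\<lambda>_. borel))"
      by (simp add: vimage_def Int_def conj_commute)
  qed
  moreover have "(\<lambda>x. (\<chi> i. x (ka, i)) :: real^'d) \<in> borel_measurable (PiM G2 (\<lambda>_. borel))"
    by (intro vec_meas measurable_component_singleton) (simp add: G2_def)
  then have "S2 \<in> sets (PiM G2 (\<lambda>_. borel))"
    unfolding S2_def using measurable_sets[OF _ C] by (simp add: vimage_def Int_def conj_commute)
  ultimately have "prob ((\<lambda>x. (\<lambda>i\<in>G1. D i x, \<lambda>i\<in>G2. D i x)) -` (S1 \<times> S2) \<inter> space M) =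
    prob ((\<lambda>x. \<lambda>i\<in>G1. D i x) -` S1 \<inter> space M) * prob ((\<lambda>x. \<lambda>i\<in>G2. D i x) -` S2 \<inter> space M)"
    by (rule indep_varD[OF ind2])
  moreover have "(\<lambda>x. \<lambda>i\<in>G1. D i x) -` S1 \<inter> space M = E1"
    by (auto simp: S1_def E1_def FJ space_PiM)
  moreover have "(\<lambda>x. \<lambda>i\<in>G2. D i x) -` S2 \<inter> space M = E2"
  proof -
    have "(\<chi> i. (\<lambda>i\<in>G2. D i \<omega>) (ka, i)) = W b \<omega> - W a \<omega>" for \<omega>
      using ka kb kb_eq by (auto simp: vec_eq_iff G2_def D_def)
    then show ?thesis by (auto simp: S2_def E2_def space_PiM)
  qed
  moreover have "(\<lambda>x. (\<lambda>i\<in>G1. D i x, \<lambda>i\<in>G2. D i x)) -` (S1 \<times> S2) \<inter> space M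
    = ((\<lambda>x. \<lambda>i\<in>G1. D i x) -` S1 \<inter> space M) \<inter> ((\<lambda>x. \<lambda>i\<in>G2. D i x) -` S2 \<inter> space M)" by auto
  ultimately show ?thesis by simp
qed

text \<open>Besides mean and covariance the fourth moment is recorded: being quadratic in the length
  of the interval, its sum over a grid vanishes with the mesh.\<close>

lemma bm_increment_moments:
  fixes W :: "real \<Rightarrow> 'a \<Rightarrow> real^'d"
  assumes bm: "brownian_motion M W" and ab: "0 \<le> a" "a < b"
  shows "integrable M (\<lambda>\<omega>. ((W b \<omega> - W a \<omega>) $ i) ^ n)"
    and "(\<integral>\<omega>. (W b \<omega> - W a \<omega>) $ i \<partial>M) = 0"
    and "integrable M (\<lambda>\<omega>. (W b \<omega> - W a \<omega>) $ i * (W b \<omega> - W a \<omega>) $ j)"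
    and "(\<integral>\<omega>. (W b \<omega> - W a \<omega>) $ i * (W b \<omega> - W a \<omega>) $ j \<partial>M) = (if i = j then b - a else 0)"
    and "(\<integral>\<omega>. ((W b \<omega> - W a \<omega>) $ i) ^ 4 \<partial>M) = 3 * (b - a)\<^sup>2"
proof -
  interpret prob_space M using bm by (simp add: brownian_motion_def)
  let ?D = "\<lambda>i \<omega>. (W b \<omega> - W a \<omega>) $ i"
  let ?ts = "\<lambda>k::nat. if k = 0 then a else b"
  have 1: "indep_vars (\<lambda>_. borel) (\<lambda>(k, i) \<omega>. (W (?ts (Suc k)) \<omega> - W (?ts k) \<omega>) $ i) ({..<1} \<times> UNIV)"
    by (rule brownian_motionD(1)[OF bm]) (use ab in auto)
  have "distributed M lborel (\<lambda>\<omega>. (W (?ts (Suc 0)) \<omega> - W (?ts 0) \<omega>) $ i)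
      (\<lambda>x. ennreal (normal_density 0 (sqrt (?ts (Suc 0) - ?ts 0)) x))" for i
    by (rule brownian_motionD(2)[OF bm, of _ 1]) (use ab in auto)
  then have dist: "distributed M lborel (?D i) (\<lambda>x. ennreal (normal_density 0 (sqrt (b - a)) x))" for i
    by simp
  have \<sigma>: "sqrt (b - a) > 0" using ab by simp
  have int: "integrable M (\<lambda>\<omega>. ?D i \<omega> ^ n)" for i n
    using distributed_integrable[OF dist[of i], of "\<lambda>x. x ^ n"] integrable_normal_moment[OF \<sigma>, of 0 n]
    by (simp add: normal_density_nonneg)
  have ex: "(\<integral>\<omega>. ?D i \<omega> ^ n \<partial>M) = (\<integral>x. normal_density 0 (sqrt (b - a)) x * x ^ n \<partial>lborel)" for i n
    using distributed_integral[OF dist[of i], of "\<lambda>x. x ^ n"] by (simp add: normal_density_nonneg)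
  show "integrable M (\<lambda>\<omega>. ?D i \<omega> ^ n)" by (rule int)
  show E1: "(\<integral>\<omega>. ?D i \<omega> \<partial>M) = 0" for i
    using ex[of i 1] integral_normal_moment_odd[OF \<sigma>, of 0 0] by simp
  have E2: "(\<integral>\<omega>. ?D i \<omega> * ?D i \<omega> \<partial>M) = b - a" for i
    using ex[of i 2] integral_normal_moment_even[OF \<sigma>, of 0 1] ab by (simp add: power2_eq_square fact_numeral)
  show "(\<integral>\<omega>. ?D i \<omega> ^ 4 \<partial>M) = 3 * (b - a)\<^sup>2"
    using ex[of i 4] integral_normal_moment_even[OF \<sigma>, of 0 2] ab
    by (simp add: power2_eq_square fact_numeral field_simps)
  have ind: "indep_var borel (?D i) borel (?D j)" if "i \<noteq> j" for i j
  proof -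
    have "indep_var (PiM {(0,i)} (\<lambda>_. borel)) (\<lambda>\<omega>. restrict (\<lambda>p. (\<lambda>(k, i) \<omega>. (W (?ts (Suc k)) \<omega> - W (?ts k) \<omega>) $ i) p \<omega>) {(0,i)})
       (PiM {(0,j)} (\<lambda>_. borel)) (\<lambda>\<omega>. restrict (\<lambda>p. (\<lambda>(k, i) \<omega>. (W (?ts (Suc k)) \<omega> - W (?ts k) \<omega>) $ i) p \<omega>) {(0,j)})"
      by (rule indep_var_restrict[OF 1]) (use that in auto)
    from indep_var_compose[OF this, of "\<lambda>x. x (0,i)" borel "\<lambda>x. x (0,j)" borel]
    show ?thesis by (simp add: comp_def measurable_component_singleton)
  qed
  show "integrable M (\<lambda>\<omega>. ?D i \<omega> * ?D j \<omega>)"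
  proof (cases "i = j")
    case True then show ?thesis using int[of i 2] by (simp add: power2_eq_square)
  next
    case False
    show ?thesis by (rule indep_var_integrable[OF ind[OF False]]) (use int[of _ 1] in auto)
  qed
  show "(\<integral>\<omega>. ?D i \<omega> * ?D j \<omega> \<partial>M) = (if i = j then b - a else 0)"
  proof (cases "i = j")
    case True then show ?thesis using E2 by simp
  next
    case False
    have "(\<integral>\<omega>. ?D i \<omega> * ?D j \<omega> \<partial>M) = (\<integral>\<omega>. ?D i \<omega> \<partial>M) * (\<integral>\<omega>. ?D j \<omega> \<partial>M)"
      by (rule indep_var_lebesgue_integral[OF ind[OF False]]) (use int[of _ 1] in auto)
    then show ?thesis using False E1 by simp
  qed
qed

section \<open>Forward and backward sigma-algebras on the product space\<close>

text \<open>The projection \<open>p\<close> leads to the factor that carries \<open>W\<close>,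
  \<open>q\<close> to the other one, and \<open>prod\<close> expresses their independence. Keeping
  the projections abstract allows the roles of the two Brownian motions to be exchanged by
  instantiation.\<close>

locale bm_proj = prob_space P for P :: "'w measure" +
  fixes M1 :: "'a measure" and M2 :: "'b measure" and p :: "'w \<Rightarrow> 'a" and q :: "'w \<Rightarrow> 'b"
    and W :: "real \<Rightarrow> 'a \<Rightarrow> real^'d"
  assumes bm: "brownian_motion M1 W" and M2: "prob_space M2"
    and p [measurable]: "p \<in> measurable P M1" and q [measurable]: "q \<in> measurable P M2"
    and prod: "\<And>A B. A \<in> sets M1 \<Longrightarrow> B \<in> sets M2 \<Longrightarrow> measure P (p -` A \<inter> q -` B \<inter> space P) = measure M1 A * measure M2 B"
begin

lemma M1: "prob_space M1" and W_meas [measurable]: "W t \<in> borel_measurable M1"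
  and W0: "AE x in M1. W 0 x = 0"
  using bm by (auto simp: brownian_motion_def)

lemma measure_p: "A \<in> sets M1 \<Longrightarrow> measure P (p -` A \<inter> space P) = measure M1 A"
  using prod[of A "space M2"] prob_space.prob_space[OF M2] measurable_space[OF q]
  by (simp add: Int_def vimage_def conj_commute cong: conj_cong)

lemma distr_p: "distr P M1 p = M1"
proof (rule measure_eqI)
  fix A assume "A \<in> sets (distr P M1 p)"
  then have A: "A \<in> sets M1" by simp
  interpret M1: prob_space M1 by (rule M1)
  show "emeasure (distr P M1 p) A = emeasure M1 A"
    using measure_p[OF A] A by (simp add: emeasure_distr emeasure_eq_measure M1.emeasure_eq_measure)
qed simp

definition incr :: "real \<Rightarrow> real \<Rightarrow> 'w \<Rightarrow> real^'d" where
  "incr u v \<omega> = W v (p \<omega>) - W u (p \<omega>)"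

lemma incr_meas [measurable]: "incr u v \<in> borel_measurable P"
  unfolding incr_def by measurable

text \<open>Enlarging by the whole second factor makes the family monotone in \<open>u\<close>,
  without spoiling independence from later increments of \<open>W\<close>. \<open>Gbwd\<close> does
  the same with the future increments, decreasing in \<open>v\<close>.\<close>

definition Gfwd :: "real \<Rightarrow> 'w measure" where
  "Gfwd u = sigma (space P) ({(\<lambda>\<omega>. W r (p \<omega>)) -` A \<inter> space P | r A. 0 \<le> r \<and> r \<le> u \<and> A \<in> sets borel}
     \<union> {q -` A \<inter> space P | A. A \<in> sets M2} \<union> null_sets P)"

definition Gbwd :: "real \<Rightarrow> 'w measure" where
  "Gbwd v = sigma (space P) ({(\<lambda>\<omega>. W r (p \<omega>) - W v (p \<omega>)) -` A \<inter> space P | r A. v \<le> r \<and> A \<in> sets borel}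
     \<union> {q -` A \<inter> space P | A. A \<in> sets M2} \<union> null_sets P)"

text \<open>Only increments are independent, so times up to \<open>a\<close> are measured from time
  \<open>0\<close> and later ones from \<open>b\<close>; both kinds avoid the interval between
  \<open>a\<close> and \<open>b\<close>.\<close>

definition away :: "real \<Rightarrow> real \<Rightarrow> real \<Rightarrow> 'a \<Rightarrow> real^'d" where
  "away a b r x = W r x - W (if r \<le> a then 0 else b) x"

text \<open>Events that agree almost surely with a rectangle whose first side involves only increments
  of \<open>W\<close> away from the interval from \<open>a\<close> to \<open>b\<close>; a \<open>\<pi>\<close>-system generating both filtrations.\<close>

definition core :: "real \<Rightarrow> real \<Rightarrow> 'w set set" where
  "core a b = {A \<in> sets P. \<exists>J Ar A2. finite J \<and> J \<subseteq> {0..a} \<union> {b..} \<and> (\<forall>r. Ar r \<in> sets borel) \<and> A2 \<in> sets M2 \<and>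
     (AE \<omega> in P. \<omega> \<in> A \<longleftrightarrow> (\<forall>r\<in>J. away a b r (p \<omega>) \<in> Ar r) \<and> q \<omega> \<in> A2)}"

lemma coreI:
  assumes "A \<in> sets P" "finite J" "J \<subseteq> {0..a} \<union> {b..}" "\<And>r. Ar r \<in> sets borel" "A2 \<in> sets M2"
    "AE \<omega> in P. \<omega> \<in> A \<longleftrightarrow> (\<forall>r\<in>J. away a b r (p \<omega>) \<in> Ar r) \<and> q \<omega> \<in> A2"
  shows "A \<in> core a b"
  using assms unfolding core_def by blast

lemma Int_stable_core: "Int_stable (core a b)"
proof (rule Int_stableI)
  fix A A' assume "A \<in> core a b" "A' \<in> core a b"
  then obtain J Ar A2 J' Ar' A2' where
    A: "A \<in> sets P" "finite J" "J \<subseteq> {0..a} \<union> {b..}" "\<And>r. Ar r \<in> sets borel" "A2 \<in> sets M2"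
      "AE \<omega> in P. \<omega> \<in> A \<longleftrightarrow> (\<forall>r\<in>J. away a b r (p \<omega>) \<in> Ar r) \<and> q \<omega> \<in> A2"
    and A': "A' \<in> sets P" "finite J'" "J' \<subseteq> {0..a} \<union> {b..}" "\<And>r. Ar' r \<in> sets borel" "A2' \<in> sets M2"
      "AE \<omega> in P. \<omega> \<in> A' \<longleftrightarrow> (\<forall>r\<in>J'. away a b r (p \<omega>) \<in> Ar' r) \<and> q \<omega> \<in> A2'"
    unfolding core_def by blast
  show "A \<inter> A' \<in> core a b"
  proof (rule coreI[where J="J \<union> J'" and Ar="\<lambda>r. (if r \<in> J then Ar r else UNIV) \<inter> (if r \<in> J' then Ar' r else UNIV)" and ?A2.0="A2 \<inter> A2'"])
    show "AE \<omega> in P. \<omega> \<in> A \<inter> A' \<longleftrightarrow> (\<forall>r\<in>J \<union> J'. away a b r (p \<omega>)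
      \<in> (if r \<in> J then Ar r else UNIV) \<inter> (if r \<in> J' then Ar' r else UNIV)) \<and> q \<omega> \<in> A2 \<inter> A2'"
      using A(6) A'(6) by eventually_elim auto
  qed (use A A' in auto)
qed

text \<open>Replacing the event by its almost surely equal rectangle lets \<open>prod\<close> split
  off the second factor; what remains is independence of increments on \<open>M1\<close>.\<close>

lemma core_indep:
  assumes ab: "0 \<le> a" "a < b" and A: "A \<in> core a b" and C: "C \<in> sets borel"
  shows "prob (A \<inter> (incr a b -` C \<inter> space P)) = prob A * prob (incr a b -` C \<inter> space P)"
proof -
  from A obtain J Ar A2 where
    A: "A \<in> sets P" "finite J" "J \<subseteq> {0..a} \<union> {b..}" "\<And>r. Ar r \<in> sets borel" "A2 \<in> sets M2"
      "AE \<omega> in P. \<omega> \<in> A \<longleftrightarrow> (\<forall>r\<in>J. away a b r (p \<omega>) \<in> Ar r) \<and> q \<omega> \<in> A2"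
    unfolding core_def by blast
  define E1 where "E1 = {x\<in>space M1. \<forall>r\<in>J. away a b r x \<in> Ar r}"
  define E2 where "E2 = {x\<in>space M1. W b x - W a x \<in> C}"
  have E1: "E1 \<in> sets M1" unfolding E1_def
  proof (rule sets.sets_Collect_finite_All[OF _ A(2)])
    fix r
    have "away a b r \<in> borel_measurable M1" unfolding away_def by measurable
    from measurable_sets[OF this A(4)[of r]]
    show "{x \<in> space M1. away a b r x \<in> Ar r} \<in> sets M1"
      by (simp add: vimage_def Int_def conj_commute)
  qed
  have E2: "E2 \<in> sets M1"
  proof -
    have "(\<lambda>x. W b x - W a x) \<in> borel_measurable M1" by measurable
    from measurable_sets[OF this C] show ?thesis by (simp add: E2_def vimage_def Int_def conj_commute)
  qed
  have ind: "measure M1 (E1 \<inter> E2) = measure M1 E1 * measure M1 E2"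
    unfolding E1_def E2_def away_def by (rule bm_increment_indep[OF bm ab A(2,3)]) (use A(4) C in auto)
  have D: "incr a b -` C \<inter> space P = p -` E2 \<inter> space P"
    using measurable_space[OF p] by (auto simp: E2_def incr_def)
  have "prob A = prob (p -` E1 \<inter> q -` A2 \<inter> space P)"
    by (rule finite_measure_eq_AE) (use A(6) A(1,5) E1 measurable_space[OF p] in \<open>auto simp: E1_def elim!: eventually_mono\<close>)
  also have "\<dots> = measure M1 E1 * measure M2 A2" by (rule prod[OF E1 A(5)])
  finally have pA: "prob A = measure M1 E1 * measure M2 A2" .
  have "prob (A \<inter> (p -` E2 \<inter> space P)) = prob (p -` (E1 \<inter> E2) \<inter> q -` A2 \<inter> space P)"
    by (rule finite_measure_eq_AE) (use A(6) A(1,5) E1 E2 measurable_space[OF p] in \<open>auto simp: E1_def elim!: eventually_mono\<close>)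
  also have "\<dots> = measure M1 (E1 \<inter> E2) * measure M2 A2" by (rule prod[OF _ A(5)]) (use E1 E2 in auto)
  finally show ?thesis unfolding D using pA ind measure_p[OF E2] by simp
qed

text \<open>Both generating systems are closed under intersection, so independence passes to the
  generated sigma-algebras.\<close>

lemma sigma_core_indep:
  assumes ab: "0 \<le> a" "a < b" and A: "A \<in> sigma_sets (space P) (core a b)" and C: "C \<in> sets borel"
  shows "prob (A \<inter> (incr a b -` C \<inter> space P)) = prob A * prob (incr a b -` C \<inter> space P)"
proof -
  let ?B = "{incr a b -` C \<inter> space P | C. C \<in> sets borel}"
  have "indep_set (core a b) ?B"
    unfolding indep_sets2_eq
  proof (intro conjI ballI)
    show "core a b \<subseteq> events" by (auto simp: core_def)
    show "?B \<subseteq> events" using measurable_sets[OF incr_meas] by blast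
  qed (use core_indep[OF ab] in blast)
  moreover have "Int_stable ?B"
  proof (rule Int_stableI)
    fix A A' assume "A \<in> ?B" "A' \<in> ?B"
    then obtain C C' where "A = incr a b -` C \<inter> space P" "A' = incr a b -` C' \<inter> space P" "C \<in> sets borel" "C' \<in> sets borel"
      by blast
    then have "A \<inter> A' = incr a b -` (C \<inter> C') \<inter> space P" "C \<inter> C' \<in> sets borel" by auto
    then show "A \<inter> A' \<in> ?B" by blast
  qed
  ultimately have "indep_set (sigma_sets (space P) (core a b)) (sigma_sets (space P) ?B)"
    by (intro indep_set_sigma_sets Int_stable_core)
  then show ?thesis using A C by (intro indep_setD) (auto intro!: sigma_sets.Basic)
qed

lemma W0_P: "AE \<omega> in P. W 0 (p \<omega>) = 0"
proof -
  have "AE x in distr P M1 p. W 0 x = 0" unfolding distr_p by (rule W0)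
  then show ?thesis by (subst (asm) AE_distr_iff) auto
qed

lemma coreI_q: "A \<in> sets M2 \<Longrightarrow> q -` A \<inter> space P \<in> core a b"
  by (rule coreI[where J="{}" and Ar="\<lambda>_. UNIV" and ?A2.0=A]) (auto intro!: AE_I2)

lemma coreI_null: "A \<in> null_sets P \<Longrightarrow> A \<in> core a b"
  by (rule coreI[where J="{}" and Ar="\<lambda>_. UNIV" and ?A2.0="{}"])
     (use AE_not_in[of A P] in \<open>auto elim!: eventually_mono\<close>)

lemma space_G [simp]: "space (Gfwd u) = space P" "space (Gbwd u) = space P"
  by (simp_all add: Gfwd_def Gbwd_def space_measure_of_conv)

lemma Gfwd_core:
  assumes "0 \<le> a" "a < b" shows "sets (Gfwd a) \<subseteq> sigma_sets (space P) (core a b)"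
proof -
  have "{(\<lambda>\<omega>. W r (p \<omega>)) -` A \<inter> space P | r A. 0 \<le> r \<and> r \<le> a \<and> A \<in> sets borel}
     \<union> {q -` A \<inter> space P | A. A \<in> sets M2} \<union> null_sets P \<subseteq> core a b" (is "?G \<subseteq> _")
  proof (intro Un_least subsetI)
    fix B assume "B \<in> {(\<lambda>\<omega>. W r (p \<omega>)) -` A \<inter> space P | r A. 0 \<le> r \<and> r \<le> a \<and> A \<in> sets borel}"
    then obtain r A where B: "B = (\<lambda>\<omega>. W r (p \<omega>)) -` A \<inter> space P" "0 \<le> r" "r \<le> a" "A \<in> sets borel" by blast
    show "B \<in> core a b"
    proof (rule coreI[where J="{r}" and Ar="\<lambda>_. A" and ?A2.0="space M2"])
      show "B \<in> sets P" unfolding B by (rule measurable_sets[OF _ B(4)]) measurable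
      \<comment> \<open>Brownian motion starts at \<open>0\<close> only almost surely; this is where
        rectangles up to null sets are needed to describe events in terms of \<open>W r\<close> by
        the increment from time \<open>0\<close>.\<close>
      show "AE \<omega> in P. \<omega> \<in> B \<longleftrightarrow> (\<forall>r\<in>{r}. away a b r (p \<omega>) \<in> A) \<and> q \<omega> \<in> space M2"
        using W0_P AE_space by eventually_elim (use B measurable_space[OF q] in \<open>auto simp: away_def\<close>)
    qed (use B in auto)
  qed (use coreI_q coreI_null in auto)
  then have "sigma_sets (space P) ?G \<subseteq> sigma_sets (space P) (core a b)"
    by (intro sigma_sets_mono') auto
  moreover have "sets (Gfwd a) = sigma_sets (space P) ?G"
    unfolding Gfwd_def by (rule sets_measure_of) (auto dest: null_setsD2 sets.sets_into_space)
  ultimately show ?thesis by simp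
qed

lemma Gbwd_core:
  assumes "0 \<le> a" "a < b" shows "sets (Gbwd b) \<subseteq> sigma_sets (space P) (core a b)"
proof -
  have "{(\<lambda>\<omega>. W r (p \<omega>) - W b (p \<omega>)) -` A \<inter> space P | r A. b \<le> r \<and> A \<in> sets borel}
     \<union> {q -` A \<inter> space P | A. A \<in> sets M2} \<union> null_sets P \<subseteq> core a b" (is "?G \<subseteq> _")
  proof (intro Un_least subsetI)
    fix B assume "B \<in> {(\<lambda>\<omega>. W r (p \<omega>) - W b (p \<omega>)) -` A \<inter> space P | r A. b \<le> r \<and> A \<in> sets borel}"
    then obtain r A where B: "B = (\<lambda>\<omega>. W r (p \<omega>) - W b (p \<omega>)) -` A \<inter> space P" "b \<le> r" "A \<in> sets borel" by blast
    show "B \<in> core a b"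
    proof (rule coreI[where J="{r}" and Ar="\<lambda>_. A" and ?A2.0="space M2"])
      show "B \<in> sets P" unfolding B by (rule measurable_sets[OF _ B(3)]) measurable
      show "AE \<omega> in P. \<omega> \<in> B \<longleftrightarrow> (\<forall>r\<in>{r}. away a b r (p \<omega>) \<in> A) \<and> q \<omega> \<in> space M2"
        using AE_space by eventually_elim (use B assms measurable_space[OF q] in \<open>auto simp: away_def\<close>)
    qed (use B in auto)
  qed (use coreI_q coreI_null in auto)
  then have "sigma_sets (space P) ?G \<subseteq> sigma_sets (space P) (core a b)"
    by (intro sigma_sets_mono') auto
  moreover have "sets (Gbwd b) = sigma_sets (space P) ?G"
    unfolding Gbwd_def by (rule sets_measure_of) (auto dest: null_setsD2 sets.sets_into_space)
  ultimately show ?thesis by simp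
qed

lemma integral_p:
  fixes f :: "'a \<Rightarrow> real"
  assumes "f \<in> borel_measurable M1"
  shows "(\<integral>\<omega>. f (p \<omega>) \<partial>P) = (\<integral>x. f x \<partial>M1)" "integrable P (\<lambda>\<omega>. f (p \<omega>)) \<longleftrightarrow> integrable M1 f"
  using integral_distr[OF p assms] integrable_distr_eq[OF p assms] by (simp_all add: distr_p)

lemma incr_moments:
  assumes "0 \<le> a" "a \<le> b"
  shows "integrable P (\<lambda>\<omega>. (incr a b \<omega> $ i) ^ n)" (is ?A)
    and "(\<integral>\<omega>. incr a b \<omega> $ i \<partial>P) = 0" (is ?B)
    and "integrable P (\<lambda>\<omega>. incr a b \<omega> $ i * incr a b \<omega> $ j)" (is ?C)
    and "(\<integral>\<omega>. incr a b \<omega> $ i * incr a b \<omega> $ j \<partial>P) = (if i = j then b - a else 0)" (is ?D)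
    and "(\<integral>\<omega>. (incr a b \<omega> $ i) ^ 4 \<partial>P) = 3 * (b - a)\<^sup>2" (is ?E)
proof -
  have [measurable]: "(\<lambda>x. W t x $ i) \<in> borel_measurable M1" for t i
    by (rule measurable_compose[OF W_meas]) (intro borel_measurable_continuous_onI continuous_intros)
  have "?A \<and> ?B \<and> ?C \<and> ?D \<and> ?E"
  proof (cases "a = b")
    case True then show ?thesis by (simp add: incr_def)
  next
    case False
    then have "a < b" using assms by simp
    note m = bm_increment_moments[OF bm assms(1) this]
    show ?thesis using m(1)[of i n] m(2)[of i] m(3,4)[of i j] m(5)[of i]
      integral_p[of "\<lambda>x. ((W b x - W a x) $ i) ^ n"] integral_p[of "\<lambda>x. (W b x - W a x) $ i"]
      integral_p[of "\<lambda>x. (W b x - W a x) $ i * (W b x - W a x) $ j"] integral_p[of "\<lambda>x. ((W b x - W a x) $ i) ^ 4"]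
      by (simp add: incr_def)
  qed
  then show ?A ?B ?C ?D ?E by blast+
qed

text \<open>Both \<open>Gfwd a\<close> and \<open>Gbwd b\<close> lie in the sigma-algebra generated
  by \<open>core a b\<close>, so one independence statement serves both time directions. For
  \<open>a = b\<close> the increment is zero.\<close>

lemma incr_h:
  assumes ab: "0 \<le> a" "a \<le> b" and N: "N = Gfwd a \<or> N = Gbwd b"
    and h: "h \<in> borel_measurable N" "integrable P h"
  shows "integrable P (\<lambda>\<omega>. h \<omega> * incr a b \<omega> $ i)" (is ?A) and "(\<integral>\<omega>. h \<omega> * incr a b \<omega> $ i \<partial>P) = 0" (is ?B)
    and "integrable P (\<lambda>\<omega>. h \<omega> * (incr a b \<omega> $ i * incr a b \<omega> $ j))" (is ?C)
    and "(\<integral>\<omega>. h \<omega> * (incr a b \<omega> $ i * incr a b \<omega> $ j) \<partial>P) = (if i = j then b - a else 0) * (\<integral>\<omega>. h \<omega> \<partial>P)" (is ?D)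
proof -
  have "?A \<and> ?B \<and> ?C \<and> ?D"
  proof (cases "a = b")
    case True then show ?thesis by (simp add: incr_def)
  next
    case False
    then have lt: "a < b" using ab by simp
    have sub: "sets N \<subseteq> sigma_sets (space P) (core a b)" and spN: "space N = space P"
      using N Gfwd_core[OF ab(1) lt] Gbwd_core[OF ab(1) lt] by auto
    have subP: "sets N \<subseteq> sets P"
      using sub sets.sigma_sets_subset[of "core a b" P] by (auto simp: core_def)
    note I = indep_algebra_integral[OF spN subP incr_meas _ h, of a b]
    have ind: "prob (A \<inter> (incr a b -` C \<inter> space P)) = prob A * prob (incr a b -` C \<inter> space P)"
      if "A \<in> sets N" "C \<in> sets borel" for A C
      using sigma_core_indep[OF ab(1) lt _ that(2)] that(1) sub by blast
    have m: "(\<lambda>x::real^'d. x $ i) \<in> borel_measurable borel" for i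
      by (intro borel_measurable_continuous_onI continuous_intros)
    have m2: "(\<lambda>x::real^'d. x $ i * x $ j) \<in> borel_measurable borel"
      by (intro borel_measurable_times m)
    have i1: "integrable P (\<lambda>\<omega>. incr a b \<omega> $ i)" using incr_moments(1)[OF ab, of i 1] by simp
    have "(\<integral>\<omega>. h \<omega> * incr a b \<omega> $ i \<partial>P) = (\<integral>\<omega>. h \<omega> \<partial>P) * (\<integral>\<omega>. incr a b \<omega> $ i \<partial>P)"
      by (rule I(2)[where \<phi>="\<lambda>x. x $ i"]) (use ind m i1 in auto)
    then have "?B" unfolding incr_moments(2)[OF ab] by simp
    moreover have "(\<integral>\<omega>. h \<omega> * (incr a b \<omega> $ i * incr a b \<omega> $ j) \<partial>P) = (\<integral>\<omega>. h \<omega> \<partial>P) * (\<integral>\<omega>. incr a b \<omega> $ i * incr a b \<omega> $ j \<partial>P)"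
      by (rule I(2)[where \<phi>="\<lambda>x. x $ i * x $ j"]) (use ind m2 incr_moments(3)[OF ab] in auto)
    then have "?D" unfolding incr_moments(4)[OF ab] by (simp add: mult.commute)
    moreover have ?A by (rule I(1)[where \<phi>="\<lambda>x. x $ i"]) (use ind m i1 in auto)
    moreover have ?C by (rule I(1)[where \<phi>="\<lambda>x. x $ i * x $ j"]) (use ind m2 incr_moments(3)[OF ab] in auto)
    ultimately show ?thesis by blast
  qed
  then show ?A ?B ?C ?D by blast+
qed

end

section \<open>Square integrable functions\<close>

definition sqint :: "'a measure \<Rightarrow> ('a \<Rightarrow> 'b::euclidean_space) \<Rightarrow> bool" where
  "sqint M f \<longleftrightarrow> f \<in> borel_measurable M \<and> integrable M (\<lambda>x. (norm (f x))\<^sup>2)"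

definition nsq :: "'a measure \<Rightarrow> ('a \<Rightarrow> 'b::euclidean_space) \<Rightarrow> real" where
  "nsq M f = (\<integral>x. (norm (f x))\<^sup>2 \<partial>M)"

lemma sqint_meas [measurable_dest]: "sqint M f \<Longrightarrow> f \<in> borel_measurable M"
  and sqint_int: "sqint M f \<Longrightarrow> integrable M (\<lambda>x. (norm (f x))\<^sup>2)"
  by (auto simp: sqint_def)

lemma nsq_nonneg: "0 \<le> nsq M f"
  by (simp add: nsq_def)

text \<open>Young's inequality by completing the square; the free parameter decides which of the two
  factors is made small.\<close>

lemma two_mult_le_eta:
  fixes a b \<eta> :: real assumes "\<eta> > 0" shows "2 * (a * b) \<le> \<eta> * a\<^sup>2 + b\<^sup>2 / \<eta>"
proof -
  have "0 \<le> (\<eta> * a - b)\<^sup>2 / \<eta>" using assms by simp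
  also have "(\<eta> * a - b)\<^sup>2 / \<eta> = \<eta> * a\<^sup>2 + b\<^sup>2 / \<eta> - 2 * (a * b)"
    using assms by (simp add: power2_eq_square field_simps)
  finally show ?thesis by simp
qed

lemma norm_add_sq_le: "(norm (a + b))\<^sup>2 \<le> 2 * (norm a)\<^sup>2 + 2 * (norm (b::'b::real_normed_vector))\<^sup>2"
proof -
  have "(norm (a + b))\<^sup>2 \<le> (norm a + norm b)\<^sup>2" by (intro power_mono norm_triangle_ineq) auto
  also have "\<dots> \<le> 2 * (norm a)\<^sup>2 + 2 * (norm b)\<^sup>2"
    using two_mult_le_eta[of 1 "norm a" "norm b"] by (simp add: power2_sum)
  finally show ?thesis .
qed

lemma sqint_add:
  assumes "sqint M f" "sqint M g"
  shows "sqint M (\<lambda>x. f x + g x)" "nsq M (\<lambda>x. f x + g x) \<le> 2 * nsq M f + 2 * nsq M g"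
proof -
  have i: "integrable M (\<lambda>x. 2 * (norm (f x))\<^sup>2 + 2 * (norm (g x))\<^sup>2)"
    using assms by (auto simp: sqint_def)
  have i2: "integrable M (\<lambda>x. (norm (f x + g x))\<^sup>2)"
    by (rule Bochner_Integration.integrable_bound[OF i])
       (use assms norm_add_sq_le in \<open>auto simp: sqint_def\<close>)
  then show "sqint M (\<lambda>x. f x + g x)" using assms by (auto simp: sqint_def)
  have "nsq M (\<lambda>x. f x + g x) \<le> (\<integral>x. 2 * (norm (f x))\<^sup>2 + 2 * (norm (g x))\<^sup>2 \<partial>M)"
    unfolding nsq_def by (rule integral_mono[OF i2 i norm_add_sq_le])
  also have "\<dots> = 2 * nsq M f + 2 * nsq M g" using assms by (simp add: sqint_def nsq_def)
  finally show "nsq M (\<lambda>x. f x + g x) \<le> 2 * nsq M f + 2 * nsq M g" .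
qed

lemma sqint_uminus: "sqint M f \<Longrightarrow> sqint M (\<lambda>x. - f x)" and nsq_uminus: "nsq M (\<lambda>x. - f x) = nsq M f"
  by (auto simp: sqint_def nsq_def)

lemma sqint_diff:
  assumes "sqint M f" "sqint M g"
  shows "sqint M (\<lambda>x. f x - g x)" "nsq M (\<lambda>x. f x - g x) \<le> 2 * nsq M f + 2 * nsq M g"
  using sqint_add[OF assms(1) sqint_uminus[OF assms(2)]] by (simp_all add: nsq_uminus)

lemma sqint_zero [simp]: "sqint M (\<lambda>x. 0)" and nsq_zero [simp]: "nsq M (\<lambda>x. 0) = 0"
  by (simp_all add: sqint_def nsq_def)

lemma sqint_mult_bounded:
  fixes c :: "'a \<Rightarrow> real"
  assumes f: "sqint M f" and c: "c \<in> borel_measurable M" "\<And>x. x \<in> space M \<Longrightarrow> \<bar>c x\<bar> \<le> C"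
  shows "sqint M (\<lambda>x. c x *\<^sub>R f x)" and "integrable M (\<lambda>x. c x * (norm (f x))\<^sup>2)"
proof -
  have i: "integrable M (\<lambda>x. C\<^sup>2 * (norm (f x))\<^sup>2)" "integrable M (\<lambda>x. \<bar>C\<bar> * (norm (f x))\<^sup>2)"
    using f by (auto simp: sqint_def)
  have "integrable M (\<lambda>x. (norm (c x *\<^sub>R f x))\<^sup>2)"
  proof (rule Bochner_Integration.integrable_bound[OF i(1)])
    show "AE x in M. norm ((norm (c x *\<^sub>R f x))\<^sup>2) \<le> norm (C\<^sup>2 * (norm (f x))\<^sup>2)"
      using c(2) by (intro AE_I2) (auto simp: power_mult_distrib abs_le_square_iff intro!: mult_right_mono,
        metis abs_ge_self abs_le_square_iff order_trans power2_abs)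
  qed (use f c in \<open>auto simp: sqint_def\<close>)
  then show "sqint M (\<lambda>x. c x *\<^sub>R f x)" using f c by (auto simp: sqint_def)
  show "integrable M (\<lambda>x. c x * (norm (f x))\<^sup>2)"
  proof (rule Bochner_Integration.integrable_bound[OF i(2)])
    show "AE x in M. norm (c x * (norm (f x))\<^sup>2) \<le> norm (\<bar>C\<bar> * (norm (f x))\<^sup>2)"
      using c(2) by (intro AE_I2) (force simp: abs_mult intro!: mult_right_mono)
  qed (use f c in \<open>auto simp: sqint_def\<close>)
qed

lemma sqint_scale: "sqint M f \<Longrightarrow> sqint M (\<lambda>x. r *\<^sub>R f x)"
  by (rule sqint_mult_bounded(1)[where C="\<bar>r\<bar>"]) auto

lemma sqint_inner:
  assumes "sqint M f" "sqint M g"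
  shows "integrable M (\<lambda>x. f x \<bullet> g x)"
    and "\<eta> > 0 \<Longrightarrow> \<bar>\<integral>x. f x \<bullet> g x \<partial>M\<bar> \<le> \<eta> * nsq M f + nsq M g / \<eta>"
proof -
  have b: "\<bar>f x \<bullet> g x\<bar> \<le> \<eta> * (norm (f x))\<^sup>2 + (norm (g x))\<^sup>2 / \<eta>" if "\<eta> > 0" for \<eta> x
  proof -
    have "\<bar>f x \<bullet> g x\<bar> \<le> norm (f x) * norm (g x)" by (rule Cauchy_Schwarz_ineq2)
    also have "\<dots> \<le> 2 * (norm (f x) * norm (g x))" by simp
    also have "\<dots> \<le> \<eta> * (norm (f x))\<^sup>2 + (norm (g x))\<^sup>2 / \<eta>" by (rule two_mult_le_eta[OF that])
    finally show ?thesis .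
  qed
  have i: "integrable M (\<lambda>x. \<eta> * (norm (f x))\<^sup>2 + (norm (g x))\<^sup>2 / \<eta>)" for \<eta>
    using assms by (auto simp: sqint_def)
  show ii: "integrable M (\<lambda>x. f x \<bullet> g x)"
    by (rule Bochner_Integration.integrable_bound[OF i[of 1]])
       (use assms b[of 1] in \<open>auto simp: sqint_def intro!: AE_I2\<close>)
  assume e: "\<eta> > 0"
  have "\<bar>\<integral>x. f x \<bullet> g x \<partial>M\<bar> \<le> (\<integral>x. \<bar>f x \<bullet> g x\<bar> \<partial>M)" by (rule integral_abs_bound)
  also have "\<dots> \<le> (\<integral>x. \<eta> * (norm (f x))\<^sup>2 + (norm (g x))\<^sup>2 / \<eta> \<partial>M)"
    by (rule integral_mono) (use ii i b[OF e] in auto)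
  also have "\<dots> = \<eta> * nsq M f + nsq M g / \<eta>" using assms by (simp add: sqint_def nsq_def)
  finally show "\<bar>\<integral>x. f x \<bullet> g x \<partial>M\<bar> \<le> \<eta> * nsq M f + nsq M g / \<eta>" .
qed

lemma sqint_mult:
  fixes f g :: "'a \<Rightarrow> real"
  assumes "sqint M f" "sqint M g"
  shows "integrable M (\<lambda>x. f x * g x)"
    and "\<eta> > 0 \<Longrightarrow> \<bar>\<integral>x. f x * g x \<partial>M\<bar> \<le> \<eta> * nsq M f + nsq M g / \<eta>"
  using sqint_inner[OF assms] by simp_all

text \<open>Continuity of weighted squared norms in mean square, with an explicit bound: the squares
  are expanded around \<open>f\<close> and the cross term is split by Young's inequality. It carries
  the weighted isometry from simple integrands to their limits.\<close>

lemma nsq_weight_diff: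
  fixes c :: "'a \<Rightarrow> real"
  assumes f: "sqint M f" "sqint M g" and c: "c \<in> borel_measurable M" "\<And>x. x \<in> space M \<Longrightarrow> \<bar>c x\<bar> \<le> C"
    and e: "\<eta> > 0" and C: "0 \<le> C"
  shows "\<bar>(\<integral>x. c x * (norm (f x))\<^sup>2 \<partial>M) - (\<integral>x. c x * (norm (g x))\<^sup>2 \<partial>M)\<bar>
     \<le> C * (\<eta> * nsq M f + (1 + 1 / \<eta>) * nsq M (\<lambda>x. f x - g x))"
proof -
  have b: "\<bar>(norm (f x))\<^sup>2 - (norm (g x))\<^sup>2\<bar> \<le> \<eta> * (norm (f x))\<^sup>2 + (1 + 1 / \<eta>) * (norm (f x - g x))\<^sup>2" for x
  proof -
    have "(norm (f x))\<^sup>2 - (norm (g x))\<^sup>2 = 2 * (f x \<bullet> (f x - g x)) - (norm (f x - g x))\<^sup>2"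
      by (simp add: power2_norm_eq_inner inner_diff_left inner_diff_right inner_commute)
    then have "\<bar>(norm (f x))\<^sup>2 - (norm (g x))\<^sup>2\<bar> \<le> 2 * \<bar>f x \<bullet> (f x - g x)\<bar> + (norm (f x - g x))\<^sup>2"
      by (simp add: abs_le_iff) (smt (verit) zero_le_power2)
    also have "\<dots> \<le> 2 * (norm (f x) * norm (f x - g x)) + (norm (f x - g x))\<^sup>2"
      using Cauchy_Schwarz_ineq2[of "f x" "f x - g x"] by simp
    also have "\<dots> \<le> \<eta> * (norm (f x))\<^sup>2 + (norm (f x - g x))\<^sup>2 / \<eta> + (norm (f x - g x))\<^sup>2"
      using two_mult_le_eta[OF e, of "norm (f x)" "norm (f x - g x)"] by simp
    finally show ?thesis by (simp add: algebra_simps)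
  qed
  note fg = sqint_diff(1)[OF f]
  have i: "integrable M (\<lambda>x. C * (\<eta> * (norm (f x))\<^sup>2 + (1 + 1 / \<eta>) * (norm (f x - g x))\<^sup>2))"
    using sqint_int[OF f(1)] sqint_int[OF fg] by auto
  note ci = sqint_mult_bounded(2)[OF f(1) c] sqint_mult_bounded(2)[OF f(2) c]
  have "\<bar>(\<integral>x. c x * (norm (f x))\<^sup>2 \<partial>M) - (\<integral>x. c x * (norm (g x))\<^sup>2 \<partial>M)\<bar>
    = \<bar>\<integral>x. c x * (norm (f x))\<^sup>2 - c x * (norm (g x))\<^sup>2 \<partial>M\<bar>" using ci by simp
  also have "\<dots> \<le> (\<integral>x. \<bar>c x * (norm (f x))\<^sup>2 - c x * (norm (g x))\<^sup>2\<bar> \<partial>M)" by (rule integral_abs_bound)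
  also have "\<dots> \<le> (\<integral>x. C * (\<eta> * (norm (f x))\<^sup>2 + (1 + 1 / \<eta>) * (norm (f x - g x))\<^sup>2) \<partial>M)"
  proof (rule integral_mono[OF _ i])
    show "integrable M (\<lambda>x. \<bar>c x * (norm (f x))\<^sup>2 - c x * (norm (g x))\<^sup>2\<bar>)" using ci by auto
    fix x assume x: "x \<in> space M"
    have "\<bar>c x * (norm (f x))\<^sup>2 - c x * (norm (g x))\<^sup>2\<bar> = \<bar>c x\<bar> * \<bar>(norm (f x))\<^sup>2 - (norm (g x))\<^sup>2\<bar>"
      by (simp add: abs_mult[symmetric] algebra_simps)
    also have "\<dots> \<le> C * (\<eta> * (norm (f x))\<^sup>2 + (1 + 1 / \<eta>) * (norm (f x - g x))\<^sup>2)"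
      by (rule mult_mono[OF c(2)[OF x] b]) (use C in auto)
    finally show "\<bar>c x * (norm (f x))\<^sup>2 - c x * (norm (g x))\<^sup>2\<bar> \<le> C * (\<eta> * (norm (f x))\<^sup>2 + (1 + 1 / \<eta>) * (norm (f x - g x))\<^sup>2)" .
  qed
  also have "\<dots> = C * (\<eta> * nsq M f + (1 + 1 / \<eta>) * nsq M (\<lambda>x. f x - g x))"
    using sqint_int[OF f(1)] sqint_int[OF fg] by (simp add: nsq_def)
  finally show ?thesis .
qed

lemma (in finite_measure) sqint_bounded:
  assumes "f \<in> borel_measurable M" "\<And>x. x \<in> space M \<Longrightarrow> norm (f x) \<le> C"
  shows "sqint M f"
  unfolding sqint_def
proof (intro conjI assms(1))
  show "integrable M (\<lambda>x. (norm (f x))\<^sup>2)"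
    by (rule integrable_const_bound[where B="C\<^sup>2"]) (use assms in \<open>auto intro!: AE_I2 power_mono\<close>)
qed

lemma (in finite_measure) sqint_integrable:
  assumes "sqint M f" shows "integrable M (f :: _ \<Rightarrow> real)"
proof -
  have "sqint M (\<lambda>_. 1::real)" by (rule sqint_bounded[where C=1]) auto
  from sqint_mult(1)[OF assms this] show ?thesis by simp
qed

lemma sqint_le:
  assumes "sqint M h" "g \<in> borel_measurable M" "\<And>\<omega>. \<omega> \<in> space M \<Longrightarrow> \<bar>g \<omega>\<bar> \<le> \<bar>h \<omega>\<bar>"
  shows "sqint M (g :: 'a \<Rightarrow> real)"
  unfolding sqint_def
proof (intro conjI assms(2))
  show "integrable M (\<lambda>\<omega>. (norm (g \<omega>))\<^sup>2)"
    by (rule Bochner_Integration.integrable_bound[OF sqint_int[OF assms(1)]])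
       (use assms(2,3) in \<open>auto intro!: AE_I2 simp: abs_le_square_iff\<close>)
qed

lemma real_eq_if_abs_le:
  fixes x y :: real
  assumes "\<And>e. e > 0 \<Longrightarrow> \<bar>x - y\<bar> \<le> e" shows "x = y"
  by (rule ccontr) (use assms[of "\<bar>x - y\<bar> / 2"] in auto)

section \<open>The product of the time interval with the probability space\<close>

definition timeprod :: "real \<Rightarrow> 'w measure \<Rightarrow> (real \<times> 'w) measure" where
  "timeprod T P = restrict_space lborel {0..T} \<Otimes>\<^sub>M P"

lemma finite_measure_time: "finite_measure (restrict_space lborel {0..T::real})"
  by (rule finite_measureI) (simp add: emeasure_restrict_space space_restrict_space emeasure_lborel_Icc_eq)

lemma space_timeprod [simp]: "space (timeprod T P) = {0..T} \<times> space P"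
  by (simp add: timeprod_def space_pair_measure space_restrict_space)

lemma fst_timeprod [measurable]: "fst \<in> borel_measurable (timeprod T P)"
proof -
  have "(\<lambda>s. s) \<in> borel_measurable (restrict_space lborel {0..T::real})"
    by (rule measurable_restrict_space1) simp
  from measurable_compose[OF measurable_fst this] show ?thesis
    by (simp add: timeprod_def)
qed

lemma snd_timeprod [measurable]: "snd \<in> measurable (timeprod T P) P"
  by (simp add: timeprod_def)

context prob_space
begin

lemma pair_sigma_finite_time: "pair_sigma_finite (restrict_space lborel {0..T::real}) M"
  using finite_measure_time[of T] finite_measure_axioms
  by (intro pair_sigma_finite.intro finite_measure.axioms(1))

lemma finite_measure_timeprod: "finite_measure (timeprod T M)"
  unfolding timeprod_def by (rule finite_measure_pair_measure[OF finite_measure_axioms finite_measure_time])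

lemma integral_timeprod_rect:
  fixes k :: "'a \<Rightarrow> real"
  assumes k: "integrable M k" and uv: "0 \<le> u" "u \<le> v" "v \<le> T"
  shows "integrable (timeprod T M) (\<lambda>x. indicator {u<..v} (fst x) * k (snd x))"
    and "(\<integral>x. indicator {u<..v} (fst x) * k (snd x) \<partial>timeprod T M) = (v - u) * (\<integral>\<omega>. k \<omega> \<partial>M)"
proof -
  interpret pair_sigma_finite "restrict_space lborel {0..T}" M by (rule pair_sigma_finite_time)
  have km [measurable]: "k \<in> borel_measurable M" using k by auto
  have I: "(\<integral>s. indicator {u<..v} s \<partial>restrict_space lborel {0..T}) = v - u"
    "integrable (restrict_space lborel {0..T}) (\<lambda>s. indicator {u<..v} s :: real)"
  proof -
    have e: "indicator {0..T} s *\<^sub>R indicator {u<..v} s = (indicator {u<..v} s :: real)" for s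
      using uv by (auto simp: indicator_def)
    show "(\<integral>s. indicator {u<..v} s \<partial>restrict_space lborel {0..T}) = v - u"
      using uv by (subst integral_restrict_space, simp, unfold e) simp
    show "integrable (restrict_space lborel {0..T}) (\<lambda>s. indicator {u<..v} s :: real)"
      using uv by (subst integrable_restrict_space, simp, unfold e) simp
  qed
  show int: "integrable (timeprod T M) (\<lambda>x. indicator {u<..v} (fst x) * k (snd x))"
    unfolding timeprod_def
  proof (rule Fubini_integrable)
    show "(\<lambda>x. indicator {u<..v} (fst x) * k (snd x)) \<in> borel_measurable (restrict_space lborel {0..T} \<Otimes>\<^sub>M M)"
      unfolding timeprod_def[symmetric] by measurable
    show "integrable (restrict_space lborel {0..T}) (\<lambda>x. \<integral>y. norm (indicator {u<..v} (fst (x, y)) * k (snd (x, y))) \<partial>M)"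
      using I(2) by (simp add: abs_mult)
    show "AE x in restrict_space lborel {0..T}. integrable M (\<lambda>y. indicator {u<..v} (fst (x, y)) * k (snd (x, y)))"
      using k by simp
  qed
  have "(\<integral>x. indicator {u<..v} (fst x) * k (snd x) \<partial>timeprod T M)
     = (\<integral>s. (\<integral>\<omega>. indicator {u<..v} s * k \<omega> \<partial>M) \<partial>restrict_space lborel {0..T})"
    using integral_fst'[OF int[unfolded timeprod_def]] by (simp add: timeprod_def)
  also have "\<dots> = (v - u) * (\<integral>\<omega>. k \<omega> \<partial>M)" using I by simp
  finally show "(\<integral>x. indicator {u<..v} (fst x) * k (snd x) \<partial>timeprod T M) = (v - u) * (\<integral>\<omega>. k \<omega> \<partial>M)" .
qed

end

section \<open>An abstract stochastic integral\<close>

text \<open>\<open>A u v\<close> is a sigma-algebra independent of the increment \<open>X u v\<close>. For the forward integral it depends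
  only on the left endpoint \<open>u\<close>, for the backward one only on the right endpoint \<open>v\<close>, so that one theory
  serves both.\<close>

locale noise = prob_space P for P :: "'w measure" +
  fixes T :: real and A :: "real \<Rightarrow> real \<Rightarrow> 'w measure" and X :: "real \<Rightarrow> real \<Rightarrow> 'w \<Rightarrow> real^'d"
  assumes A_space: "space (A u v) = space P"
    and A_sets: "\<lbrakk>0 \<le> u; u \<le> v; v \<le> T\<rbrakk> \<Longrightarrow> sets (A u v) \<subseteq> sets P"
    and A_mono: "\<lbrakk>0 \<le> u; u \<le> u'; u' \<le> v'; v' \<le> v; v \<le> T\<rbrakk> \<Longrightarrow> sets (A u v) \<subseteq> sets (A u' v')"
    and X_meas [measurable]: "(\<lambda>\<omega>. X u v \<omega> $ i) \<in> borel_measurable P"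
    and X_add: "X u v \<omega> + X v w \<omega> = X u w \<omega>"
    and X_int1: "\<lbrakk>0 \<le> u; u \<le> v; v \<le> T; h \<in> borel_measurable (A u v); integrable P h\<rbrakk> \<Longrightarrow>
       integrable P (\<lambda>\<omega>. h \<omega> * X u v \<omega> $ i)"
    and X_mean: "\<lbrakk>0 \<le> u; u \<le> v; v \<le> T; h \<in> borel_measurable (A u v); integrable P h\<rbrakk> \<Longrightarrow>
       (\<integral>\<omega>. h \<omega> * X u v \<omega> $ i \<partial>P) = 0"
    and X_int2: "\<lbrakk>0 \<le> u; u \<le> v; v \<le> T; h \<in> borel_measurable (A u v); integrable P h\<rbrakk> \<Longrightarrow>
       integrable P (\<lambda>\<omega>. h \<omega> * (X u v \<omega> $ i * X u v \<omega> $ j))"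
    and X_cov: "\<lbrakk>0 \<le> u; u \<le> v; v \<le> T; h \<in> borel_measurable (A u v); integrable P h\<rbrakk> \<Longrightarrow>
       (\<integral>\<omega>. h \<omega> * (X u v \<omega> $ i * X u v \<omega> $ j) \<partial>P) = (if i = j then v - u else 0) * (\<integral>\<omega>. h \<omega> \<partial>P)"
    and X_int4: "\<lbrakk>0 \<le> u; u \<le> v; v \<le> T\<rbrakk> \<Longrightarrow> integrable P (\<lambda>\<omega>. (X u v \<omega> $ i) ^ 4)"
    and X_four: "\<lbrakk>0 \<le> u; u \<le> v; v \<le> T\<rbrakk> \<Longrightarrow> (\<integral>\<omega>. (X u v \<omega> $ i) ^ 4 \<partial>P) = 3 * (v - u)\<^sup>2"
    and X_orth: "\<lbrakk>0 \<le> u; u \<le> v; v \<le> u'; u' \<le> v'; v' \<le> T;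
       h \<in> borel_measurable (A u v); sqint P h; h' \<in> borel_measurable (A u' v'); sqint P h'\<rbrakk> \<Longrightarrow>
       (\<integral>\<omega>. (h \<omega> * X u v \<omega> $ i) * (h' \<omega> * X u' v' \<omega> $ j) \<partial>P) = 0"
begin

abbreviation Q :: "(real \<times> 'w) measure" where
  "Q \<equiv> timeprod T P"

lemma X_self [simp]: "X u u \<omega> = 0"
  using X_add[of u u \<omega> u] by simp

lemma A_meas: "\<lbrakk>0 \<le> u; u \<le> v; v \<le> T; h \<in> borel_measurable (A u v)\<rbrakk> \<Longrightarrow> h \<in> borel_measurable P"
  using A_sets[of u v] A_space[of u v] by (auto simp: measurable_def)

text \<open>A coefficient admissible on an interval stays admissible on every subinterval, since
  shrinking moves the left end forward and the right end backward and the sigma-algebra grows in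
  either case. Subdividing intervals rests on this.\<close>

lemma A_meas_mono: "\<lbrakk>0 \<le> u; u \<le> u'; u' \<le> v'; v' \<le> v; v \<le> T; h \<in> borel_measurable (A u v)\<rbrakk>
    \<Longrightarrow> h \<in> borel_measurable (A u' v')"
  using A_mono[of u u' v' v] A_space[of u v] A_space[of u' v'] by (auto simp: measurable_def)

text \<open>The covariance rule is applied to the squared coefficient, which is measurable with
  respect to the same sigma-algebra.\<close>

lemma sqint_elem:
  assumes "0 \<le> u" "u \<le> v" "v \<le> T" "h \<in> borel_measurable (A u v)" "sqint P h"
  shows "sqint P (\<lambda>\<omega>. h \<omega> * X u v \<omega> $ i)" "nsq P (\<lambda>\<omega>. h \<omega> * X u v \<omega> $ i) = (v - u) * nsq P h"
proof -
  have hm: "(\<lambda>\<omega>. (h \<omega>)\<^sup>2) \<in> borel_measurable (A u v)" using assms by measurable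
  have hi: "integrable P (\<lambda>\<omega>. (h \<omega>)\<^sup>2)" using assms(5) by (simp add: sqint_def)
  note i2 = X_int2[OF assms(1-3) hm hi, of i i] and c = X_cov[OF assms(1-3) hm hi, of i i]
  have e: "(norm (h \<omega> * X u v \<omega> $ i))\<^sup>2 = (h \<omega>)\<^sup>2 * (X u v \<omega> $ i * X u v \<omega> $ i)" for \<omega>
    by (simp add: power_mult_distrib power2_eq_square)
  show "sqint P (\<lambda>\<omega>. h \<omega> * X u v \<omega> $ i)"
    unfolding sqint_def e using i2 A_meas[OF assms(1-4)] by auto
  show "nsq P (\<lambda>\<omega>. h \<omega> * X u v \<omega> $ i) = (v - u) * nsq P h"
    unfolding nsq_def e using c by simp
qed

text \<open>Each interval is cut into the pieces before, inside and after the overlap. Pieces on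
  different sides are orthogonal, and on the overlap both increments coincide, so that the
  covariance rule applies to the product of the coefficients.\<close>

lemma elem_cov:
  assumes o: "0 \<le> u" "u \<le> v" "v \<le> T" "0 \<le> u'" "u' \<le> v'" "v' \<le> T"
    and h: "h \<in> borel_measurable (A u v)" "sqint P h" and h': "h' \<in> borel_measurable (A u' v')" "sqint P h'"
  shows "(\<integral>\<omega>. (h \<omega> * X u v \<omega> $ i) * (h' \<omega> * X u' v' \<omega> $ j) \<partial>P)
    = (if i = j then max 0 (min v v' - max u u') else 0) * (\<integral>\<omega>. h \<omega> * h' \<omega> \<partial>P)"
proof -
  \<comment> \<open>The overlap runs from \<open>l\<close> to \<open>r\<close>; the maximum in
    \<open>r\<close> makes it empty rather than reversed for disjoint intervals. \<open>m1\<close>,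
    \<open>m2\<close> clamp its ends to the first interval and \<open>n1\<close>, \<open>n2\<close>
    to the second.\<close>
  define l where "l = max u u'"
  define r where "r = max l (min v v')"
  define m1 where "m1 = min l v" define m2 where "m2 = min r v"
  define n1 where "n1 = min l v'" define n2 where "n2 = min r v'"
  have om: "u \<le> m1" "m1 \<le> m2" "m2 \<le> v" "u' \<le> n1" "n1 \<le> n2" "n2 \<le> v'"
    using o by (auto simp: l_def r_def m1_def m2_def n1_def n2_def)
  \<comment> \<open>One alternative for each of the eight products of unlike pieces: either the two
    pieces are ordered in time or one of them is empty.\<close>
  have ds: "u = m1 \<or> u' = n1" "m1 \<le> n1 \<or> n1 = n2" "m1 \<le> n2 \<or> n2 = v'" "n1 \<le> m1 \<or> m1 = m2"
    "m2 \<le> n2 \<or> n2 = v'" "n1 \<le> m2 \<or> m2 = v" "n2 \<le> m2 \<or> m2 = v" "m2 = v \<or> n2 = v'"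
    using o unfolding l_def r_def m1_def m2_def n1_def n2_def by linarith+
  define a where "a = (\<lambda>\<omega>. h \<omega> * X u m1 \<omega> $ i)" define b where "b = (\<lambda>\<omega>. h \<omega> * X m1 m2 \<omega> $ i)"
  define c where "c = (\<lambda>\<omega>. h \<omega> * X m2 v \<omega> $ i)"
  define a' where "a' = (\<lambda>\<omega>. h' \<omega> * X u' n1 \<omega> $ j)" define b' where "b' = (\<lambda>\<omega>. h' \<omega> * X n1 n2 \<omega> $ j)"
  define c' where "c' = (\<lambda>\<omega>. h' \<omega> * X n2 v' \<omega> $ j)"
  have hA: "h \<in> borel_measurable (A s t)" if "u \<le> s" "s \<le> t" "t \<le> v" for s t
    using A_meas_mono[OF o(1) that o(3) h(1)] .
  have hA': "h' \<in> borel_measurable (A s t)" if "u' \<le> s" "s \<le> t" "t \<le> v'" for s t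
    using A_meas_mono[OF o(4) that o(6) h'(1)] .
  have sq: "sqint P a" "sqint P b" "sqint P c" "sqint P a'" "sqint P b'" "sqint P c'"
    unfolding a_def b_def c_def a'_def b'_def c'_def using o om h(2) h'(2)
    by (auto intro!: sqint_elem hA hA')
  have orth: "(\<integral>\<omega>. (h \<omega> * X s t \<omega> $ i) * (h' \<omega> * X s' t' \<omega> $ j) \<partial>P) = 0"
    if "u \<le> s" "s \<le> t" "t \<le> v" "u' \<le> s'" "s' \<le> t'" "t' \<le> v'" "t \<le> s' \<or> t' \<le> s \<or> s = t \<or> s' = t'" for s t s' t'
    using that(7)
  proof (elim disjE)
    assume "t \<le> s'"
    then show ?thesis using that o h(2) h'(2) by (intro X_orth hA hA') auto
  next
    assume *: "t' \<le> s"
    have "(\<integral>\<omega>. (h' \<omega> * X s' t' \<omega> $ j) * (h \<omega> * X s t \<omega> $ i) \<partial>P) = 0"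
      using * that o h(2) h'(2) by (intro X_orth hA hA') auto
    then show ?thesis by (simp add: mult.commute)
  qed auto
  have e: "h \<omega> * X u v \<omega> $ i = a \<omega> + b \<omega> + c \<omega>" "h' \<omega> * X u' v' \<omega> $ j = a' \<omega> + b' \<omega> + c' \<omega>" for \<omega>
    unfolding a_def b_def c_def a'_def b'_def c'_def
    using X_add[of u m1 \<omega> m2] X_add[of u m2 \<omega> v] X_add[of u' n1 \<omega> n2] X_add[of u' n2 \<omega> v']
    by (auto simp: distrib_left[symmetric] vector_add_component[symmetric] simp del: vector_add_component)
  have int: "integrable P (\<lambda>\<omega>. f \<omega> * g \<omega>)" if "f \<in> {a, b, c}" "g \<in> {a', b', c'}" for f g
    using sqint_mult(1)[of P f g] that sq by auto
  have "(\<integral>\<omega>. (h \<omega> * X u v \<omega> $ i) * (h' \<omega> * X u' v' \<omega> $ j) \<partial>P)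
     = (\<integral>\<omega>. a \<omega> * a' \<omega> \<partial>P) + (\<integral>\<omega>. a \<omega> * b' \<omega> \<partial>P) + (\<integral>\<omega>. a \<omega> * c' \<omega> \<partial>P)
     + ((\<integral>\<omega>. b \<omega> * a' \<omega> \<partial>P) + (\<integral>\<omega>. b \<omega> * b' \<omega> \<partial>P) + (\<integral>\<omega>. b \<omega> * c' \<omega> \<partial>P))
     + ((\<integral>\<omega>. c \<omega> * a' \<omega> \<partial>P) + (\<integral>\<omega>. c \<omega> * b' \<omega> \<partial>P) + (\<integral>\<omega>. c \<omega> * c' \<omega> \<partial>P))"
    unfolding e using int by (simp add: distrib_left distrib_right)
  also have "(\<integral>\<omega>. a \<omega> * a' \<omega> \<partial>P) = 0"
    unfolding a_def a'_def by (rule orth) (use om ds(1) in auto)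
  also have "(\<integral>\<omega>. a \<omega> * b' \<omega> \<partial>P) = 0"
    unfolding a_def b'_def by (rule orth) (use om ds(2) in auto)
  also have "(\<integral>\<omega>. a \<omega> * c' \<omega> \<partial>P) = 0"
    unfolding a_def c'_def by (rule orth) (use om ds(3) in auto)
  also have "(\<integral>\<omega>. b \<omega> * a' \<omega> \<partial>P) = 0"
    unfolding b_def a'_def by (rule orth) (use om ds(4) in auto)
  also have "(\<integral>\<omega>. b \<omega> * c' \<omega> \<partial>P) = 0"
    unfolding b_def c'_def by (rule orth) (use om ds(5) in auto)
  also have "(\<integral>\<omega>. c \<omega> * a' \<omega> \<partial>P) = 0"
    unfolding c_def a'_def by (rule orth) (use om ds(6) in auto)
  also have "(\<integral>\<omega>. c \<omega> * b' \<omega> \<partial>P) = 0"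
    unfolding c_def b'_def by (rule orth) (use om ds(7) in auto)
  also have "(\<integral>\<omega>. c \<omega> * c' \<omega> \<partial>P) = 0"
    unfolding c_def c'_def by (rule orth) (use om ds(8) in auto)
  also have "(\<integral>\<omega>. b \<omega> * b' \<omega> \<partial>P) = (if i = j then max 0 (min v v' - max u u') else 0) * (\<integral>\<omega>. h \<omega> * h' \<omega> \<partial>P)"
  proof (cases "max u u' \<le> min v v'")
    case True
    then have "m1 = l" "n1 = l" "m2 = r" "n2 = r" "l \<le> r" "r = min v v'"
      by (auto simp: l_def r_def m1_def m2_def n1_def n2_def)
    then have "(\<integral>\<omega>. b \<omega> * b' \<omega> \<partial>P) = (\<integral>\<omega>. (h \<omega> * h' \<omega>) * (X l r \<omega> $ i * X l r \<omega> $ j) \<partial>P)"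
      by (simp add: b_def b'_def mult_ac)
    also have "\<dots> = (if i = j then r - l else 0) * (\<integral>\<omega>. h \<omega> * h' \<omega> \<partial>P)"
    proof (rule X_cov)
      show "(\<lambda>\<omega>. h \<omega> * h' \<omega>) \<in> borel_measurable (A l r)"
        using True by (intro borel_measurable_times hA hA') (auto simp: l_def r_def)
    qed (use True o sqint_mult(1)[OF h(2) h'(2)] in \<open>auto simp: l_def r_def\<close>)
    finally show ?thesis using True by (simp add: l_def r_def)
  next
    case False
    then have "m1 = m2 \<or> n1 = n2" using o by (auto simp: l_def r_def m1_def m2_def n1_def n2_def)
    then have "(\<integral>\<omega>. b \<omega> * b' \<omega> \<partial>P) = 0" by (auto simp: b_def b'_def)
    then show ?thesis using False by (auto simp: max_def)
  qed
  finally show ?thesis by simp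
qed

lemma finite_measure_Q: "finite_measure Q"
  by (rule finite_measure_timeprod)

text \<open>\<open>SI a b Z R\<close>: \<open>R\<close> is the integral over the interval from \<open>a\<close> to \<open>b\<close> of the bounded simple integrand \<open>Z\<close>.
  \<open>ITO a b Z R\<close> below is its closure in mean square.\<close>

inductive SI :: "real \<Rightarrow> real \<Rightarrow> (real \<times> 'w \<Rightarrow> real^'d) \<Rightarrow> ('w \<Rightarrow> real) \<Rightarrow> bool" for a b where
  zero: "SI a b (\<lambda>_. 0) (\<lambda>_. 0)"
| step: "\<lbrakk>SI a b Z R; a \<le> u; u \<le> v; v \<le> b; h \<in> borel_measurable (A u v); \<And>\<omega>. \<omega> \<in> space P \<Longrightarrow> \<bar>h \<omega>\<bar> \<le> c\<rbrakk>
   \<Longrightarrow> SI a b (\<lambda>x. Z x + (indicator {u<..v} (fst x) * h (snd x)) *\<^sub>R axis i 1) (\<lambda>\<omega>. R \<omega> + h \<omega> * X u v \<omega> $ i)"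

lemma SI_elem:
  assumes "a \<le> u" "u \<le> v" "v \<le> b" "h \<in> borel_measurable (A u v)" "\<And>\<omega>. \<omega> \<in> space P \<Longrightarrow> \<bar>h \<omega>\<bar> \<le> c"
  shows "SI a b (\<lambda>x. (indicator {u<..v} (fst x) * h (snd x)) *\<^sub>R axis i 1) (\<lambda>\<omega>. h \<omega> * X u v \<omega> $ i)"
  using SI.step[OF SI.zero assms, of i] by simp

lemma SI_add:
  assumes "SI a b Z R" "SI a b Z' R'"
  shows "SI a b (\<lambda>x. Z x + Z' x) (\<lambda>\<omega>. R \<omega> + R' \<omega>)"
  using assms(2)
proof induction
  case zero then show ?case using assms(1) by simp
next
  case (step Z' R' u v h c i)
  from SI.step[OF step(7) step(2-5) step(6), of i] show ?case by (simp add: add.assoc)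
qed

text \<open>A factor in \<open>A a b\<close> is admissible on every block inside the interval and
  may be moved into the integrand. This turns the isometry into a conditional one.\<close>

lemma SI_mult:
  assumes "SI a b Z R" "0 \<le> a" "b \<le> T" and k: "k \<in> borel_measurable (A a b)" "\<And>\<omega>. \<omega> \<in> space P \<Longrightarrow> \<bar>k \<omega>\<bar> \<le> C"
  shows "SI a b (\<lambda>x. k (snd x) *\<^sub>R Z x) (\<lambda>\<omega>. k \<omega> * R \<omega>)"
  using assms(1)
proof induction
  case zero then show ?case using SI.zero by simp
next
  case (step Z' R' u v h c i)
  have m: "(\<lambda>\<omega>. k \<omega> * h \<omega>) \<in> borel_measurable (A u v)"
    using step A_meas_mono[OF assms(2) step(2,3,4) assms(3) k(1)] by measurable
  have b: "\<bar>k \<omega> * h \<omega>\<bar> \<le> \<bar>C\<bar> * \<bar>c\<bar>" if "\<omega> \<in> space P" for \<omega>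
    unfolding abs_mult by (rule mult_mono) (use k(2)[OF that] step(6)[OF that] in auto)
  from SI.step[OF step(7) step(2-4) m b, of i] show ?case
    by (simp add: scaleR_add_right distrib_left mult_ac)
qed

lemma SI_const: 
  assumes "SI a b Z R" "0 \<le> a" "b \<le> T" shows "SI a b (\<lambda>x. r *\<^sub>R Z x) (\<lambda>\<omega>. r * R \<omega>)"
  by (rule SI_mult[OF assms, where C="\<bar>r\<bar>"]) auto

lemma SI_diff:
  assumes "SI a b Z R" "SI a b Z' R'" "0 \<le> a" "b \<le> T"
  shows "SI a b (\<lambda>x. Z x - Z' x) (\<lambda>\<omega>. R \<omega> - R' \<omega>)"
  using SI_add[OF assms(1) SI_const[OF assms(2-4), of "-1"]] by simp

lemma SI_meas:
  assumes "SI a b Z R" "0 \<le> a" "b \<le> T"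
  shows SI_measZ: "Z \<in> borel_measurable Q" and SI_sqintR: "sqint P R" and SI_bdd: "\<exists>c. \<forall>x\<in>space Q. norm (Z x) \<le> c"
    and SI_supp: "\<And>x. fst x \<notin> {a<..b} \<Longrightarrow> Z x = 0"
proof -
  have "Z \<in> borel_measurable Q \<and> sqint P R \<and> (\<exists>c. \<forall>x\<in>space Q. norm (Z x) \<le> c) \<and> (\<forall>x. fst x \<notin> {a<..b} \<longrightarrow> Z x = 0)"
    using assms(1)
  proof induction
    case zero then show ?case by auto
  next
    case (step Z R u v h c i)
    have uv: "0 \<le> u" "v \<le> T" using step assms by auto
    have hP [measurable]: "h \<in> borel_measurable P" by (rule A_meas[OF uv(1) step(3) uv(2) step(5)])
    have "sqint P h" by (rule sqint_bounded[OF hP]) (use step(6) in auto)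
    then have "sqint P (\<lambda>\<omega>. h \<omega> * X u v \<omega> $ i)" by (rule sqint_elem[OF uv(1) step(3) uv(2) step(5)])
    moreover have "(\<lambda>x. (indicator {u<..v} (fst x) * h (snd x)) *\<^sub>R axis i 1 :: real^'d) \<in> borel_measurable Q"
      by measurable
    ultimately have m: "sqint P (\<lambda>\<omega>. h \<omega> * X u v \<omega> $ i)"
      "(\<lambda>x. (indicator {u<..v} (fst x) * h (snd x)) *\<^sub>R axis i 1 :: real^'d) \<in> borel_measurable Q" by auto
    obtain c' where c': "\<forall>x\<in>space Q. norm (Z x) \<le> c'" using step by blast
    have bd: "norm (Z x + (indicator {u<..v} (fst x) * h (snd x)) *\<^sub>R axis i 1) \<le> c' + \<bar>c\<bar>" if "x \<in> space Q" for x
    proof (rule order_trans[OF norm_triangle_ineq add_mono])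
      show "norm (Z x) \<le> c'" using c' that by blast
      have "snd x \<in> space P" using that by auto
      from step(6)[OF this] show "norm ((indicator {u<..v} (fst x) * h (snd x)) *\<^sub>R axis i 1 :: real^'d) \<le> \<bar>c\<bar>"
        by (auto simp: indicator_def)
    qed
    have "\<forall>x. fst x \<notin> {a<..b} \<longrightarrow> Z x + (indicator {u<..v} (fst x) * h (snd x)) *\<^sub>R axis i 1 = 0"
      using step by (auto simp: indicator_def)
    then show ?case using step(7) m sqint_add(1)[OF _ m(1)]
      by (intro conjI exI[of _ "c' + \<bar>c\<bar>"] ballI bd borel_measurable_add) auto
  qed
  then show "Z \<in> borel_measurable Q" "sqint P R" "\<exists>c. \<forall>x\<in>space Q. norm (Z x) \<le> c" "\<And>x. fst x \<notin> {a<..b} \<Longrightarrow> Z x = 0" by blast+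
qed

lemma SI_sqintZ:
  assumes "SI a b Z R" "0 \<le> a" "b \<le> T" shows "sqint Q Z"
proof -
  obtain c where "\<forall>x\<in>space Q. norm (Z x) \<le> c" using SI_bdd[OF assms] by blast
  then show ?thesis
    by (intro finite_measure.sqint_bounded[OF finite_measure_Q SI_measZ[OF assms], of c]) auto
qed

text \<open>The isometry is proved in polarised form because the induction extends one factor by one
  block at a time. The remaining case of two blocks is \<open>elem_cov\<close>, matched with the
  integral of the product of two rectangles over time and probability.\<close>

lemma SI_bilinear_elem:
  assumes "SI a b Z R" "0 \<le> a" "b \<le> T"
    and o': "0 \<le> u'" "u' \<le> v'" "v' \<le> T" and h': "h' \<in> borel_measurable (A u' v')" "\<And>\<omega>. \<omega> \<in> space P \<Longrightarrow> \<bar>h' \<omega>\<bar> \<le> c'"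
  shows "(\<integral>\<omega>. R \<omega> * (h' \<omega> * X u' v' \<omega> $ j) \<partial>P) = (\<integral>x. Z x \<bullet> ((indicator {u'<..v'} (fst x) * h' (snd x)) *\<^sub>R axis j 1) \<partial>Q)"
  using assms(1)
proof induction
  case zero then show ?case by simp
next
  case (step Z R u v h c i)
  have uv: "0 \<le> u" "v \<le> T" using step assms by auto
  have hP: "h \<in> borel_measurable P" by (rule A_meas[OF uv(1) step(3) uv(2) step(5)])
  have h'P: "h' \<in> borel_measurable P" by (rule A_meas[OF o' h'(1)])
  have sh: "sqint P h" by (rule sqint_bounded[OF hP]) (use step(6) in auto)
  have sh': "sqint P h'" by (rule sqint_bounded[OF h'P]) (use h' in auto)
  let ?e = "\<lambda>x. (indicator {u<..v} (fst x) * h (snd x)) *\<^sub>R axis i 1 :: real^'d"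
  let ?e' = "\<lambda>x. (indicator {u'<..v'} (fst x) * h' (snd x)) *\<^sub>R axis j 1 :: real^'d"
  have se: "sqint Q ?e" using SI_sqintZ[OF SI_elem[OF step(2-6)] assms(2,3)] .
  have se': "sqint Q ?e'" using SI_sqintZ[OF SI_elem[OF order_refl o'(2) order_refl h'] o'(1,3)] .
  have "(\<integral>x. ?e x \<bullet> ?e' x \<partial>Q) = (if i = j then max 0 (min v v' - max u u') else 0) * (\<integral>\<omega>. h \<omega> * h' \<omega> \<partial>P)"
  proof (cases "i = j \<and> max u u' \<le> min v v'")
    case True
    have "(\<integral>x. ?e x \<bullet> ?e' x \<partial>Q) = (\<integral>x. indicator {max u u'<..min v v'} (fst x) * (h (snd x) * h' (snd x)) \<partial>Q)"
      by (rule Bochner_Integration.integral_cong) (use True in \<open>auto simp: indicator_def inner_axis_axis\<close>)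
    also have "\<dots> = (min v v' - max u u') * (\<integral>\<omega>. h \<omega> * h' \<omega> \<partial>P)"
      by (rule integral_timeprod_rect(2)[OF sqint_mult(1)[OF sh sh']]) (use True uv o' in auto)
    finally show ?thesis using True by simp
  next
    case False
    then have "(\<integral>x. ?e x \<bullet> ?e' x \<partial>Q) = (\<integral>x. 0 \<partial>Q)"
      by (intro Bochner_Integration.integral_cong) (auto simp: indicator_def inner_axis_axis)
    then show ?thesis using False by (auto simp: max_def)
  qed
  then have 1: "(\<integral>x. ?e x \<bullet> ?e' x \<partial>Q) = (\<integral>\<omega>. (h \<omega> * X u v \<omega> $ i) * (h' \<omega> * X u' v' \<omega> $ j) \<partial>P)"
    using elem_cov[OF uv(1) step(3) uv(2) o' step(5) sh h'(1) sh', of i j] by simp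
  note sx = sqint_elem(1)[OF uv(1) step(3) uv(2) step(5) sh, of i] and sx' = sqint_elem(1)[OF o' h'(1) sh', of j]
  note sR = SI_sqintR[OF step(1) assms(2,3)] and sZ = SI_sqintZ[OF step(1) assms(2,3)]
  show ?case
    unfolding distrib_right inner_add_left
      Bochner_Integration.integral_add[OF sqint_mult(1)[OF sR sx'] sqint_mult(1)[OF sx sx']]
      Bochner_Integration.integral_add[OF sqint_inner(1)[OF sZ se'] sqint_inner(1)[OF se se']]
    using step(7) 1 by simp
qed

lemma SI_bilinear:
  assumes "SI a b Z R" "0 \<le> a" "b \<le> T" "SI a' b' Z' R'" "0 \<le> a'" "b' \<le> T"
  shows "(\<integral>\<omega>. R \<omega> * R' \<omega> \<partial>P) = (\<integral>x. Z x \<bullet> Z' x \<partial>Q)"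
  using assms(4)
proof induction
  case zero then show ?case by simp
next
  case (step Z' R' u' v' h' c' j)
  have uv: "0 \<le> u'" "v' \<le> T" using step assms by auto
  note sR = SI_sqintR[OF assms(1-3)] and sZ = SI_sqintZ[OF assms(1-3)]
  note sR' = SI_sqintR[OF step(1) assms(5,6)] and sZ' = SI_sqintZ[OF step(1) assms(5,6)]
  have E: "SI a' b' (\<lambda>x. (indicator {u'<..v'} (fst x) * h' (snd x)) *\<^sub>R axis j 1) (\<lambda>\<omega>. h' \<omega> * X u' v' \<omega> $ j)"
    by (rule SI_elem[OF step(2-5)]) (rule step(6))
  have B: "(\<integral>\<omega>. R \<omega> * (h' \<omega> * X u' v' \<omega> $ j) \<partial>P) = (\<integral>x. Z x \<bullet> ((indicator {u'<..v'} (fst x) * h' (snd x)) *\<^sub>R axis j 1) \<partial>Q)"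
    by (rule SI_bilinear_elem[OF assms(1-3) uv(1) step(3) uv(2) step(5)]) (rule step(6))
  note sx = SI_sqintR[OF E assms(5,6)] and se = SI_sqintZ[OF E assms(5,6)]
  show ?case
    using step(7) B
      Bochner_Integration.integral_add[OF sqint_mult(1)[OF sR sR'] sqint_mult(1)[OF sR sx]]
      Bochner_Integration.integral_add[OF sqint_inner(1)[OF sZ sZ'] sqint_inner(1)[OF sZ se]]
    unfolding distrib_left inner_add_right by argo
qed

lemma SI_nsq:
  assumes "SI a b Z R" "0 \<le> a" "b \<le> T"
  shows "nsq P R = nsq Q Z"
  using SI_bilinear[OF assms assms] unfolding nsq_def power2_norm_eq_inner by simp

text \<open>The test variable \<open>k\<close> is admissible on each block, so it merges with the
  coefficient and the increment is centred against the product.\<close>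

lemma SI_mean:
  assumes "SI a b Z R" "0 \<le> a" "b \<le> T" and k: "k \<in> borel_measurable (A a b)" "sqint P k"
  shows "(\<integral>\<omega>. k \<omega> * R \<omega> \<partial>P) = 0"
  using assms(1)
proof induction
  case zero then show ?case by simp
next
  case (step Z R u v h c i)
  have uv: "0 \<le> u" "v \<le> T" using step assms by auto
  have hP: "h \<in> borel_measurable P" by (rule A_meas[OF uv(1) step(3) uv(2) step(5)])
  have sh: "sqint P h" by (rule sqint_bounded[OF hP]) (use step(6) in auto)
  have m: "(\<lambda>\<omega>. k \<omega> * h \<omega>) \<in> borel_measurable (A u v)"
    using step A_meas_mono[OF assms(2) step(2,3,4) assms(3) k(1)] by measurable
  have "(\<integral>\<omega>. (k \<omega> * h \<omega>) * X u v \<omega> $ i \<partial>P) = 0"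
    by (rule X_mean[OF uv(1) step(3) uv(2) m sqint_mult(1)[OF k(2) sh]])
  then show ?case
    using step(7) sqint_mult(1)[OF k(2) SI_sqintR[OF step(1) assms(2,3)]]
      X_int1[OF uv(1) step(3) uv(2) m sqint_mult(1)[OF k(2) sh], of i]
    by (simp add: distrib_left mult.assoc)
qed

text \<open>Integrals over all subintervals are chosen together, additively in the interval, with a
  fourth moment quadratic in its length. The constant depends on the simple integrand and may be
  large; that integrand stays fixed while the mesh shrinks.\<close>

lemma SI_restrict:
  assumes "SI a b Z R" "0 \<le> a" "b \<le> T"
  shows "\<exists>Rr C. 0 \<le> C \<and> (\<forall>u v. a \<le> u \<longrightarrow> u \<le> v \<longrightarrow> v \<le> b \<longrightarrow>
      SI u v (\<lambda>x. indicator {u<..v} (fst x) *\<^sub>R Z x) (Rr u v) \<and>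
      integrable P (\<lambda>\<omega>. Rr u v \<omega> ^ 4) \<and> (\<integral>\<omega>. Rr u v \<omega> ^ 4 \<partial>P) \<le> C * (v - u)\<^sup>2)
    \<and> (\<forall>s\<in>{a..b}. R = (\<lambda>\<omega>. Rr a s \<omega> + Rr s b \<omega>))"
  using assms(1)
proof induction
  case zero
  have "SI u v (\<lambda>x. indicator {u<..v} (fst x) *\<^sub>R 0) (\<lambda>_. 0)" for u v using SI.zero by simp
  then show ?case by (intro exI[of _ "\<lambda>_ _ _. 0"] exI[of _ "0::real"]) auto
next
  case (step Z R u v h c i)
  then obtain Rr C where C: "0 \<le> C" and Rr: "\<And>s t. \<lbrakk>a \<le> s; s \<le> t; t \<le> b\<rbrakk> \<Longrightarrow>
      SI s t (\<lambda>x. indicator {s<..t} (fst x) *\<^sub>R Z x) (Rr s t) \<and>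
      integrable P (\<lambda>\<omega>. Rr s t \<omega> ^ 4) \<and> (\<integral>\<omega>. Rr s t \<omega> ^ 4 \<partial>P) \<le> C * (t - s)\<^sup>2"
    and Rs: "\<And>s. s \<in> {a..b} \<Longrightarrow> R = (\<lambda>\<omega>. Rr a s \<omega> + Rr s b \<omega>)" by blast
  \<comment> \<open>The interval from \<open>u\<close> to \<open>v\<close> clipped to the one from
    \<open>s\<close> to \<open>t\<close>; the outer minimum and maximum give \<open>lo = hi\<close>
    when they do not meet, so the added increment is then zero.\<close>
  define lo where "lo = (\<lambda>s t. min t (max s u))"
  define hi where "hi = (\<lambda>s t. max (lo s t) (min t v))"
  define c4 where "c4 = \<bar>c\<bar> ^ 4"
  define Rn where "Rn = (\<lambda>s t \<omega>. Rr s t \<omega> + h \<omega> * X (lo s t) (hi s t) \<omega> $ i)"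
  have lohi: "s \<le> lo s t" "lo s t \<le> hi s t" "hi s t \<le> t" if "s \<le> t" for s t
    using that by (auto simp: lo_def hi_def)
  have ind: "indicator {s<..t} x * indicator {u<..v} x = (indicator {lo s t<..hi s t} x :: real)" if "s \<le> t" for s t x
    using that step(3) by (auto simp: lo_def hi_def indicator_def)
  \<comment> \<open>The new constant combines \<open>(x + y) ^ 4 \<le> 8 * x ^ 4 + 8 * y ^ 4\<close>
    with the Gaussian fourth moment \<open>3\<close>, whence \<open>24 = 8 * 3\<close>.\<close>
  have "SI s t (\<lambda>x. indicator {s<..t} (fst x) *\<^sub>R (Z x + (indicator {u<..v} (fst x) * h (snd x)) *\<^sub>R axis i 1)) (Rn s t) \<and>
      integrable P (\<lambda>\<omega>. Rn s t \<omega> ^ 4) \<and> (\<integral>\<omega>. Rn s t \<omega> ^ 4 \<partial>P) \<le> (8 * C + 24 * c4) * (t - s)\<^sup>2"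
    if st: "a \<le> s" "s \<le> t" "t \<le> b" for s t
  proof -
    let ?l = "lo s t" and ?r = "hi s t"
    note lh = lohi[OF st(2)]
    note R1 = Rr[OF st]
    have SI1: "SI s t (\<lambda>x. indicator {s<..t} (fst x) *\<^sub>R Z x + (indicator {?l<..?r} (fst x) * h (snd x)) *\<^sub>R axis i 1) (Rn s t)"
    proof (cases "u \<le> ?l \<and> ?r \<le> v")
      case True
      have hA: "h \<in> borel_measurable (A ?l ?r)"
        using A_meas_mono[of u ?l ?r v h] True lh step(2,4,5) assms(2,3) by auto
      show ?thesis unfolding Rn_def using R1 lh
        by (intro SI.step[where c=c] hA) (use step(6) in auto)
    next
      case False
      then have "?l = ?r" using step(3) by (auto simp: lo_def hi_def min_def max_def split: if_splits)
      then show ?thesis using R1 by (simp add: Rn_def)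
    qed
    have pw: "Rn s t \<omega> ^ 4 \<le> 8 * Rr s t \<omega> ^ 4 + 8 * c4 * (X ?l ?r \<omega> $ i) ^ 4" if w: "\<omega> \<in> space P" for \<omega>
    proof -
      have 4: "(x + y) ^ 4 \<le> 8 * x ^ 4 + 8 * y ^ 4" for x y :: real
      proof -
        have "(x + y)\<^sup>2 \<le> 2 * x\<^sup>2 + 2 * y\<^sup>2" using norm_add_sq_le[of x y] by simp
        then have "((x + y)\<^sup>2)\<^sup>2 \<le> (2 * x\<^sup>2 + 2 * y\<^sup>2)\<^sup>2" by (rule power_mono) simp
        also have "\<dots> \<le> 2 * (2 * x\<^sup>2)\<^sup>2 + 2 * (2 * y\<^sup>2)\<^sup>2" using norm_add_sq_le[of "2 * x\<^sup>2" "2 * y\<^sup>2"] by simp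
        finally show ?thesis by (simp add: power_mult_distrib power_mult[symmetric])
      qed
      have "\<bar>h \<omega>\<bar> \<le> \<bar>c\<bar>" using step(6)[OF w] by simp
      then have "\<bar>h \<omega>\<bar> ^ 4 \<le> c4" unfolding c4_def by (intro power_mono) auto
      then have "(h \<omega>) ^ 4 * (X ?l ?r \<omega> $ i) ^ 4 \<le> c4 * (X ?l ?r \<omega> $ i) ^ 4"
        by (intro mult_right_mono) auto
      then show ?thesis using 4[of "Rr s t \<omega>" "h \<omega> * X ?l ?r \<omega> $ i"] by (simp add: Rn_def power_mult_distrib)
    qed
    have lrT: "0 \<le> ?l" "?l \<le> ?r" "?r \<le> T" using lh st assms by auto
    have ib: "integrable P (\<lambda>\<omega>. 8 * Rr s t \<omega> ^ 4 + 8 * c4 * (X ?l ?r \<omega> $ i) ^ 4)"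
      using R1 X_int4[OF lrT] by auto
    have RnP: "Rn s t \<in> borel_measurable P"
      using SI_sqintR[OF SI1] st assms by (auto simp: sqint_def)
    have in4: "integrable P (\<lambda>\<omega>. Rn s t \<omega> ^ 4)"
      by (rule Bochner_Integration.integrable_bound[OF ib])
         (use RnP pw in \<open>auto intro!: AE_I2 intro: order_trans[OF _ abs_ge_self]\<close>)
    have "(\<integral>\<omega>. Rn s t \<omega> ^ 4 \<partial>P) \<le> (\<integral>\<omega>. 8 * Rr s t \<omega> ^ 4 + 8 * c4 * (X ?l ?r \<omega> $ i) ^ 4 \<partial>P)"
      by (rule integral_mono[OF in4 ib pw])
    also have "\<dots> = 8 * (\<integral>\<omega>. Rr s t \<omega> ^ 4 \<partial>P) + 8 * c4 * (3 * (?r - ?l)\<^sup>2)"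
      using R1 X_int4[OF lrT, of i] X_four[OF lrT, of i] by simp
    also have "\<dots> \<le> 8 * (C * (t - s)\<^sup>2) + 8 * c4 * (3 * (t - s)\<^sup>2)"
      using R1 lh by (intro add_mono mult_left_mono power_mono) (auto simp: c4_def)
    finally have "(\<integral>\<omega>. Rn s t \<omega> ^ 4 \<partial>P) \<le> (8 * C + 24 * c4) * (t - s)\<^sup>2" by (simp add: algebra_simps)
    moreover have "(\<lambda>x. indicator {s<..t} (fst x) *\<^sub>R (Z x + (indicator {u<..v} (fst x) * h (snd x)) *\<^sub>R axis i 1))
       = (\<lambda>x. indicator {s<..t} (fst x) *\<^sub>R Z x + (indicator {?l<..?r} (fst x) * h (snd x)) *\<^sub>R axis i 1)"
      unfolding ind[OF st(2), symmetric] by (simp add: scaleR_add_right mult.assoc)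
    ultimately show ?thesis using SI1 in4 by simp
  qed
  moreover have "(\<lambda>\<omega>. R \<omega> + h \<omega> * X u v \<omega> $ i) = (\<lambda>\<omega>. Rn a s \<omega> + Rn s b \<omega>)" if s: "s \<in> {a..b}" for s
  proof -
    have "X (lo a s) (hi a s) \<omega> + X (lo s b) (hi s b) \<omega> = X u v \<omega>" for \<omega>
    proof -
      consider "s \<le> u" | "u \<le> s" "s \<le> v" | "v \<le> s" by linarith
      then show ?thesis
      proof cases
        case 1
        then have "lo a s = hi a s" "lo s b = u" "hi s b = v"
          using step(2,3,4) s by (auto simp: lo_def hi_def min_def max_def)
        then show ?thesis by simp
      next
        case 2
        then have "lo a s = u" "hi a s = s" "lo s b = s" "hi s b = v"
          using step(2,3,4) s by (auto simp: lo_def hi_def min_def max_def)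
        then show ?thesis using X_add by simp
      next
        case 3
        then have "lo a s = u" "hi a s = v" "lo s b = hi s b"
          using step(2,3,4) s by (auto simp: lo_def hi_def min_def max_def)
        then show ?thesis by simp
      qed
    qed
    then have "h \<omega> * X u v \<omega> $ i = h \<omega> * X (lo a s) (hi a s) \<omega> $ i + h \<omega> * X (lo s b) (hi s b) \<omega> $ i" for \<omega>
      by (metis distrib_left vector_add_component)
    then show ?thesis using Rs[OF s] by (auto simp: Rn_def fun_eq_iff)
  qed
  ultimately show ?case
    by (intro exI[of _ Rn] exI[of _ "8 * C + 24 * c4"]) (use C in \<open>auto simp: c4_def\<close>)
qed

lemma indicator_block_meas [measurable]: "(\<lambda>x. indicator {a<..b::real} (fst x) :: real) \<in> borel_measurable Q"
  by measurable

lemma sqint_block: "sqint Q Z \<Longrightarrow> sqint Q (\<lambda>x. indicator {a<..b} (fst x) *\<^sub>R Z x)"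
  by (rule sqint_mult_bounded(1)[where C=1]) (auto simp: indicator_def)

section \<open>Mean square closure of the simple integrals\<close>

text \<open>The integrand is cut off to the interval only inside the approximation, so the same
  \<open>Z\<close> can be integrated over every subinterval.\<close>

definition ITO :: "real \<Rightarrow> real \<Rightarrow> (real \<times> 'w \<Rightarrow> real^'d) \<Rightarrow> ('w \<Rightarrow> real) \<Rightarrow> bool" where
  "ITO a b Z R \<longleftrightarrow> sqint P R \<and> sqint Q Z \<and>
    (\<forall>e>0. \<exists>Z' R'. SI a b Z' R' \<and> nsq P (\<lambda>\<omega>. R \<omega> - R' \<omega>) < e \<and>
       nsq Q (\<lambda>x. indicator {a<..b} (fst x) *\<^sub>R Z x - Z' x) < e)"

lemma ITO_sqint: "ITO a b Z R \<Longrightarrow> sqint P R" "ITO a b Z R \<Longrightarrow> sqint Q Z"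
  by (auto simp: ITO_def)

lemma ITO_approx:
  assumes "ITO a b Z R" "e > 0"
  obtains Z' R' where "SI a b Z' R'" "nsq P (\<lambda>\<omega>. R \<omega> - R' \<omega>) < e" "nsq Q (\<lambda>x. indicator {a<..b} (fst x) *\<^sub>R Z x - Z' x) < e"
  using assms unfolding ITO_def by blast

lemma ITO_limit:
  assumes ab: "0 \<le> a" "b \<le> T" and R: "sqint P R" "sqint Q Z"
    and ap: "\<And>e. e > 0 \<Longrightarrow> \<exists>Z' R'. ITO a b Z' R' \<and> nsq P (\<lambda>\<omega>. R \<omega> - R' \<omega>) < e \<and>
       nsq Q (\<lambda>x. indicator {a<..b} (fst x) *\<^sub>R (Z x - Z' x)) < e"
  shows "ITO a b Z R"
  unfolding ITO_def
proof (intro conjI R allI impI)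
  fix e :: real assume e: "e > 0"
  then obtain Z1 R1 where 1: "ITO a b Z1 R1" "nsq P (\<lambda>\<omega>. R \<omega> - R1 \<omega>) < e/4"
      "nsq Q (\<lambda>x. indicator {a<..b} (fst x) *\<^sub>R (Z x - Z1 x)) < e/4" using ap[of "e/4"] by auto
  obtain Z2 R2 where 2: "SI a b Z2 R2" "nsq P (\<lambda>\<omega>. R1 \<omega> - R2 \<omega>) < e/4"
      "nsq Q (\<lambda>x. indicator {a<..b} (fst x) *\<^sub>R Z1 x - Z2 x) < e/4" using ITO_approx[OF 1(1), of "e/4"] e by auto
  note s1 = ITO_sqint[OF 1(1)] and s2 = SI_sqintR[OF 2(1) ab] SI_sqintZ[OF 2(1) ab]
  have "nsq P (\<lambda>\<omega>. (R \<omega> - R1 \<omega>) + (R1 \<omega> - R2 \<omega>)) < e"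
    using sqint_add(2)[OF sqint_diff(1)[OF R(1) s1(1)] sqint_diff(1)[OF s1(1) s2(1)]] 1 2 by simp
  moreover have "nsq Q (\<lambda>x. indicator {a<..b} (fst x) *\<^sub>R (Z x - Z1 x) + (indicator {a<..b} (fst x) *\<^sub>R Z1 x - Z2 x)) < e"
    using sqint_add(2)[OF sqint_block[OF sqint_diff(1)[OF R(2) s1(2)], of a b] sqint_diff(1)[OF sqint_block[OF s1(2), of a b] s2(2)]] 1 2
    by simp
  ultimately show "\<exists>Z' R'. SI a b Z' R' \<and> nsq P (\<lambda>\<omega>. R \<omega> - R' \<omega>) < e \<and>
       nsq Q (\<lambda>x. indicator {a<..b} (fst x) *\<^sub>R Z x - Z' x) < e"
    by (intro exI[of _ Z2] exI[of _ R2]) (simp add: 2(1) scaleR_diff_right)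
qed

lemma SI_ITO:
  assumes "SI a b Z R" "0 \<le> a" "b \<le> T" shows "ITO a b Z R"
proof -
  have "indicator {a<..b} (fst x) *\<^sub>R Z x = Z x" for x
    using SI_supp[OF assms, of x] by (auto simp: indicator_def)
  then show ?thesis unfolding ITO_def using SI_sqintR[OF assms] SI_sqintZ[OF assms] assms(1)
    by (auto intro!: exI[of _ Z] exI[of _ R])
qed

lemma ITO_add:
  assumes ab: "0 \<le> a" "b \<le> T" and 1: "ITO a b Z1 R1" and 2: "ITO a b Z2 R2"
  shows "ITO a b (\<lambda>x. Z1 x + Z2 x) (\<lambda>\<omega>. R1 \<omega> + R2 \<omega>)"
  unfolding ITO_def
proof (intro conjI allI impI)
  note s = ITO_sqint[OF 1] ITO_sqint[OF 2]
  show "sqint P (\<lambda>\<omega>. R1 \<omega> + R2 \<omega>)" "sqint Q (\<lambda>x. Z1 x + Z2 x)" using s by (auto intro: sqint_add(1))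
  fix e :: real assume e: "e > 0"
  obtain Z1' R1' where 1: "SI a b Z1' R1'" "nsq P (\<lambda>\<omega>. R1 \<omega> - R1' \<omega>) < e/4"
      "nsq Q (\<lambda>x. indicator {a<..b} (fst x) *\<^sub>R Z1 x - Z1' x) < e/4" using ITO_approx[OF 1, of "e/4"] e by auto
  obtain Z2' R2' where 2: "SI a b Z2' R2'" "nsq P (\<lambda>\<omega>. R2 \<omega> - R2' \<omega>) < e/4"
      "nsq Q (\<lambda>x. indicator {a<..b} (fst x) *\<^sub>R Z2 x - Z2' x) < e/4" using ITO_approx[OF 2, of "e/4"] e by auto
  note t = SI_sqintR[OF 1(1) ab] SI_sqintZ[OF 1(1) ab] SI_sqintR[OF 2(1) ab] SI_sqintZ[OF 2(1) ab]
  have "nsq P (\<lambda>\<omega>. (R1 \<omega> - R1' \<omega>) + (R2 \<omega> - R2' \<omega>)) < e"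
    using sqint_add(2)[OF sqint_diff(1)[OF s(1) t(1)] sqint_diff(1)[OF s(3) t(3)]] 1 2 by simp
  moreover have "nsq Q (\<lambda>x. (indicator {a<..b} (fst x) *\<^sub>R Z1 x - Z1' x) + (indicator {a<..b} (fst x) *\<^sub>R Z2 x - Z2' x)) < e"
    using sqint_add(2)[OF sqint_diff(1)[OF sqint_block[OF s(2), of a b] t(2)] sqint_diff(1)[OF sqint_block[OF s(4), of a b] t(4)]] 1 2
    by simp
  ultimately show "\<exists>Z' R'. SI a b Z' R' \<and> nsq P (\<lambda>\<omega>. R1 \<omega> + R2 \<omega> - R' \<omega>) < e \<and>
       nsq Q (\<lambda>x. indicator {a<..b} (fst x) *\<^sub>R (Z1 x + Z2 x) - Z' x) < e"
    using SI_add[OF 1(1) 2(1)]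
    by (intro exI[of _ "\<lambda>x. Z1' x + Z2' x"] exI[of _ "\<lambda>\<omega>. R1' \<omega> + R2' \<omega>"])
       (simp add: scaleR_add_right algebra_simps)
qed

lemma ITO_uminus:
  assumes ab: "0 \<le> a" "b \<le> T" and 1: "ITO a b Z R"
  shows "ITO a b (\<lambda>x. - Z x) (\<lambda>\<omega>. - R \<omega>)"
  unfolding ITO_def
proof (intro conjI allI impI)
  show "sqint P (\<lambda>\<omega>. - R \<omega>)" "sqint Q (\<lambda>x. - Z x)" using ITO_sqint[OF 1] by (auto intro: sqint_uminus)
  fix e :: real assume e: "e > 0"
  obtain Z' R' where *: "SI a b Z' R'" "nsq P (\<lambda>\<omega>. R \<omega> - R' \<omega>) < e"
      "nsq Q (\<lambda>x. indicator {a<..b} (fst x) *\<^sub>R Z x - Z' x) < e" using ITO_approx[OF 1 e] .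
  have "nsq P (\<lambda>\<omega>. - (R \<omega> - R' \<omega>)) < e" "nsq Q (\<lambda>x. - (indicator {a<..b} (fst x) *\<^sub>R Z x - Z' x)) < e"
    using * unfolding nsq_uminus by auto
  then show "\<exists>Z' R'. SI a b Z' R' \<and> nsq P (\<lambda>\<omega>. - R \<omega> - R' \<omega>) < e \<and>
       nsq Q (\<lambda>x. indicator {a<..b} (fst x) *\<^sub>R - Z x - Z' x) < e"
    using SI_const[OF *(1) ab, of "-1"]
    by (intro exI[of _ "\<lambda>x. - Z' x"] exI[of _ "\<lambda>\<omega>. - R' \<omega>"]) (simp add: algebra_simps)
qed

lemma ITO_diff:
  assumes "0 \<le> a" "b \<le> T" "ITO a b Z1 R1" "ITO a b Z2 R2"
  shows "ITO a b (\<lambda>x. Z1 x - Z2 x) (\<lambda>\<omega>. R1 \<omega> - R2 \<omega>)"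
  using ITO_add[OF assms(1-3) ITO_uminus[OF assms(1,2,4)]] by simp

lemma ITO_zero: "0 \<le> a \<Longrightarrow> b \<le> T \<Longrightarrow> ITO a b (\<lambda>_. 0) (\<lambda>_. 0)"
  by (rule SI_ITO[OF SI.zero])

lemma ITO_sum:
  assumes "0 \<le> a" "b \<le> T" "finite I" "\<And>i. i \<in> I \<Longrightarrow> ITO a b (Z i) (R i)"
  shows "ITO a b (\<lambda>x. \<Sum>i\<in>I. Z i x) (\<lambda>\<omega>. \<Sum>i\<in>I. R i \<omega>)"
  using assms(3,4) by (induction I rule: finite_induct) (auto intro!: ITO_zero ITO_add assms(1,2))

lemma sqint_rect:
  assumes "sqint P h" "0 \<le> u" "u \<le> v" "v \<le> T"
  shows "sqint Q (\<lambda>x. (indicator {u<..v} (fst x) * h (snd x)) *\<^sub>R axis i 1 :: real^'d)"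
    and "nsq Q (\<lambda>x. (indicator {u<..v} (fst x) * h (snd x)) *\<^sub>R axis i 1 :: real^'d) = (v - u) * nsq P h"
proof -
  have [measurable]: "h \<in> borel_measurable P" using assms(1) by (simp add: sqint_def)
  have e: "(norm ((indicator {u<..v} (fst x) * h (snd x)) *\<^sub>R axis i 1 :: real^'d))\<^sup>2
      = indicator {u<..v} (fst x) * (norm (h (snd x)))\<^sup>2" for x :: "real \<times> 'w"
    by (auto simp: indicator_def)
  show "sqint Q (\<lambda>x. (indicator {u<..v} (fst x) * h (snd x)) *\<^sub>R axis i 1 :: real^'d)"
    unfolding sqint_def e using integral_timeprod_rect(1)[OF sqint_int[OF assms(1)] assms(2-4)] by simp
  show "nsq Q (\<lambda>x. (indicator {u<..v} (fst x) * h (snd x)) *\<^sub>R axis i 1 :: real^'d) = (v - u) * nsq P h"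
    unfolding nsq_def e using integral_timeprod_rect(2)[OF sqint_int[OF assms(1)] assms(2-4)] by simp
qed

text \<open>Simple integrands have bounded coefficients; a square integrable one is reached by
  truncation. By the isometry for one block both approximation errors equal \<open>v - u\<close>
  times the squared truncation error.\<close>

lemma ITO_elem:
  assumes ab: "0 \<le> a" "b \<le> T" and uv: "a \<le> u" "u \<le> v" "v \<le> b"
    and h: "h \<in> borel_measurable (A u v)" "sqint P h"
  shows "ITO a b (\<lambda>x. (indicator {u<..v} (fst x) * h (snd x)) *\<^sub>R axis i 1) (\<lambda>\<omega>. h \<omega> * X u v \<omega> $ i)"
proof (rule ITO_limit[OF ab])
  have uvT: "0 \<le> u" "u \<le> v" "v \<le> T" using ab uv by auto
  show "sqint P (\<lambda>\<omega>. h \<omega> * X u v \<omega> $ i)" by (rule sqint_elem(1)[OF uvT h])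
  show "sqint Q (\<lambda>x. (indicator {u<..v} (fst x) * h (snd x)) *\<^sub>R axis i 1 :: real^'d)" by (rule sqint_rect(1)[OF h(2) uvT])
  define hn where "hn = (\<lambda>n::nat. \<lambda>\<omega>. if \<bar>h \<omega>\<bar> \<le> real n then h \<omega> else 0)"
  have hnm: "hn n \<in> borel_measurable (A u v)" for n using h(1) unfolding hn_def by measurable
  have hP [measurable]: "h \<in> borel_measurable P" using h(2) by (simp add: sqint_def)
  have hnP: "hn n \<in> borel_measurable P" for n unfolding hn_def by measurable
  have hns: "sqint P (hn n)" for n by (rule sqint_bounded[OF hnP, where C="real n"]) (auto simp: hn_def)
  have "(\<lambda>n. nsq P (\<lambda>\<omega>. h \<omega> - hn n \<omega>)) \<longlonglongrightarrow> (\<integral>\<omega>. 0 \<partial>P)"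
    unfolding nsq_def
  proof (rule integral_dominated_convergence[where w="\<lambda>\<omega>. (norm (h \<omega>))\<^sup>2"])
    show "integrable P (\<lambda>\<omega>. (norm (h \<omega>))\<^sup>2)" by (rule sqint_int[OF h(2)])
    show "AE \<omega> in P. (\<lambda>n. (norm (h \<omega> - hn n \<omega>))\<^sup>2) \<longlonglongrightarrow> 0"
    proof (rule AE_I2)
      fix \<omega>
      obtain N where "\<bar>h \<omega>\<bar> \<le> real N" using real_arch_simple by blast
      then have "\<forall>\<^sub>F n in sequentially. (norm (h \<omega> - hn n \<omega>))\<^sup>2 = 0"
        by (auto simp: hn_def eventually_sequentially intro!: exI[of _ N])
      then show "(\<lambda>n. (norm (h \<omega> - hn n \<omega>))\<^sup>2) \<longlonglongrightarrow> 0" by (rule tendsto_eventually)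
    qed
    show "AE \<omega> in P. norm ((norm (h \<omega> - hn n \<omega>))\<^sup>2) \<le> (norm (h \<omega>))\<^sup>2" for n
      by (rule AE_I2) (auto simp: hn_def)
  qed (use hnP in auto)
  then have lim: "(\<lambda>n. (v - u) * nsq P (\<lambda>\<omega>. h \<omega> - hn n \<omega>)) \<longlonglongrightarrow> (v - u) * 0"
    by (intro tendsto_intros) simp
  fix e :: real assume "e > 0"
  with lim have "\<forall>\<^sub>F n in sequentially. (v - u) * nsq P (\<lambda>\<omega>. h \<omega> - hn n \<omega>) < e"
    by (intro order_tendstoD(2)[where y="(v - u) * 0"]) auto
  then obtain n where n: "(v - u) * nsq P (\<lambda>\<omega>. h \<omega> - hn n \<omega>) < e"
    by (meson eventually_sequentially order_refl)
  have dm: "(\<lambda>\<omega>. h \<omega> - hn n \<omega>) \<in> borel_measurable (A u v)" using h(1) hnm[of n] by measurable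
  have ds: "sqint P (\<lambda>\<omega>. h \<omega> - hn n \<omega>)" by (rule sqint_diff(1)[OF h(2) hns])
  have SI: "SI a b (\<lambda>x. (indicator {u<..v} (fst x) * hn n (snd x)) *\<^sub>R axis i 1) (\<lambda>\<omega>. hn n \<omega> * X u v \<omega> $ i)"
    by (rule SI_elem[OF uv hnm, where c="real n"]) (auto simp: hn_def)
  have "nsq P (\<lambda>\<omega>. h \<omega> * X u v \<omega> $ i - hn n \<omega> * X u v \<omega> $ i) < e"
    using sqint_elem(2)[OF uvT dm ds, of i] n by (simp add: left_diff_distrib)
  moreover have "nsq Q (\<lambda>x. indicator {a<..b} (fst x) *\<^sub>R ((indicator {u<..v} (fst x) * h (snd x)) *\<^sub>R axis i 1
      - (indicator {u<..v} (fst x) * hn n (snd x)) *\<^sub>R axis i (1::real))) < e"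
  proof -
    have "indicator {a<..b} (fst x) *\<^sub>R ((indicator {u<..v} (fst x) * h (snd x)) *\<^sub>R axis i 1
      - (indicator {u<..v} (fst x) * hn n (snd x)) *\<^sub>R axis i (1::real))
      = (indicator {u<..v} (fst x) * (h (snd x) - hn n (snd x))) *\<^sub>R axis i 1" for x :: "real \<times> 'w"
      using uv by (auto simp: indicator_def scaleR_diff_left)
    then show ?thesis using sqint_rect(2)[OF ds uvT, of i] n by simp
  qed
  ultimately show "\<exists>Z' R'. ITO a b Z' R' \<and> nsq P (\<lambda>\<omega>. h \<omega> * X u v \<omega> $ i - R' \<omega>) < e \<and>
       nsq Q (\<lambda>x. indicator {a<..b} (fst x) *\<^sub>R ((indicator {u<..v} (fst x) * h (snd x)) *\<^sub>R axis i 1 - Z' x)) < e"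
    using SI_ITO[OF SI ab] by blast
qed

text \<open>The isometry conditioned on the information in \<open>A a b\<close>. For simple
  integrands the weight is moved into one factor of the bilinear isometry; both sides are continuous
  in mean square by \<open>nsq_weight_diff\<close>.\<close>

lemma ITO_weight:
  assumes I: "ITO a b Z R" and ab: "0 \<le> a" "a \<le> b" "b \<le> T"
    and c: "c \<in> borel_measurable (A a b)" "\<And>\<omega>. \<omega> \<in> space P \<Longrightarrow> \<bar>c \<omega>\<bar> \<le> C"
  shows "(\<integral>\<omega>. c \<omega> * (R \<omega>)\<^sup>2 \<partial>P) = (\<integral>x. indicator {a<..b} (fst x) * (c (snd x) * (norm (Z x))\<^sup>2) \<partial>Q)"
proof -
  let ?Z = "\<lambda>x. indicator {a<..b} (fst x) *\<^sub>R Z x"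
  have cP [measurable]: "c \<in> borel_measurable P" by (rule A_meas[OF ab c(1)])
  have cQ: "(\<lambda>x. c (snd x)) \<in> borel_measurable Q" "\<And>x. x \<in> space Q \<Longrightarrow> \<bar>c (snd x)\<bar> \<le> \<bar>C\<bar>"
    using c(2) by (auto intro: order_trans[OF _ abs_ge_self])
  have cC: "\<And>\<omega>. \<omega> \<in> space P \<Longrightarrow> \<bar>c \<omega>\<bar> \<le> \<bar>C\<bar>" using c(2) by (auto intro: order_trans[OF _ abs_ge_self])
  note s = ITO_sqint[OF I]
  note sZ = sqint_block[OF s(2), of a b]
  have "(\<integral>\<omega>. c \<omega> * (norm (R \<omega>))\<^sup>2 \<partial>P) = (\<integral>x. c (snd x) * (norm (?Z x))\<^sup>2 \<partial>Q)"
  proof (rule real_eq_if_abs_le)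
    fix e :: real assume e: "e > 0"
    \<comment> \<open>\<open>B\<close> collects the coefficients of \<open>\<eta>\<close> and
      \<open>K\<close> those of the approximation error \<open>d\<close>; their choices allot
      \<open>e / 2\<close> to each. The added \<open>1\<close> keeps the divisors positive.\<close>
    define B where "B = \<bar>C\<bar> * (nsq P R + nsq Q ?Z) + 1"
    have B: "B > 0" unfolding B_def using nsq_nonneg[of P R] nsq_nonneg[of Q ?Z]
      by (intro add_nonneg_pos mult_nonneg_nonneg) auto
    define \<eta> where "\<eta> = e / (2 * B)"
    have \<eta>: "\<eta> > 0" using e B by (simp add: \<eta>_def)
    define K where "K = 2 * \<bar>C\<bar> * (1 + 1 / \<eta>) + 1"
    have K: "K > 0" using \<eta> unfolding K_def by (intro add_nonneg_pos mult_nonneg_nonneg) auto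
    define d where "d = e / (2 * K)"
    have d: "d > 0" using e K by (simp add: d_def)
    obtain Z' R' where *: "SI a b Z' R'" "nsq P (\<lambda>\<omega>. R \<omega> - R' \<omega>) < d" "nsq Q (\<lambda>x. ?Z x - Z' x) < d"
      using ITO_approx[OF I d] .
    note t = SI_sqintR[OF *(1) ab(1,3)] SI_sqintZ[OF *(1) ab(1,3)]
    have "(\<integral>\<omega>. (c \<omega> * R' \<omega>) * R' \<omega> \<partial>P) = (\<integral>x. (c (snd x) *\<^sub>R Z' x) \<bullet> Z' x \<partial>Q)"
      by (rule SI_bilinear[OF SI_mult[OF *(1) ab(1,3) c(1) cC] ab(1,3) *(1) ab(1,3)])
    then have eq: "(\<integral>\<omega>. c \<omega> * (norm (R' \<omega>))\<^sup>2 \<partial>P) = (\<integral>x. c (snd x) * (norm (Z' x))\<^sup>2 \<partial>Q)"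
      unfolding power2_norm_eq_inner by (simp add: mult.assoc)
    have 1: "\<bar>(\<integral>\<omega>. c \<omega> * (norm (R \<omega>))\<^sup>2 \<partial>P) - (\<integral>\<omega>. c \<omega> * (norm (R' \<omega>))\<^sup>2 \<partial>P)\<bar>
        \<le> \<bar>C\<bar> * (\<eta> * nsq P R + (1 + 1 / \<eta>) * d)"
      by (rule order_trans[OF nsq_weight_diff[OF s(1) t(1) cP cC \<eta>]]) (use *(2) \<eta> in \<open>auto intro!: mult_left_mono\<close>)
    have 2: "\<bar>(\<integral>x. c (snd x) * (norm (?Z x))\<^sup>2 \<partial>Q) - (\<integral>x. c (snd x) * (norm (Z' x))\<^sup>2 \<partial>Q)\<bar>
        \<le> \<bar>C\<bar> * (\<eta> * nsq Q ?Z + (1 + 1 / \<eta>) * d)"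
      by (rule order_trans[OF nsq_weight_diff[OF sZ t(2) cQ \<eta>]]) (use *(3) \<eta> in \<open>auto intro!: mult_left_mono\<close>)
    have "\<bar>(\<integral>\<omega>. c \<omega> * (norm (R \<omega>))\<^sup>2 \<partial>P) - (\<integral>x. c (snd x) * (norm (?Z x))\<^sup>2 \<partial>Q)\<bar>
      \<le> \<bar>C\<bar> * (\<eta> * nsq P R + (1 + 1 / \<eta>) * d) + \<bar>C\<bar> * (\<eta> * nsq Q ?Z + (1 + 1 / \<eta>) * d)"
      using 1 2 eq by linarith
    also have "\<dots> = \<eta> * (B - 1) + (K - 1) * d"
      by (simp add: B_def K_def algebra_simps)
    also have "\<dots> \<le> \<eta> * B + K * d" using \<eta> d by (simp add: algebra_simps)
    also have "\<dots> = e" using B K by (simp add: \<eta>_def d_def)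
    finally show "\<bar>(\<integral>\<omega>. c \<omega> * (norm (R \<omega>))\<^sup>2 \<partial>P) - (\<integral>x. c (snd x) * (norm (?Z x))\<^sup>2 \<partial>Q)\<bar> \<le> e" .
  qed
  moreover have "c (snd x) * (norm (?Z x))\<^sup>2 = indicator {a<..b} (fst x) * (c (snd x) * (norm (Z x))\<^sup>2)" for x
    by (auto simp: indicator_def)
  ultimately show ?thesis by (simp only: real_norm_def power2_abs)
qed

lemma ITO_nsq:
  assumes I: "ITO a b Z R" and ab: "0 \<le> a" "a \<le> b" "b \<le> T"
  shows "nsq P R = nsq Q (\<lambda>x. indicator {a<..b} (fst x) *\<^sub>R Z x)"
proof -
  have "(norm (indicator {a<..b} (fst x) *\<^sub>R Z x))\<^sup>2 = indicator {a<..b} (fst x) * (1 * (norm (Z x))\<^sup>2)" for x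
    by (auto simp: indicator_def)
  then show ?thesis using ITO_weight[OF I ab, of "\<lambda>_. 1" 1] by (simp add: nsq_def)
qed

text \<open>Approximation by a simple integral costs at most \<open>\<eta> * nsq P k\<close> plus
  the squared error over \<open>\<eta>\<close>. The error is therefore taken proportional to
  \<open>\<eta> * e\<close>.\<close>

lemma ITO_mean:
  assumes I: "ITO a b Z R" and ab: "0 \<le> a" "a \<le> b" "b \<le> T"
    and k: "k \<in> borel_measurable (A a b)" "sqint P k"
  shows "(\<integral>\<omega>. k \<omega> * R \<omega> \<partial>P) = 0"
proof (rule real_eq_if_abs_le)
  fix e :: real assume e: "e > 0"
  define \<eta> where "\<eta> = e / (2 * (nsq P k + 1))"
  have k0: "nsq P k + 1 > 0" using nsq_nonneg[of P k] by linarith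
  then have \<eta>: "\<eta> > 0" using e by (simp add: \<eta>_def)
  have "\<eta> * e / 2 > 0" using e \<eta> by simp
  then obtain Z' R' where *: "SI a b Z' R'" "nsq P (\<lambda>\<omega>. R \<omega> - R' \<omega>) < \<eta> * e / 2"
    using ITO_approx[OF I] by metis
  note s = ITO_sqint[OF I] and t = SI_sqintR[OF *(1) ab(1,3)]
  have "(\<integral>\<omega>. k \<omega> * R \<omega> \<partial>P) = (\<integral>\<omega>. k \<omega> * (R \<omega> - R' \<omega>) \<partial>P) + (\<integral>\<omega>. k \<omega> * R' \<omega> \<partial>P)"
    using sqint_mult(1)[OF k(2) s(1)] sqint_mult(1)[OF k(2) t] by (simp add: right_diff_distrib)
  also have "(\<integral>\<omega>. k \<omega> * R' \<omega> \<partial>P) = 0" by (rule SI_mean[OF *(1) ab(1,3) k])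
  finally have "\<bar>(\<integral>\<omega>. k \<omega> * R \<omega> \<partial>P)\<bar> \<le> \<eta> * nsq P k + nsq P (\<lambda>\<omega>. R \<omega> - R' \<omega>) / \<eta>"
    using sqint_mult(2)[OF k(2) sqint_diff(1)[OF s(1) t] \<eta>] by simp
  also have "\<dots> \<le> \<eta> * (nsq P k + 1) + (\<eta> * e / 2) / \<eta>"
    using * \<eta> by (intro add_mono mult_left_mono divide_right_mono) auto
  also have "\<eta> * (nsq P k + 1) = e / 2" using k0 by (simp add: \<eta>_def field_simps)
  also have "e / 2 + (\<eta> * e / 2) / \<eta> = e" using \<eta> by simp
  finally show "\<bar>(\<integral>\<omega>. k \<omega> * R \<omega> \<partial>P) - 0\<bar> \<le> e" by simp
qed

end

section \<open>Increments of the integral and sums of small jumps\<close>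

text \<open>Here \<open>x\<close> is the increment of a simple integral, with a good fourth moment,
  and \<open>y\<close> a remainder small in mean square. If \<open>y\<close> dominates, the square
  is of order \<open>y\<^sup>2\<close>. If \<open>x\<close> dominates, either the truncation factor
  is at most \<open>\<eta>\<close>, or \<open>2 * L * \<bar>x\<bar> > \<eta>\<close> and the square
  of this ratio turns \<open>x\<^sup>2\<close> into a fourth power.\<close>

lemma min_jump_le:
  fixes x y L \<eta> :: real
  assumes L: "0 \<le> L" and e: "0 < \<eta>"
  shows "min 1 (L * \<bar>x + y\<bar>) * (x + y)\<^sup>2 \<le> 4 * y\<^sup>2 + 4 * \<eta> * x\<^sup>2 + 16 * (L / \<eta>)\<^sup>2 * x ^ 4"
proof (cases "\<bar>x\<bar> \<le> \<bar>y\<bar>")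
  case True
  have "\<bar>x + y\<bar> \<le> 2 * \<bar>y\<bar>" using True by linarith
  then have "\<bar>x + y\<bar>\<^sup>2 \<le> (2 * \<bar>y\<bar>)\<^sup>2" by (rule power_mono) simp
  then have "(x + y)\<^sup>2 \<le> 4 * y\<^sup>2" by (simp add: power_mult_distrib)
  moreover have "min 1 (L * \<bar>x + y\<bar>) * (x + y)\<^sup>2 \<le> 1 * (x + y)\<^sup>2" by (rule mult_right_mono) auto
  moreover have "0 \<le> 4 * \<eta> * x\<^sup>2 + 16 * (L / \<eta>)\<^sup>2 * x ^ 4" using e by (intro add_nonneg_nonneg mult_nonneg_nonneg) auto
  ultimately show ?thesis by linarith
next
  case False
  have a: "\<bar>x + y\<bar> \<le> 2 * \<bar>x\<bar>" using False by linarith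
  then have "\<bar>x + y\<bar>\<^sup>2 \<le> (2 * \<bar>x\<bar>)\<^sup>2" by (rule power_mono) simp
  then have sq: "(x + y)\<^sup>2 \<le> 4 * x\<^sup>2" by (simp add: power_mult_distrib)
  have "min 1 (L * \<bar>x + y\<bar>) * (x + y)\<^sup>2 \<le> min 1 (L * \<bar>x + y\<bar>) * (4 * x\<^sup>2)"
    using L by (intro mult_left_mono[OF sq]) auto
  also have "\<dots> \<le> 4 * \<eta> * x\<^sup>2 + 16 * (L / \<eta>)\<^sup>2 * x ^ 4"
  proof (cases "2 * L * \<bar>x\<bar> \<le> \<eta>")
    case True
    have "L * \<bar>x + y\<bar> \<le> L * (2 * \<bar>x\<bar>)" by (rule mult_left_mono[OF a L])
    then have "min 1 (L * \<bar>x + y\<bar>) \<le> \<eta>" using True by (simp add: min_le_iff_disj mult_ac)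
    then have "min 1 (L * \<bar>x + y\<bar>) * (4 * x\<^sup>2) \<le> \<eta> * (4 * x\<^sup>2)" by (rule mult_right_mono) simp
    moreover have "0 \<le> 16 * (L / \<eta>)\<^sup>2 * x ^ 4" by (intro mult_nonneg_nonneg) auto
    ultimately show ?thesis by linarith
  next
    case False
    then have "1 \<le> 2 * L * \<bar>x\<bar> / \<eta>" using e by simp
    then have "1\<^sup>2 \<le> (2 * L * \<bar>x\<bar> / \<eta>)\<^sup>2" by (rule power_mono) simp
    then have "1 \<le> 4 * (L / \<eta>)\<^sup>2 * x\<^sup>2" by (simp add: power_mult_distrib power_divide)
    then have "1 * (4 * x\<^sup>2) \<le> 4 * (L / \<eta>)\<^sup>2 * x\<^sup>2 * (4 * x\<^sup>2)" by (rule mult_right_mono) simp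
    moreover have "4 * (L / \<eta>)\<^sup>2 * x\<^sup>2 * (4 * x\<^sup>2) = 16 * (L / \<eta>)\<^sup>2 * x ^ 4"
      by (simp add: power2_eq_square power4_eq_xxxx)
    moreover have "min 1 (L * \<bar>x + y\<bar>) * (4 * x\<^sup>2) \<le> 1 * (4 * x\<^sup>2)" by (rule mult_right_mono) auto
    moreover have "0 \<le> 4 * \<eta> * x\<^sup>2" using e by simp
    ultimately show ?thesis by linarith
  qed
  also have "\<dots> \<le> 4 * y\<^sup>2 + 4 * \<eta> * x\<^sup>2 + 16 * (L / \<eta>)\<^sup>2 * x ^ 4" by simp
  finally show ?thesis .
qed

context noise
begin

text \<open>The two integrals to \<open>b\<close> come with unrelated approximations, so subtracting
  these does not visibly leave an integral up to \<open>s'\<close>. The approximation of the first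
  is cut at \<open>s'\<close>; on the common stretch its tail and the second approximation have
  integrands close to the same \<open>Z\<close>, and the isometry makes their values close.\<close>

lemma ITO_increment:
  assumes I: "ITO s b Z R" "ITO s' b Z R'" and o: "0 \<le> s" "s \<le> s'" "s' \<le> b" "b \<le> T"
  shows "ITO s s' Z (\<lambda>\<omega>. R \<omega> - R' \<omega>)"
  unfolding ITO_def
proof (intro conjI allI impI)
  note sq = ITO_sqint[OF I(1)] ITO_sqint[OF I(2)]
  show "sqint P (\<lambda>\<omega>. R \<omega> - R' \<omega>)" "sqint Q Z" using sq by (auto intro: sqint_diff(1))
  fix e :: real assume e: "e > 0"
  \<comment> \<open>Three errors are combined by the factor \<open>2\<close> of
    \<open>sqint_add\<close>: the nested pair contributes \<open>2 * (2 * e/16 + 2 * e/16)\<close>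
    and the tail comparison \<open>2 * e/4\<close>, in total \<open>e\<close>.\<close>
  have e16: "e / 16 > 0" using e by simp
  obtain Z1 R1 where 1: "SI s b Z1 R1" "nsq P (\<lambda>\<omega>. R \<omega> - R1 \<omega>) < e/16"
      "nsq Q (\<lambda>x. indicator {s<..b} (fst x) *\<^sub>R Z x - Z1 x) < e/16" using ITO_approx[OF I(1) e16] .
  obtain Z2 R2 where 2: "SI s' b Z2 R2" "nsq P (\<lambda>\<omega>. R' \<omega> - R2 \<omega>) < e/16"
      "nsq Q (\<lambda>x. indicator {s'<..b} (fst x) *\<^sub>R Z x - Z2 x) < e/16" using ITO_approx[OF I(2) e16] .
  have o1: "0 \<le> s'" using o by simp
  note sZ1 = SI_sqintZ[OF 1(1) o(1,4)] and sZ2 = SI_sqintZ[OF 2(1) o1 o(4)]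
  note sR1 = SI_sqintR[OF 1(1) o(1,4)] and sR2 = SI_sqintR[OF 2(1) o1 o(4)]
  obtain Rr where Rr: "\<And>u v. \<lbrakk>s \<le> u; u \<le> v; v \<le> b\<rbrakk> \<Longrightarrow> SI u v (\<lambda>x. indicator {u<..v} (fst x) *\<^sub>R Z1 x) (Rr u v)"
    and Rs: "\<And>u. u \<in> {s..b} \<Longrightarrow> R1 = (\<lambda>\<omega>. Rr s u \<omega> + Rr u b \<omega>)"
    using SI_restrict[OF 1(1) o(1,4)] by blast
  have S1: "SI s s' (\<lambda>x. indicator {s<..s'} (fst x) *\<^sub>R Z1 x) (Rr s s')" by (rule Rr) (use o in auto)
  have S2: "SI s' b (\<lambda>x. indicator {s'<..b} (fst x) *\<^sub>R Z1 x) (Rr s' b)" by (rule Rr) (use o in auto)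
  have R1: "R1 = (\<lambda>\<omega>. Rr s s' \<omega> + Rr s' b \<omega>)" by (rule Rs) (use o in auto)
  have sr: "sqint P (Rr s s')" "sqint P (Rr s' b)"
    using SI_sqintR[OF S1] SI_sqintR[OF S2] o by auto
  define D where "D = (\<lambda>x. indicator {s<..b} (fst x) *\<^sub>R Z x - Z1 x)"
  have sD: "sqint Q D" unfolding D_def by (rule sqint_diff(1)[OF sqint_block[OF sq(2)] sZ1])
  have Dle: "nsq Q (\<lambda>x. indicator {u<..v} (fst x) *\<^sub>R D x) < e/16" for u v
  proof -
    have "nsq Q (\<lambda>x. indicator {u<..v} (fst x) *\<^sub>R D x) \<le> nsq Q D" unfolding nsq_def
      by (rule integral_mono) (use sqint_block[OF sD, of u v] sD in \<open>auto simp: sqint_def indicator_def\<close>)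
    then show ?thesis using 1(3) unfolding D_def by simp
  qed
  have D1: "indicator {s<..s'} (fst x) *\<^sub>R D x = indicator {s<..s'} (fst x) *\<^sub>R Z x - indicator {s<..s'} (fst x) *\<^sub>R Z1 x" for x
    using o by (auto simp: D_def indicator_def)
  have nZ: "nsq Q (\<lambda>x. indicator {s<..s'} (fst x) *\<^sub>R Z x - indicator {s<..s'} (fst x) *\<^sub>R Z1 x) < e"
    using Dle[of s s'] e unfolding D1 by simp
  have D2: "indicator {s'<..b} (fst x) *\<^sub>R Z1 x - Z2 x
     = (indicator {s'<..b} (fst x) *\<^sub>R Z x - Z2 x) - indicator {s'<..b} (fst x) *\<^sub>R D x" for x
    using o by (auto simp: D_def indicator_def)
  have s2: "sqint Q (\<lambda>x. indicator {s'<..b} (fst x) *\<^sub>R Z x - Z2 x)" by (rule sqint_diff(1)[OF sqint_block[OF sq(2)] sZ2])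
  have "nsq P (\<lambda>\<omega>. Rr s' b \<omega> - R2 \<omega>) = nsq Q (\<lambda>x. indicator {s'<..b} (fst x) *\<^sub>R Z1 x - Z2 x)"
    by (rule SI_nsq[OF SI_diff[OF S2 2(1) o1 o(4)] o1 o(4)])
  also have "\<dots> \<le> 2 * nsq Q (\<lambda>x. indicator {s'<..b} (fst x) *\<^sub>R Z x - Z2 x) + 2 * nsq Q (\<lambda>x. indicator {s'<..b} (fst x) *\<^sub>R D x)"
    unfolding D2 by (rule sqint_diff(2)[OF s2 sqint_block[OF sD]])
  also have "\<dots> < e/4" using 2(3) Dle[of s' b] by simp
  finally have n3: "nsq P (\<lambda>\<omega>. Rr s' b \<omega> - R2 \<omega>) < e/4" .
  have s12: "sqint P (\<lambda>\<omega>. R \<omega> - R1 \<omega>)" "sqint P (\<lambda>\<omega>. R' \<omega> - R2 \<omega>)" "sqint P (\<lambda>\<omega>. Rr s' b \<omega> - R2 \<omega>)"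
    using sq sR1 sR2 sr by (auto intro: sqint_diff(1))
  have "(\<lambda>\<omega>. (R \<omega> - R' \<omega>) - Rr s s' \<omega>) = (\<lambda>\<omega>. ((R \<omega> - R1 \<omega>) - (R' \<omega> - R2 \<omega>)) + (Rr s' b \<omega> - R2 \<omega>))"
    unfolding R1 by (auto simp: algebra_simps)
  moreover have "nsq P (\<lambda>\<omega>. ((R \<omega> - R1 \<omega>) - (R' \<omega> - R2 \<omega>)) + (Rr s' b \<omega> - R2 \<omega>)) < e"
    using sqint_add(2)[OF sqint_diff(1)[OF s12(1,2)] s12(3)] sqint_diff(2)[OF s12(1,2)] 1(2) 2(2) n3 by simp
  ultimately have "nsq P (\<lambda>\<omega>. (R \<omega> - R' \<omega>) - Rr s s' \<omega>) < e" by simp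
  then show "\<exists>Z' R''. SI s s' Z' R'' \<and> nsq P (\<lambda>\<omega>. R \<omega> - R' \<omega> - R'' \<omega>) < e \<and>
       nsq Q (\<lambda>x. indicator {s<..s'} (fst x) *\<^sub>R Z x - Z' x) < e"
    using S1 nZ by blast
qed

lemma sum_block_nsq:
  assumes "sqint Q Z" "a \<le> b" "n > 0"
  shows "(\<Sum>k<n. nsq Q (\<lambda>x. indicator {grid a b n k<..grid a b n (Suc k)} (fst x) *\<^sub>R Z x)) = nsq Q (\<lambda>x. indicator {a<..b} (fst x) *\<^sub>R Z x)"
proof -
  have e: "(norm (indicator {u<..v} (fst x) *\<^sub>R Z x))\<^sup>2 = indicator {u<..v} (fst x) * (norm (Z x))\<^sup>2" for u v x
    by (auto simp: indicator_def)
  have i: "integrable Q (\<lambda>x. indicator {u<..v} (fst x) * (norm (Z x))\<^sup>2)" for u v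
    using sqint_int[OF sqint_block[OF assms(1), of u v]] unfolding e .
  show ?thesis unfolding nsq_def e
    by (subst Bochner_Integration.integral_sum[symmetric])
       (auto simp: i sum_distrib_right[symmetric] sum_indicator_grid[OF assms(2,3)] simp del: sum_indicator_mult)
qed

text \<open>With a simple integrand close to \<open>Z\<close>, \<open>min_jump_le\<close> splits
  each jump. The remainders add up to a small mean square by isometry, the squares of the simple
  part to \<open>\<eta>\<close> times a constant, and its \<open>n\<close> fourth powers of order
  \<open>1 / n\<^sup>2\<close> to order \<open>1 / n\<close>.\<close>

lemma ITO_small_jumps:
  assumes I: "\<And>r. r \<in> {t..T} \<Longrightarrow> ITO r T Z (J r)" and t: "0 \<le> t" "t \<le> T" and L: "0 \<le> L"
  defines "dJ \<equiv> \<lambda>n k \<omega>. J (grid t T n k) \<omega> - J (grid t T n (Suc k)) \<omega>"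
  shows "(\<lambda>n. \<Sum>k<n. \<integral>\<omega>. min 1 (L * \<bar>dJ n k \<omega>\<bar>) * (dJ n k \<omega>)\<^sup>2 \<partial>P) \<longlonglongrightarrow> 0"
    and "k < n \<Longrightarrow> integrable P (\<lambda>\<omega>. min 1 (L * \<bar>dJ n k \<omega>\<bar>) * (dJ n k \<omega>)\<^sup>2)"
proof -
  have gb: "grid t T n k \<in> {t..T}" if "k \<le> n" for n k using grid_bounds[OF t(2) that] .
  have IT: "ITO (grid t T n k) (grid t T n (Suc k)) Z (dJ n k)" if "k < n" for n k
    unfolding dJ_def
    by (rule ITO_increment[where b=T]) (use I[OF gb] gb[of k n] gb[of "Suc k" n] that t grid_mono[OF t(2), of k "Suc k" n] in auto)
  have sq: "sqint P (dJ n k)" if "k < n" for n k by (rule ITO_sqint(1)[OF IT[OF that]])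
  have jm: "\<bar>min 1 (L * \<bar>y\<bar>)\<bar> \<le> 1" for y using L by (auto simp: min_def abs_mult)
  show int: "integrable P (\<lambda>\<omega>. min 1 (L * \<bar>dJ n k \<omega>\<bar>) * (dJ n k \<omega>)\<^sup>2)" if "k < n" for n k
    using sqint_mult_bounded(2)[OF sq[OF that], of "\<lambda>\<omega>. min 1 (L * \<bar>dJ n k \<omega>\<bar>)" 1] jm sqint_meas[OF sq[OF that]] by auto
  have nonneg: "0 \<le> (\<Sum>k<n. \<integral>\<omega>. min 1 (L * \<bar>dJ n k \<omega>\<bar>) * (dJ n k \<omega>)\<^sup>2 \<partial>P)" for n
    using L by (intro sum_nonneg Bochner_Integration.integral_nonneg) auto
  show "(\<lambda>n. \<Sum>k<n. \<integral>\<omega>. min 1 (L * \<bar>dJ n k \<omega>\<bar>) * (dJ n k \<omega>)\<^sup>2 \<partial>P) \<longlonglongrightarrow> 0"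
  proof (rule LIMSEQ_I)
    fix e :: real assume e: "e > 0"
    have It: "ITO t T Z (J t)" by (rule I) (use t in auto)
    \<comment> \<open>Bounds the energy of the simple integrand before it is chosen, since its
      distance to \<open>Z\<close> will be at most \<open>d \<le> 1\<close>. Then
      \<open>4 * \<eta> * B = e / 4\<close> and \<open>4 * d \<le> e / 4\<close>.\<close>
    define B where "B = 2 * nsq Q (\<lambda>x. indicator {t<..T} (fst x) *\<^sub>R Z x) + 2"
    have B: "B > 0" using nsq_nonneg[of Q "\<lambda>x. indicator {t<..T} (fst x) *\<^sub>R Z x"] by (simp add: B_def)
    define \<eta> where "\<eta> = e / (16 * B)"
    have \<eta>: "\<eta> > 0" using e B by (simp add: \<eta>_def)
    define d where "d = min 1 (e / 16)"
    have d: "d > 0" using e by (simp add: d_def)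
    obtain Z' R' where *: "SI t T Z' R'" "nsq Q (\<lambda>x. indicator {t<..T} (fst x) *\<^sub>R Z x - Z' x) < d"
      using ITO_approx[OF It d] by metis
    note sZ' = SI_sqintZ[OF *(1) t(1) order_refl]
    have supp: "indicator {t<..T} (fst x) *\<^sub>R Z' x = Z' x" for x
      using SI_supp[OF *(1) t(1) order_refl, of x] by (auto simp: indicator_def)
    note sZ = ITO_sqint(2)[OF It]
    have nd: "nsq Q (\<lambda>x. indicator {t<..T} (fst x) *\<^sub>R (Z x - Z' x)) < d"
      using *(2) by (simp add: scaleR_diff_right supp)
    have nZ': "nsq Q (\<lambda>x. indicator {t<..T} (fst x) *\<^sub>R Z' x) \<le> B"
    proof -
      have "nsq Q (\<lambda>x. indicator {t<..T} (fst x) *\<^sub>R Z x - (indicator {t<..T} (fst x) *\<^sub>R Z x - Z' x))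
        \<le> 2 * nsq Q (\<lambda>x. indicator {t<..T} (fst x) *\<^sub>R Z x) + 2 * nsq Q (\<lambda>x. indicator {t<..T} (fst x) *\<^sub>R Z x - Z' x)"
        by (rule sqint_diff(2)[OF sqint_block[OF sZ] sqint_diff(1)[OF sqint_block[OF sZ] sZ']])
      also have "\<dots> \<le> B" using *(2) by (simp add: B_def d_def)
      finally show ?thesis by (simp add: supp)
    qed
    obtain Rr C where C: "0 \<le> C" and Rr: "\<And>u v. \<lbrakk>t \<le> u; u \<le> v; v \<le> T\<rbrakk> \<Longrightarrow> SI u v (\<lambda>x. indicator {u<..v} (fst x) *\<^sub>R Z' x) (Rr u v)
       \<and> integrable P (\<lambda>\<omega>. Rr u v \<omega> ^ 4) \<and> (\<integral>\<omega>. Rr u v \<omega> ^ 4 \<partial>P) \<le> C * (v - u)\<^sup>2"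
      using SI_restrict[OF *(1) t(1) order_refl] by blast
    define K where "K = 16 * (L / \<eta>)\<^sup>2 * C * (T - t)\<^sup>2"
    have K: "K \<ge> 0" using C by (simp add: K_def)
    have main: "(\<Sum>k<n. \<integral>\<omega>. min 1 (L * \<bar>dJ n k \<omega>\<bar>) * (dJ n k \<omega>)\<^sup>2 \<partial>P) \<le> e/2 + K / real n" if n: "n > 0" for n
    proof -
      let ?u = "grid t T n" and ?v = "\<lambda>k. grid t T n (Suc k)"
      let ?N = "\<lambda>k F. nsq Q (\<lambda>x. indicator {?u k<..?v k} (fst x) *\<^sub>R F x)"
      have blk: "(\<integral>\<omega>. min 1 (L * \<bar>dJ n k \<omega>\<bar>) * (dJ n k \<omega>)\<^sup>2 \<partial>P)
         \<le> 4 * ?N k (\<lambda>x. Z x - Z' x) + 4 * \<eta> * ?N k Z' + 16 * (L / \<eta>)\<^sup>2 * (C * ((T - t) / real n)\<^sup>2)" if k: "k < n" for k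
      proof -
        have uv: "t \<le> ?u k" "?u k \<le> ?v k" "?v k \<le> T"
          using gb[of k n] gb[of "Suc k" n] k grid_mono[OF t(2), of k "Suc k" n] by auto
        have uv0: "0 \<le> ?u k" using uv t by simp
        define x where "x = Rr (?u k) (?v k)"
        note R = Rr[OF uv, folded x_def]
        have sx: "sqint P x" using SI_sqintR[OF conjunct1[OF R]] uv t by auto
        have nx: "nsq P x = ?N k Z'" using SI_nsq[OF conjunct1[OF R]] uv t by auto
        have Ix: "ITO (?u k) (?v k) (\<lambda>y. indicator {?u k<..?v k} (fst y) *\<^sub>R Z' y) x"
          by (rule SI_ITO[OF conjunct1[OF R] uv0 uv(3)])
        note sy = sqint_diff(1)[OF sq[OF k] sx]
        have "nsq P (\<lambda>\<omega>. dJ n k \<omega> - x \<omega>) = nsq Q (\<lambda>y. indicator {?u k<..?v k} (fst y) *\<^sub>R (Z y - indicator {?u k<..?v k} (fst y) *\<^sub>R Z' y))"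
          by (rule ITO_nsq[OF ITO_diff[OF uv0 uv(3) IT[OF k] Ix] uv0 uv(2,3)])
        also have "\<dots> = ?N k (\<lambda>x. Z x - Z' x)"
          by (intro arg_cong[where f="nsq Q"]) (auto simp: indicator_def)
        finally have ny: "nsq P (\<lambda>\<omega>. dJ n k \<omega> - x \<omega>) = ?N k (\<lambda>x. Z x - Z' x)" .
        have ib: "integrable P (\<lambda>\<omega>. 4 * (dJ n k \<omega> - x \<omega>)\<^sup>2 + 4 * \<eta> * (x \<omega>)\<^sup>2 + 16 * (L / \<eta>)\<^sup>2 * x \<omega> ^ 4)"
          using sqint_int[OF sy] sqint_int[OF sx] R by auto
        have "(\<integral>\<omega>. min 1 (L * \<bar>dJ n k \<omega>\<bar>) * (dJ n k \<omega>)\<^sup>2 \<partial>P)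
          \<le> (\<integral>\<omega>. 4 * (dJ n k \<omega> - x \<omega>)\<^sup>2 + 4 * \<eta> * (x \<omega>)\<^sup>2 + 16 * (L / \<eta>)\<^sup>2 * x \<omega> ^ 4 \<partial>P)"
        proof (rule integral_mono[OF int[OF k] ib])
          fix \<omega>
          show "min 1 (L * \<bar>dJ n k \<omega>\<bar>) * (dJ n k \<omega>)\<^sup>2
            \<le> 4 * (dJ n k \<omega> - x \<omega>)\<^sup>2 + 4 * \<eta> * (x \<omega>)\<^sup>2 + 16 * (L / \<eta>)\<^sup>2 * x \<omega> ^ 4"
            using min_jump_le[OF L \<eta>, of "x \<omega>" "dJ n k \<omega> - x \<omega>"] by simp
        qed
        also have "\<dots> = 4 * nsq P (\<lambda>\<omega>. dJ n k \<omega> - x \<omega>) + 4 * \<eta> * nsq P x + 16 * (L / \<eta>)\<^sup>2 * (\<integral>\<omega>. x \<omega> ^ 4 \<partial>P)"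
          using sqint_int[OF sy] sqint_int[OF sx] R by (simp add: nsq_def)
        also have "\<dots> \<le> 4 * nsq P (\<lambda>\<omega>. dJ n k \<omega> - x \<omega>) + 4 * \<eta> * nsq P x + 16 * (L / \<eta>)\<^sup>2 * (C * (?v k - ?u k)\<^sup>2)"
          using R \<eta> by (intro add_mono mult_left_mono) auto
        finally show ?thesis unfolding nx ny by (simp add: grid_Suc)
      qed
      have "(\<Sum>k<n. \<integral>\<omega>. min 1 (L * \<bar>dJ n k \<omega>\<bar>) * (dJ n k \<omega>)\<^sup>2 \<partial>P)
        \<le> (\<Sum>k<n. 4 * ?N k (\<lambda>x. Z x - Z' x) + 4 * \<eta> * ?N k Z' + 16 * (L / \<eta>)\<^sup>2 * (C * ((T - t) / real n)\<^sup>2))"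
        by (rule sum_mono) (use blk in auto)
      also have "\<dots> = 4 * (\<Sum>k<n. ?N k (\<lambda>x. Z x - Z' x)) + 4 * \<eta> * (\<Sum>k<n. ?N k Z') + real n * (16 * (L / \<eta>)\<^sup>2 * (C * ((T - t) / real n)\<^sup>2))"
        by (simp only: sum.distrib sum_distrib_left sum_constant card_lessThan)
      also have "(\<Sum>k<n. ?N k (\<lambda>x. Z x - Z' x)) = nsq Q (\<lambda>x. indicator {t<..T} (fst x) *\<^sub>R (Z x - Z' x))"
        by (rule sum_block_nsq[OF sqint_diff(1)[OF sZ sZ'] t(2) n])
      also have "(\<Sum>k<n. ?N k Z') = nsq Q (\<lambda>x. indicator {t<..T} (fst x) *\<^sub>R Z' x)"
        by (rule sum_block_nsq[OF sZ' t(2) n])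
      also have "real n * (16 * (L / \<eta>)\<^sup>2 * (C * ((T - t) / real n)\<^sup>2)) = K / real n"
        using n by (simp add: K_def power_divide power2_eq_square)
      also have "4 * nsq Q (\<lambda>x. indicator {t<..T} (fst x) *\<^sub>R (Z x - Z' x)) + 4 * \<eta> * nsq Q (\<lambda>x. indicator {t<..T} (fst x) *\<^sub>R Z' x) + K / real n
        \<le> 4 * d + 4 * \<eta> * B + K / real n"
        using nd nZ' \<eta> by (intro add_mono mult_left_mono) auto
      also have "\<dots> \<le> e/2 + K / real n" using B by (simp add: \<eta>_def d_def min_def)
      finally show ?thesis .
    qed
    obtain n0 :: nat where n0: "K / (e/4) < real n0" using reals_Archimedean2 by blast
    show "\<exists>no. \<forall>n\<ge>no. norm ((\<Sum>k<n. \<integral>\<omega>. min 1 (L * \<bar>dJ n k \<omega>\<bar>) * (dJ n k \<omega>)\<^sup>2 \<partial>P) - 0) < e"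
    proof (intro exI[of _ "Suc n0"] allI impI)
      fix n assume "Suc n0 \<le> n"
      then have n: "n > 0" "K / (e/4) < real n" using n0 by linarith+
      then have "K / real n < e/4" using e by (simp add: field_simps)
      then show "norm ((\<Sum>k<n. \<integral>\<omega>. min 1 (L * \<bar>dJ n k \<omega>\<bar>) * (dJ n k \<omega>)\<^sup>2 \<partial>P) - 0) < e"
        using main[OF n(1)] nonneg[of n] e unfolding real_norm_def diff_0_right by linarith
    qed
  qed
qed

section \<open>From the stated stochastic integrals to the abstract one\<close>

lemma nsq_ennreal:
  assumes "sqint M f" shows "ennreal (nsq M f) = (\<integral>\<^sup>+x. ennreal ((norm (f x))\<^sup>2) \<partial>M)"
  unfolding nsq_def by (rule nn_integral_eq_integral[symmetric]) (use assms in \<open>auto simp: sqint_def\<close>)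

text \<open>A vector valued simple process is a finite sum of coordinate blocks, hence an integral
  in the closed class; closedness then handles the limit. The stated errors are iterated nonnegative
  integrals, which Tonelli's theorem matches with the norm on the product space.\<close>

lemma ITO_of_simple:
  fixes Z :: "real \<Rightarrow> 'w \<Rightarrow> real^'d"
  assumes ab: "0 \<le> a" "b \<le> T" and sZ: "sqint Q (\<lambda>(s, \<omega>). Z s \<omega>)" and R: "R \<in> borel_measurable P"
    and part: "\<And>n. partition_on a b (m n) (tt n)"
    and h: "\<And>n k. k < m n \<Longrightarrow> h n k \<in> borel_measurable (A (tt n k) (tt n (Suc k))) \<and> integrable P (\<lambda>\<omega>. (norm (h n k \<omega>))\<^sup>2)"
    and L1: "(\<lambda>n. \<integral>\<^sup>+\<omega>. (\<integral>\<^sup>+s\<in>{a..b}. ennreal ((norm (simple_proc (m n) (tt n) (h n) s \<omega> - Z s \<omega>))\<^sup>2) \<partial>lborel) \<partial>P) \<longlonglongrightarrow> 0"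
    and L2: "(\<lambda>n. \<integral>\<^sup>+\<omega>. ennreal ((R \<omega> - (\<Sum>k<m n. h n k \<omega> \<bullet> X (tt n k) (tt n (Suc k)) \<omega>))\<^sup>2) \<partial>P) \<longlonglongrightarrow> 0"
  shows "ITO a b (\<lambda>(s, \<omega>). Z s \<omega>) R"
proof -
  define Zn where "Zn = (\<lambda>n x. simple_proc (m n) (tt n) (h n) (fst x) (snd x))"
  define Rn where "Rn = (\<lambda>n \<omega>. \<Sum>k<m n. h n k \<omega> \<bullet> X (tt n k) (tt n (Suc k)) \<omega>)"
  have mono: "tt n k \<le> tt n l" if "k \<le> l" "l \<le> m n" for n k l
    using that
  proof (induction l)
    case (Suc l)
    show ?case
    proof (cases "k = Suc l")
      case False
      then have "tt n k \<le> tt n l" using Suc by auto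
      also have "\<dots> < tt n (Suc l)" using part[of n] Suc by (auto simp: Defs.partition_on_def)
      finally show ?thesis by simp
    qed simp
  qed simp
  have tin: "a \<le> tt n k" "tt n k \<le> tt n (Suc k)" "tt n (Suc k) \<le> b" if "k < m n" for n k
    using mono[of 0 k n] mono[of k "Suc k" n] mono[of "Suc k" "m n" n] part[of n] that by (auto simp: Defs.partition_on_def)
  have In: "ITO a b (Zn n) (Rn n)" for n
  proof -
    have hi: "(\<lambda>\<omega>. h n k \<omega> $ i) \<in> borel_measurable (A (tt n k) (tt n (Suc k)))" "sqint P (\<lambda>\<omega>. h n k \<omega> $ i)"
      if k: "k < m n" for k i
    proof -
      have c: "(\<lambda>x::real^'d. x $ i) \<in> borel_measurable borel"
        by (intro borel_measurable_continuous_onI continuous_intros)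
      show hm: "(\<lambda>\<omega>. h n k \<omega> $ i) \<in> borel_measurable (A (tt n k) (tt n (Suc k)))"
        by (rule measurable_compose[OF _ c]) (use h[OF k] in blast)
      have hP: "(\<lambda>\<omega>. h n k \<omega> $ i) \<in> borel_measurable P"
        by (rule A_meas[OF _ _ _ hm]) (use tin[OF k] ab in auto)
      have "integrable P (\<lambda>\<omega>. (norm (h n k \<omega> $ i))\<^sup>2)"
        by (rule Bochner_Integration.integrable_bound[of P "\<lambda>\<omega>. (norm (h n k \<omega>))\<^sup>2"])
           (use h[OF k] hP in \<open>auto intro!: AE_I2 power_mono component_le_norm_cart simp: abs_le_square_iff[symmetric]\<close>)
      then show "sqint P (\<lambda>\<omega>. h n k \<omega> $ i)" using hP by (simp add: sqint_def)
    qed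
    have "ITO a b (\<lambda>x. \<Sum>(k, i)\<in>{..<m n} \<times> UNIV. (indicator {tt n k<..tt n (Suc k)} (fst x) * h n k (snd x) $ i) *\<^sub>R axis i 1)
       (\<lambda>\<omega>. \<Sum>(k, i)\<in>{..<m n} \<times> UNIV. h n k \<omega> $ i * X (tt n k) (tt n (Suc k)) \<omega> $ i)"
      unfolding split_def
      by (rule ITO_sum[OF ab]) (use tin ab hi in \<open>auto intro!: ITO_elem\<close>)
    also have "(\<lambda>x. \<Sum>(k, i)\<in>{..<m n} \<times> UNIV. (indicator {tt n k<..tt n (Suc k)} (fst x) * h n k (snd x) $ i) *\<^sub>R axis i 1) = Zn n"
    proof
      fix x :: "real \<times> 'w"
      have "(\<Sum>i\<in>UNIV. (r * y $ i) *\<^sub>R axis i 1) = r *\<^sub>R (y :: real^'d)" for r y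
        using basis_expansion[of y] by (simp add: scaleR_sum_right[symmetric] scaleR_scaleR[symmetric] scalar_mult_eq_scaleR del: scaleR_scaleR)
      then show "(\<Sum>(k, i)\<in>{..<m n} \<times> UNIV. (indicator {tt n k<..tt n (Suc k)} (fst x) * h n k (snd x) $ i) *\<^sub>R axis i 1) = Zn n x"
        by (simp add: sum.cartesian_product[symmetric] Zn_def simple_proc_def)
    qed
    also have "(\<lambda>\<omega>. \<Sum>(k, i)\<in>{..<m n} \<times> UNIV. h n k \<omega> $ i * X (tt n k) (tt n (Suc k)) \<omega> $ i) = Rn n"
      by (simp add: sum.cartesian_product[symmetric] Rn_def inner_vec_def)
    finally show ?thesis .
  qed
  note sn = ITO_sqint[OF In]
  have fin: "sqint P (\<lambda>\<omega>. R \<omega> - Rn n \<omega>)" if "(\<integral>\<^sup>+\<omega>. ennreal ((R \<omega> - Rn n \<omega>)\<^sup>2) \<partial>P) < e" "e \<le> \<infinity>" for n and e :: ennreal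
  proof -
    have m: "(\<lambda>\<omega>. R \<omega> - Rn n \<omega>) \<in> borel_measurable P" using R sqint_meas[OF sn(1)] by measurable
    have "integrable P (\<lambda>\<omega>. (norm (R \<omega> - Rn n \<omega>))\<^sup>2)"
      using m that by (intro integrableI_bounded) (auto simp: less_top[symmetric] intro: order_less_le_trans)
    then show ?thesis using m by (simp add: sqint_def)
  qed
  have L2': "(\<lambda>n. \<integral>\<^sup>+\<omega>. ennreal ((R \<omega> - Rn n \<omega>)\<^sup>2) \<partial>P) \<longlonglongrightarrow> 0"
    using L2 by (simp add: Rn_def)
  \<comment> \<open>\<open>R\<close> is assumed only measurable; it is square integrable because it
    lies at finite distance from one simple integral.\<close>
  obtain n1 where "(\<integral>\<^sup>+\<omega>. ennreal ((R \<omega> - Rn n1 \<omega>)\<^sup>2) \<partial>P) < 1"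
    using order_tendstoD(2)[OF L2', of 1] by (auto simp: eventually_sequentially)
  then have "sqint P (\<lambda>\<omega>. R \<omega> - Rn n1 \<omega>)" by (rule fin) simp
  from sqint_add(1)[OF this sn(1)[of n1]] have sR: "sqint P R" by simp
  show ?thesis
  proof (rule ITO_limit[OF ab sR sZ])
    fix e :: real assume e: "e > 0"
    have "\<forall>\<^sub>F n in sequentially. (\<integral>\<^sup>+\<omega>. ennreal ((R \<omega> - Rn n \<omega>)\<^sup>2) \<partial>P) < ennreal e"
      using order_tendstoD(2)[OF L2', of "ennreal e"] e by simp
    moreover have "\<forall>\<^sub>F n in sequentially. (\<integral>\<^sup>+\<omega>. (\<integral>\<^sup>+s\<in>{a..b}. ennreal ((norm (simple_proc (m n) (tt n) (h n) s \<omega> - Z s \<omega>))\<^sup>2) \<partial>lborel) \<partial>P) < ennreal e"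
      using order_tendstoD(2)[OF L1, of "ennreal e"] e by simp
    ultimately have "\<forall>\<^sub>F n in sequentially. (\<integral>\<^sup>+\<omega>. ennreal ((R \<omega> - Rn n \<omega>)\<^sup>2) \<partial>P) < ennreal e \<and>
      (\<integral>\<^sup>+\<omega>. (\<integral>\<^sup>+s\<in>{a..b}. ennreal ((norm (simple_proc (m n) (tt n) (h n) s \<omega> - Z s \<omega>))\<^sup>2) \<partial>lborel) \<partial>P) < ennreal e"
      by eventually_elim simp
    then obtain n where n1: "(\<integral>\<^sup>+\<omega>. ennreal ((R \<omega> - Rn n \<omega>)\<^sup>2) \<partial>P) < ennreal e"
      and n2: "(\<integral>\<^sup>+\<omega>. (\<integral>\<^sup>+s\<in>{a..b}. ennreal ((norm (simple_proc (m n) (tt n) (h n) s \<omega> - Z s \<omega>))\<^sup>2) \<partial>lborel) \<partial>P) < ennreal e"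
      by (auto simp: eventually_sequentially)
    let ?D = "\<lambda>x. indicator {a<..b} (fst x) *\<^sub>R ((\<lambda>(s, \<omega>). Z s \<omega>) x - Zn n x)"
    have "ennreal (nsq P (\<lambda>\<omega>. R \<omega> - Rn n \<omega>)) < ennreal e"
      using n1 by (subst nsq_ennreal[OF sqint_diff(1)[OF sR sn(1)]]) simp
    then have 1: "nsq P (\<lambda>\<omega>. R \<omega> - Rn n \<omega>) < e" using e by (simp add: ennreal_less_iff nsq_nonneg)
    have sD: "sqint Q ?D" by (rule sqint_block[OF sqint_diff(1)[OF sZ sn(2)]])
    interpret pq: pair_sigma_finite "restrict_space lborel {0..T}" P by (rule pair_sigma_finite_time)
    have "(\<integral>\<^sup>+x. ennreal ((norm (?D x))\<^sup>2) \<partial>Q) = (\<integral>\<^sup>+\<omega>. (\<integral>\<^sup>+s. ennreal ((norm (?D (s, \<omega>)))\<^sup>2) \<partial>restrict_space lborel {0..T}) \<partial>P)"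
    proof -
      have "(\<lambda>x. ennreal ((norm (?D x))\<^sup>2)) \<in> borel_measurable Q" using sqint_meas[OF sD] by measurable
      then show ?thesis unfolding timeprod_def by (subst pq.nn_integral_snd[symmetric]) auto
    qed
    also have "\<dots> \<le> (\<integral>\<^sup>+\<omega>. (\<integral>\<^sup>+s\<in>{a..b}. ennreal ((norm (simple_proc (m n) (tt n) (h n) s \<omega> - Z s \<omega>))\<^sup>2) \<partial>lborel) \<partial>P)"
      by (intro nn_integral_mono, subst nn_integral_restrict_space)
         (auto intro!: nn_integral_mono simp: indicator_def Zn_def norm_minus_commute)
    also note n2
    finally have "ennreal (nsq Q ?D) < ennreal e" unfolding nsq_ennreal[OF sD] .
    then have 2: "nsq Q ?D < e" using e by (simp add: ennreal_less_iff nsq_nonneg)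
    show "\<exists>Z' R'. ITO a b Z' R' \<and> nsq P (\<lambda>\<omega>. R \<omega> - R' \<omega>) < e \<and>
       nsq Q (\<lambda>x. indicator {a<..b} (fst x) *\<^sub>R ((\<lambda>(s, \<omega>). Z s \<omega>) x - Z' x)) < e"
      using In[of n] 1 2 by blast
  qed
qed

end

section \<open>Brownian motion as forward and backward noise\<close>

context bm_proj
begin

lemma sets_Gfwd: "sets (Gfwd u) = sigma_sets (space P) ({(\<lambda>\<omega>. W r (p \<omega>)) -` A \<inter> space P | r A. 0 \<le> r \<and> r \<le> u \<and> A \<in> sets borel}
     \<union> {q -` A \<inter> space P | A. A \<in> sets M2} \<union> null_sets P)"
  unfolding Gfwd_def by (rule sets_measure_of) (auto dest: null_setsD2 sets.sets_into_space)

lemma sets_Gbwd: "sets (Gbwd v) = sigma_sets (space P) ({(\<lambda>\<omega>. W r (p \<omega>) - W v (p \<omega>)) -` A \<inter> space P | r A. v \<le> r \<and> A \<in> sets borel}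
     \<union> {q -` A \<inter> space P | A. A \<in> sets M2} \<union> null_sets P)"
  unfolding Gbwd_def by (rule sets_measure_of) (auto dest: null_setsD2 sets.sets_into_space)

lemma measurable_Gfwd:
  assumes "0 \<le> r" "r \<le> u" shows "(\<lambda>\<omega>. W r (p \<omega>)) \<in> borel_measurable (Gfwd u)"
proof (rule measurableI)
  fix A :: "(real^'d) set" assume "A \<in> sets borel"
  then have "(\<lambda>\<omega>. W r (p \<omega>)) -` A \<inter> space P \<in> sets (Gfwd u)"
    unfolding sets_Gfwd using assms by (intro sigma_sets.Basic UnI1) blast
  then show "(\<lambda>\<omega>. W r (p \<omega>)) -` A \<inter> space (Gfwd u) \<in> sets (Gfwd u)" by simp
qed simp

lemma measurable_Gbwd:
  assumes "v \<le> r" shows "(\<lambda>\<omega>. W r (p \<omega>) - W v (p \<omega>)) \<in> borel_measurable (Gbwd v)"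
proof (rule measurableI)
  fix A :: "(real^'d) set" assume "A \<in> sets borel"
  then have "(\<lambda>\<omega>. W r (p \<omega>) - W v (p \<omega>)) -` A \<inter> space P \<in> sets (Gbwd v)"
    unfolding sets_Gbwd using assms by (intro sigma_sets.Basic UnI1) blast
  then show "(\<lambda>\<omega>. W r (p \<omega>) - W v (p \<omega>)) -` A \<inter> space (Gbwd v) \<in> sets (Gbwd v)" by simp
qed simp

lemma Gfwd_mono: "u \<le> u' \<Longrightarrow> sets (Gfwd u) \<subseteq> sets (Gfwd u')"
  unfolding sets_Gfwd by (intro sigma_sets_mono' Un_mono subset_refl) (blast intro: order_trans)

lemma q_in_G: "A \<in> sets M2 \<Longrightarrow> q -` A \<inter> space P \<in> sets (Gfwd u)" "A \<in> sets M2 \<Longrightarrow> q -` A \<inter> space P \<in> sets (Gbwd u)"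
  and null_in_G: "N \<in> null_sets P \<Longrightarrow> N \<in> sets (Gfwd u)" "N \<in> null_sets P \<Longrightarrow> N \<in> sets (Gbwd u)"
  unfolding sets_Gfwd sets_Gbwd by (intro sigma_sets.Basic; blast)+

lemma incr_Gbwd: "v \<le> u' \<Longrightarrow> v \<le> v' \<Longrightarrow> incr u' v' \<in> borel_measurable (Gbwd v)"
proof -
  assume "v \<le> u'" "v \<le> v'"
  then have "(\<lambda>\<omega>. (W v' (p \<omega>) - W v (p \<omega>)) - (W u' (p \<omega>) - W v (p \<omega>))) \<in> borel_measurable (Gbwd v)"
    by (intro borel_measurable_diff measurable_Gbwd)
  then show ?thesis by (simp add: incr_def[abs_def])
qed

text \<open>An increment from \<open>v'\<close> onward is a difference of two increments taken from
  the earlier time \<open>v\<close>.\<close>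

lemma Gbwd_mono: "v \<le> v' \<Longrightarrow> sets (Gbwd v') \<subseteq> sets (Gbwd v)"
proof -
  assume v: "v \<le> v'"
  have "sigma_sets (space (Gbwd v)) ({(\<lambda>\<omega>. W r (p \<omega>) - W v' (p \<omega>)) -` A \<inter> space P | r A. v' \<le> r \<and> A \<in> sets borel}
     \<union> {q -` A \<inter> space P | A. A \<in> sets M2} \<union> null_sets P) \<subseteq> sets (Gbwd v)"
  proof (rule sets.sigma_sets_subset, intro Un_least subsetI)
    fix B assume "B \<in> {(\<lambda>\<omega>. W r (p \<omega>) - W v' (p \<omega>)) -` A \<inter> space P | r A. v' \<le> r \<and> A \<in> sets borel}"
    then obtain r A where B: "B = (\<lambda>\<omega>. W r (p \<omega>) - W v' (p \<omega>)) -` A \<inter> space P" "v' \<le> r" "A \<in> sets borel" by blast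
    have "incr v' r \<in> borel_measurable (Gbwd v)" by (rule incr_Gbwd) (use v B in auto)
    from measurable_sets[OF this B(3)] show "B \<in> sets (Gbwd v)" by (simp add: B(1) incr_def[abs_def])
  qed (auto intro: q_in_G null_in_G)
  then show ?thesis by (simp add: sets_Gbwd[of v'])
qed

lemma G_P:
  shows "sets (Gfwd u) \<subseteq> sets P" "sets (Gbwd u) \<subseteq> sets P"
proof -
  have 0: "(\<lambda>\<omega>. W r (p \<omega>)) \<in> borel_measurable P" "(\<lambda>\<omega>. W r (p \<omega>) - W u (p \<omega>)) \<in> borel_measurable P" for r
    by measurable
  have 1: "(\<lambda>\<omega>. W r (p \<omega>)) -` A \<inter> space P \<in> sets P" "(\<lambda>\<omega>. W r (p \<omega>) - W u (p \<omega>)) -` A \<inter> space P \<in> sets P" if "A \<in> sets borel" for r A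
    using measurable_sets[OF 0(1) that] measurable_sets[OF 0(2) that] by auto
  show "sets (Gfwd u) \<subseteq> sets P" "sets (Gbwd u) \<subseteq> sets P"
    unfolding sets_Gfwd sets_Gbwd by (rule sets.sigma_sets_subset; use 1 in \<open>auto intro: measurable_sets[OF q]\<close>)+
qed

lemma measurable_mono_sets:
  "h \<in> borel_measurable N \<Longrightarrow> sets N \<subseteq> sets N' \<Longrightarrow> space N = space N' \<Longrightarrow> h \<in> borel_measurable N'"
  by (auto simp: measurable_def)

lemma comp_meas: "(\<lambda>x::real^'d. x $ i) \<in> borel_measurable borel"
  by (intro borel_measurable_continuous_onI continuous_intros)

lemma sqint_incr:
  assumes "0 \<le> a" "a \<le> b" "N = Gfwd a \<or> N = Gbwd b" "h \<in> borel_measurable N" "sqint P h"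
  shows "sqint P (\<lambda>\<omega>. h \<omega> * incr a b \<omega> $ i)"
proof -
  have hm: "(\<lambda>\<omega>. (h \<omega>)\<^sup>2) \<in> borel_measurable N" using assms by measurable
  have hi: "integrable P (\<lambda>\<omega>. (h \<omega>)\<^sup>2)" using assms(5) by (simp add: sqint_def)
  have e: "(norm (h \<omega> * incr a b \<omega> $ i))\<^sup>2 = (h \<omega>)\<^sup>2 * (incr a b \<omega> $ i * incr a b \<omega> $ i)" for \<omega>
    by (simp add: power_mult_distrib power2_eq_square)
  have [measurable]: "h \<in> borel_measurable P" using assms(5) by (simp add: sqint_def)
  have [measurable]: "(\<lambda>\<omega>. incr a b \<omega> $ i) \<in> borel_measurable P" by (rule measurable_compose[OF incr_meas comp_meas])
  show ?thesis unfolding sqint_def e using incr_h(3)[OF assms(1-3) hm hi, of i i] by simp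
qed

text \<open>The first block and \<open>h'\<close> are known at time \<open>u'\<close>, so their
  product serves as one coefficient for the later, centred increment.\<close>

lemma fwd_orth:
  fixes h h' :: "'w \<Rightarrow> real"
  assumes *: "0 \<le> u" "u \<le> v" "v \<le> u'" "u' \<le> v'" "v' \<le> T"
    "h \<in> borel_measurable (Gfwd u)" "sqint P h" "h' \<in> borel_measurable (Gfwd u')" "sqint P h'"
  shows "(\<integral>\<omega>. (h \<omega> * incr u v \<omega> $ i) * (h' \<omega> * incr u' v' \<omega> $ j) \<partial>P) = 0"
proof -
  have i1: "integrable P (\<lambda>\<omega>. (h \<omega> * incr u v \<omega> $ i) * h' \<omega>)"
    by (rule sqint_mult(1)[OF sqint_incr[OF *(1,2)] *(9)]) (use * in auto)
  have [measurable]: "(\<lambda>\<omega>. incr u v \<omega> $ i) \<in> borel_measurable (Gfwd u')"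
    by (rule measurable_compose[OF _ comp_meas], unfold incr_def, intro borel_measurable_diff measurable_Gfwd) (use * in auto)
  have [measurable]: "h \<in> borel_measurable (Gfwd u')"
    by (rule measurable_mono_sets[OF *(6) Gfwd_mono]) (use * in auto)
  note [measurable] = *(8)
  have "(\<lambda>\<omega>. (h \<omega> * incr u v \<omega> $ i) * h' \<omega>) \<in> borel_measurable (Gfwd u')" by measurable
  from incr_h(2)[OF _ *(4) _ this i1, of j]
  show "(\<integral>\<omega>. (h \<omega> * incr u v \<omega> $ i) * (h' \<omega> * incr u' v' \<omega> $ j) \<partial>P) = 0"
    using * by (simp add: mult.assoc)
qed

lemma noise_fwd: "noise P T (\<lambda>u v. Gfwd u) incr"
  apply (rule noise.intro[OF prob_space_axioms], rule noise_axioms.intro)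
  subgoal by (rule space_G)
  subgoal by (rule G_P)
  subgoal by (rule Gfwd_mono)
  subgoal by (rule measurable_compose[OF incr_meas comp_meas])
  subgoal by (simp add: incr_def)
  subgoal by (rule incr_h(1)[OF _ _ disjI1[OF refl]])
  subgoal by (rule incr_h(2)[OF _ _ disjI1[OF refl]])
  subgoal by (rule incr_h(3)[OF _ _ disjI1[OF refl]])
  subgoal by (rule incr_h(4)[OF _ _ disjI1[OF refl]])
  subgoal by (rule incr_moments(1))
  subgoal by (rule incr_moments(5))
  subgoal by (rule fwd_orth)
  done

text \<open>The mirror image: the whole later block lies in the future of \<open>v\<close> and acts
  as a coefficient for the earlier increment, which is the one that is centred.\<close>

lemma bwd_orth:
  fixes h h' :: "'w \<Rightarrow> real"
  assumes *: "0 \<le> u" "u \<le> v" "v \<le> u'" "u' \<le> v'" "v' \<le> T"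
    "h \<in> borel_measurable (Gbwd v)" "sqint P h" "h' \<in> borel_measurable (Gbwd v')" "sqint P h'"
  shows "(\<integral>\<omega>. (h \<omega> * incr u v \<omega> $ i) * (h' \<omega> * incr u' v' \<omega> $ j) \<partial>P) = 0"
proof -
  have u': "0 \<le> u'" using * by simp
  have i1: "integrable P (\<lambda>\<omega>. h \<omega> * (h' \<omega> * incr u' v' \<omega> $ j))"
    by (rule sqint_mult(1)[OF *(7) sqint_incr[OF u' *(4)]]) (use * in auto)
  have [measurable]: "(\<lambda>\<omega>. incr u' v' \<omega> $ j) \<in> borel_measurable (Gbwd v)"
    by (rule measurable_compose[OF incr_Gbwd comp_meas]) (use * in auto)
  have [measurable]: "h' \<in> borel_measurable (Gbwd v)"
    by (rule measurable_mono_sets[OF *(8) Gbwd_mono]) (use * in auto)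
  note [measurable] = *(6)
  have "(\<lambda>\<omega>. h \<omega> * (h' \<omega> * incr u' v' \<omega> $ j)) \<in> borel_measurable (Gbwd v)" by measurable
  from incr_h(2)[OF *(1,2) _ this i1, of i]
  show "(\<integral>\<omega>. (h \<omega> * incr u v \<omega> $ i) * (h' \<omega> * incr u' v' \<omega> $ j) \<partial>P) = 0"
    by (simp add: mult_ac)
qed

lemma noise_bwd: "noise P T (\<lambda>u v. Gbwd v) incr"
  apply (rule noise.intro[OF prob_space_axioms], rule noise_axioms.intro)
  subgoal by (rule space_G)
  subgoal by (rule G_P)
  subgoal by (rule Gbwd_mono)
  subgoal by (rule measurable_compose[OF incr_meas comp_meas])
  subgoal by (simp add: incr_def)
  subgoal by (rule incr_h(1)[OF _ _ disjI2[OF refl]])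
  subgoal by (rule incr_h(2)[OF _ _ disjI2[OF refl]])
  subgoal by (rule incr_h(3)[OF _ _ disjI2[OF refl]])
  subgoal by (rule incr_h(4)[OF _ _ disjI2[OF refl]])
  subgoal by (rule incr_moments(1))
  subgoal by (rule incr_moments(5))
  subgoal by (rule bwd_orth)
  done

end

section \<open>The completed product space and its filtration\<close>

lemma bm_proj_prodP:
  assumes "prob_space M1" "prob_space M2"
  shows "brownian_motion M1 W \<Longrightarrow> bm_proj (prodP M1 M2) M1 M2 fst snd W"
    and "brownian_motion M2 B \<Longrightarrow> bm_proj (prodP M1 M2) M2 M1 snd fst B"
proof -
  interpret M1: prob_space M1 by fact
  interpret M2: prob_space M2 by fact
  interpret pair_prob_space M1 M2 by unfold_locales
  have P: "prob_space (prodP M1 M2)"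
    unfolding prodP_def by (rule prob_space_completion)
  have m: "fst \<in> measurable (prodP M1 M2) M1" "snd \<in> measurable (prodP M1 M2) M2"
    unfolding prodP_def by (auto intro: measurable_completion)
  have sp: "space (prodP M1 M2) = space M1 \<times> space M2" by (simp add: prodP_def space_pair_measure)
  have pr: "measure (prodP M1 M2) (fst -` A \<inter> snd -` B \<inter> space (prodP M1 M2)) = measure M1 A * measure M2 B"
    if "A \<in> sets M1" "B \<in> sets M2" for A B
  proof -
    have "fst -` A \<inter> snd -` B \<inter> space (prodP M1 M2) = A \<times> B"
      using sets.sets_into_space[OF that(1)] sets.sets_into_space[OF that(2)] by (auto simp: sp)
    moreover have "measure (prodP M1 M2) (A \<times> B) = measure (M1 \<Otimes>\<^sub>M M2) (A \<times> B)"
      unfolding prodP_def by (rule measure_completion) (use that in auto)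
    moreover have "measure (M1 \<Otimes>\<^sub>M M2) (A \<times> B) = measure M1 A * measure M2 B"
      using M2.emeasure_pair_measure_Times[OF that] by (simp add: measure_def enn2real_mult)
    ultimately show ?thesis by simp
  qed
  show "brownian_motion M1 W \<Longrightarrow> bm_proj (prodP M1 M2) M1 M2 fst snd W"
    unfolding bm_proj_def bm_proj_axioms_def using P m pr assms by auto
  have pr': "measure (prodP M1 M2) (snd -` A \<inter> fst -` B \<inter> space (prodP M1 M2)) = measure M2 A * measure M1 B"
    if "A \<in> sets M2" "B \<in> sets M1" for A B
    using pr[OF that(2,1)] by (simp add: Int_commute mult.commute)
  show "brownian_motion M2 B \<Longrightarrow> bm_proj (prodP M1 M2) M2 M1 snd fst B"
    unfolding bm_proj_def bm_proj_axioms_def using P m pr' assms by auto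
qed

lemma sets_filt:
  "sets (filt P W B T t) = sigma_sets (space P)
     ({W r -` A \<inter> space P | r A. 0 \<le> r \<and> r \<le> t \<and> A \<in> sets borel}
      \<union> {(\<lambda>\<omega>. B r \<omega> - B t \<omega>) -` A \<inter> space P | r A. t \<le> r \<and> r \<le> T \<and> A \<in> sets borel}
      \<union> null_sets P)"
  unfolding filt_def by (rule sets_measure_of) (auto dest: null_setsD2 sets.sets_into_space)

lemma space_filt [simp]: "space (filt P W B T t) = space P"
  by (simp add: filt_def space_measure_of_conv)

text \<open>The bridge from the non-monotone family to the two monotone ones: one of the two noises
  is treated with the correct time direction, and the events of the other lie in the factor that is
  included entirely.\<close>

lemma filt_subset:
  fixes W :: "real \<Rightarrow> 'a \<Rightarrow> real^'d" and B :: "real \<Rightarrow> 'b \<Rightarrow> real^'l"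
  assumes M: "prob_space M1" "prob_space M2" and bm: "brownian_motion M1 W" "brownian_motion M2 B"
  defines "P \<equiv> prodP M1 M2"
  shows "sets (filt P (liftW W) (liftB B) T t) \<subseteq> sets (bm_proj.Gfwd P M2 fst snd W t)"
    and "sets (filt P (liftW W) (liftB B) T t) \<subseteq> sets (bm_proj.Gbwd P M1 snd fst B t)"
proof -
  interpret w: bm_proj P M1 M2 fst snd W unfolding P_def by (rule bm_proj_prodP(1)[OF M bm(1)])
  interpret b: bm_proj P M2 M1 snd fst B unfolding P_def by (rule bm_proj_prodP(2)[OF M bm(2)])
  have Wm: "W r \<in> borel_measurable M1" "B r \<in> borel_measurable M2" for r using bm by (auto simp: brownian_motion_def)
  have W1: "liftW W r -` A \<inter> space P = fst -` (W r -` A \<inter> space M1) \<inter> space P" for r A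
    using measurable_space[OF w.p] by (auto simp: liftW_def)
  have B1: "(\<lambda>\<omega>. liftB B r \<omega> - liftB B t \<omega>) -` A \<inter> space P = snd -` ((\<lambda>x. B r x - B t x) -` A \<inter> space M2) \<inter> space P" for r A
    using measurable_space[OF b.p] by (auto simp: liftB_def)
  have Bd: "(\<lambda>x. B r x - B t x) -` A \<inter> space M2 \<in> sets M2" if "A \<in> sets borel" for r A
    using measurable_sets[OF borel_measurable_diff[OF Wm(2) Wm(2)] that] .
  show "sets (filt P (liftW W) (liftB B) T t) \<subseteq> sets (w.Gfwd t)"
  proof -
    have "sigma_sets (space (w.Gfwd t)) ({liftW W r -` A \<inter> space P | r A. 0 \<le> r \<and> r \<le> t \<and> A \<in> sets borel}
      \<union> {(\<lambda>\<omega>. liftB B r \<omega> - liftB B t \<omega>) -` A \<inter> space P | r A. t \<le> r \<and> r \<le> T \<and> A \<in> sets borel}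
      \<union> null_sets P) \<subseteq> sets (w.Gfwd t)"
    proof (rule sets.sigma_sets_subset, intro Un_least subsetI)
      fix X assume "X \<in> {liftW W r -` A \<inter> space P | r A. 0 \<le> r \<and> r \<le> t \<and> A \<in> sets borel}"
      then obtain r A where X: "X = liftW W r -` A \<inter> space P" "0 \<le> r" "r \<le> t" "A \<in> sets borel" by blast
      from measurable_sets[OF w.measurable_Gfwd[OF X(2,3)] X(4)] show "X \<in> sets (w.Gfwd t)"
        by (simp add: X(1) liftW_def[abs_def])
    next
      fix X assume "X \<in> {(\<lambda>\<omega>. liftB B r \<omega> - liftB B t \<omega>) -` A \<inter> space P | r A. t \<le> r \<and> r \<le> T \<and> A \<in> sets borel}"
      then obtain r A where X: "X = (\<lambda>\<omega>. liftB B r \<omega> - liftB B t \<omega>) -` A \<inter> space P" "A \<in> sets borel" by blast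
      show "X \<in> sets (w.Gfwd t)" unfolding X(1) B1 by (rule w.q_in_G(1)[OF Bd[OF X(2)]])
    qed (auto intro: w.null_in_G)
    then show ?thesis by (simp add: sets_filt)
  qed
  show "sets (filt P (liftW W) (liftB B) T t) \<subseteq> sets (b.Gbwd t)"
  proof -
    have "sigma_sets (space (b.Gbwd t)) ({liftW W r -` A \<inter> space P | r A. 0 \<le> r \<and> r \<le> t \<and> A \<in> sets borel}
      \<union> {(\<lambda>\<omega>. liftB B r \<omega> - liftB B t \<omega>) -` A \<inter> space P | r A. t \<le> r \<and> r \<le> T \<and> A \<in> sets borel}
      \<union> null_sets P) \<subseteq> sets (b.Gbwd t)"
    proof (rule sets.sigma_sets_subset, intro Un_least subsetI)
      fix X assume "X \<in> {(\<lambda>\<omega>. liftB B r \<omega> - liftB B t \<omega>) -` A \<inter> space P | r A. t \<le> r \<and> r \<le> T \<and> A \<in> sets borel}"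
      then obtain r A where X: "X = (\<lambda>\<omega>. liftB B r \<omega> - liftB B t \<omega>) -` A \<inter> space P" "t \<le> r" "A \<in> sets borel" by blast
      from measurable_sets[OF b.measurable_Gbwd[OF X(2)] X(3)] show "X \<in> sets (b.Gbwd t)"
        by (simp add: X(1) liftB_def[abs_def])
    next
      fix X assume "X \<in> {liftW W r -` A \<inter> space P | r A. 0 \<le> r \<and> r \<le> t \<and> A \<in> sets borel}"
      then obtain r A where X: "X = liftW W r -` A \<inter> space P" "A \<in> sets borel" by blast
      show "X \<in> sets (b.Gbwd t)" unfolding X(1) W1 by (rule b.q_in_G(2)[OF measurable_sets[OF Wm(1) X(2)]])
    qed (auto intro: b.null_in_G)
    then show ?thesis by (simp add: sets_filt)
  qed
qed

lemma measurable_Phi [measurable]: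
  "pp \<in> borel_measurable borel" "Phi d \<in> borel_measurable borel" "Phi1 d \<in> borel_measurable borel" "Phi2 d \<in> borel_measurable borel"
  unfolding Phi_def[abs_def] Phi1_def[abs_def] Phi2_def[abs_def] pp_def[abs_def] by measurable

lemma continuous_on_pp: "continuous_on S f \<Longrightarrow> continuous_on S (\<lambda>x. pp (f x))"
  unfolding pp_def by (intro continuous_intros)

section \<open>Pathwise limits of Riemann sums\<close>

text \<open>The null set may depend on the time. Good times have full measure in the interval and
  are therefore dense; along a countable dense set of them one null set suffices, and continuity of
  paths covers all other times.\<close>

lemma AE_all_times:
  fixes V :: "real \<Rightarrow> 'w \<Rightarrow> real"
  assumes T: "0 < T" and V: "AE t in lborel. t \<in> {0..T} \<longrightarrow> (AE \<omega> in P. 0 \<le> V t \<omega>)"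
    and c: "\<And>\<omega>. \<omega> \<in> space P \<Longrightarrow> continuous_on {0..T} (\<lambda>t. V t \<omega>)"
  shows "AE \<omega> in P. \<forall>t\<in>{0..T}. 0 \<le> V t \<omega>"
proof -
  define G where "G = {t\<in>{0..T}. AE \<omega> in P. 0 \<le> V t \<omega>}"
  have dense: "t \<in> closure G" if t: "t \<in> {0..T}" for t
    unfolding closure_approachable
  proof (intro allI impI)
    fix e :: real assume e: "0 < e"
    \<comment> \<open>A nondegenerate interval around \<open>t\<close> inside \<open>{0..T}\<close>;
      if it held no good time, a set of positive length would be null.\<close>
    define a where "a = max 0 (t - e/2)" define b where "b = min T (t + e/2)"
    have ab: "a < b" using t e T by (auto simp: a_def b_def)
    show "\<exists>y\<in>G. dist y t < e"
    proof (rule ccontr)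
      assume no: "\<not> (\<exists>y\<in>G. dist y t < e)"
      have "\<forall>s\<in>{a..b}. \<not> (s \<in> {0..T} \<longrightarrow> (AE \<omega> in P. 0 \<le> V s \<omega>))"
      proof
        fix s assume "s \<in> {a..b}"
        then have "s \<in> {0..T}" "dist s t < e" using e by (auto simp: a_def b_def dist_real_def)
        then show "\<not> (s \<in> {0..T} \<longrightarrow> (AE \<omega> in P. 0 \<le> V s \<omega>))" using no unfolding G_def by blast
      qed
      then have "AE s in lborel. s \<notin> {a..b}" using V by (auto elim!: eventually_mono)
      then have "emeasure lborel {a..b} = 0" by (subst (asm) AE_iff_measurable[of "{a..b}"]) auto
      then show False using ab by simp
    qed
  qed
  \<comment> \<open>The countable set is chosen inside \<open>G\<close> itself, so that the
    inequality holds almost surely at each of its points.\<close>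
  obtain E where E: "countable E" "E \<subseteq> G" "G \<subseteq> closure E" using separable by blast
  have "closure G \<subseteq> closure E" using closure_mono[OF E(3)] by simp
  then have dE: "t \<in> closure E" if "t \<in> {0..T}" for t using dense[OF that] by blast
  have "AE \<omega> in P. \<forall>t\<in>E. 0 \<le> V t \<omega>"
    using E by (subst AE_ball_countable) (auto simp: G_def)
  then show ?thesis using AE_space
  proof eventually_elim
    case (elim \<omega>)
    show ?case
    proof
      fix t assume t: "t \<in> {0..T}"
      obtain x where x: "\<And>n. x n \<in> E" "x \<longlonglongrightarrow> t" using dE[OF t] unfolding closure_sequential by blast
      have xT: "x n \<in> {0..T}" for n using x(1)[of n] E(2) by (auto simp: G_def)
      have "(\<lambda>n. V (x n) \<omega>) \<longlonglongrightarrow> V t \<omega>"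
        by (rule continuous_on_tendsto_compose[OF c[OF elim(2)] x(2) t]) (use xT in auto)
      then show "0 \<le> V t \<omega>" by (rule LIMSEQ_le_const) (use elim x in auto)
    qed
  qed
qed

text \<open>A continuous monotone path has zero quadratic variation: the largest increment tends to
  \<open>0\<close> by uniform continuity while the increments add up to the total one. The second
  bound is the majorant for taking expectations.\<close>

lemma sum_square_increments_tendsto:
  fixes K :: "real \<Rightarrow> real"
  assumes ab: "a \<le> b" and c: "continuous_on {a..b} K" and m: "mono_on {a..b} K"
  shows "(\<lambda>n. \<Sum>k<n. (K (grid a b n (Suc k)) - K (grid a b n k))\<^sup>2) \<longlonglongrightarrow> 0"
    and "(\<Sum>k<n. (K (grid a b n (Suc k)) - K (grid a b n k))\<^sup>2) \<le> (K b - K a)\<^sup>2"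
proof -
  have inc: "0 \<le> K (grid a b n (Suc k)) - K (grid a b n k)" if "k < n" for n k
    using mono_onD[OF m grid_bounds[OF ab, of k n] grid_bounds[OF ab, of "Suc k" n] grid_mono[OF ab]] that by simp
  have tel: "(\<Sum>k<n. K (grid a b n (Suc k)) - K (grid a b n k)) = K b - K a" if "n > 0" for n
    using sum_lessThan_telescope[of "\<lambda>k. K (grid a b n k)" n] that by simp
  have Kab: "0 \<le> K b - K a" using mono_onD[OF m, of a b] ab by simp
  have bound: "(\<Sum>k<n. (K (grid a b n (Suc k)) - K (grid a b n k))\<^sup>2) \<le> e * (K b - K a)"
    if n: "n > 0" and e: "\<And>k. k < n \<Longrightarrow> K (grid a b n (Suc k)) - K (grid a b n k) \<le> e" for n e
  proof -
    have "(\<Sum>k<n. (K (grid a b n (Suc k)) - K (grid a b n k))\<^sup>2) \<le> (\<Sum>k<n. e * (K (grid a b n (Suc k)) - K (grid a b n k)))"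
      unfolding power2_eq_square by (rule sum_mono) (use e inc in \<open>auto intro!: mult_right_mono\<close>)
    also have "\<dots> = e * (K b - K a)" using tel[OF n] by (simp add: sum_distrib_left[symmetric])
    finally show ?thesis .
  qed
  show "(\<Sum>k<n. (K (grid a b n (Suc k)) - K (grid a b n k))\<^sup>2) \<le> (K b - K a)\<^sup>2"
  proof (cases "n = 0")
    case False
    have "K (grid a b n (Suc k)) - K (grid a b n k) \<le> K b - K a" if "k < n" for k
    proof -
      have "K (grid a b n (Suc k)) \<le> K b" "K a \<le> K (grid a b n k)"
        using mono_onD[OF m, of "grid a b n (Suc k)" b] mono_onD[OF m, of a "grid a b n k"]
          grid_bounds[OF ab, of k n] grid_bounds[OF ab, of "Suc k" n] that ab by auto
      then show ?thesis by simp
    qed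
    then show ?thesis using bound[of n "K b - K a"] False by (simp add: power2_eq_square)
  qed simp
  show "(\<lambda>n. \<Sum>k<n. (K (grid a b n (Suc k)) - K (grid a b n k))\<^sup>2) \<longlonglongrightarrow> 0"
  proof (rule LIMSEQ_I)
    fix e :: real assume e: "e > 0"
    define e' where "e' = e / (2 * (K b - K a + 1))"
    have e': "e' > 0" using e Kab by (simp add: e'_def)
    have "uniformly_continuous_on {a..b} K" by (rule compact_uniformly_continuous[OF c]) simp
    then obtain d where d: "d > 0" "\<And>x y. x \<in> {a..b} \<Longrightarrow> y \<in> {a..b} \<Longrightarrow> dist y x < d \<Longrightarrow> dist (K y) (K x) < e'"
      using e' unfolding uniformly_continuous_on_def by metis
    obtain n0 where n0: "(b - a) / d < real n0" using reals_Archimedean2 by blast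
    show "\<exists>no. \<forall>n\<ge>no. norm ((\<Sum>k<n. (K (grid a b n (Suc k)) - K (grid a b n k))\<^sup>2) - 0) < e"
    proof (intro exI[of _ "Suc n0"] allI impI)
      fix n assume n: "Suc n0 \<le> n"
      then have np: "n > 0" by simp
      have "(b - a) / d < real n" using n0 n by linarith
      then have mesh: "(b - a) / real n < d" using d np by (simp add: field_simps)
      have "K (grid a b n (Suc k)) - K (grid a b n k) \<le> e'" if "k < n" for k
      proof -
        have "dist (K (grid a b n (Suc k))) (K (grid a b n k)) < e'"
          by (rule d(2)) (use grid_bounds[OF ab, of k n] grid_bounds[OF ab, of "Suc k" n] that mesh ab np in \<open>auto simp: dist_real_def grid_Suc\<close>)
        then show ?thesis by (simp add: dist_real_def)
      qed
      then have "(\<Sum>k<n. (K (grid a b n (Suc k)) - K (grid a b n k))\<^sup>2) \<le> e' * (K b - K a)" by (rule bound[OF np])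
      also have "\<dots> \<le> e' * (K b - K a + 1)" using e' by (intro mult_left_mono) auto
      also have "\<dots> = e / 2" using Kab by (simp add: e'_def field_simps)
      finally show "norm ((\<Sum>k<n. (K (grid a b n (Suc k)) - K (grid a b n k))\<^sup>2) - 0) < e"
        using e by (simp add: sum_nonneg)
    qed
  qed
qed

text \<open>The left end point sums converge to the integral of \<open>U\<close> over the interval
  from \<open>t\<close> to \<open>T\<close>, by \<open>step_integral_tendsto\<close> for the
  Stieltjes measure. Nonnegativity of \<open>U\<close> squeezes that integral between
  \<open>0\<close> and the vanishing integral over \<open>{0..T}\<close>.\<close>

lemma riemann_stieltjes_tendsto_zero:
  fixes K U :: "real \<Rightarrow> real"
  assumes t: "0 \<le> t" "t \<le> T" and K: "continuous_on {0..T} K" "mono_on {0..T} K"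
    and U: "continuous_on {0..T} U" "\<And>s. s \<in> {0..T} \<Longrightarrow> 0 \<le> U s"
    and z: "(LINT s:{0..T}|interval_measure (\<lambda>s. K (max 0 (min T s))). U s) = 0"
  shows "(\<lambda>n. \<Sum>k<n. U (grid t T n k) * (K (grid t T n (Suc k)) - K (grid t T n k))) \<longlonglongrightarrow> 0"
proof -
  \<comment> \<open>\<open>K\<close> continued as a constant on both sides, so that it is monotone
    and continuous on the whole line and defines an interval measure.\<close>
  define F where "F = (\<lambda>s. K (max 0 (min T s)))"
  define \<mu> where "\<mu> = interval_measure F"
  have T: "0 \<le> T" using t by simp
  have Fm: "F x \<le> F y" if "x \<le> y" for x y
    unfolding F_def by (rule mono_onD[OF K(2)]) (use that T in auto)
  have Fc: "continuous (at x) F" for x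
  proof -
    have "continuous_on UNIV F" unfolding F_def
      by (rule continuous_on_compose2[OF K(1)]) (use T in \<open>auto intro!: continuous_intros\<close>)
    then show ?thesis by (simp add: continuous_on_eq_continuous_at)
  qed
  have em: "emeasure \<mu> {a<..b} = ennreal (F b - F a)" if "a \<le> b" for a b
    unfolding \<mu>_def by (rule emeasure_interval_measure_Ioc[OF that]) (use Fm Fc in \<open>auto intro: continuous_at_imp_continuous_within\<close>)
  have FK: "F s = K s" if "s \<in> {0..T}" for s using that by (simp add: F_def)
  have me: "measure \<mu> {a<..b} = K b - K a" if "a \<in> {0..T}" "b \<in> {0..T}" "a \<le> b" for a b
    using em[OF that(3)] Fm[OF that(3)] FK[OF that(1)] FK[OF that(2)] by (simp add: measure_def)
  have setsmu [simp]: "sets \<mu> = sets borel" "space \<mu> = UNIV" by (simp_all add: \<mu>_def)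
  have tb: "t \<le> T" by (rule t)
  have "bounded (U ` {0..T})" by (intro compact_imp_bounded compact_continuous_image U(1)) simp
  then obtain C where C: "\<And>s. s \<in> {0..T} \<Longrightarrow> \<bar>U s\<bar> \<le> C"
    unfolding bounded_iff by (auto simp del: atLeastAtMost_iff)
  have C0: "0 \<le> C" using C[of 0] T by (smt (verit) atLeastAtMost_iff)
  have fin0: "emeasure \<mu> {0..T} < \<infinity>"
  proof -
    \<comment> \<open>The measure is known on half-open intervals; one that starts at
      \<open>-1\<close> contains the closed one, and \<open>F\<close> is constant on the added
      stretch.\<close>
    have "emeasure \<mu> {0..T} \<le> emeasure \<mu> {-1<..T}" by (rule emeasure_mono) auto
    also have "\<dots> < \<infinity>" using em[of "-1" T] T by simp
    finally show ?thesis .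
  qed
  have fin: "emeasure \<mu> {t<..T} < \<infinity>" using em[OF tb] by simp
  have Ub: "(\<lambda>s. indicator {0..T} s *\<^sub>R U s) \<in> borel_measurable \<mu>"
    using borel_measurable_continuous_on_indicator[OF _ U(1)] by (simp cong: measurable_cong_sets)
  have i0: "integrable \<mu> (\<lambda>s. indicator {0..T} s *\<^sub>R U s)"
  proof (rule Bochner_Integration.integrable_bound[OF _ Ub])
    show "integrable \<mu> (\<lambda>s. C * indicator {0..T} s)" using fin0 by (intro integrable_mult_right integrable_real_indicator) auto
  qed (use C C0 in \<open>auto simp: indicator_def\<close>)
  define H where "H = (\<lambda>x::real. indicator {t<..T} x :: real)"
  have H: "(\<lambda>x. x) \<in> borel_measurable \<mu>" "H \<in> borel_measurable \<mu>" unfolding H_def by (simp_all cong: measurable_cong_sets)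
  have iC: "integrable \<mu> (\<lambda>x. C * H x)" unfolding H_def using fin by (intro integrable_mult_right integrable_real_indicator) auto
  have bd: "\<bar>U r * H x\<bar> \<le> C * H x" if "r \<in> {t..T}" for r x
    using C[of r] that t by (auto simp: H_def indicator_def)
  note st = step_integral_tendsto[where N=\<mu> and \<sigma>="\<lambda>x. x" and c="\<lambda>r x. U r" and H=H and D="\<lambda>x. C * H x" and tau="\<lambda>n k. grid t T n k", OF tb H]
  have Uc: "continuous_on {t..T} U" by (rule continuous_on_subset[OF U(1)]) (use t in auto)
  have lim: "(\<lambda>n. \<Sum>k<n. \<integral>x. indicator {grid t T n k<..grid t T n (Suc k)} x * (U (grid t T n k) * H x) \<partial>\<mu>)
     \<longlonglongrightarrow> (\<integral>x. indicator {t<..T} x * (U x * H x) \<partial>\<mu>)"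
    by (rule st(1)) (use Uc bd iC grid_mono[OF tb] in auto)
  have i1: "integrable \<mu> (\<lambda>x. indicator {t<..T} x * (U x * H x))"
    by (rule st(2)) (use Uc bd iC grid_mono[OF tb] in auto)
  have "(\<integral>x. indicator {t<..T} x * (U x * H x) \<partial>\<mu>) \<le> (\<integral>x. indicator {0..T} x *\<^sub>R U x \<partial>\<mu>)"
    by (rule integral_mono[OF i1 i0]) (use U(2) t in \<open>auto simp: H_def indicator_def\<close>)
  also have "\<dots> = 0" using z by (simp add: set_lebesgue_integral_def \<mu>_def F_def)
  finally have "(\<integral>x. indicator {t<..T} x * (U x * H x) \<partial>\<mu>) = 0"
    using U(2) t by (intro antisym Bochner_Integration.integral_nonneg) (auto simp: H_def indicator_def)
  moreover have "(\<integral>x. indicator {grid t T n k<..grid t T n (Suc k)} x * (U (grid t T n k) * H x) \<partial>\<mu>)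
     = U (grid t T n k) * (K (grid t T n (Suc k)) - K (grid t T n k))" if "k < n" for n k
  proof -
    have g: "grid t T n k \<in> {t..T}" "grid t T n (Suc k) \<in> {t..T}" "grid t T n k \<le> grid t T n (Suc k)"
      using grid_bounds[OF tb, of k n] grid_bounds[OF tb, of "Suc k" n] grid_mono[OF tb, of k "Suc k" n] that by auto
    have "(\<integral>x. indicator {grid t T n k<..grid t T n (Suc k)} x * (U (grid t T n k) * H x) \<partial>\<mu>)
      = (\<integral>x. U (grid t T n k) * indicator {grid t T n k<..grid t T n (Suc k)} x \<partial>\<mu>)"
      by (rule Bochner_Integration.integral_cong) (use g in \<open>auto simp: H_def indicator_def\<close>)
    also have "\<dots> = U (grid t T n k) * measure \<mu> {grid t T n k<..grid t T n (Suc k)}" by simp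
    finally show ?thesis using me[of "grid t T n k" "grid t T n (Suc k)"] g t by simp
  qed
  ultimately show ?thesis using lim by simp
qed

section \<open>Time integrals of square integrable processes\<close>

context prob_space
begin

lemma integrable_timeprod_snd:
  fixes k :: "'a \<Rightarrow> real"
  assumes k: "integrable M k"
  shows "integrable (timeprod T M) (\<lambda>x. k (snd x))"
proof -
  interpret pair_sigma_finite "restrict_space lborel {0..T}" M by (rule pair_sigma_finite_time)
  interpret t: finite_measure "restrict_space lborel {0..T}" by (rule finite_measure_time)
  have km [measurable]: "k \<in> borel_measurable M" using k by auto
  show ?thesis
    unfolding timeprod_def
  proof (rule Fubini_integrable)
    show "(\<lambda>x. k (snd x)) \<in> borel_measurable (restrict_space lborel {0..T} \<Otimes>\<^sub>M M)" by measurable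
    show "integrable (restrict_space lborel {0..T}) (\<lambda>x. \<integral>y. norm (k (snd (x, y))) \<partial>M)" by simp
    show "AE x in restrict_space lborel {0..T}. integrable M (\<lambda>y. k (snd (x, y)))" using k by simp
  qed
qed

lemma sqint_timeprod_snd: "sqint M k \<Longrightarrow> sqint (timeprod T M) (\<lambda>x. k (snd x) :: real)"
  using integrable_timeprod_snd[of "\<lambda>\<omega>. (norm (k \<omega>))\<^sup>2" T] by (auto simp: sqint_def intro: measurable_compose[OF snd_timeprod])

text \<open>The pathwise integral over a half-open block, written with the restricted measure so
  that Fubini's theorem on \<open>timeprod\<close> applies directly. On paths where it does not
  exist it has the default value \<open>0\<close>.\<close>

definition time_int :: "real \<Rightarrow> (real \<times> 'a \<Rightarrow> real) \<Rightarrow> real \<Rightarrow> real \<Rightarrow> 'a \<Rightarrow> real" where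
  "time_int T f u v \<omega> = (\<integral>s. indicator {u<..v} s * f (s, \<omega>) \<partial>restrict_space lborel {0..T})"

lemma time_int_meas:
  assumes "f \<in> borel_measurable (timeprod T M)"
  shows "time_int T f u v \<in> borel_measurable M"
proof -
  interpret pair_sigma_finite "restrict_space lborel {0..T}" M by (rule pair_sigma_finite_time)
  have "(\<lambda>x. indicator {u<..v} (fst x) * f x) \<in> borel_measurable (timeprod T M)"
    using assms by measurable
  then have "(\<lambda>(\<omega>, s). indicator {u<..v} s * f (s, \<omega>)) \<in> borel_measurable (M \<Otimes>\<^sub>M restrict_space lborel {0..T})"
    unfolding timeprod_def by (subst measurable_pair_swap_iff) (simp add: split_def)
  then show ?thesis unfolding time_int_def[abs_def]
    by (rule M1.borel_measurable_lebesgue_integral)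
qed

lemma AE_set_integrable_timeprod:
  assumes f: "integrable (timeprod T M) f"
  shows "AE \<omega> in M. set_integrable lborel {0..T} (\<lambda>s. f (s, \<omega>) :: real)"
proof -
  interpret pair_sigma_finite "restrict_space lborel {0..T}" M by (rule pair_sigma_finite_time)
  have "AE \<omega> in M. integrable (restrict_space lborel {0..T}) (\<lambda>s. f (s, \<omega>))"
    by (rule AE_integrable_snd) (use f in \<open>simp add: timeprod_def\<close>)
  then show ?thesis by eventually_elim (simp add: integrable_restrict_space set_integrable_def)
qed

lemma time_int_diff:
  assumes f: "integrable (timeprod T M) f" and uv: "0 \<le> u" "u \<le> v" "v \<le> T"
  shows "AE \<omega> in M. (LINT s:{u..T}|lborel. f (s, \<omega>)) - (LINT s:{v..T}|lborel. f (s, \<omega>)) = time_int T f u v \<omega>"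
  using AE_set_integrable_timeprod[OF f]
proof eventually_elim
  case (elim \<omega>)
  have "set_integrable lborel {u..T} (\<lambda>s. f (s, \<omega>))" by (rule set_integrable_subset[OF elim]) (use uv in auto)
  from tail_integral_split[OF this uv(2,3)]
  have "(LINT s:{u..T}|lborel. f (s, \<omega>)) - (LINT s:{v..T}|lborel. f (s, \<omega>)) = (LINT s:{u<..v}|lborel. f (s, \<omega>))" .
  also have "\<dots> = time_int T f u v \<omega>"
    unfolding time_int_def set_lebesgue_integral_def
    by (subst integral_restrict_space) (use uv in \<open>auto intro!: Bochner_Integration.integral_cong simp: indicator_def\<close>)
  finally show ?case .
qed

lemma time_int_mult:
  assumes f: "sqint (timeprod T M) f" and k: "sqint M k"
  shows "(\<integral>\<omega>. k \<omega> * time_int T f u v \<omega> \<partial>M) = (\<integral>x. indicator {u<..v} (fst x) * (k (snd x) * f x) \<partial>timeprod T M)"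
proof -
  interpret pair_sigma_finite "restrict_space lborel {0..T}" M by (rule pair_sigma_finite_time)
  have "integrable (timeprod T M) (\<lambda>x. indicator {u<..v} (fst x) *\<^sub>R (k (snd x) * f x))"
    by (rule Bochner_Integration.integrable_bound[OF sqint_mult(1)[OF sqint_timeprod_snd[OF k] f]])
       (use sqint_meas[OF f] sqint_meas[OF k] in \<open>auto simp: indicator_def\<close>)
  then have i: "integrable (restrict_space lborel {0..T} \<Otimes>\<^sub>M M) (\<lambda>(s, \<omega>). indicator {u<..v} s * (k \<omega> * f (s, \<omega>)))"
    by (simp add: timeprod_def split_def)
  have "(\<integral>\<omega>. (\<integral>s. indicator {u<..v} s * (k \<omega> * f (s, \<omega>)) \<partial>restrict_space lborel {0..T}) \<partial>M)
     = (\<integral>x. indicator {u<..v} (fst x) * (k (snd x) * f x) \<partial>timeprod T M)"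
    using integral_snd[OF i] by (simp add: timeprod_def split_def)
  moreover have "(\<integral>s. indicator {u<..v} s * (k \<omega> * f (s, \<omega>)) \<partial>restrict_space lborel {0..T}) = k \<omega> * time_int T f u v \<omega>" for \<omega>
    unfolding time_int_def by (subst integral_mult_right_zero[symmetric]) (simp add: mult_ac)
  ultimately show ?thesis by simp
qed

text \<open>The Cauchy-Schwarz inequality in time along almost every path, then Fubini's theorem.
  The factor \<open>v - u\<close> makes the squared drift negligible when summed over a
  grid.\<close>

lemma time_int_sq:
  assumes f: "sqint (timeprod T M) f" and uv: "0 \<le> u" "u \<le> v" "v \<le> T"
  shows "sqint M (time_int T f u v)"
    and "nsq M (time_int T f u v) \<le> (v - u) * nsq (timeprod T M) (\<lambda>x. indicator {u<..v} (fst x) *\<^sub>R f x)"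
proof -
  let ?\<tau> = "restrict_space lborel {0..T}"
  interpret pair_sigma_finite ?\<tau> M by (rule pair_sigma_finite_time)
  interpret Q: finite_measure "timeprod T M" by (rule finite_measure_timeprod)
  have fm: "f \<in> borel_measurable (timeprod T M)" by (rule sqint_meas[OF f])
  define g where "g = (\<lambda>x. indicator {u<..v} (fst x) * (f x)\<^sup>2)"
  have e: "(norm (indicator {u<..v} (fst x) *\<^sub>R f x))\<^sup>2 = g x" for x by (auto simp: g_def indicator_def)
  have gi: "integrable (timeprod T M) g"
    unfolding g_def
    by (rule Bochner_Integration.integrable_bound[OF sqint_int[OF f]]) (use fm in \<open>auto simp: indicator_def\<close>)
  have fi: "integrable (timeprod T M) (\<lambda>x. indicator {u<..v} (fst x) * f x)"
  proof -
    have "sqint (timeprod T M) (\<lambda>_. 1::real)" by (rule Q.sqint_bounded[where C=1]) auto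
    from sqint_mult(1)[OF f this] have "integrable (timeprod T M) f" by simp
    then show ?thesis by (rule Bochner_Integration.integrable_bound) (use fm in \<open>auto simp: indicator_def\<close>)
  qed
  have gi': "integrable (?\<tau> \<Otimes>\<^sub>M M) (\<lambda>(s, \<omega>). g (s, \<omega>))" and fi': "integrable (?\<tau> \<Otimes>\<^sub>M M) (\<lambda>(s, \<omega>). indicator {u<..v} s * f (s, \<omega>))"
    using gi fi by (simp_all add: timeprod_def split_def)
  define Gi where "Gi = (\<lambda>\<omega>. \<integral>s. g (s, \<omega>) \<partial>?\<tau>)"
  have Gii: "integrable M Gi" unfolding Gi_def by (rule integrable_snd[OF gi'])
  have GiE: "(\<integral>\<omega>. Gi \<omega> \<partial>M) = (\<integral>x. g x \<partial>timeprod T M)"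
    unfolding Gi_def using integral_snd[OF gi'] by (simp add: timeprod_def)
  have I1: "(\<integral>s. indicator {u<..v} s \<partial>?\<tau>) = v - u" "integrable ?\<tau> (\<lambda>s. indicator {u<..v} s :: real)"
  proof -
    have e: "indicator {0..T} s *\<^sub>R indicator {u<..v} s = (indicator {u<..v} s :: real)" for s
      using uv by (auto simp: indicator_def)
    show "(\<integral>s. indicator {u<..v} s \<partial>?\<tau>) = v - u"
      using uv by (subst integral_restrict_space, simp, unfold e) simp
    show "integrable ?\<tau> (\<lambda>s. indicator {u<..v} s :: real)"
      using uv by (subst integrable_restrict_space, simp, unfold e) simp
  qed
  have "AE \<omega> in M. integrable ?\<tau> (\<lambda>s. g (s, \<omega>))" "AE \<omega> in M. integrable ?\<tau> (\<lambda>s. indicator {u<..v} s * f (s, \<omega>))"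
    by (rule AE_integrable_snd[OF gi'], rule AE_integrable_snd[OF fi'])
  then have le: "AE \<omega> in M. (time_int T f u v \<omega>)\<^sup>2 \<le> (v - u) * Gi \<omega>"
  proof eventually_elim
    case (elim \<omega>)
    let ?m = "time_int T f u v \<omega>"
    show ?case
    proof (cases "u = v")
      case True then show ?thesis by (simp add: time_int_def)
    next
      case False
      then have vu: "v - u > 0" using uv by simp
      \<comment> \<open>The mean of the path over the block; the integral of the squared deviation
        from it is nonnegative, which is the Cauchy-Schwarz inequality.\<close>
      define c where "c = ?m / (v - u)"
      have "0 \<le> (\<integral>s. indicator {u<..v} s * (f (s, \<omega>) - c)\<^sup>2 \<partial>?\<tau>)" by simp
      also have "(\<lambda>s. indicator {u<..v} s * (f (s, \<omega>) - c)\<^sup>2)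
        = (\<lambda>s. g (s, \<omega>) - 2 * c * (indicator {u<..v} s * f (s, \<omega>)) + c\<^sup>2 * indicator {u<..v} s)"
        by (auto simp: g_def power2_diff algebra_simps)
      also have "(\<integral>s. g (s, \<omega>) - 2 * c * (indicator {u<..v} s * f (s, \<omega>)) + c\<^sup>2 * indicator {u<..v} s \<partial>?\<tau>)
        = Gi \<omega> - 2 * c * ?m + c\<^sup>2 * (v - u)"
        using elim I1 by (simp add: Gi_def time_int_def)
      finally have "0 \<le> Gi \<omega> - 2 * c * ?m + c\<^sup>2 * (v - u)" .
      moreover have cm: "c * (v - u) = ?m" using vu by (simp add: c_def)
      then have "c\<^sup>2 * (v - u) = c * ?m" by (simp add: power2_eq_square mult.assoc)
      ultimately have "0 \<le> (Gi \<omega> - c * ?m) * (v - u)" using vu by simp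
      also have "\<dots> = (v - u) * Gi \<omega> - (c * (v - u)) * ?m" by (simp add: algebra_simps)
      finally show ?thesis unfolding cm by (simp add: power2_eq_square)
    qed
  qed
  have i: "integrable M (\<lambda>\<omega>. (time_int T f u v \<omega>)\<^sup>2)"
    by (rule Bochner_Integration.integrable_bound[OF Bochner_Integration.integrable_mult_right[OF Gii, of "v - u"]])
       (use le time_int_meas[OF fm, of u v] in \<open>auto elim!: eventually_mono intro: order_trans[OF _ abs_ge_self]\<close>)
  then show "sqint M (time_int T f u v)" using time_int_meas[OF fm, of u v] by (simp add: sqint_def)
  have "nsq M (time_int T f u v) \<le> (\<integral>\<omega>. (v - u) * Gi \<omega> \<partial>M)"
    unfolding nsq_def real_norm_def power2_abs
    by (rule integral_mono_AE[OF i _ le]) (use Gii in auto)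
  also have "\<dots> = (v - u) * nsq (timeprod T M) (\<lambda>x. indicator {u<..v} (fst x) *\<^sub>R f x)"
    unfolding nsq_def e using GiE by simp
  finally show "nsq M (time_int T f u v) \<le> (v - u) * nsq (timeprod T M) (\<lambda>x. indicator {u<..v} (fst x) *\<^sub>R f x)" .
qed

end

section \<open>The one-sided Ito inequality\<close>

text \<open>Here \<open>Y\<close> is the difference of the two solutions and \<open>U\<close> the gap between the first solution and its
  obstacle, so that \<open>K1\<close> grows only where \<open>U\<close> vanishes. Where \<open>Y\<close> is positive, \<open>U\<close> dominates it.\<close>

locale ito_eq = wn: noise P T AW XW + bn: noise P T AB XB
  for P :: "'w measure" and T :: real and AW :: "real \<Rightarrow> real \<Rightarrow> 'w measure" and XW :: "real \<Rightarrow> real \<Rightarrow> 'w \<Rightarrow> real^'d"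
    and AB :: "real \<Rightarrow> real \<Rightarrow> 'w measure" and XB :: "real \<Rightarrow> real \<Rightarrow> 'w \<Rightarrow> real^'l" +
  fixes Y U K1 K2 :: "real \<Rightarrow> 'w \<Rightarrow> real" and D DU \<xi> :: "'w \<Rightarrow> real"
    and Z :: "real \<times> 'w \<Rightarrow> real^'d" and G :: "real \<times> 'w \<Rightarrow> real^'l" and f :: "real \<times> 'w \<Rightarrow> real"
    and IW IB :: "real \<Rightarrow> 'w \<Rightarrow> real"
  assumes T0: "0 < T"
    and Yc: "\<And>\<omega>. \<omega> \<in> space P \<Longrightarrow> continuous_on {0..T} (\<lambda>t. Y t \<omega>)"
    and YW: "\<And>t v. 0 \<le> t \<Longrightarrow> t \<le> v \<Longrightarrow> v \<le> T \<Longrightarrow> Y t \<in> borel_measurable (AW t v)"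
    and YB: "\<And>u t. 0 \<le> u \<Longrightarrow> u \<le> t \<Longrightarrow> t \<le> T \<Longrightarrow> Y t \<in> borel_measurable (AB u t)"
    and YD: "\<And>t \<omega>. t \<in> {0..T} \<Longrightarrow> \<omega> \<in> space P \<Longrightarrow> \<bar>Y t \<omega>\<bar> \<le> D \<omega>" and D: "sqint P D"
    and IW: "\<And>r. r \<in> {0..T} \<Longrightarrow> wn.ITO r T Z (IW r)" and IB: "\<And>r. r \<in> {0..T} \<Longrightarrow> bn.ITO r T G (IB r)"
    and f: "sqint (timeprod T P) f"
    and K1: "\<And>\<omega>. \<omega> \<in> space P \<Longrightarrow> continuous_on {0..T} (\<lambda>t. K1 t \<omega>) \<and> mono_on {0..T} (\<lambda>t. K1 t \<omega>)"
    and K2: "\<And>\<omega>. \<omega> \<in> space P \<Longrightarrow> continuous_on {0..T} (\<lambda>t. K2 t \<omega>) \<and> mono_on {0..T} (\<lambda>t. K2 t \<omega>)"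
    and Km: "\<And>t. t \<in> {0..T} \<Longrightarrow> K1 t \<in> borel_measurable P" "\<And>t. t \<in> {0..T} \<Longrightarrow> K2 t \<in> borel_measurable P"
    and KT: "sqint P (\<lambda>\<omega>. K1 T \<omega> - K1 0 \<omega>)" "sqint P (\<lambda>\<omega>. K2 T \<omega> - K2 0 \<omega>)"
    and eq: "\<And>r. r \<in> {0..T} \<Longrightarrow> AE \<omega> in P. Y r \<omega> = \<xi> \<omega> + (LINT s:{r..T}|lborel. f (s, \<omega>)) + IB r \<omega>
       + (K1 T \<omega> - K1 r \<omega>) - (K2 T \<omega> - K2 r \<omega>) - IW r \<omega>"
    and xi: "AE \<omega> in P. \<xi> \<omega> \<le> 0"
    and Uc: "\<And>\<omega>. \<omega> \<in> space P \<Longrightarrow> continuous_on {0..T} (\<lambda>t. U t \<omega>)"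
    and Um: "\<And>t. t \<in> {0..T} \<Longrightarrow> U t \<in> borel_measurable P"
    and UD: "\<And>t \<omega>. t \<in> {0..T} \<Longrightarrow> \<omega> \<in> space P \<Longrightarrow> \<bar>U t \<omega>\<bar> \<le> DU \<omega>" and DU: "sqint P DU"
    and UY: "\<And>t. t \<in> {0..T} \<Longrightarrow> AE \<omega> in P. pp (Y t \<omega>) \<le> U t \<omega>"
    and Usk: "AE \<omega> in P. (LINT s:{0..T}|interval_measure (\<lambda>s. K1 (max 0 (min T s)) \<omega>). U s \<omega>) = 0"
begin

abbreviation Q :: "(real \<times> 'w) measure" where "Q \<equiv> timeprod T P"

lemma YP: "t \<in> {0..T} \<Longrightarrow> Y t \<in> borel_measurable P"
  using wn.A_meas[OF _ _ _ YW, of t t] by auto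

lemma fint: "integrable Q f"
  by (rule finite_measure.sqint_integrable[OF wn.finite_measure_Q f])

lemma dK_bounds:
  assumes "0 \<le> u" "u \<le> v" "v \<le> T" "\<omega> \<in> space P"
  shows "0 \<le> K1 v \<omega> - K1 u \<omega>" "K1 v \<omega> - K1 u \<omega> \<le> K1 T \<omega> - K1 0 \<omega>"
    "0 \<le> K2 v \<omega> - K2 u \<omega>" "K2 v \<omega> - K2 u \<omega> \<le> K2 T \<omega> - K2 0 \<omega>"
  using mono_onD[OF conjunct2[OF K1[OF assms(4)]], of u v] mono_onD[OF conjunct2[OF K1[OF assms(4)]], of v T]
    mono_onD[OF conjunct2[OF K1[OF assms(4)]], of 0 u] mono_onD[OF conjunct2[OF K2[OF assms(4)]], of u v]
    mono_onD[OF conjunct2[OF K2[OF assms(4)]], of v T] mono_onD[OF conjunct2[OF K2[OF assms(4)]], of 0 u] assms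
  by auto

lemma sqint_dK:
  assumes "0 \<le> u" "u \<le> v" "v \<le> T"
  shows "sqint P (\<lambda>\<omega>. K1 v \<omega> - K1 u \<omega>)" "sqint P (\<lambda>\<omega>. K2 v \<omega> - K2 u \<omega>)"
proof -
  have m: "(\<lambda>\<omega>. K1 v \<omega> - K1 u \<omega>) \<in> borel_measurable P" "(\<lambda>\<omega>. K2 v \<omega> - K2 u \<omega>) \<in> borel_measurable P"
    using assms by (auto intro!: borel_measurable_diff Km)
  show "sqint P (\<lambda>\<omega>. K1 v \<omega> - K1 u \<omega>)"
    by (rule sqint_le[OF KT(1) m(1)]) (use dK_bounds(1,2)[OF assms] in fastforce)
  show "sqint P (\<lambda>\<omega>. K2 v \<omega> - K2 u \<omega>)"
    by (rule sqint_le[OF KT(2) m(2)]) (use dK_bounds(3,4)[OF assms] in fastforce)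
qed

lemma dI:
  assumes "0 \<le> u" "u \<le> v" "v \<le> T"
  shows "wn.ITO u v Z (\<lambda>\<omega>. IW u \<omega> - IW v \<omega>)" "bn.ITO u v G (\<lambda>\<omega>. IB u \<omega> - IB v \<omega>)"
  using wn.ITO_increment[OF IW IW assms order_refl] bn.ITO_increment[OF IB IB assms order_refl] assms by auto

context
  fixes d :: real
  assumes d: "d > 0"
begin

text \<open>The remainder bound of \<open>Phi_Taylor\<close>, in the form summed by
  \<open>ITO_small_jumps\<close> with \<open>L = 2 / d\<close>.\<close>

definition gam :: "real \<Rightarrow> real" where "gam x = min 1 (2 / d * \<bar>x\<bar>) * x\<^sup>2"

lemma integrable_gam: "sqint P h \<Longrightarrow> integrable P (\<lambda>\<omega>. gam (h \<omega>))"
  using sqint_mult_bounded(2)[of P h "\<lambda>\<omega>. min 1 (2 / d * \<bar>h \<omega>\<bar>)" 1] d sqint_meas[of P h]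
  by (auto simp: gam_def abs_mult min_def)

lemma sqint_Phi1: "t \<in> {0..T} \<Longrightarrow> sqint P (\<lambda>\<omega>. Phi1 d (Y t \<omega>))"
proof (rule sqint_le[OF sqint_scale[OF D, of 2]])
  assume t: "t \<in> {0..T}"
  show "(\<lambda>\<omega>. Phi1 d (Y t \<omega>)) \<in> borel_measurable P" using YP[OF t] by measurable
  fix \<omega> assume "\<omega> \<in> space P"
  from YD[OF t this] have "pp (Y t \<omega>) \<le> D \<omega>" using pp_simps(3)[of "Y t \<omega>"] by linarith
  then show "\<bar>Phi1 d (Y t \<omega>)\<bar> \<le> \<bar>2 *\<^sub>R D \<omega>\<bar>"
    using Phi1_le[OF d, of "Y t \<omega>"] Phi1_nonneg[OF d, of "Y t \<omega>"] by simp
qed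

lemma integrable_Phi: "t \<in> {0..T} \<Longrightarrow> integrable P (\<lambda>\<omega>. Phi d (Y t \<omega>))"
proof (rule Bochner_Integration.integrable_bound[OF sqint_int[OF D]])
  assume t: "t \<in> {0..T}"
  show "(\<lambda>\<omega>. Phi d (Y t \<omega>)) \<in> borel_measurable P" using YP[OF t] by measurable
  show "AE \<omega> in P. norm (Phi d (Y t \<omega>)) \<le> norm ((norm (D \<omega>))\<^sup>2)"
  proof (rule AE_I2)
    fix \<omega> assume w: "\<omega> \<in> space P"
    have "pp (Y t \<omega>) ^ 2 \<le> (D \<omega>)\<^sup>2"
      by (rule power_mono) (rule order_trans[OF pp_simps(3) YD[OF t w]], simp)
    then show "norm (Phi d (Y t \<omega>)) \<le> norm ((norm (D \<omega>))\<^sup>2)"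
      using Phi_le[OF d, of "Y t \<omega>"] Phi_nonneg[OF d, of "Y t \<omega>"] by simp
  qed
qed

text \<open>Moving the forward increment to the left endpoint and the backward increment to the right one leaves
  \<open>dF + k1 - k2\<close>, which needs no second order expansion because \<open>Phi d\<close> is convex.\<close>

lemma block_pointwise:
  fixes a b dZ dG dF k1 k2 u :: real
  assumes e: "a + dZ = b + dG + dF + k1 - k2" and k: "0 \<le> k1" "0 \<le> k2" and u: "pp a \<le> u"
  shows "Phi d a + Phi1 d a * dZ + Phi2 d a / 2 * dZ\<^sup>2
    \<le> Phi d b + Phi1 d b * dG + Phi2 d b / 2 * dG\<^sup>2 + gam dZ + gam dG + Phi1 d a * dF + 2 * (u * k1)
      + 2 * (\<bar>dZ\<bar> * (\<bar>dF\<bar> + (k1 + k2)))"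
proof -
  have 1: "Phi d a + Phi1 d a * dZ + Phi2 d a / 2 * dZ\<^sup>2 \<le> Phi d (a + dZ) + gam dZ"
    using Phi_Taylor[OF d, of a dZ] unfolding gam_def by linarith
  have 2: "Phi d (b + dG) \<le> Phi d b + Phi1 d b * dG + Phi2 d b / 2 * dG\<^sup>2 + gam dG"
    using Phi_Taylor[OF d, of b dG] unfolding gam_def by linarith
  have "Phi d (a + dZ) - Phi d (b + dG) \<le> Phi1 d (a + dZ) * (dF + k1 - k2)"
  proof -
    have "a + dZ - (b + dG) = dF + k1 - k2" using e by simp
    then show ?thesis using Phi_convex[OF d, of "a + dZ" "b + dG"] by simp
  qed
  \<comment> \<open>Convexity yields the slope at \<open>a + dZ\<close>, which involves the forward
    increment. Moving it back to \<open>a\<close> costs a Lipschitz error, a product of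
    \<open>\<bar>dZ\<bar>\<close> with finite variation increments.\<close>
  also have "\<dots> = Phi1 d a * (dF + k1 - k2) + (Phi1 d (a + dZ) - Phi1 d a) * (dF + k1 - k2)" by (simp add: algebra_simps)
  also have "(Phi1 d (a + dZ) - Phi1 d a) * (dF + k1 - k2) \<le> (2 * \<bar>dZ\<bar>) * (\<bar>dF\<bar> + (k1 + k2))"
  proof -
    have "(Phi1 d (a + dZ) - Phi1 d a) * (dF + k1 - k2) \<le> \<bar>Phi1 d (a + dZ) - Phi1 d a\<bar> * \<bar>dF + k1 - k2\<bar>"
      by (metis abs_ge_self abs_mult)
    also have "\<dots> \<le> (2 * \<bar>dZ\<bar>) * (\<bar>dF\<bar> + (k1 + k2))"
      using Phi1_Lipschitz[OF d, of "a + dZ" a] k by (intro mult_mono) auto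
    finally show ?thesis .
  qed
  \<comment> \<open>The \<open>k2\<close> term has the favourable sign and is dropped. For
    \<open>k1\<close> the slope is at most \<open>2 * pp a\<close>, hence at most
    \<open>2 * u\<close>, which prepares the Skorokhod condition.\<close>
  also have "Phi1 d a * (dF + k1 - k2) \<le> Phi1 d a * dF + 2 * (u * k1)"
  proof -
    have "Phi1 d a * k1 \<le> (2 * u) * k1" by (rule mult_right_mono) (use Phi1_le[OF d, of a] u k in auto)
    moreover have "0 \<le> Phi1 d a * k2" using Phi1_nonneg[OF d, of a] k by simp
    ultimately show ?thesis by (simp add: algebra_simps)
  qed
  finally show ?thesis using 1 2 by simp
qed

text \<open>In expectation the first order terms vanish and the second order ones become integrals
  by the conditional isometry, because \<open>Y u\<close> belongs to \<open>AW u v\<close> and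
  \<open>Y v\<close> to \<open>AB u v\<close>. The mixed error is split by Young's inequality: the
  energies of \<open>Z\<close> add up to a constant, multiplied by the small \<open>\<eta>\<close>,
  and the other squares add up to something vanishing with the mesh.\<close>

lemma block_ineq:
  assumes uv: "0 \<le> u" "u \<le> v" "v \<le> T" and eta: "\<eta> > 0"
  defines "dZ \<equiv> \<lambda>\<omega>. IW u \<omega> - IW v \<omega>" and "dG \<equiv> \<lambda>\<omega>. IB u \<omega> - IB v \<omega>"
  shows "(\<integral>\<omega>. Phi d (Y u \<omega>) \<partial>P) + (\<integral>x. indicator {u<..v} (fst x) * (Phi2 d (Y u (snd x)) * (norm (Z x))\<^sup>2) \<partial>Q) / 2
    \<le> (\<integral>\<omega>. Phi d (Y v \<omega>) \<partial>P) + (\<integral>x. indicator {u<..v} (fst x) * (Phi2 d (Y v (snd x)) * (norm (G x))\<^sup>2) \<partial>Q) / 2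
      + (\<integral>x. indicator {u<..v} (fst x) * (Phi1 d (Y u (snd x)) * f x) \<partial>Q)
      + 2 * (\<integral>\<omega>. U u \<omega> * (K1 v \<omega> - K1 u \<omega>) \<partial>P) + (\<integral>\<omega>. gam (dZ \<omega>) \<partial>P) + (\<integral>\<omega>. gam (dG \<omega>) \<partial>P)
      + 2 * (\<eta> * nsq Q (\<lambda>x. indicator {u<..v} (fst x) *\<^sub>R Z x)
        + (2 * ((v - u) * nsq Q (\<lambda>x. indicator {u<..v} (fst x) *\<^sub>R f x)) + 4 * nsq P (\<lambda>\<omega>. K1 v \<omega> - K1 u \<omega>) + 4 * nsq P (\<lambda>\<omega>. K2 v \<omega> - K2 u \<omega>)) / \<eta>)"
proof -
  note I = dI[OF uv, folded dZ_def dG_def]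
  have uT: "u \<in> {0..T}" "v \<in> {0..T}" using uv by auto
  note sZ = wn.ITO_sqint(1)[OF I(1)] and sG = bn.ITO_sqint(1)[OF I(2)]
  define dF where "dF = wn.time_int T f u v"
  have sF: "sqint P dF" and nF: "nsq P dF \<le> (v - u) * nsq Q (\<lambda>x. indicator {u<..v} (fst x) *\<^sub>R f x)"
    unfolding dF_def using wn.time_int_sq[OF f uv] by auto
  note sK = sqint_dK[OF uv]
  \<comment> \<open>All finite variation increments of the block together; the constants
    \<open>2\<close> and \<open>4\<close> in its norm come from two applications of
    \<open>sqint_add\<close>.\<close>
  define w where "w = (\<lambda>\<omega>. \<bar>dF \<omega>\<bar> + ((K1 v \<omega> - K1 u \<omega>) + (K2 v \<omega> - K2 u \<omega>)))"
  have sFa: "sqint P (\<lambda>\<omega>. \<bar>dF \<omega>\<bar>)" "nsq P (\<lambda>\<omega>. \<bar>dF \<omega>\<bar>) = nsq P dF" using sF by (auto simp: sqint_def nsq_def)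
  have sZa: "sqint P (\<lambda>\<omega>. \<bar>dZ \<omega>\<bar>)" "nsq P (\<lambda>\<omega>. \<bar>dZ \<omega>\<bar>) = nsq P dZ" using sZ by (auto simp: sqint_def nsq_def)
  have sw: "sqint P w" unfolding w_def by (intro sqint_add(1) sFa sK)
  have nw: "nsq P w \<le> 2 * ((v - u) * nsq Q (\<lambda>x. indicator {u<..v} (fst x) *\<^sub>R f x)) + 4 * nsq P (\<lambda>\<omega>. K1 v \<omega> - K1 u \<omega>) + 4 * nsq P (\<lambda>\<omega>. K2 v \<omega> - K2 u \<omega>)"
    unfolding w_def using sqint_add(2)[OF sFa(1) sqint_add(1)[OF sK]] sqint_add(2)[OF sK] sFa(2) nF by simp
  have P2W: "(\<lambda>\<omega>. Phi2 d (Y u \<omega>)) \<in> borel_measurable (AW u v)" using YW[OF uv] by measurable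
  have P2B: "(\<lambda>\<omega>. Phi2 d (Y v \<omega>)) \<in> borel_measurable (AB u v)" using YB[OF uv] by measurable
  have P1W: "(\<lambda>\<omega>. Phi1 d (Y u \<omega>)) \<in> borel_measurable (AW u v)" using YW[OF uv] by measurable
  have P1B: "(\<lambda>\<omega>. Phi1 d (Y v \<omega>)) \<in> borel_measurable (AB u v)" using YB[OF uv] by measurable
  have b2: "\<bar>Phi2 d y\<bar> \<le> 2" for y using Phi2_bounds[OF d, of y] by simp
  note E1 = wn.ITO_mean[OF I(1) uv P1W sqint_Phi1[OF uT(1)]] and E2 = bn.ITO_mean[OF I(2) uv P1B sqint_Phi1[OF uT(2)]]
  note W1 = wn.ITO_weight[OF I(1) uv P2W b2] and W2 = bn.ITO_weight[OF I(2) uv P2B b2]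
  have mY: "(\<lambda>\<omega>. Phi2 d (Y u \<omega>)) \<in> borel_measurable P" "(\<lambda>\<omega>. Phi2 d (Y v \<omega>)) \<in> borel_measurable P"
    using YP[OF uT(1)] YP[OF uT(2)] by measurable
  have i2: "integrable P (\<lambda>\<omega>. Phi2 d (Y u \<omega>) * (dZ \<omega>)\<^sup>2)" "integrable P (\<lambda>\<omega>. Phi2 d (Y v \<omega>) * (dG \<omega>)\<^sup>2)"
    using sqint_mult_bounded(2)[OF sZ mY(1) b2] sqint_mult_bounded(2)[OF sG mY(2) b2] by auto
  have sU: "sqint P (U u)"
    by (rule sqint_le[OF DU Um[OF uT(1)]]) (use UD[OF uT(1)] in \<open>auto intro: order_trans[OF _ abs_ge_self]\<close>)
  note i1 = sqint_mult(1)[OF sqint_Phi1[OF uT(1)] sZ] sqint_mult(1)[OF sqint_Phi1[OF uT(2)] sG]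
  note i3 = sqint_mult(1)[OF sqint_Phi1[OF uT(1)] sF] sqint_mult(1)[OF sU sK(1)] sqint_mult(1)[OF sZa(1) sw]
  note i4 = integrable_gam[OF sZ] integrable_gam[OF sG] integrable_Phi[OF uT(1)] integrable_Phi[OF uT(2)]
  have "AE \<omega> in P. Phi d (Y u \<omega>) + Phi1 d (Y u \<omega>) * dZ \<omega> + Phi2 d (Y u \<omega>) / 2 * (dZ \<omega>)\<^sup>2
    \<le> Phi d (Y v \<omega>) + Phi1 d (Y v \<omega>) * dG \<omega> + Phi2 d (Y v \<omega>) / 2 * (dG \<omega>)\<^sup>2 + gam (dZ \<omega>) + gam (dG \<omega>)
      + Phi1 d (Y u \<omega>) * dF \<omega> + 2 * (U u \<omega> * (K1 v \<omega> - K1 u \<omega>)) + 2 * (\<bar>dZ \<omega>\<bar> * w \<omega>)"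
    using eq[OF uT(1)] eq[OF uT(2)] wn.time_int_diff[OF fint uv] UY[OF uT(1)] AE_space
  proof eventually_elim
    case (elim \<omega>)
    show ?case unfolding w_def
      by (rule block_pointwise) (use elim dK_bounds[OF uv elim(5)] in \<open>auto simp: dZ_def dG_def dF_def\<close>)
  qed
  then have "(\<integral>\<omega>. Phi d (Y u \<omega>) + Phi1 d (Y u \<omega>) * dZ \<omega> + Phi2 d (Y u \<omega>) / 2 * (dZ \<omega>)\<^sup>2 \<partial>P)
    \<le> (\<integral>\<omega>. Phi d (Y v \<omega>) + Phi1 d (Y v \<omega>) * dG \<omega> + Phi2 d (Y v \<omega>) / 2 * (dG \<omega>)\<^sup>2 + gam (dZ \<omega>) + gam (dG \<omega>)
      + Phi1 d (Y u \<omega>) * dF \<omega> + 2 * (U u \<omega> * (K1 v \<omega> - K1 u \<omega>)) + 2 * (\<bar>dZ \<omega>\<bar> * w \<omega>) \<partial>P)"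
    by (intro integral_mono_AE) (use i1 i2 i3 i4 in auto)
  also have "(\<integral>\<omega>. Phi d (Y u \<omega>) + Phi1 d (Y u \<omega>) * dZ \<omega> + Phi2 d (Y u \<omega>) / 2 * (dZ \<omega>)\<^sup>2 \<partial>P)
    = (\<integral>\<omega>. Phi d (Y u \<omega>) \<partial>P) + (\<integral>x. indicator {u<..v} (fst x) * (Phi2 d (Y u (snd x)) * (norm (Z x))\<^sup>2) \<partial>Q) / 2"
    using i1 i2 i4 E1 W1 by simp
  also have "(\<integral>\<omega>. Phi d (Y v \<omega>) + Phi1 d (Y v \<omega>) * dG \<omega> + Phi2 d (Y v \<omega>) / 2 * (dG \<omega>)\<^sup>2 + gam (dZ \<omega>) + gam (dG \<omega>)
      + Phi1 d (Y u \<omega>) * dF \<omega> + 2 * (U u \<omega> * (K1 v \<omega> - K1 u \<omega>)) + 2 * (\<bar>dZ \<omega>\<bar> * w \<omega>) \<partial>P)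
    = (\<integral>\<omega>. Phi d (Y v \<omega>) \<partial>P) + (\<integral>x. indicator {u<..v} (fst x) * (Phi2 d (Y v (snd x)) * (norm (G x))\<^sup>2) \<partial>Q) / 2
      + (\<integral>\<omega>. gam (dZ \<omega>) \<partial>P) + (\<integral>\<omega>. gam (dG \<omega>) \<partial>P) + (\<integral>\<omega>. Phi1 d (Y u \<omega>) * dF \<omega> \<partial>P)
      + 2 * (\<integral>\<omega>. U u \<omega> * (K1 v \<omega> - K1 u \<omega>) \<partial>P) + 2 * (\<integral>\<omega>. \<bar>dZ \<omega>\<bar> * w \<omega> \<partial>P)"
    using i1 i2 i3 i4 E2 W2 by simp
  also have "(\<integral>\<omega>. Phi1 d (Y u \<omega>) * dF \<omega> \<partial>P) = (\<integral>x. indicator {u<..v} (fst x) * (Phi1 d (Y u (snd x)) * f x) \<partial>Q)"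
    unfolding dF_def by (rule wn.time_int_mult[OF f sqint_Phi1[OF uT(1)]])
  finally have main: "(\<integral>\<omega>. Phi d (Y u \<omega>) \<partial>P) + (\<integral>x. indicator {u<..v} (fst x) * (Phi2 d (Y u (snd x)) * (norm (Z x))\<^sup>2) \<partial>Q) / 2
    \<le> (\<integral>\<omega>. Phi d (Y v \<omega>) \<partial>P) + (\<integral>x. indicator {u<..v} (fst x) * (Phi2 d (Y v (snd x)) * (norm (G x))\<^sup>2) \<partial>Q) / 2
      + (\<integral>\<omega>. gam (dZ \<omega>) \<partial>P) + (\<integral>\<omega>. gam (dG \<omega>) \<partial>P) + (\<integral>x. indicator {u<..v} (fst x) * (Phi1 d (Y u (snd x)) * f x) \<partial>Q)
      + 2 * (\<integral>\<omega>. U u \<omega> * (K1 v \<omega> - K1 u \<omega>) \<partial>P) + 2 * (\<integral>\<omega>. \<bar>dZ \<omega>\<bar> * w \<omega> \<partial>P)" .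
  have "(\<integral>\<omega>. \<bar>dZ \<omega>\<bar> * w \<omega> \<partial>P) \<le> \<eta> * nsq P (\<lambda>\<omega>. \<bar>dZ \<omega>\<bar>) + nsq P w / \<eta>"
    using sqint_mult(2)[OF sZa(1) sw eta] by simp
  also have "nsq P (\<lambda>\<omega>. \<bar>dZ \<omega>\<bar>) = nsq Q (\<lambda>x. indicator {u<..v} (fst x) *\<^sub>R Z x)"
    unfolding sZa(2) by (rule wn.ITO_nsq[OF I(1) uv])
  finally have 1: "(\<integral>\<omega>. \<bar>dZ \<omega>\<bar> * w \<omega> \<partial>P) \<le> \<eta> * nsq Q (\<lambda>x. indicator {u<..v} (fst x) *\<^sub>R Z x) + nsq P w / \<eta>" .
  define rest where "rest = (2 * ((v - u) * nsq Q (\<lambda>x. indicator {u<..v} (fst x) *\<^sub>R f x)) + 4 * nsq P (\<lambda>\<omega>. K1 v \<omega> - K1 u \<omega>) + 4 * nsq P (\<lambda>\<omega>. K2 v \<omega> - K2 u \<omega>)) / \<eta>"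
  have "nsq P w / \<eta> \<le> rest" unfolding rest_def using nw eta by (intro divide_right_mono) auto
  with 1 have "(\<integral>\<omega>. \<bar>dZ \<omega>\<bar> * w \<omega> \<partial>P) \<le> \<eta> * nsq Q (\<lambda>x. indicator {u<..v} (fst x) *\<^sub>R Z x) + rest" by (rule order_trans[OF _ add_left_mono])
  moreover have arith: "L \<le> a + b + e + 2 * h + c + c' + 2 * (N + r)"
    if "L \<le> a + b + c + c' + e + 2 * h + 2 * E" "E \<le> N + r" for L a b c c' e h E N r :: real
    using that by argo
  ultimately show ?thesis unfolding rest_def by (intro arith[OF main])
qed

text \<open>At the terminal time the stochastic integrals run over an empty interval, so the
  isometry makes them vanish almost surely, and \<open>Y T\<close> reduces to the nonpositive
  \<open>\<xi>\<close>.\<close>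

lemma integral_Phi_T: "(\<integral>\<omega>. Phi d (Y T \<omega>) \<partial>P) = 0"
proof -
  have TT: "T \<in> {0..T}" using T0 by simp
  have z: "AE \<omega> in P. h \<omega> = 0" if "sqint P h" "nsq P h = 0" for h :: "'w \<Rightarrow> real"
  proof -
    have "AE \<omega> in P. (norm (h \<omega>))\<^sup>2 = 0"
      using integral_nonneg_eq_0_iff_AE[OF sqint_int[OF that(1)]] that(2) by (simp add: nsq_def)
    then show ?thesis by eventually_elim simp
  qed
  have "nsq P (IW T) = 0" "nsq P (IB T) = 0"
    using wn.ITO_nsq[OF IW[OF TT]] bn.ITO_nsq[OF IB[OF TT]] T0 by auto
  then have "AE \<omega> in P. IW T \<omega> = 0" "AE \<omega> in P. IB T \<omega> = 0"
    using z wn.ITO_sqint(1)[OF IW[OF TT]] bn.ITO_sqint(1)[OF IB[OF TT]] by auto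
  then have "AE \<omega> in P. Phi d (Y T \<omega>) = 0"
    using eq[OF TT] xi
  proof eventually_elim
    case (elim \<omega>)
    have "(LINT s:{T..T}|lborel. f (s, \<omega>)) = 0" by (rule set_integral_singleton_zero)
    then have "Y T \<omega> \<le> 0" using elim by simp
    then show ?case by (rule Phi_nonpos[OF d])
  qed
  then show ?thesis by (rule integral_eq_zero_AE)
qed

text \<open>Zero quadratic variation path by path, with the squared total increment as
  majorant.\<close>

lemma sum_nsq_dK_tendsto:
  assumes t: "t \<in> {0..T}"
  shows "(\<lambda>n. \<Sum>k<n. nsq P (\<lambda>\<omega>. K1 (grid t T n (Suc k)) \<omega> - K1 (grid t T n k) \<omega>)) \<longlonglongrightarrow> 0"
    and "(\<lambda>n. \<Sum>k<n. nsq P (\<lambda>\<omega>. K2 (grid t T n (Suc k)) \<omega> - K2 (grid t T n k) \<omega>)) \<longlonglongrightarrow> 0"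
proof -
  have tT: "t \<le> T" using t by simp
  have g: "grid t T n k \<in> {0..T}" "grid t T n (Suc k) \<in> {0..T}" "grid t T n k \<le> grid t T n (Suc k)" if "k < n" for n k
    using grid_bounds[OF tT, of k n] grid_bounds[OF tT, of "Suc k" n] grid_mono[OF tT, of k "Suc k" n] that t by auto
  have gen: "(\<lambda>n. \<Sum>k<n. nsq P (\<lambda>\<omega>. K (grid t T n (Suc k)) \<omega> - K (grid t T n k) \<omega>)) \<longlonglongrightarrow> 0"
    if K: "\<And>\<omega>. \<omega> \<in> space P \<Longrightarrow> continuous_on {0..T} (\<lambda>t. K t \<omega>) \<and> mono_on {0..T} (\<lambda>t. K t \<omega>)"
      and Km: "\<And>t. t \<in> {0..T} \<Longrightarrow> K t \<in> borel_measurable P"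
      and KT: "sqint P (\<lambda>\<omega>. K T \<omega> - K 0 \<omega>)"
      and sK: "\<And>u v. 0 \<le> u \<Longrightarrow> u \<le> v \<Longrightarrow> v \<le> T \<Longrightarrow> sqint P (\<lambda>\<omega>. K v \<omega> - K u \<omega>)" for K :: "real \<Rightarrow> 'w \<Rightarrow> real"
  proof -
    define S where "S = (\<lambda>n \<omega>. \<Sum>k<n. (K (grid t T n (Suc k)) \<omega> - K (grid t T n k) \<omega>)\<^sup>2)"
    have Ki: "continuous_on {t..T} (\<lambda>t. K t \<omega>)" "mono_on {t..T} (\<lambda>t. K t \<omega>)" if "\<omega> \<in> space P" for \<omega>
      using K[OF that] t by (auto intro: continuous_on_subset simp: mono_on_def)
    have "(\<lambda>n. \<integral>\<omega>. S n \<omega> \<partial>P) \<longlonglongrightarrow> (\<integral>\<omega>. 0 \<partial>P)"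
    proof (rule integral_dominated_convergence[where w="\<lambda>\<omega>. (norm (K T \<omega> - K 0 \<omega>))\<^sup>2"])
      show "integrable P (\<lambda>\<omega>. (norm (K T \<omega> - K 0 \<omega>))\<^sup>2)" by (rule sqint_int[OF KT])
      show "S n \<in> borel_measurable P" for n
        unfolding S_def using g by (intro borel_measurable_sum borel_measurable_power borel_measurable_diff Km) auto
      show "AE \<omega> in P. (\<lambda>n. S n \<omega>) \<longlonglongrightarrow> 0"
        unfolding S_def using sum_square_increments_tendsto(1)[OF tT Ki] by (intro AE_I2) auto
      show "AE \<omega> in P. norm (S n \<omega>) \<le> (norm (K T \<omega> - K 0 \<omega>))\<^sup>2" for n
      proof (rule AE_I2)
        fix \<omega> assume w: "\<omega> \<in> space P"
        have "S n \<omega> \<le> (K T \<omega> - K t \<omega>)\<^sup>2" unfolding S_def by (rule sum_square_increments_tendsto(2)[OF tT Ki[OF w]])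
        also have "\<dots> \<le> (K T \<omega> - K 0 \<omega>)\<^sup>2"
          using mono_onD[OF conjunct2[OF K[OF w]], of 0 t] mono_onD[OF conjunct2[OF K[OF w]], of t T] t
          by (intro power_mono) auto
        finally show "norm (S n \<omega>) \<le> (norm (K T \<omega> - K 0 \<omega>))\<^sup>2" by (simp add: S_def sum_nonneg)
      qed
    qed simp
    moreover have "(\<integral>\<omega>. S n \<omega> \<partial>P) = (\<Sum>k<n. nsq P (\<lambda>\<omega>. K (grid t T n (Suc k)) \<omega> - K (grid t T n k) \<omega>))" for n
      unfolding S_def nsq_def real_norm_def power2_abs
      by (rule Bochner_Integration.integral_sum) (use sqint_int[OF sK] g in auto)
    ultimately show ?thesis by simp
  qed
  show "(\<lambda>n. \<Sum>k<n. nsq P (\<lambda>\<omega>. K1 (grid t T n (Suc k)) \<omega> - K1 (grid t T n k) \<omega>)) \<longlonglongrightarrow> 0"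
    by (rule gen[OF K1 Km(1) KT(1) sqint_dK(1)])
  show "(\<lambda>n. \<Sum>k<n. nsq P (\<lambda>\<omega>. K2 (grid t T n (Suc k)) \<omega> - K2 (grid t T n k) \<omega>)) \<longlonglongrightarrow> 0"
    by (rule gen[OF K2 Km(2) KT(2) sqint_dK(2)])
qed

lemma sum_U_dK_tendsto:
  assumes t: "t \<in> {0..T}"
  shows "(\<lambda>n. \<Sum>k<n. \<integral>\<omega>. U (grid t T n k) \<omega> * (K1 (grid t T n (Suc k)) \<omega> - K1 (grid t T n k) \<omega>) \<partial>P) \<longlonglongrightarrow> 0"
proof -
  have tT: "0 \<le> t" "t \<le> T" using t by auto
  have g: "grid t T n k \<in> {0..T}" "grid t T n (Suc k) \<in> {0..T}" "grid t T n k \<le> grid t T n (Suc k)" if "k < n" for n k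
    using grid_bounds[OF tT(2), of k n] grid_bounds[OF tT(2), of "Suc k" n] grid_mono[OF tT(2), of k "Suc k" n] that t by auto
  \<comment> \<open>The Stieltjes argument is pathwise and needs the sign of \<open>U\<close> at all
    times outside one null set.\<close>
  have U0: "AE \<omega> in P. \<forall>s\<in>{0..T}. 0 \<le> U s \<omega>"
  proof (rule AE_all_times[OF T0 _ Uc])
    have "AE \<omega> in P. 0 \<le> U s \<omega>" if "s \<in> {0..T}" for s
      using UY[OF that] by eventually_elim (use pp_simps(1) order_trans in blast)
    then show "AE s in lborel. s \<in> {0..T} \<longrightarrow> (AE \<omega> in P. 0 \<le> U s \<omega>)" by simp
  qed
  define S where "S = (\<lambda>n \<omega>. \<Sum>k<n. U (grid t T n k) \<omega> * (K1 (grid t T n (Suc k)) \<omega> - K1 (grid t T n k) \<omega>))"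
  have "(\<lambda>n. \<integral>\<omega>. S n \<omega> \<partial>P) \<longlonglongrightarrow> (\<integral>\<omega>. 0 \<partial>P)"
  proof (rule integral_dominated_convergence[where w="\<lambda>\<omega>. DU \<omega> * (K1 T \<omega> - K1 0 \<omega>)"])
    show "integrable P (\<lambda>\<omega>. DU \<omega> * (K1 T \<omega> - K1 0 \<omega>))" by (rule sqint_mult(1)[OF DU KT(1)])
    show "S n \<in> borel_measurable P" for n
      unfolding S_def using g by (intro borel_measurable_sum borel_measurable_times borel_measurable_diff Km Um) auto
    show "AE \<omega> in P. (\<lambda>n. S n \<omega>) \<longlonglongrightarrow> 0"
      using U0 Usk AE_space
    proof eventually_elim
      case (elim \<omega>)
      show ?case unfolding S_def
        by (rule riemann_stieltjes_tendsto_zero[OF tT]) (use K1[OF elim(3)] Uc[OF elim(3)] elim in auto)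
    qed
    show "AE \<omega> in P. norm (S n \<omega>) \<le> DU \<omega> * (K1 T \<omega> - K1 0 \<omega>)" for n
    proof (rule AE_I2)
      fix \<omega> assume w: "\<omega> \<in> space P"
      have DU0: "0 \<le> DU \<omega>" using UD[OF t w] by linarith
      have "norm (S n \<omega>) \<le> (\<Sum>k<n. DU \<omega> * (K1 (grid t T n (Suc k)) \<omega> - K1 (grid t T n k) \<omega>))"
        unfolding S_def
      proof (rule order_trans[OF norm_sum sum_mono])
        fix k assume "k \<in> {..<n}"
        then have k: "k < n" by simp
        have dk: "0 \<le> K1 (grid t T n (Suc k)) \<omega> - K1 (grid t T n k) \<omega>"
          by (rule dK_bounds(1)[OF _ _ _ w]) (use g[OF k] in auto)
        show "norm (U (grid t T n k) \<omega> * (K1 (grid t T n (Suc k)) \<omega> - K1 (grid t T n k) \<omega>))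
          \<le> DU \<omega> * (K1 (grid t T n (Suc k)) \<omega> - K1 (grid t T n k) \<omega>)"
          unfolding norm_mult using dk UD[OF g(1)[OF k] w] by (auto intro!: mult_right_mono)
      qed
      also have "\<dots> = DU \<omega> * (K1 (grid t T n n) \<omega> - K1 (grid t T n 0) \<omega>)"
        unfolding sum_distrib_left[symmetric] using sum_lessThan_telescope[of "\<lambda>k. K1 (grid t T n k) \<omega>" n] by simp
      also have "\<dots> \<le> DU \<omega> * (K1 T \<omega> - K1 0 \<omega>)"
        by (rule mult_left_mono[OF dK_bounds(2)[OF _ _ _ w] DU0])
           (use grid_bounds[OF tT(2), of n n] grid_mono[OF tT(2), of 0 n n] tT in auto)
      finally show "norm (S n \<omega>) \<le> DU \<omega> * (K1 T \<omega> - K1 0 \<omega>)" .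
    qed
  qed simp
  moreover have "(\<integral>\<omega>. S n \<omega> \<partial>P) = (\<Sum>k<n. \<integral>\<omega>. U (grid t T n k) \<omega> * (K1 (grid t T n (Suc k)) \<omega> - K1 (grid t T n k) \<omega>) \<partial>P)" for n
    unfolding S_def
  proof (rule Bochner_Integration.integral_sum)
    fix k assume "k \<in> {..<n}"
    then have k: "k < n" by simp
    have "sqint P (U (grid t T n k))"
      by (rule sqint_le[OF DU Um[OF g(1)[OF k]]]) (use UD[OF g(1)[OF k]] in \<open>auto intro: order_trans[OF _ abs_ge_self]\<close>)
    from sqint_mult(1)[OF this sqint_dK(1)] g[OF k]
    show "integrable P (\<lambda>\<omega>. U (grid t T n k) \<omega> * (K1 (grid t T n (Suc k)) \<omega> - K1 (grid t T n k) \<omega>))" by auto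
  qed
  ultimately show ?thesis by simp
qed

lemma cont_Phi:
  assumes w: "\<omega> \<in> space P" and t: "t \<in> {0..T}"
  shows "continuous_on {t..T} (\<lambda>r. Phi2 d (Y r \<omega>))" "continuous_on {t..T} (\<lambda>r. Phi1 d (Y r \<omega>))"
proof -
  have c: "continuous_on {t..T} (\<lambda>r. Y r \<omega>)" by (rule continuous_on_subset[OF Yc[OF w]]) (use t in auto)
  show "continuous_on {t..T} (\<lambda>r. Phi2 d (Y r \<omega>))" "continuous_on {t..T} (\<lambda>r. Phi1 d (Y r \<omega>))"
    unfolding Phi1_def Phi2_def using d by (intro continuous_intros continuous_on_pp c; simp)+
qed

text \<open>The block inequalities telescope over a grid. For fixed \<open>\<eta>\<close> the mesh
  is sent to \<open>0\<close> first: Riemann sums converge, while jump remainders, drift squares and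
  \<open>K\<close> terms disappear. Only a multiple of \<open>\<eta>\<close> survives, and
  \<open>\<eta>\<close> is arbitrary.\<close>

lemma ito_ineq:
  assumes t: "t \<in> {0..T}"
  defines "EG \<equiv> \<lambda>x. indicator {t<..T} (fst x) * (Phi2 d (Y (fst x) (snd x)) * (norm (G x))\<^sup>2)"
    and "EZ \<equiv> \<lambda>x. indicator {t<..T} (fst x) * (Phi2 d (Y (fst x) (snd x)) * (norm (Z x))\<^sup>2)"
    and "Ef \<equiv> \<lambda>x. indicator {t<..T} (fst x) * (Phi1 d (Y (fst x) (snd x)) * f x)"
  shows "(\<integral>\<omega>. Phi d (Y t \<omega>) \<partial>P) \<le> (\<integral>x. EG x \<partial>Q) / 2 - (\<integral>x. EZ x \<partial>Q) / 2 + (\<integral>x. Ef x \<partial>Q)"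
    and "integrable Q EG" "integrable Q EZ" "integrable Q Ef"
proof -
  have tT: "0 \<le> t" "t \<le> T" using t by auto
  have T1: "0 \<in> {0..T}" using T0 by simp
  note sZ = wn.ITO_sqint(2)[OF IW[OF T1]] and sG = bn.ITO_sqint(2)[OF IB[OF T1]]
  let ?g = "grid t T"
  have g: "?g n k \<in> {0..T}" "?g n (Suc k) \<in> {0..T}" "?g n k \<le> ?g n (Suc k)" if "k < n" for n k
    using grid_bounds[OF tT(2), of k n] grid_bounds[OF tT(2), of "Suc k" n] grid_mono[OF tT(2), of k "Suc k" n] that t by auto
  have mQ: "(\<lambda>x. Y r (snd x)) \<in> borel_measurable Q" if "r \<in> {t..T}" for r
    by (rule measurable_compose[OF snd_timeprod YP]) (use that t in auto)
  have cm: "(\<lambda>x. Phi2 d (Y r (snd x))) \<in> borel_measurable Q" "(\<lambda>x. Phi1 d (Y r (snd x))) \<in> borel_measurable Q" if "r \<in> {t..T}" for r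
    using mQ[OF that] by measurable
  have cc: "continuous_on {t..T} (\<lambda>r. Phi2 d (Y r (snd x)))" "continuous_on {t..T} (\<lambda>r. Phi1 d (Y r (snd x)))" if "x \<in> space Q" for x
    using cont_Phi[OF _ t, of "snd x"] that by auto
  have b2: "\<bar>Phi2 d y * (norm (Z x))\<^sup>2\<bar> \<le> 2 * (norm (Z x))\<^sup>2" "\<bar>Phi2 d y * (norm (G x))\<^sup>2\<bar> \<le> 2 * (norm (G x))\<^sup>2" for y x
    using Phi2_bounds[OF d, of y] by (simp_all add: abs_mult mult_right_mono)
  have b1: "\<bar>Phi1 d (Y r (snd x)) * f x\<bar> \<le> 2 * D (snd x) * \<bar>f x\<bar>" if "r \<in> {t..T}" "x \<in> space Q" for r x
  proof -
    have w: "snd x \<in> space P" "r \<in> {0..T}" using that t by auto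
    have "pp (Y r (snd x)) \<le> D (snd x)" using YD[OF w(2,1)] pp_simps(3)[of "Y r (snd x)"] by linarith
    then have "\<bar>Phi1 d (Y r (snd x))\<bar> \<le> 2 * D (snd x)" using Phi1_le[OF d, of "Y r (snd x)"] Phi1_nonneg[OF d, of "Y r (snd x)"] by simp
    then show ?thesis unfolding abs_mult by (rule mult_right_mono) simp
  qed
  have iD: "integrable Q (\<lambda>x. 2 * D (snd x) * \<bar>f x\<bar>)"
  proof -
    have "sqint Q (\<lambda>x. \<bar>f x\<bar>)" using f by (auto simp: sqint_def)
    from sqint_mult(1)[OF wn.sqint_timeprod_snd[OF D] this]
    have "integrable Q (\<lambda>x. 2 * (D (snd x) * \<bar>f x\<bar>))" by (rule integrable_mult_right)
    then show ?thesis by (simp add: mult.assoc)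
  qed
  have mZ: "(\<lambda>x. (norm (Z x))\<^sup>2) \<in> borel_measurable Q" and mG: "(\<lambda>x. (norm (G x))\<^sup>2) \<in> borel_measurable Q"
    using sqint_meas[OF sZ] sqint_meas[OF sG] by measurable
  have i2: "integrable Q (\<lambda>x. 2 * (norm (Z x))\<^sup>2)" "integrable Q (\<lambda>x. 2 * (norm (G x))\<^sup>2)"
    using sqint_int[OF sZ] sqint_int[OF sG] by auto
  have gg: "?g n k \<le> ?g n k \<and> ?g n k \<le> ?g n (Suc k)" "?g n k \<le> ?g n (Suc k) \<and> ?g n (Suc k) \<le> ?g n (Suc k)" if "k < n" for n k
    using g(3)[OF that] by auto
  note sA = step_integral_tendsto[where N=Q and \<sigma>=fst and c="\<lambda>r x. Phi2 d (Y r (snd x))" and H="\<lambda>x. (norm (Z x))\<^sup>2"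
     and D="\<lambda>x. 2 * (norm (Z x))\<^sup>2" and tau="\<lambda>n k. ?g n k", OF tT(2) fst_timeprod mZ cm(1) cc(1) b2(1) i2(1) gg(1)]
  \<comment> \<open>Weights of the backward part sit at right end points, in contrast to the other
    two sums; by continuity of \<open>Y\<close> the limits have the same form.\<close>
  note sB = step_integral_tendsto[where N=Q and \<sigma>=fst and c="\<lambda>r x. Phi2 d (Y r (snd x))" and H="\<lambda>x. (norm (G x))\<^sup>2"
     and D="\<lambda>x. 2 * (norm (G x))\<^sup>2" and tau="\<lambda>n k. ?g n (Suc k)", OF tT(2) fst_timeprod mG cm(1) cc(1) b2(2) i2(2) gg(2)]
  note sC = step_integral_tendsto[where N=Q and \<sigma>=fst and c="\<lambda>r x. Phi1 d (Y r (snd x))" and H=f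
     and D="\<lambda>x. 2 * D (snd x) * \<bar>f x\<bar>" and tau="\<lambda>n k. ?g n k", OF tT(2) fst_timeprod sqint_meas[OF f] cm(2) cc(2) b1 iD gg(1)]
  show "integrable Q EG" "integrable Q EZ" "integrable Q Ef"
    unfolding EG_def EZ_def Ef_def using sA(2) sB(2) sC(2) by auto
  define A where "A = (\<lambda>n. \<Sum>k<n. \<integral>x. indicator {?g n k<..?g n (Suc k)} (fst x) * (Phi2 d (Y (?g n k) (snd x)) * (norm (Z x))\<^sup>2) \<partial>Q)"
  define B where "B = (\<lambda>n. \<Sum>k<n. \<integral>x. indicator {?g n k<..?g n (Suc k)} (fst x) * (Phi2 d (Y (?g n (Suc k)) (snd x)) * (norm (G x))\<^sup>2) \<partial>Q)"
  define C where "C = (\<lambda>n. \<Sum>k<n. \<integral>x. indicator {?g n k<..?g n (Suc k)} (fst x) * (Phi1 d (Y (?g n k) (snd x)) * f x) \<partial>Q)"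
  define UK where "UK = (\<lambda>n. \<Sum>k<n. \<integral>\<omega>. U (?g n k) \<omega> * (K1 (?g n (Suc k)) \<omega> - K1 (?g n k) \<omega>) \<partial>P)"
  define gZ where "gZ = (\<lambda>n. \<Sum>k<n. \<integral>\<omega>. gam (IW (?g n k) \<omega> - IW (?g n (Suc k)) \<omega>) \<partial>P)"
  define gG where "gG = (\<lambda>n. \<Sum>k<n. \<integral>\<omega>. gam (IB (?g n k) \<omega> - IB (?g n (Suc k)) \<omega>) \<partial>P)"
  define k1 where "k1 = (\<lambda>n. \<Sum>k<n. nsq P (\<lambda>\<omega>. K1 (?g n (Suc k)) \<omega> - K1 (?g n k) \<omega>))"
  define k2 where "k2 = (\<lambda>n. \<Sum>k<n. nsq P (\<lambda>\<omega>. K2 (?g n (Suc k)) \<omega> - K2 (?g n k) \<omega>))"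
  define NZ where "NZ = nsq Q (\<lambda>x. indicator {t<..T} (fst x) *\<^sub>R Z x)"
  define Nf where "Nf = nsq Q (\<lambda>x. indicator {t<..T} (fst x) *\<^sub>R f x)"
  have limA: "A \<longlonglongrightarrow> (\<integral>x. EZ x \<partial>Q)" unfolding A_def EZ_def using sA(1) .
  have limB: "B \<longlonglongrightarrow> (\<integral>x. EG x \<partial>Q)" unfolding B_def EG_def using sB(1) .
  have limC: "C \<longlonglongrightarrow> (\<integral>x. Ef x \<partial>Q)" unfolding C_def Ef_def using sC(1) .
  have limU: "UK \<longlonglongrightarrow> 0" unfolding UK_def by (rule sum_U_dK_tendsto[OF t])
  have limk: "k1 \<longlonglongrightarrow> 0" "k2 \<longlonglongrightarrow> 0" unfolding k1_def k2_def by (rule sum_nsq_dK_tendsto[OF t])+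
  have d0: "0 \<le> 2 / d" using d by simp
  have limgZ: "gZ \<longlonglongrightarrow> 0" unfolding gZ_def gam_def
    by (rule wn.ITO_small_jumps(1)[OF IW tT d0]) (use tT in auto)
  have limgG: "gG \<longlonglongrightarrow> 0" unfolding gG_def gam_def
    by (rule bn.ITO_small_jumps(1)[OF IB tT d0]) (use tT in auto)
  have sumf: "(\<Sum>k<n. nsq Q (\<lambda>x. indicator {?g n k<..?g n (Suc k)} (fst x) *\<^sub>R f x)) = Nf" if "n > 0" for n
  proof -
    have e: "(norm (indicator {u<..v} (fst x) *\<^sub>R f x))\<^sup>2 = indicator {u<..v} (fst x) * (norm (f x))\<^sup>2" for u v x
      by (auto simp: indicator_def)
    have i: "integrable Q (\<lambda>x. indicator {u<..v} (fst x) * (norm (f x))\<^sup>2)" for u v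
      by (rule Bochner_Integration.integrable_bound[OF sqint_int[OF f]])
         (use sqint_meas[OF f] in \<open>auto simp: indicator_def\<close>)
    show ?thesis unfolding nsq_def Nf_def e
      by (subst Bochner_Integration.integral_sum[symmetric])
         (auto simp: i sum_distrib_right[symmetric] sum_indicator_grid[OF tT(2) that] simp del: sum_indicator_mult real_norm_def)
  qed
  have main: "(\<integral>\<omega>. Phi d (Y t \<omega>) \<partial>P) + A n / 2 \<le> B n / 2 + C n + 2 * UK n + gZ n + gG n
     + 2 * (\<eta> * NZ + (2 * ((T - t) / real n * Nf) + 4 * k1 n + 4 * k2 n) / \<eta>)" if n: "n > 0" and eta: "\<eta> > 0" for n \<eta>
  proof -
    have "(\<Sum>k<n. (\<integral>\<omega>. Phi d (Y (?g n k) \<omega>) \<partial>P) + (\<integral>x. indicator {?g n k<..?g n (Suc k)} (fst x) * (Phi2 d (Y (?g n k) (snd x)) * (norm (Z x))\<^sup>2) \<partial>Q) / 2)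
      \<le> (\<Sum>k<n. (\<integral>\<omega>. Phi d (Y (?g n (Suc k)) \<omega>) \<partial>P) + (\<integral>x. indicator {?g n k<..?g n (Suc k)} (fst x) * (Phi2 d (Y (?g n (Suc k)) (snd x)) * (norm (G x))\<^sup>2) \<partial>Q) / 2
      + (\<integral>x. indicator {?g n k<..?g n (Suc k)} (fst x) * (Phi1 d (Y (?g n k) (snd x)) * f x) \<partial>Q)
      + 2 * (\<integral>\<omega>. U (?g n k) \<omega> * (K1 (?g n (Suc k)) \<omega> - K1 (?g n k) \<omega>) \<partial>P)
      + (\<integral>\<omega>. gam (IW (?g n k) \<omega> - IW (?g n (Suc k)) \<omega>) \<partial>P) + (\<integral>\<omega>. gam (IB (?g n k) \<omega> - IB (?g n (Suc k)) \<omega>) \<partial>P)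
      + 2 * (\<eta> * nsq Q (\<lambda>x. indicator {?g n k<..?g n (Suc k)} (fst x) *\<^sub>R Z x)
        + (2 * ((T - t) / real n * nsq Q (\<lambda>x. indicator {?g n k<..?g n (Suc k)} (fst x) *\<^sub>R f x))
           + 4 * nsq P (\<lambda>\<omega>. K1 (?g n (Suc k)) \<omega> - K1 (?g n k) \<omega>) + 4 * nsq P (\<lambda>\<omega>. K2 (?g n (Suc k)) \<omega> - K2 (?g n k) \<omega>)) / \<eta>))"
    proof (rule sum_mono)
      fix k assume "k \<in> {..<n}"
      then have k: "k < n" by simp
      have "?g n (Suc k) - ?g n k = (T - t) / real n" by (simp add: grid_Suc)
      with block_ineq[of "?g n k" "?g n (Suc k)" \<eta>] g[OF k] eta
      show "(\<integral>\<omega>. Phi d (Y (?g n k) \<omega>) \<partial>P) + (\<integral>x. indicator {?g n k<..?g n (Suc k)} (fst x) * (Phi2 d (Y (?g n k) (snd x)) * (norm (Z x))\<^sup>2) \<partial>Q) / 2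
      \<le> (\<integral>\<omega>. Phi d (Y (?g n (Suc k)) \<omega>) \<partial>P) + (\<integral>x. indicator {?g n k<..?g n (Suc k)} (fst x) * (Phi2 d (Y (?g n (Suc k)) (snd x)) * (norm (G x))\<^sup>2) \<partial>Q) / 2
      + (\<integral>x. indicator {?g n k<..?g n (Suc k)} (fst x) * (Phi1 d (Y (?g n k) (snd x)) * f x) \<partial>Q)
      + 2 * (\<integral>\<omega>. U (?g n k) \<omega> * (K1 (?g n (Suc k)) \<omega> - K1 (?g n k) \<omega>) \<partial>P)
      + (\<integral>\<omega>. gam (IW (?g n k) \<omega> - IW (?g n (Suc k)) \<omega>) \<partial>P) + (\<integral>\<omega>. gam (IB (?g n k) \<omega> - IB (?g n (Suc k)) \<omega>) \<partial>P)
      + 2 * (\<eta> * nsq Q (\<lambda>x. indicator {?g n k<..?g n (Suc k)} (fst x) *\<^sub>R Z x)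
        + (2 * ((T - t) / real n * nsq Q (\<lambda>x. indicator {?g n k<..?g n (Suc k)} (fst x) *\<^sub>R f x))
           + 4 * nsq P (\<lambda>\<omega>. K1 (?g n (Suc k)) \<omega> - K1 (?g n k) \<omega>) + 4 * nsq P (\<lambda>\<omega>. K2 (?g n (Suc k)) \<omega> - K2 (?g n k) \<omega>)) / \<eta>)"
        by simp
    qed
    then have "(\<Sum>k<n. \<integral>\<omega>. Phi d (Y (?g n k) \<omega>) \<partial>P) + A n / 2 \<le> (\<Sum>k<n. \<integral>\<omega>. Phi d (Y (?g n (Suc k)) \<omega>) \<partial>P) + B n / 2 + C n + 2 * UK n + gZ n + gG n
     + 2 * (\<eta> * (\<Sum>k<n. nsq Q (\<lambda>x. indicator {?g n k<..?g n (Suc k)} (fst x) *\<^sub>R Z x))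
       + (2 * ((T - t) / real n * (\<Sum>k<n. nsq Q (\<lambda>x. indicator {?g n k<..?g n (Suc k)} (fst x) *\<^sub>R f x))) + 4 * k1 n + 4 * k2 n) / \<eta>)"
      unfolding A_def B_def C_def UK_def gZ_def gG_def k1_def k2_def
      by (simp only: sum.distrib sum_distrib_left[symmetric] sum_divide_distrib[symmetric])
    moreover have "(\<Sum>k<n. \<integral>\<omega>. Phi d (Y (?g n (Suc k)) \<omega>) \<partial>P) = (\<Sum>k<n. \<integral>\<omega>. Phi d (Y (?g n k) \<omega>) \<partial>P) - (\<integral>\<omega>. Phi d (Y t \<omega>) \<partial>P)"
      using sum_lessThan_telescope[of "\<lambda>k. \<integral>\<omega>. Phi d (Y (?g n k) \<omega>) \<partial>P" n] n integral_Phi_T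
      by (simp add: sum_subtractf)
    ultimately show ?thesis unfolding wn.sum_block_nsq[OF sZ tT(2) n, folded NZ_def] sumf[OF n] by linarith
  qed
  have "(\<integral>\<omega>. Phi d (Y t \<omega>) \<partial>P) + (\<integral>x. EZ x \<partial>Q) / 2 \<le> (\<integral>x. EG x \<partial>Q) / 2 + (\<integral>x. Ef x \<partial>Q) + e" if e: "e > 0" for e
  proof -
    have NZ0: "0 \<le> NZ" unfolding NZ_def by (rule nsq_nonneg)
    \<comment> \<open>Makes the surviving term \<open>2 * (\<eta> * NZ)\<close> at most
      \<open>e\<close>; the added \<open>1\<close> covers \<open>NZ = 0\<close>.\<close>
    define \<eta> where "\<eta> = e / (2 * (NZ + 1))"
    have eta: "\<eta> > 0" using e NZ0 by (simp add: \<eta>_def)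
    have "\<eta> * NZ \<le> \<eta> * (NZ + 1)" using eta by simp
    also have "\<dots> = e / 2" using NZ0 by (simp add: \<eta>_def field_simps)
    finally have eN: "2 * (\<eta> * NZ) \<le> e" by simp
    have l1: "(\<lambda>n. (\<integral>\<omega>. Phi d (Y t \<omega>) \<partial>P) + A n / 2) \<longlonglongrightarrow> (\<integral>\<omega>. Phi d (Y t \<omega>) \<partial>P) + (\<integral>x. EZ x \<partial>Q) / 2"
      by (intro tendsto_intros limA) simp
    have "(\<lambda>n. (T - t) * inverse (real n) * Nf) \<longlonglongrightarrow> (T - t) * 0 * Nf"
      by (intro tendsto_intros lim_inverse_n)
    then have lf: "(\<lambda>n. (T - t) / real n * Nf) \<longlonglongrightarrow> 0" by (simp add: divide_inverse)
    have "(\<lambda>n. B n / 2 + C n + 2 * UK n + gZ n + gG n + 2 * (\<eta> * NZ + (2 * ((T - t) / real n * Nf) + 4 * k1 n + 4 * k2 n) / \<eta>))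
      \<longlonglongrightarrow> (\<integral>x. EG x \<partial>Q) / 2 + (\<integral>x. Ef x \<partial>Q) + 2 * 0 + 0 + 0 + 2 * (\<eta> * NZ + (2 * 0 + 4 * 0 + 4 * 0) / \<eta>)"
      by (intro tendsto_intros limB limC limU limgZ limgG limk lf) (use eta in auto)
    then have "(\<integral>\<omega>. Phi d (Y t \<omega>) \<partial>P) + (\<integral>x. EZ x \<partial>Q) / 2 \<le> (\<integral>x. EG x \<partial>Q) / 2 + (\<integral>x. Ef x \<partial>Q) + 2 * 0 + 0 + 0 + 2 * (\<eta> * NZ + (2 * 0 + 4 * 0 + 4 * 0) / \<eta>)"
      by (rule LIMSEQ_le[OF l1]) (use main[OF _ eta] in \<open>auto intro!: exI[of _ "Suc 0"]\<close>)
    then show ?thesis using eN by simp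
  qed
  then have "(\<integral>\<omega>. Phi d (Y t \<omega>) \<partial>P) + (\<integral>x. EZ x \<partial>Q) / 2 \<le> (\<integral>x. EG x \<partial>Q) / 2 + (\<integral>x. Ef x \<partial>Q)"
    by (rule field_le_epsilon)
  then show "(\<integral>\<omega>. Phi d (Y t \<omega>) \<partial>P) \<le> (\<integral>x. EG x \<partial>Q) / 2 - (\<integral>x. EZ x \<partial>Q) / 2 + (\<integral>x. Ef x \<partial>Q)" by linarith
qed

end

end

lemma (in prob_space) integrable_timeprod_mult:
  fixes k :: "'a \<Rightarrow> real" and r :: "real \<Rightarrow> real"
  assumes k: "integrable M k" and r: "integrable (restrict_space lborel {0..T}) r"
  shows "integrable (timeprod T M) (\<lambda>x. r (fst x) * k (snd x))"
proof -
  interpret pair_sigma_finite "restrict_space lborel {0..T}" M by (rule pair_sigma_finite_time)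
  have [measurable]: "k \<in> borel_measurable M" "r \<in> borel_measurable (restrict_space lborel {0..T})" using k r by auto
  show ?thesis
    unfolding timeprod_def
  proof (rule Fubini_integrable)
    show "(\<lambda>x. r (fst x) * k (snd x)) \<in> borel_measurable (restrict_space lborel {0..T} \<Otimes>\<^sub>M M)" by measurable
    show "integrable (restrict_space lborel {0..T}) (\<lambda>x. \<integral>y. norm (r (fst (x, y)) * k (snd (x, y))) \<partial>M)"
      using r by (simp add: abs_mult)
    show "AE x in restrict_space lborel {0..T}. integrable M (\<lambda>y. r (fst (x, y)) * k (snd (x, y)))" using k by simp
  qed
qed

lemma set_integral_restrict_Ioc:
  fixes m :: "real \<Rightarrow> real"
  assumes "t \<in> {0..T}" and m: "m \<in> borel_measurable (restrict_space lborel {0..T})"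
  shows "(\<integral>s. indicator {t<..T} s * m s \<partial>restrict_space lborel {0..T}) = (LINT s:{t..T}|lborel. m s)"
proof -
  have mb: "(\<lambda>s. indicator {0..T} s *\<^sub>R m s) \<in> borel_measurable lborel"
    using m by (subst (asm) borel_measurable_restrict_space_iff) auto
  have mA: "(\<lambda>s. indicator A s *\<^sub>R m s) \<in> borel_measurable lborel" if A: "A \<in> sets borel" "A \<subseteq> {0..T}" for A
  proof -
    have "(\<lambda>s. indicator A s *\<^sub>R (indicator {0..T} s *\<^sub>R m s)) \<in> borel_measurable lborel"
      using mb A(1) by measurable
    also have "(\<lambda>s. indicator A s *\<^sub>R (indicator {0..T} s *\<^sub>R m s)) = (\<lambda>s. indicator A s *\<^sub>R m s)"
      using A(2) by (auto simp: indicator_def fun_eq_iff)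
    finally show ?thesis .
  qed
  have "(\<integral>s. indicator {t<..T} s * m s \<partial>restrict_space lborel {0..T}) = (LBINT s. indicator {t<..T} s *\<^sub>R m s)"
    by (subst integral_restrict_space) (use assms in \<open>auto intro!: Bochner_Integration.integral_cong simp: indicator_def\<close>)
  also have "\<dots> = (LBINT s. indicator {t..T} s *\<^sub>R m s)"
  proof (rule integral_cong_AE)
    show "AE s in lborel. indicator {t<..T} s *\<^sub>R m s = indicator {t..T} s *\<^sub>R m s"
      using AE_lborel_singleton[of t] by eventually_elim (auto simp: indicator_def)
    show "(\<lambda>s. indicator {t<..T} s *\<^sub>R m s) \<in> borel_measurable lborel" "(\<lambda>s. indicator {t..T} s *\<^sub>R m s) \<in> borel_measurable lborel"
      by (rule mA; use assms in auto)+
  qed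
  finally show ?thesis by (simp add: set_lebesgue_integral_def)
qed

section \<open>Vanishing of the positive part of the difference\<close>

context ito_eq
begin

text \<open>The variable \<open>fd\<close> stands for a difference of one generator at two points,
  to which the growth condition applies, while \<open>f\<close> is the difference of two generators.
  An upper bound suffices because the weight \<open>Phi1\<close> of the drift is
  nonnegative.\<close>

lemma pos_part_zero:
  assumes A: "condA T \<rho>" and C: "C > 0" and al: "\<alpha> < 1"
    and Ym: "(\<lambda>x. Y (fst x) (snd x)) \<in> borel_measurable Q"
    and ffd: "AE x in Q. f x \<le> fd x"
    and fd: "AE x in Q. (fd x)\<^sup>2 \<le> \<rho> (fst x) ((Y (fst x) (snd x))\<^sup>2) + C * (norm (Z x))\<^sup>2"
    and G: "AE x in Q. (norm (G x))\<^sup>2 \<le> \<rho> (fst x) ((Y (fst x) (snd x))\<^sup>2) + \<alpha> * (norm (Z x))\<^sup>2"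
    and t: "t \<in> {0..T}"
  shows "AE \<omega> in P. Y t \<omega> \<le> 0"
proof -
  let ?\<tau> = "restrict_space lborel {0..T}"
  interpret pq: pair_sigma_finite ?\<tau> P by (rule wn.pair_sigma_finite_time)
  \<comment> \<open>Chosen so that \<open>\<alpha> + e * C = 1\<close>: the share of
    \<open>Z\<close> coming from \<open>G\<close> and the share coming from the drift then use up
    the available \<open>Z\<close> term exactly.\<close>
  define e where "e = (1 - \<alpha>) / C"
  have e: "e > 0" using al C by (simp add: e_def)
  have eC: "\<alpha> + e * C = 1" using C by (simp add: e_def)
  define y where "y = (\<lambda>x. (pp (Y (fst x) (snd x)))\<^sup>2)"
  have ym [measurable]: "y \<in> borel_measurable Q" unfolding y_def using Ym by measurable
  have y0: "0 \<le> y x" for x by (simp add: y_def)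
  have ppD: "pp (Y s \<omega>) \<le> D \<omega>" if "s \<in> {0..T}" "\<omega> \<in> space P" for s \<omega>
    by (rule order_trans[OF pp_simps(3) YD[OF that]])
  have yD: "y x \<le> (D (snd x))\<^sup>2" if "x \<in> space Q" for x
    unfolding y_def using that by (intro power_mono ppD) auto
  have D2: "integrable P (\<lambda>\<omega>. (D \<omega>)\<^sup>2)" using sqint_int[OF D] by simp
  have yi: "integrable Q y"
    by (rule Bochner_Integration.integrable_bound[OF wn.integrable_timeprod_snd[OF D2] ym])
       (use yD y0 in \<open>auto intro!: AE_I2\<close>)
  define \<phi> where "\<phi> = (\<lambda>s. \<integral>\<omega>. (pp (Y s \<omega>))\<^sup>2 \<partial>P)"
  have ppi: "integrable P (\<lambda>\<omega>. (pp (Y s \<omega>))\<^sup>2)" if s: "s \<in> {0..T}" for s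
  proof (rule Bochner_Integration.integrable_bound[OF D2])
    show "(\<lambda>\<omega>. (pp (Y s \<omega>))\<^sup>2) \<in> borel_measurable P" using YP[OF s] by measurable
    show "AE \<omega> in P. norm ((pp (Y s \<omega>))\<^sup>2) \<le> norm ((D \<omega>)\<^sup>2)"
      using yD[of "(s, _)"] s by (intro AE_I2) (auto simp: y_def)
  qed
  have \<phi>b: "0 \<le> \<phi> s \<and> \<phi> s \<le> (\<integral>\<omega>. (D \<omega>)\<^sup>2 \<partial>P)" if s: "s \<in> {0..T}" for s
    unfolding \<phi>_def
    by (intro conjI Bochner_Integration.integral_nonneg integral_mono[OF ppi[OF s] D2])
       (use yD[of "(s, _)"] s in \<open>auto simp: y_def\<close>)
  have \<phi>m: "\<phi> \<in> borel_measurable ?\<tau>"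
  proof -
    have "(\<lambda>(s, \<omega>). (pp (Y s \<omega>))\<^sup>2) \<in> borel_measurable (?\<tau> \<Otimes>\<^sub>M P)"
      using ym by (simp add: y_def timeprod_def split_def)
    then show ?thesis unfolding \<phi>_def by (rule wn.borel_measurable_lebesgue_integral)
  qed
  define r where "r = (\<lambda>x. \<rho> (fst x) (y x))"
  have rm [measurable]: "r \<in> borel_measurable Q"
    unfolding r_def by (rule condA_measurable[OF A]) (use y0 in auto)
  have r0: "0 \<le> r x" if "x \<in> space Q" for x
    unfolding r_def by (rule condA_nonneg[OF A]) (use that y0 in auto)
  have \<rho>1: "integrable ?\<tau> (\<lambda>s. \<rho> s 1)"
    using A unfolding condA_def set_integrable_def by (subst integrable_restrict_space) auto
  have ri: "integrable Q r"
  proof (rule Bochner_Integration.integrable_bound[OF _ rm])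
    have "integrable P (\<lambda>\<omega>. 1 + (D \<omega>)\<^sup>2)" using D2 by simp
    from wn.integrable_timeprod_mult[OF this \<rho>1]
    show "integrable Q (\<lambda>x. \<rho> (fst x) 1 * (1 + (D (snd x))\<^sup>2))" .
    show "AE x in Q. norm (r x) \<le> norm (\<rho> (fst x) 1 * (1 + (D (snd x))\<^sup>2))"
    proof (rule AE_I2)
      fix x assume x: "x \<in> space Q"
      then have s: "fst x \<in> {0..T}" by auto
      have "r x \<le> \<rho> (fst x) 1 * (1 + y x)" unfolding r_def by (rule condA_growth[OF A s y0])
      also have "\<dots> \<le> \<rho> (fst x) 1 * (1 + (D (snd x))\<^sup>2)"
        by (rule mult_left_mono) (use yD[OF x] condA_nonneg[OF A s, of 1] in auto)
      finally show "norm (r x) \<le> norm (\<rho> (fst x) 1 * (1 + (D (snd x))\<^sup>2))" using r0[OF x] by simp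
    qed
  qed
  \<comment> \<open>What remains once the \<open>Z\<close> terms have cancelled:
    \<open>y x / e\<close> from Young's inequality, and \<open>\<rho>\<close> once from
    \<open>G\<close> and \<open>e\<close> times from the drift.\<close>
  define H where "H = (\<lambda>x. y x / e + (1 + e) * r x)"
  have Hi: "integrable Q H" unfolding H_def using yi ri by auto
  define m where "m = (\<lambda>s. \<phi> s / e + (1 + e) * \<rho> s (\<phi> s))"
  have \<rho>\<phi>m: "(\<lambda>s. \<rho> s (\<phi> s)) \<in> borel_measurable ?\<tau>"
    by (rule condA_measurable[OF A]) (use \<phi>m \<phi>b in \<open>auto simp: space_restrict_space intro!: measurable_restrict_space1\<close>)
  have mm: "m \<in> borel_measurable ?\<tau>" unfolding m_def using \<phi>m \<rho>\<phi>m by measurable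
  have \<rho>\<phi>i: "set_integrable lborel {s..T} (\<lambda>s. \<rho> s (\<phi> s))" if "s \<in> {0..T}" for s
    by (rule condA_set_integrable[OF A that \<phi>m \<phi>b])
  have \<phi>i: "set_integrable lborel {s..T} \<phi>" if s: "s \<in> {0..T}" for s
  proof -
    have "integrable ?\<tau> \<phi>"
      by (rule finite_measure.integrable_const_bound[OF finite_measure_time, where B="\<integral>\<omega>. (D \<omega>)\<^sup>2 \<partial>P"])
         (use \<phi>b \<phi>m in \<open>auto simp: space_restrict_space intro!: AE_I2\<close>)
    then have "set_integrable lborel {0..T} \<phi>" by (simp add: integrable_restrict_space set_integrable_def)
    then show ?thesis by (rule set_integrable_subset) (use s in auto)
  qed
  have T00: "0 \<in> {0..T}" using T0 by simp
  have mi: "integrable ?\<tau> m"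
  proof -
    have "set_integrable lborel {0..T} m" unfolding m_def using \<rho>\<phi>i[OF T00] \<phi>i[OF T00]
      by (intro set_integral_add set_integrable_mult_right set_integrable_divide) auto
    then show ?thesis by (simp add: integrable_restrict_space set_integrable_def)
  qed
  \<comment> \<open>Concavity of \<open>\<rho>\<close> moves the expectation inside, which closes
    the estimate in terms of \<open>\<phi>\<close> alone.\<close>
  have inner: "(\<integral>\<omega>. H (s, \<omega>) \<partial>P) \<le> m s" if s: "s \<in> {0..T}" for s
  proof -
    note J = condA_jensen[OF wn.prob_space_axioms A s ppi[OF s]]
    have "(\<integral>\<omega>. H (s, \<omega>) \<partial>P) = \<phi> s / e + (1 + e) * (\<integral>\<omega>. \<rho> s ((pp (Y s \<omega>))\<^sup>2) \<partial>P)"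
      unfolding H_def r_def y_def \<phi>_def using ppi[OF s] J(1) by simp
    also have "\<dots> \<le> m s" unfolding m_def using J(2) e by (simp add: \<phi>_def)
    finally show ?thesis .
  qed
  have key: "\<phi> t \<le> (LINT s:{t..T}|lborel. m s)" if t: "t \<in> {0..T}" for t
  proof -
    have Phi_le_m: "(\<integral>\<omega>. Phi d (Y t \<omega>) \<partial>P) \<le> (LINT s:{t..T}|lborel. m s)" if d: "d > 0" for d
    proof -
      note I = ito_ineq[OF d t]
      let ?I = "\<lambda>x. indicator {t<..T} (fst x) :: real"
      let ?EG = "\<lambda>x. ?I x * (Phi2 d (Y (fst x) (snd x)) * (norm (G x))\<^sup>2)"
      let ?EZ = "\<lambda>x. ?I x * (Phi2 d (Y (fst x) (snd x)) * (norm (Z x))\<^sup>2)"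
      let ?Ef = "\<lambda>x. ?I x * (Phi1 d (Y (fst x) (snd x)) * f x)"
      have IHi: "integrable Q (\<lambda>x. ?I x * H x)"
        by (rule Bochner_Integration.integrable_bound[OF Hi]) (use Hi in \<open>auto simp: indicator_def\<close>)
      have "(\<integral>\<omega>. Phi d (Y t \<omega>) \<partial>P) \<le> (\<integral>x. ?EG x / 2 - ?EZ x / 2 + ?Ef x \<partial>Q)"
        using I by simp
      also have "\<dots> \<le> (\<integral>x. ?I x * H x \<partial>Q)"
      proof (rule integral_mono_AE[OF _ IHi])
        show "integrable Q (\<lambda>x. ?EG x / 2 - ?EZ x / 2 + ?Ef x)" using I by simp
        show "AE x in Q. ?EG x / 2 - ?EZ x / 2 + ?Ef x \<le> ?I x * H x"
          using ffd fd G AE_space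
        proof eventually_elim
          case (elim x)
          define v where "v = Y (fst x) (snd x)"
          define n where "n = (norm (Z x))\<^sup>2"
          have H0: "0 \<le> H x" unfolding H_def using e y0 r0[OF elim(4)] by (intro add_nonneg_nonneg mult_nonneg_nonneg divide_nonneg_pos) auto
          have "Phi2 d v * (norm (G x))\<^sup>2 / 2 - Phi2 d v * n / 2 + Phi1 d v * f x \<le> H x"
          proof (cases "v \<le> 0")
            case True
            have "Phi2 d v = 0" by (rule Phi2_nonpos[OF d True])
            moreover have "Phi1 d v = 0" using Phi1_le_Phi2[OF d, of v] Phi1_nonneg[OF d, of v] \<open>Phi2 d v = 0\<close> by simp
            ultimately show ?thesis using H0 by simp
          next
            case False
            then have pv: "pp v = v" by (simp add: pp_def)
            define R where "R = \<rho> (fst x) (v\<^sup>2)"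
            have rR: "r x = R" "y x = v\<^sup>2" using pv by (simp_all add: r_def y_def R_def v_def)
            note P2 = Phi2_bounds[OF d, of v]
            have g1: "Phi2 d v * (norm (G x))\<^sup>2 \<le> Phi2 d v * (R + \<alpha> * n)"
              by (rule mult_left_mono) (use elim(3) P2 in \<open>auto simp: R_def v_def n_def\<close>)
            \<comment> \<open>The drift is put under the weight \<open>Phi2 d v / 2\<close> that the
              other two terms carry, and Young's inequality with parameter \<open>1 / e\<close>
              separates \<open>v\<close> from \<open>fd\<close>.\<close>
            have "Phi1 d v * f x \<le> Phi1 d v * \<bar>fd x\<bar>"
              by (rule mult_left_mono) (use elim(1) Phi1_nonneg[OF d, of v] in auto)
            also have "\<dots> \<le> (v * Phi2 d v) * \<bar>fd x\<bar>"
              by (rule mult_right_mono) (use Phi1_le_Phi2[OF d, of v] pv in auto)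
            also have "\<dots> = Phi2 d v / 2 * (2 * (v * \<bar>fd x\<bar>))" by simp
            also have "\<dots> \<le> Phi2 d v / 2 * ((1 / e) * v\<^sup>2 + \<bar>fd x\<bar>\<^sup>2 / (1 / e))"
              by (rule mult_left_mono[OF two_mult_le_eta]) (use e P2 in auto)
            also have "\<dots> \<le> Phi2 d v / 2 * ((1 / e) * v\<^sup>2 + e * (R + C * n))"
              using elim(2) P2 e by (intro mult_left_mono add_left_mono) (auto simp: R_def v_def n_def mult.commute)
            finally have f1: "Phi1 d v * f x \<le> Phi2 d v / 2 * ((1 / e) * v\<^sup>2 + e * (R + C * n))" .
            have "Phi2 d v * (norm (G x))\<^sup>2 / 2 - Phi2 d v * n / 2 + Phi1 d v * f x
              \<le> Phi2 d v / 2 * (R + \<alpha> * n) - Phi2 d v / 2 * n + Phi2 d v / 2 * ((1 / e) * v\<^sup>2 + e * (R + C * n))"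
              by (rule add_mono[OF diff_mono f1]) (use g1 in auto)
            also have "\<dots> = Phi2 d v / 2 * (v\<^sup>2 / e + (1 + e) * R + (\<alpha> + e * C - 1) * n)"
              by (simp add: algebra_simps)
            also have "\<dots> = Phi2 d v / 2 * H x" unfolding eC H_def rR by simp
            also have "\<dots> \<le> 1 * H x" by (rule mult_right_mono) (use P2 H0 in auto)
            finally show ?thesis by simp
          qed
          then show ?case unfolding v_def[symmetric] n_def[symmetric] using H0
            by (cases "fst x \<in> {t<..T}") auto
        qed
      qed
      also have "\<dots> = (\<integral>s. (\<integral>\<omega>. ?I (s, \<omega>) * H (s, \<omega>) \<partial>P) \<partial>?\<tau>)"
        using pq.integral_fst'[OF IHi[unfolded timeprod_def]] by (simp add: timeprod_def)
      also have "\<dots> \<le> (\<integral>s. indicator {t<..T} s * m s \<partial>?\<tau>)"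
      proof (rule integral_mono_AE)
        show "integrable ?\<tau> (\<lambda>s. \<integral>\<omega>. ?I (s, \<omega>) * H (s, \<omega>) \<partial>P)"
          using pq.integrable_fst'[OF IHi[unfolded timeprod_def]] by simp
        show "integrable ?\<tau> (\<lambda>s. indicator {t<..T} s * m s)"
        proof (rule Bochner_Integration.integrable_bound[OF mi])
          have "(\<lambda>s. indicator {t<..T} s :: real) \<in> borel_measurable ?\<tau>" by (rule measurable_restrict_space1) simp
          then show "(\<lambda>s. indicator {t<..T} s * m s) \<in> borel_measurable ?\<tau>" using mm by (rule borel_measurable_times)
        qed (auto simp: indicator_def)
        show "AE s in ?\<tau>. (\<integral>\<omega>. ?I (s, \<omega>) * H (s, \<omega>) \<partial>P) \<le> indicator {t<..T} s * m s"
          by (rule AE_I2) (use inner in \<open>auto simp: indicator_def space_restrict_space\<close>)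
      qed
      also have "\<dots> = (LINT s:{t..T}|lborel. m s)" by (rule set_integral_restrict_Ioc[OF t mm])
      finally show ?thesis .
    qed
    have ppi1: "integrable P (\<lambda>\<omega>. pp (Y t \<omega>))"
      by (rule Bochner_Integration.integrable_bound[OF wn.sqint_integrable[OF D]])
         (use YP[OF t] ppD[OF t] in \<open>auto intro!: AE_I2 intro: order_trans[OF _ abs_ge_self]\<close>)
    define E where "E = (\<integral>\<omega>. pp (Y t \<omega>) \<partial>P)"
    have E0: "0 \<le> E" unfolding E_def by simp
    show ?thesis
    proof (rule field_le_epsilon)
      fix c :: real assume c: "c > 0"
      \<comment> \<open>\<open>Phi_ge\<close> loses at most \<open>d * E\<close> in expectation,
        which this choice keeps below \<open>c\<close>.\<close>
      define d where "d = c / (E + 1)"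
      have d: "d > 0" using c E0 by (simp add: d_def)
      have "\<phi> t - d * E = (\<integral>\<omega>. (pp (Y t \<omega>))\<^sup>2 - d * pp (Y t \<omega>) \<partial>P)"
        unfolding \<phi>_def E_def using ppi[OF t] ppi1 by simp
      also have "\<dots> \<le> (\<integral>\<omega>. Phi d (Y t \<omega>) \<partial>P)"
        by (rule integral_mono) (use ppi[OF t] ppi1 integrable_Phi[OF d t] Phi_ge[OF d] in auto)
      also have "\<dots> \<le> (LINT s:{t..T}|lborel. m s)" by (rule Phi_le_m[OF d])
      finally have "\<phi> t \<le> (LINT s:{t..T}|lborel. m s) + d * E" by simp
      also have "d * E \<le> d * (E + 1)" using d by simp
      also have "d * (E + 1) = c" using E0 by (simp add: d_def)
      finally show "\<phi> t \<le> (LINT s:{t..T}|lborel. m s) + c" by simp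
    qed
  qed
  have intm: "(LINT s:{s0..T}|lborel. m s) = (LINT s:{s0..T}|lborel. (1 / e) * \<phi> s) + (1 + e) * (LINT s:{s0..T}|lborel. \<rho> s (\<phi> s))"
    if "s0 \<in> {0..T}" for s0
    unfolding m_def using \<rho>\<phi>i[OF that] \<phi>i[OF that] by (subst set_integral_add(2)) auto
  \<comment> \<open>The constant delivered by Gronwall's inequality with rate \<open>1 / e\<close>
    and source factor \<open>1 + e\<close>; bounding \<open>T - t\<close> by \<open>T\<close> makes
    it independent of \<open>t\<close>.\<close>
  define M where "M = 2 * (1 + e) * exp (2 * (T / e))"
  have M: "M > 0" using e by (simp add: M_def)
  have grw: "\<phi> t \<le> M * (LINT s:{t..T}|lborel. \<rho> s (\<phi> s))" if t: "t \<in> {0..T}" for t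
  proof -
    \<comment> \<open>The tail from \<open>t\<close> dominates the tails from all later times, so it
      acts as the constant source while the linear term in \<open>\<phi>\<close> is removed on
      \<open>{t..T}\<close>.\<close>
    define A0 where "A0 = (LINT s:{t..T}|lborel. \<rho> s (\<phi> s))"
    have \<rho>0: "0 \<le> \<rho> s (\<phi> s)" if "s \<in> {0..T}" for s
      by (rule condA_nonneg[OF A that]) (use \<phi>b[OF that] in simp)
    have A0: "0 \<le> A0" unfolding A0_def set_lebesgue_integral_def
      by (rule Bochner_Integration.integral_nonneg) (use \<rho>0 t in \<open>auto simp: indicator_def\<close>)
    have "\<phi> t \<le> 2 * ((1 + e) * A0) * exp (2 * (LINT s:{t..T}|lborel. 1 / e))"
    proof (rule gronwall_tail[where r="\<lambda>s. 1 / e" and v=\<phi> and D="\<integral>\<omega>. (D \<omega>)\<^sup>2 \<partial>P"])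
      show "set_integrable lborel {t..T} (\<lambda>s. 1 / e)"
        unfolding set_integrable_def real_scaleR_def
        by (intro integrable_mult_left integrable_real_indicator) (auto simp: emeasure_lborel_Icc_eq)
      show "set_integrable lborel {t..T} (\<lambda>s. 1 / e * \<phi> s)" using \<phi>i[OF t] by simp
      fix s assume s: "s \<in> {t..T}"
      then have s': "s \<in> {0..T}" using t by auto
      have "(LINT s:{s..T}|lborel. \<rho> s (\<phi> s)) \<le> A0"
        unfolding A0_def set_lebesgue_integral_def
        by (rule integral_mono) (use \<rho>\<phi>i[OF t] \<rho>\<phi>i[OF s'] \<rho>0 s t in \<open>auto simp: set_integrable_def indicator_def\<close>)
      then have "(1 + e) * (LINT s:{s..T}|lborel. \<rho> s (\<phi> s)) \<le> (1 + e) * A0" using e by simp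
      then show "\<phi> s \<le> (1 + e) * A0 + (LINT s:{s..T}|lborel. 1 / e * \<phi> s)"
        using key[OF s'] intm[OF s'] by linarith
    qed (use e t A0 \<phi>b in auto)
    also have "(LINT s:{t..T}|lborel. 1 / e) = (T - t) / e" using t by (simp add: set_lebesgue_integral_def)
    also have "2 * ((1 + e) * A0) * exp (2 * ((T - t) / e)) \<le> 2 * ((1 + e) * A0) * exp (2 * (T / e))"
      using e A0 t by (intro mult_left_mono) (auto simp: divide_right_mono)
    also have "\<dots> = M * A0" by (simp add: M_def)
    finally show ?thesis unfolding A0_def .
  qed
  have "\<phi> t = 0" by (rule osgood_zero[OF A M \<phi>m \<phi>b grw t])
  then have "AE \<omega> in P. (pp (Y t \<omega>))\<^sup>2 = 0"
    using integral_nonneg_eq_0_iff_AE[OF ppi[OF t]] by (simp add: \<phi>_def)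
  then show ?thesis
  proof eventually_elim
    case (elim \<omega>)
    then show ?case using pp_simps(2)[of "Y t \<omega>"] by simp
  qed
qed

end

section \<open>The comparison theorem\<close>

lemma sqint_cong_AE:
  assumes "sqint M f" "g \<in> borel_measurable M" "AE x in M. f x = g x"
  shows "sqint M g"
  unfolding sqint_def
proof (intro conjI assms(2))
  show "integrable M (\<lambda>x. (norm (g x))\<^sup>2)"
    by (rule integrable_cong_AE_imp[OF sqint_int[OF assms(1)]])
       (use assms(2,3) in \<open>auto elim!: eventually_mono\<close>)
qed

text \<open>The pathwise supremum is the natural envelope; it is finite because continuous paths are
  bounded on the compact interval.\<close>

lemma S2sp_bound:
  assumes S: "S2sp P F T \<phi>" and T: "0 < T"
  obtains D where "sqint P D" "\<And>t \<omega>. t \<in> {0..T} \<Longrightarrow> \<omega> \<in> space P \<Longrightarrow> \<bar>\<phi> t \<omega>\<bar> \<le> D \<omega>"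
proof -
  define D where "D = (\<lambda>\<omega>. SUP t\<in>{0..T}. \<bar>\<phi> t \<omega>\<bar>)"
  have i: "integrable P (\<lambda>\<omega>. (D \<omega>)\<^sup>2)" using S by (simp add: S2sp_def D_def)
  have le: "\<bar>\<phi> t \<omega>\<bar> \<le> D \<omega>" if t: "t \<in> {0..T}" and w: "\<omega> \<in> space P" for t \<omega>
  proof -
    have "continuous_on {0..T} (\<lambda>t. \<bar>\<phi> t \<omega>\<bar>)" using S w unfolding S2sp_def by (intro continuous_intros) auto
    then have "bounded ((\<lambda>t. \<bar>\<phi> t \<omega>\<bar>) ` {0..T})" by (intro compact_imp_bounded compact_continuous_image) auto
    then have "bdd_above ((\<lambda>t. \<bar>\<phi> t \<omega>\<bar>) ` {0..T})" by (rule bounded_imp_bdd_above)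
    then show ?thesis unfolding D_def using t by (intro cSUP_upper) auto
  qed
  have D0: "0 \<le> D \<omega>" if "\<omega> \<in> space P" for \<omega> using le[of 0 \<omega>] that T by force
  \<comment> \<open>Measurability of the supremum is recovered from that of its integrable square,
    the supremum being nonnegative.\<close>
  have "(\<lambda>\<omega>. sqrt ((D \<omega>)\<^sup>2)) \<in> borel_measurable P" using i by measurable
  then have "D \<in> borel_measurable P"
    by (rule measurable_cong[THEN iffD1, rotated]) (use D0 in auto)
  then have "sqint P D" using i by (simp add: sqint_def)
  then show ?thesis using le that by blast
qed

text \<open>A continuous process is the limit of its step approximations, which are jointly
  measurable. Half-open blocks miss time \<open>0\<close>, whose slice is added by hand.\<close>

lemma (in prob_space) continuous_process_measurable:
  fixes \<phi> :: "real \<Rightarrow> 'a \<Rightarrow> real"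
  assumes T: "0 < T" and c: "\<And>\<omega>. \<omega> \<in> space M \<Longrightarrow> continuous_on {0..T} (\<lambda>t. \<phi> t \<omega>)"
    and m: "\<And>t. t \<in> {0..T} \<Longrightarrow> \<phi> t \<in> borel_measurable M"
    and D: "sqint M D" "\<And>t \<omega>. t \<in> {0..T} \<Longrightarrow> \<omega> \<in> space M \<Longrightarrow> \<bar>\<phi> t \<omega>\<bar> \<le> D \<omega>"
  shows "(\<lambda>x. \<phi> (fst x) (snd x)) \<in> borel_measurable (timeprod T M)"
proof -
  have mQ: "(\<lambda>x. \<phi> r (snd x)) \<in> borel_measurable (timeprod T M)" if "r \<in> {0..T}" for r
    by (rule measurable_compose[OF snd_timeprod m[OF that]])
  have "integrable (timeprod T M) (\<lambda>x. indicator {0<..T} (fst x) * (\<phi> (fst x) (snd x) * 1))"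
  proof (rule step_integral_tendsto(2)[where \<sigma>=fst and c="\<lambda>r x. \<phi> r (snd x)" and H="\<lambda>_. 1" and D="\<lambda>x. D (snd x)" and tau="\<lambda>n k. grid 0 T n k"])
    show "integrable (timeprod T M) (\<lambda>x. D (snd x))"
      by (rule integrable_timeprod_snd[OF sqint_integrable[OF D(1)]])
  qed (use T c mQ D(2) grid_mono[of 0 T] in auto)
  then have [measurable]: "(\<lambda>x. indicator {0<..T} (fst x) * (\<phi> (fst x) (snd x) * 1)) \<in> borel_measurable (timeprod T M)" by simp
  have [measurable]: "(\<lambda>x. \<phi> 0 (snd x)) \<in> borel_measurable (timeprod T M)" using T by (intro mQ) auto
  have "(\<lambda>x. indicator {0<..T} (fst x) * (\<phi> (fst x) (snd x) * 1) + indicator {0} (fst x) * \<phi> 0 (snd x)) \<in> borel_measurable (timeprod T M)"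
    by measurable
  then show ?thesis
    by (rule measurable_cong[THEN iffD1, rotated]) (auto simp: indicator_def)
qed

text \<open>The growth condition serves twice: it makes the coefficient continuous in
  \<open>(y, z)\<close>, hence jointly measurable after composition, and with the linear growth of
  \<open>\<rho>\<close> it bounds the square by integrable terms.\<close>

lemma (in prob_space) composite_sqint:
  fixes h :: "real \<Rightarrow> 'a \<Rightarrow> real \<Rightarrow> real^'d \<Rightarrow> 'v::euclidean_space"
  assumes A: "condA T \<rho>" and c: "0 \<le> c"
    and hm: "\<And>y z. (\<lambda>(t, \<omega>). h t \<omega> y z) \<in> borel_measurable (restrict_space lborel {0..T} \<Otimes>\<^sub>M M)"
    and h0: "integrable (restrict_space lborel {0..T} \<Otimes>\<^sub>M M) (\<lambda>(t, \<omega>). (norm (h t \<omega> 0 0))\<^sup>2)"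
    and lip: "\<And>t \<omega> y1 y2 z1 z2. t \<in> {0..T} \<Longrightarrow> \<omega> \<in> space M \<Longrightarrow>
        (norm (h t \<omega> y1 z1 - h t \<omega> y2 z2))\<^sup>2 \<le> \<rho> t ((y1 - y2)\<^sup>2) + c * (norm (z1 - z2))\<^sup>2"
    and Y: "Y \<in> borel_measurable (timeprod T M)" and Z: "sqint (timeprod T M) Z"
    and D: "sqint M D" "\<And>x. x \<in> space (timeprod T M) \<Longrightarrow> \<bar>Y x\<bar> \<le> D (snd x)"
  shows "sqint (timeprod T M) (\<lambda>x. h (fst x) (snd x) (Y x) (Z x))"
proof -
  let ?Q = "timeprod T M"
  note Zm = sqint_meas[OF Z]
  have "(\<lambda>x. (\<lambda>x yz. h (fst x) (snd x) (fst yz) (snd yz)) x (Y x, Z x)) \<in> borel_measurable ?Q"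
  proof (rule caratheodory_measurable[where F="\<lambda>x yz. h (fst x) (snd x) (fst yz) (snd yz)"])
    show "(\<lambda>x. h (fst x) (snd x) (fst yz) (snd yz)) \<in> borel_measurable ?Q" for yz
      using hm[of "fst yz" "snd yz"] by (simp add: timeprod_def split_def)
    show "(\<lambda>x. (Y x, Z x)) \<in> borel_measurable ?Q" using Y Zm by (rule borel_measurable_Pair)
    fix x assume "x \<in> space ?Q"
    then have x: "fst x \<in> {0..T}" "snd x \<in> space M" by auto
    show "continuous_on UNIV (\<lambda>yz. h (fst x) (snd x) (fst yz) (snd yz))"
      unfolding continuous_on_def
    proof
      fix p :: "real \<times> (real^'d)"
      \<comment> \<open>A modulus of continuity at \<open>p\<close>; it vanishes there because
        \<open>\<rho>\<close> vanishes at \<open>0\<close>.\<close>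
      define b where "b = (\<lambda>yz. sqrt (\<rho> (fst x) ((fst yz - fst p)\<^sup>2) + c * (norm (snd yz - snd p))\<^sup>2))"
      have "continuous_on UNIV b" unfolding b_def
        by (intro continuous_intros continuous_on_compose2[OF condA_cont[OF A x(1)]]) auto
      then have "(b \<longlongrightarrow> b p) (at p)" unfolding continuous_on_def by blast
      moreover have "b p = 0" using condA_zero[OF A x(1)] by (simp add: b_def)
      ultimately have b0: "(b \<longlongrightarrow> 0) (at p)" by simp
      have "((\<lambda>yz. h (fst x) (snd x) (fst yz) (snd yz) - h (fst x) (snd x) (fst p) (snd p)) \<longlongrightarrow> 0) (at p)"
      proof (rule Lim_null_comparison[OF always_eventually b0], rule allI)
        fix yz
        show "norm (h (fst x) (snd x) (fst yz) (snd yz) - h (fst x) (snd x) (fst p) (snd p)) \<le> b yz"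
          unfolding b_def by (rule real_le_rsqrt[OF lip[OF x]])
      qed
      then show "((\<lambda>yz. h (fst x) (snd x) (fst yz) (snd yz)) \<longlongrightarrow> h (fst x) (snd x) (fst p) (snd p)) (at p within UNIV)"
        by (simp add: LIM_zero_iff)
    qed
  qed
  then have hm': "(\<lambda>x. h (fst x) (snd x) (Y x) (Z x)) \<in> borel_measurable ?Q" by simp
  have h0': "integrable ?Q (\<lambda>x. (norm (h (fst x) (snd x) 0 0))\<^sup>2)" using h0 by (simp add: timeprod_def split_def)
  have \<rho>1: "integrable (restrict_space lborel {0..T}) (\<lambda>s. \<rho> s 1)"
    using A unfolding condA_def set_integrable_def by (subst integrable_restrict_space) auto
  have "integrable M (\<lambda>\<omega>. 1 + (D \<omega>)\<^sup>2)" using sqint_int[OF D(1)] by simp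
  from integrable_timeprod_mult[OF this \<rho>1]
  have ib: "integrable ?Q (\<lambda>x. 2 * (\<rho> (fst x) 1 * (1 + (D (snd x))\<^sup>2) + c * (norm (Z x))\<^sup>2) + 2 * (norm (h (fst x) (snd x) 0 0))\<^sup>2)"
    using sqint_int[OF Z] h0' by auto
  have "integrable ?Q (\<lambda>x. (norm (h (fst x) (snd x) (Y x) (Z x)))\<^sup>2)"
  proof (rule Bochner_Integration.integrable_bound[OF ib])
    show "(\<lambda>x. (norm (h (fst x) (snd x) (Y x) (Z x)))\<^sup>2) \<in> borel_measurable ?Q" using hm' by measurable
    show "AE x in ?Q. norm ((norm (h (fst x) (snd x) (Y x) (Z x)))\<^sup>2)
      \<le> norm (2 * (\<rho> (fst x) 1 * (1 + (D (snd x))\<^sup>2) + c * (norm (Z x))\<^sup>2) + 2 * (norm (h (fst x) (snd x) 0 0))\<^sup>2)"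
    proof (rule AE_I2)
      fix x assume xQ: "x \<in> space ?Q"
      then have x: "fst x \<in> {0..T}" "snd x \<in> space M" by auto
      have "(norm (h (fst x) (snd x) (Y x) (Z x) - h (fst x) (snd x) 0 0))\<^sup>2 \<le> \<rho> (fst x) ((Y x)\<^sup>2) + c * (norm (Z x))\<^sup>2"
        using lip[OF x, of "Y x" "Z x" 0 0] by simp
      also have "\<rho> (fst x) ((Y x)\<^sup>2) \<le> \<rho> (fst x) 1 * (1 + (Y x)\<^sup>2)" by (rule condA_growth[OF A x(1)]) simp
      also have "\<dots> \<le> \<rho> (fst x) 1 * (1 + (D (snd x))\<^sup>2)"
      proof -
        have "\<bar>Y x\<bar>\<^sup>2 \<le> (D (snd x))\<^sup>2" by (rule power_mono[OF D(2)[OF xQ]]) simp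
        then show ?thesis using condA_nonneg[OF A x(1), of 1] by (intro mult_left_mono) auto
      qed
      finally have 1: "(norm (h (fst x) (snd x) (Y x) (Z x) - h (fst x) (snd x) 0 0))\<^sup>2 \<le> \<rho> (fst x) 1 * (1 + (D (snd x))\<^sup>2) + c * (norm (Z x))\<^sup>2" by simp
      have "(norm (h (fst x) (snd x) (Y x) (Z x)))\<^sup>2 = (norm ((h (fst x) (snd x) (Y x) (Z x) - h (fst x) (snd x) 0 0) + h (fst x) (snd x) 0 0))\<^sup>2" by simp
      also have "\<dots> \<le> 2 * (norm (h (fst x) (snd x) (Y x) (Z x) - h (fst x) (snd x) 0 0))\<^sup>2 + 2 * (norm (h (fst x) (snd x) 0 0))\<^sup>2"
        by (rule norm_add_sq_le)
      also have "\<dots> \<le> 2 * (\<rho> (fst x) 1 * (1 + (D (snd x))\<^sup>2) + c * (norm (Z x))\<^sup>2) + 2 * (norm (h (fst x) (snd x) 0 0))\<^sup>2"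
        using 1 by simp
      finally show "norm ((norm (h (fst x) (snd x) (Y x) (Z x)))\<^sup>2)
      \<le> norm (2 * (\<rho> (fst x) 1 * (1 + (D (snd x))\<^sup>2) + c * (norm (Z x))\<^sup>2) + 2 * (norm (h (fst x) (snd x) 0 0))\<^sup>2)"
        by (simp only: real_norm_def abs_power2)
    qed
  qed
  then show ?thesis using hm' by (simp add: sqint_def)
qed

lemma data_hypsD:
  assumes "data_hyps P F T \<rho> C \<alpha> \<xi> f g S"
  shows "C > 0" "0 < \<alpha>" "\<alpha> < 1" "condA T \<rho>" "S2sp P F T S"
    and "t \<in> {0..T} \<Longrightarrow> \<omega> \<in> space P \<Longrightarrow> (f t \<omega> y1 z1 - f t \<omega> y2 z2)\<^sup>2 \<le> \<rho> t ((y1 - y2)\<^sup>2) + C * (norm (z1 - z2))\<^sup>2"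
    and "t \<in> {0..T} \<Longrightarrow> \<omega> \<in> space P \<Longrightarrow> (norm (g t \<omega> y1 z1 - g t \<omega> y2 z2))\<^sup>2 \<le> \<rho> t ((y1 - y2)\<^sup>2) + \<alpha> * (norm (z1 - z2))\<^sup>2"
  using assms unfolding data_hyps_def by blast+

lemma rbdsde_solutionD:
  assumes "rbdsde_solution P W B T \<xi> f g S Y Z K"
  shows "S2sp P (filt P W B T) T Y" "A2sp P (filt P W B T) T K"
    and "t \<in> {0..T} \<Longrightarrow> AE \<omega> in P. S t \<omega> \<le> Y t \<omega>"
    and "AE \<omega> in P. (\<integral>s\<in>{0..T}. (Y s \<omega> - S s \<omega>) \<partial>interval_measure (\<lambda>s. K (max 0 (min T s)) \<omega>)) = 0"
  using assms unfolding rbdsde_solution_def by blast+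

lemma S2spD:
  assumes "S2sp P F T \<phi>"
  shows "\<omega> \<in> space P \<Longrightarrow> continuous_on {0..T} (\<lambda>t. \<phi> t \<omega>)" and "t \<in> {0..T} \<Longrightarrow> \<phi> t \<in> borel_measurable (F t)"
  using assms unfolding S2sp_def by blast+

lemma A2spD:
  assumes "A2sp P F T \<phi>"
  shows "\<omega> \<in> space P \<Longrightarrow> continuous_on {0..T} (\<lambda>t. \<phi> t \<omega>) \<and> mono_on {0..T} (\<lambda>t. \<phi> t \<omega>)"
    and "t \<in> {0..T} \<Longrightarrow> \<phi> t \<in> borel_measurable (F t)"
  using assms unfolding A2sp_def by blast+

section \<open>Solutions in the concrete setting\<close>

locale bdsde_setting =
  fixes M1 :: "'a measure" and M2 :: "'b measure" and W :: "real \<Rightarrow> 'a \<Rightarrow> real^'d" and B :: "real \<Rightarrow> 'b \<Rightarrow> real^'l" and T :: real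
  assumes T0: "0 < T" and prob: "prob_space M1" "prob_space M2"
    and bms: "brownian_motion M1 W" "brownian_motion M2 B"
begin

abbreviation P :: "('a \<times> 'b) measure" where "P \<equiv> prodP M1 M2"
abbreviation F :: "real \<Rightarrow> ('a \<times> 'b) measure" where "F \<equiv> filt P (liftW W) (liftB B) T"

sublocale w: bm_proj P M1 M2 fst snd W by (rule bm_proj_prodP(1)[OF prob bms(1)])
sublocale b: bm_proj P M2 M1 snd fst B by (rule bm_proj_prodP(2)[OF prob bms(2)])
sublocale wn: noise P T "\<lambda>u v. w.Gfwd u" w.incr by (rule w.noise_fwd)
sublocale bn: noise P T "\<lambda>u v. b.Gbwd v" b.incr by (rule b.noise_bwd)

text \<open>Adaptedness enters the argument in this form only: membership in both enlarged
  sigma-algebras at once.\<close>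

lemma F_meas:
  assumes "h \<in> borel_measurable (F t)"
  shows "h \<in> borel_measurable (w.Gfwd t)" "h \<in> borel_measurable (b.Gbwd t)" "h \<in> borel_measurable P"
proof -
  show 1: "h \<in> borel_measurable (w.Gfwd t)"
    by (rule w.measurable_mono_sets[OF assms filt_subset(1)[OF prob bms]]) simp
  show "h \<in> borel_measurable (b.Gbwd t)"
    by (rule w.measurable_mono_sets[OF assms filt_subset(2)[OF prob bms]]) simp
  show "h \<in> borel_measurable P" by (rule w.measurable_mono_sets[OF 1 w.G_P(1)]) simp
qed

lemma ito_fwd_ITO:
  assumes "ito_fwd P F (liftW W) a T Z X" and a: "0 \<le> a" and Z: "sqint (timeprod T P) (\<lambda>(s, \<omega>). Z s \<omega>)"
  shows "wn.ITO a T (\<lambda>(s, \<omega>). Z s \<omega>) X"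
proof -
  obtain m tt h where *: "X \<in> borel_measurable P" "\<And>n. Defs.partition_on a T (m n) (tt n)"
    "\<And>n k. k < m n \<Longrightarrow> h n k \<in> borel_measurable (F (tt n k)) \<and> integrable P (\<lambda>\<omega>. (norm (h n k \<omega>))\<^sup>2)"
    "(\<lambda>n. \<integral>\<^sup>+\<omega>. (\<integral>\<^sup>+s\<in>{a..T}. ennreal ((norm (simple_proc (m n) (tt n) (h n) s \<omega> - Z s \<omega>))\<^sup>2) \<partial>lborel) \<partial>P) \<longlonglongrightarrow> 0"
    "(\<lambda>n. \<integral>\<^sup>+\<omega>. ennreal ((X \<omega> - (\<Sum>k<m n. h n k \<omega> \<bullet> (liftW W (tt n (Suc k)) \<omega> - liftW W (tt n k) \<omega>)))\<^sup>2) \<partial>P) \<longlonglongrightarrow> 0"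
    using assms(1) unfolding ito_fwd_def by blast
  show ?thesis
  proof (rule wn.ITO_of_simple[OF a order_refl Z *(1,2) _ *(4)])
    show "(\<lambda>n. \<integral>\<^sup>+\<omega>. ennreal ((X \<omega> - (\<Sum>k<m n. h n k \<omega> \<bullet> w.incr (tt n k) (tt n (Suc k)) \<omega>))\<^sup>2) \<partial>P) \<longlonglongrightarrow> 0"
      using *(5) by (simp add: w.incr_def liftW_def)
  qed (use *(3) F_meas(1) in blast)
qed

lemma ito_bwd_ITO:
  assumes "ito_bwd P F (liftB B) a T G X" and a: "0 \<le> a" and G: "sqint (timeprod T P) (\<lambda>(s, \<omega>). G s \<omega>)"
  shows "bn.ITO a T (\<lambda>(s, \<omega>). G s \<omega>) X"
proof -
  obtain m tt h where *: "X \<in> borel_measurable P" "\<And>n. Defs.partition_on a T (m n) (tt n)"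
    "\<And>n k. k < m n \<Longrightarrow> h n k \<in> borel_measurable (F (tt n (Suc k))) \<and> integrable P (\<lambda>\<omega>. (norm (h n k \<omega>))\<^sup>2)"
    "(\<lambda>n. \<integral>\<^sup>+\<omega>. (\<integral>\<^sup>+s\<in>{a..T}. ennreal ((norm (simple_proc (m n) (tt n) (h n) s \<omega> - G s \<omega>))\<^sup>2) \<partial>lborel) \<partial>P) \<longlonglongrightarrow> 0"
    "(\<lambda>n. \<integral>\<^sup>+\<omega>. ennreal ((X \<omega> - (\<Sum>k<m n. h n k \<omega> \<bullet> (liftB B (tt n (Suc k)) \<omega> - liftB B (tt n k) \<omega>)))\<^sup>2) \<partial>P) \<longlonglongrightarrow> 0"
    using assms(1) unfolding ito_bwd_def by blast
  show ?thesis
  proof (rule bn.ITO_of_simple[OF a order_refl G *(1,2) _ *(4)])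
    show "(\<lambda>n. \<integral>\<^sup>+\<omega>. ennreal ((X \<omega> - (\<Sum>k<m n. h n k \<omega> \<bullet> b.incr (tt n k) (tt n (Suc k)) \<omega>))\<^sup>2) \<partial>P) \<longlonglongrightarrow> 0"
      using *(5) by (simp add: b.incr_def liftB_def)
  qed (use *(3) F_meas(2) in blast)
qed

lemma data_sqint:
  assumes H: "data_hyps P F T \<rho> C \<alpha> \<xi> f g S"
    and Y: "Yp \<in> borel_measurable (timeprod T P)" and Z: "sqint (timeprod T P) Zp"
    and D: "sqint P D" "\<And>x. x \<in> space (timeprod T P) \<Longrightarrow> \<bar>Yp x\<bar> \<le> D (snd x)"
  shows "sqint (timeprod T P) (\<lambda>x. f (fst x) (snd x) (Yp x) (Zp x))"
    and "sqint (timeprod T P) (\<lambda>x. g (fst x) (snd x) (Yp x) (Zp x))"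
proof -
  have fm: "\<And>y z. (\<lambda>(t, \<omega>). f t \<omega> y z) \<in> borel_measurable (restrict_space lborel {0..T} \<Otimes>\<^sub>M P)"
    and gm: "\<And>y z. (\<lambda>(t, \<omega>). g t \<omega> y z) \<in> borel_measurable (restrict_space lborel {0..T} \<Otimes>\<^sub>M P)"
    and f0: "M2sp P F T (\<lambda>t \<omega>. f t \<omega> 0 0)" and g0: "M2sp P F T (\<lambda>t \<omega>. g t \<omega> 0 0)"
    and C: "C > 0" and al: "0 < \<alpha>" "\<alpha> < 1" and A: "condA T \<rho>"
    using H unfolding data_hyps_def by auto
  have lip: "(norm (f t \<omega> y1 z1 - f t \<omega> y2 z2))\<^sup>2 \<le> \<rho> t ((y1 - y2)\<^sup>2) + C * (norm (z1 - z2))\<^sup>2"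
    "(norm (g t \<omega> y1 z1 - g t \<omega> y2 z2))\<^sup>2 \<le> \<rho> t ((y1 - y2)\<^sup>2) + \<alpha> * (norm (z1 - z2))\<^sup>2"
    if "t \<in> {0..T}" "\<omega> \<in> space P" for t \<omega> y1 y2 z1 z2
    using H that unfolding data_hyps_def real_norm_def power2_abs by blast+
  show "sqint (timeprod T P) (\<lambda>x. f (fst x) (snd x) (Yp x) (Zp x))"
    by (rule w.composite_sqint[OF A _ fm _ lip(1) Y Z D]) (use C f0 in \<open>auto simp: M2sp_def\<close>)
  show "sqint (timeprod T P) (\<lambda>x. g (fst x) (snd x) (Yp x) (Zp x))"
    by (rule w.composite_sqint[OF A _ gm _ lip(2) Y Z D]) (use al g0 in \<open>auto simp: M2sp_def\<close>)
qed

text \<open>The exceptional set in \<open>\<omega>\<close> varies with the time; joint measurability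
  of both sides combines the slices into one null set of the product.\<close>

lemma AE_timeprod_le:
  fixes u v :: "real \<times> ('a \<times> 'b) \<Rightarrow> real"
  assumes "u \<in> borel_measurable (timeprod T P)" "v \<in> borel_measurable (timeprod T P)"
    and "AE t in lborel. t \<in> {0..T} \<longrightarrow> (AE \<omega> in P. u (t, \<omega>) \<le> v (t, \<omega>))"
  shows "AE x in timeprod T P. u x \<le> v x"
proof -
  interpret pq: pair_sigma_finite "restrict_space lborel {0..T}" P by (rule w.pair_sigma_finite_time)
  have "{x \<in> space (timeprod T P). u x \<le> v x} \<in> sets (timeprod T P)" using assms(1,2) by measurable
  moreover have "AE t in restrict_space lborel {0..T}. AE \<omega> in P. u (t, \<omega>) \<le> v (t, \<omega>)"
    using assms(3) by (subst AE_restrict_space_iff) auto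
  ultimately show ?thesis unfolding timeprod_def by (rule pq.AE_pair_measure)
qed

text \<open>Translates a solution into the objects of the abstract argument. The increment of
  \<open>K\<close> needs its own proof, because \<open>A2sp\<close> controls only \<open>K T\<close>
  in mean square and leaves the initial value free.\<close>

lemma solution_facts:
  fixes Z :: "real \<Rightarrow> 'a \<times> 'b \<Rightarrow> real^'d" and g :: "real \<Rightarrow> 'a \<times> 'b \<Rightarrow> real \<Rightarrow> real^'d \<Rightarrow> real^'l"
  assumes H: "data_hyps P F T \<rho> C \<alpha> \<xi> f g S" and sol: "rbdsde_solution P (liftW W) (liftB B) T \<xi> f g S Y Z K"
  defines "Yp \<equiv> \<lambda>x. Y (fst x) (snd x)" and "Zp \<equiv> \<lambda>x. Z (fst x) (snd x)"
  defines "fp \<equiv> \<lambda>x. f (fst x) (snd x) (Yp x) (Zp x)" and "gp \<equiv> \<lambda>x. g (fst x) (snd x) (Yp x) (Zp x)"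
  shows "Yp \<in> borel_measurable (timeprod T P)" "sqint (timeprod T P) Zp" "sqint (timeprod T P) fp" "sqint (timeprod T P) gp"
    and "\<exists>IB IW. \<forall>r\<in>{0..T}. bn.ITO r T gp (IB r) \<and> wn.ITO r T Zp (IW r) \<and>
       (AE \<omega> in P. Y r \<omega> = \<xi> \<omega> + (LINT s:{r..T}|lborel. fp (s, \<omega>)) + IB r \<omega> + K T \<omega> - K r \<omega> - IW r \<omega>)"
    and "sqint P (\<lambda>\<omega>. K T \<omega> - K 0 \<omega>)"
proof -
  have Y: "S2sp P F T Y" and Z: "M2sp P F T Z" and K: "A2sp P F T K"
    using sol by (auto simp: rbdsde_solution_def)
  have xi: "\<xi> \<in> borel_measurable (F T)" "integrable P (\<lambda>\<omega>. (\<xi> \<omega>)\<^sup>2)"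
    using H unfolding data_hyps_def by auto
  obtain D where D: "sqint P D" "\<And>t \<omega>. t \<in> {0..T} \<Longrightarrow> \<omega> \<in> space P \<Longrightarrow> \<bar>Y t \<omega>\<bar> \<le> D \<omega>"
    by (rule S2sp_bound[OF Y T0]) blast
  have YP: "Y t \<in> borel_measurable P" if "t \<in> {0..T}" for t
    using Y that F_meas(3) unfolding S2sp_def by blast
  show Yp: "Yp \<in> borel_measurable (timeprod T P)" unfolding Yp_def
    by (rule w.continuous_process_measurable[OF T0 _ YP D]) (use Y in \<open>auto simp: S2sp_def\<close>)
  have DQ: "\<bar>Yp x\<bar> \<le> D (snd x)" if "x \<in> space (timeprod T P)" for x
    unfolding Yp_def using that by (intro D) auto
  show sZ: "sqint (timeprod T P) Zp"
    using Z unfolding M2sp_def sqint_def Zp_def timeprod_def by (simp add: split_def)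
  show sf: "sqint (timeprod T P) fp" unfolding fp_def by (rule data_sqint(1)[OF H Yp sZ D(1) DQ])
  show sg: "sqint (timeprod T P) gp" unfolding gp_def by (rule data_sqint(2)[OF H Yp sZ D(1) DQ])
  have gpe: "(\<lambda>(s, \<omega>). g s \<omega> (Y s \<omega>) (Z s \<omega>)) = gp" and Zpe: "(\<lambda>(s, \<omega>). Z s \<omega>) = Zp"
    by (auto simp: gp_def Yp_def Zp_def)
  have ex: "\<exists>IB IW. bn.ITO r T gp IB \<and> wn.ITO r T Zp IW \<and>
       (AE \<omega> in P. Y r \<omega> = \<xi> \<omega> + (LINT s:{r..T}|lborel. fp (s, \<omega>)) + IB \<omega> + K T \<omega> - K r \<omega> - IW \<omega>)"
    if r: "r \<in> {0..T}" for r
  proof -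
    obtain IB IW where I: "ito_bwd P F (liftB B) r T (\<lambda>s \<omega>. g s \<omega> (Y s \<omega>) (Z s \<omega>)) IB"
      "ito_fwd P F (liftW W) r T Z IW"
      "AE \<omega> in P. Y r \<omega> = \<xi> \<omega> + (\<integral>s\<in>{r..T}. f s \<omega> (Y s \<omega>) (Z s \<omega>) \<partial>lborel) + IB \<omega> + K T \<omega> - K r \<omega> - IW \<omega>"
      using sol r unfolding rbdsde_solution_def by blast
    have "bn.ITO r T gp IB" using ito_bwd_ITO[OF I(1)] r sg unfolding gpe by simp
    moreover have "wn.ITO r T Zp IW" using ito_fwd_ITO[OF I(2)] r sZ unfolding Zpe by simp
    moreover have "AE \<omega> in P. Y r \<omega> = \<xi> \<omega> + (LINT s:{r..T}|lborel. fp (s, \<omega>)) + IB \<omega> + K T \<omega> - K r \<omega> - IW \<omega>"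
      using I(3) unfolding fp_def Yp_def Zp_def fst_conv snd_conv .
    ultimately show ?thesis by (intro exI conjI)
  qed
  \<comment> \<open>The integrals are given separately for each starting time; encoding both as a
    pair lets one choice produce the two families.\<close>
  have "\<forall>r\<in>{0..T}. \<exists>p. bn.ITO r T gp (fst p) \<and> wn.ITO r T Zp (snd p) \<and>
       (AE \<omega> in P. Y r \<omega> = \<xi> \<omega> + (LINT s:{r..T}|lborel. fp (s, \<omega>)) + fst p \<omega> + K T \<omega> - K r \<omega> - snd p \<omega>)"
  proof
    fix r assume "r \<in> {0..T}"
    from ex[OF this] obtain IB IW where "bn.ITO r T gp IB \<and> wn.ITO r T Zp IW \<and>
       (AE \<omega> in P. Y r \<omega> = \<xi> \<omega> + (LINT s:{r..T}|lborel. fp (s, \<omega>)) + IB \<omega> + K T \<omega> - K r \<omega> - IW \<omega>)" by (elim exE)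
    then show "\<exists>p. bn.ITO r T gp (fst p) \<and> wn.ITO r T Zp (snd p) \<and>
       (AE \<omega> in P. Y r \<omega> = \<xi> \<omega> + (LINT s:{r..T}|lborel. fp (s, \<omega>)) + fst p \<omega> + K T \<omega> - K r \<omega> - snd p \<omega>)"
      by (intro exI[of _ "(IB, IW)"]) (simp only: fst_conv snd_conv)
  qed
  from bchoice[OF this] obtain p where "\<forall>r\<in>{0..T}. bn.ITO r T gp (fst (p r)) \<and> wn.ITO r T Zp (snd (p r)) \<and>
       (AE \<omega> in P. Y r \<omega> = \<xi> \<omega> + (LINT s:{r..T}|lborel. fp (s, \<omega>)) + fst (p r) \<omega> + K T \<omega> - K r \<omega> - snd (p r) \<omega>)" ..
  then show "\<exists>IB IW. \<forall>r\<in>{0..T}. bn.ITO r T gp (IB r) \<and> wn.ITO r T Zp (IW r) \<and>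
       (AE \<omega> in P. Y r \<omega> = \<xi> \<omega> + (LINT s:{r..T}|lborel. fp (s, \<omega>)) + IB r \<omega> + K T \<omega> - K r \<omega> - IW r \<omega>)"
    by (intro exI[of _ "\<lambda>r. fst (p r)"] exI[of _ "\<lambda>r. snd (p r)"])
  have T00: "0 \<in> {0..T}" "T \<in> {0..T}" using T0 by auto
  obtain IB IW where I: "bn.ITO 0 T gp IB" "wn.ITO 0 T Zp IW"
     "AE \<omega> in P. Y 0 \<omega> = \<xi> \<omega> + (LINT s:{0..T}|lborel. fp (s, \<omega>)) + IB \<omega> + K T \<omega> - K 0 \<omega> - IW \<omega>"
    using ex[OF T00(1)] by (elim exE conjE)
  have KP: "K t \<in> borel_measurable P" if "t \<in> {0..T}" for t
    using K that F_meas(3) unfolding A2sp_def by blast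
  have sxi: "sqint P \<xi>" using xi F_meas(3) by (simp add: sqint_def)
  have sY0: "sqint P (Y 0)"
    by (rule sqint_le[OF D(1) YP[OF T00(1)]]) (use D(2)[OF T00(1)] in \<open>auto intro: order_trans[OF _ abs_ge_self]\<close>)
  have fi: "integrable (timeprod T P) fp" by (rule finite_measure.sqint_integrable[OF wn.finite_measure_Q sf])
  have sF: "sqint P (w.time_int T fp 0 T)" by (rule w.time_int_sq(1)[OF sf]) (use T0 in auto)
  have dF: "AE \<omega> in P. (LINT s:{0..T}|lborel. fp (s, \<omega>)) - (LINT s:{T..T}|lborel. fp (s, \<omega>)) = w.time_int T fp 0 T \<omega>"
    by (rule w.time_int_diff[OF fi]) (use T0 in auto)
  \<comment> \<open>The equation at time \<open>0\<close>, solved for \<open>K T - K 0\<close>,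
    expresses the increment by square integrable terms.\<close>
  have "sqint P (\<lambda>\<omega>. (((Y 0 \<omega> - \<xi> \<omega>) - w.time_int T fp 0 T \<omega>) - IB \<omega>) + IW \<omega>)"
    by (intro sqint_add(1) sqint_diff(1) sY0 sxi sF bn.ITO_sqint(1)[OF I(1)] wn.ITO_sqint(1)[OF I(2)])
  then show "sqint P (\<lambda>\<omega>. K T \<omega> - K 0 \<omega>)"
  proof (rule sqint_cong_AE)
    show "(\<lambda>\<omega>. K T \<omega> - K 0 \<omega>) \<in> borel_measurable P" using KP[OF T00(1)] KP[OF T00(2)] by measurable
    show "AE \<omega> in P. (((Y 0 \<omega> - \<xi> \<omega>) - w.time_int T fp 0 T \<omega>) - IB \<omega>) + IW \<omega> = K T \<omega> - K 0 \<omega>"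
      using I(3) dF
    proof eventually_elim
      case (elim \<omega>)
      show ?case using elim unfolding set_integral_singleton_zero by linarith
    qed
  qed
qed

end

theorem theorem2p2:
  fixes M1 :: "'a measure" and M2 :: "'b measure"
    and W :: "real \<Rightarrow> 'a \<Rightarrow> real^'d" and B :: "real \<Rightarrow> 'b \<Rightarrow> real^'l"
    and T C \<alpha> :: real and \<rho> :: "real \<Rightarrow> real \<Rightarrow> real"
    and \<xi>1 \<xi>2 :: "'a \<times> 'b \<Rightarrow> real"
    and f1 f2 :: "real \<Rightarrow> 'a \<times> 'b \<Rightarrow> real \<Rightarrow> real^'d \<Rightarrow> real"
    and g :: "real \<Rightarrow> 'a \<times> 'b \<Rightarrow> real \<Rightarrow> real^'d \<Rightarrow> real^'l"
    and S1 S2 Y1 Y2 K1 K2 :: "real \<Rightarrow> 'a \<times> 'b \<Rightarrow> real"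
    and Z1 Z2 :: "real \<Rightarrow> 'a \<times> 'b \<Rightarrow> real^'d"
  assumes "T > 0"
    and "prob_space M1" "complete_measure M1" "prob_space M2" "complete_measure M2"
    and "brownian_motion M1 W" "brownian_motion M2 B"
    and "data_hyps (prodP M1 M2) (filt (prodP M1 M2) (liftW W) (liftB B) T) T \<rho> C \<alpha> \<xi>1 f1 g S1"
    and "data_hyps (prodP M1 M2) (filt (prodP M1 M2) (liftW W) (liftB B) T) T \<rho> C \<alpha> \<xi>2 f2 g S2"
    and "rbdsde_solution (prodP M1 M2) (liftW W) (liftB B) T \<xi>1 f1 g S1 Y1 Z1 K1"
    and "rbdsde_solution (prodP M1 M2) (liftW W) (liftB B) T \<xi>2 f2 g S2 Y2 Z2 K2"
    and "AE \<omega> in prodP M1 M2. \<xi>1 \<omega> \<le> \<xi>2 \<omega>"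
    and "(AE t in lborel. t \<in> {0..T} \<longrightarrow>
            (AE \<omega> in prodP M1 M2. f1 t \<omega> (Y1 t \<omega>) (Z1 t \<omega>) \<le> f2 t \<omega> (Y1 t \<omega>) (Z1 t \<omega>)))
       \<or> (AE t in lborel. t \<in> {0..T} \<longrightarrow>
            (AE \<omega> in prodP M1 M2. f1 t \<omega> (Y2 t \<omega>) (Z2 t \<omega>) \<le> f2 t \<omega> (Y2 t \<omega>) (Z2 t \<omega>)))"
    and "AE t in lborel. t \<in> {0..T} \<longrightarrow> (AE \<omega> in prodP M1 M2. S1 t \<omega> \<le> S2 t \<omega>)"
  shows "\<forall>t\<in>{0..T}. AE \<omega> in prodP M1 M2. Y1 t \<omega> \<le> Y2 t \<omega>"
proof
  fix t assume t: "t \<in> {0..T}"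
  interpret bdsde_setting M1 M2 W B T by (rule bdsde_setting.intro[OF assms(1,2,4,6,7)])
  let ?Q = "timeprod T P"
  note H1 = assms(8) and H2 = assms(9) and sol1 = assms(10) and sol2 = assms(11)
  note s1 = solution_facts[OF H1 sol1] and s2 = solution_facts[OF H2 sol2]
  have S2: "S2sp P F T Y1" "S2sp P F T Y2" "S2sp P F T S1" "S2sp P F T S2" and A2: "A2sp P F T K1" "A2sp P F T K2"
    by (rule rbdsde_solutionD[OF sol1] rbdsde_solutionD[OF sol2] data_hypsD(5)[OF H1] data_hypsD(5)[OF H2])+
  have cY: "continuous_on {0..T} (\<lambda>t. Y1 t \<omega>)" "continuous_on {0..T} (\<lambda>t. Y2 t \<omega>)"
    "continuous_on {0..T} (\<lambda>t. S1 t \<omega>)" "continuous_on {0..T} (\<lambda>t. S2 t \<omega>)" if "\<omega> \<in> space P" for \<omega>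
    by (rule S2[THEN S2spD(1), OF that])+
  have mY: "Y1 t \<in> borel_measurable (F t)" "Y2 t \<in> borel_measurable (F t)" "S1 t \<in> borel_measurable (F t)" if "t \<in> {0..T}" for t
    by (rule S2[THEN S2spD(2), OF that])+
  have cK: "continuous_on {0..T} (\<lambda>t. K1 t \<omega>) \<and> mono_on {0..T} (\<lambda>t. K1 t \<omega>)"
    "continuous_on {0..T} (\<lambda>t. K2 t \<omega>) \<and> mono_on {0..T} (\<lambda>t. K2 t \<omega>)" if "\<omega> \<in> space P" for \<omega>
    by (rule A2[THEN A2spD(1), OF that])+
  have mK: "K1 t \<in> borel_measurable P" "K2 t \<in> borel_measurable P" if "t \<in> {0..T}" for t
    by (rule F_meas(3)[OF A2(1)[THEN A2spD(2), OF that]], rule F_meas(3)[OF A2(2)[THEN A2spD(2), OF that]])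
  obtain D1 where D1: "sqint P D1" "\<And>t \<omega>. t \<in> {0..T} \<Longrightarrow> \<omega> \<in> space P \<Longrightarrow> \<bar>Y1 t \<omega>\<bar> \<le> D1 \<omega>"
    by (rule S2sp_bound[OF S2(1) T0]) blast
  obtain D2 where D2: "sqint P D2" "\<And>t \<omega>. t \<in> {0..T} \<Longrightarrow> \<omega> \<in> space P \<Longrightarrow> \<bar>Y2 t \<omega>\<bar> \<le> D2 \<omega>"
    by (rule S2sp_bound[OF S2(2) T0]) blast
  obtain DS where DS: "sqint P DS" "\<And>t \<omega>. t \<in> {0..T} \<Longrightarrow> \<omega> \<in> space P \<Longrightarrow> \<bar>S1 t \<omega>\<bar> \<le> DS \<omega>"
    by (rule S2sp_bound[OF S2(3) T0]) blast
  obtain IB1 IW1 where I1: "\<And>r. r \<in> {0..T} \<Longrightarrow> bn.ITO r T (\<lambda>x. g (fst x) (snd x) (Y1 (fst x) (snd x)) (Z1 (fst x) (snd x))) (IB1 r)"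
    "\<And>r. r \<in> {0..T} \<Longrightarrow> wn.ITO r T (\<lambda>x. Z1 (fst x) (snd x)) (IW1 r)"
    "\<And>r. r \<in> {0..T} \<Longrightarrow> AE \<omega> in P. Y1 r \<omega> = \<xi>1 \<omega> + (LINT s:{r..T}|lborel. f1 s \<omega> (Y1 s \<omega>) (Z1 s \<omega>)) + IB1 r \<omega> + K1 T \<omega> - K1 r \<omega> - IW1 r \<omega>"
  proof -
    from s1(5) obtain IB IW where I: "\<forall>r\<in>{0..T}. bn.ITO r T (\<lambda>x. g (fst x) (snd x) (Y1 (fst x) (snd x)) (Z1 (fst x) (snd x))) (IB r)
      \<and> wn.ITO r T (\<lambda>x. Z1 (fst x) (snd x)) (IW r) \<and>
      (AE \<omega> in P. Y1 r \<omega> = \<xi>1 \<omega> + (LINT s:{r..T}|lborel. f1 s \<omega> (Y1 s \<omega>) (Z1 s \<omega>)) + IB r \<omega> + K1 T \<omega> - K1 r \<omega> - IW r \<omega>)"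
      unfolding fst_conv snd_conv by (elim exE)
    show thesis
    proof (rule that[of IB IW])
      fix r assume "r \<in> {0..T}"
      note I = bspec[OF I this]
      show "bn.ITO r T (\<lambda>x. g (fst x) (snd x) (Y1 (fst x) (snd x)) (Z1 (fst x) (snd x))) (IB r)" by (rule conjunct1[OF I])
      show "wn.ITO r T (\<lambda>x. Z1 (fst x) (snd x)) (IW r)" by (rule conjunct1[OF conjunct2[OF I]])
      show "AE \<omega> in P. Y1 r \<omega> = \<xi>1 \<omega> + (LINT s:{r..T}|lborel. f1 s \<omega> (Y1 s \<omega>) (Z1 s \<omega>)) + IB r \<omega> + K1 T \<omega> - K1 r \<omega> - IW r \<omega>"
        by (rule conjunct2[OF conjunct2[OF I]])
    qed
  qed
  obtain IB2 IW2 where I2: "\<And>r. r \<in> {0..T} \<Longrightarrow> bn.ITO r T (\<lambda>x. g (fst x) (snd x) (Y2 (fst x) (snd x)) (Z2 (fst x) (snd x))) (IB2 r)"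
    "\<And>r. r \<in> {0..T} \<Longrightarrow> wn.ITO r T (\<lambda>x. Z2 (fst x) (snd x)) (IW2 r)"
    "\<And>r. r \<in> {0..T} \<Longrightarrow> AE \<omega> in P. Y2 r \<omega> = \<xi>2 \<omega> + (LINT s:{r..T}|lborel. f2 s \<omega> (Y2 s \<omega>) (Z2 s \<omega>)) + IB2 r \<omega> + K2 T \<omega> - K2 r \<omega> - IW2 r \<omega>"
  proof -
    from s2(5) obtain IB IW where I: "\<forall>r\<in>{0..T}. bn.ITO r T (\<lambda>x. g (fst x) (snd x) (Y2 (fst x) (snd x)) (Z2 (fst x) (snd x))) (IB r)
      \<and> wn.ITO r T (\<lambda>x. Z2 (fst x) (snd x)) (IW r) \<and>
      (AE \<omega> in P. Y2 r \<omega> = \<xi>2 \<omega> + (LINT s:{r..T}|lborel. f2 s \<omega> (Y2 s \<omega>) (Z2 s \<omega>)) + IB r \<omega> + K2 T \<omega> - K2 r \<omega> - IW r \<omega>)"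
      unfolding fst_conv snd_conv by (elim exE)
    show thesis
    proof (rule that[of IB IW])
      fix r assume "r \<in> {0..T}"
      note I = bspec[OF I this]
      show "bn.ITO r T (\<lambda>x. g (fst x) (snd x) (Y2 (fst x) (snd x)) (Z2 (fst x) (snd x))) (IB r)" by (rule conjunct1[OF I])
      show "wn.ITO r T (\<lambda>x. Z2 (fst x) (snd x)) (IW r)" by (rule conjunct1[OF conjunct2[OF I]])
      show "AE \<omega> in P. Y2 r \<omega> = \<xi>2 \<omega> + (LINT s:{r..T}|lborel. f2 s \<omega> (Y2 s \<omega>) (Z2 s \<omega>)) + IB r \<omega> + K2 T \<omega> - K2 r \<omega> - IW r \<omega>"
        by (rule conjunct2[OF conjunct2[OF I]])
    qed
  qed
  have C: "C > 0" and al: "\<alpha> < 1" and A: "condA T \<rho>" by (rule data_hypsD[OF H1])+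
  have lip: "(f1 t \<omega> y1 z1 - f1 t \<omega> y2 z2)\<^sup>2 \<le> \<rho> t ((y1 - y2)\<^sup>2) + C * (norm (z1 - z2))\<^sup>2"
    "(f2 t \<omega> y1 z1 - f2 t \<omega> y2 z2)\<^sup>2 \<le> \<rho> t ((y1 - y2)\<^sup>2) + C * (norm (z1 - z2))\<^sup>2"
    "(norm (g t \<omega> y1 z1 - g t \<omega> y2 z2))\<^sup>2 \<le> \<rho> t ((y1 - y2)\<^sup>2) + \<alpha> * (norm (z1 - z2))\<^sup>2"
    if "t \<in> {0..T}" "\<omega> \<in> space P" for t \<omega> y1 y2 z1 z2
    by (rule data_hypsD(6)[OF H1 that], rule data_hypsD(6)[OF H2 that], rule data_hypsD(7)[OF H1 that])
  define F1 where "F1 = (\<lambda>x. f1 (fst x) (snd x) (Y1 (fst x) (snd x)) (Z1 (fst x) (snd x)))"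
  define F2 where "F2 = (\<lambda>x. f2 (fst x) (snd x) (Y2 (fst x) (snd x)) (Z2 (fst x) (snd x)))"
  have sF: "sqint ?Q F1" "sqint ?Q F2" unfolding F1_def F2_def by (rule s1(3), rule s2(3))
  have fint: "integrable ?Q h" if "sqint ?Q h" for h :: "real \<times> ('a \<times> 'b) \<Rightarrow> real"
    by (rule finite_measure.sqint_integrable[OF wn.finite_measure_Q that])
  \<comment> \<open>The obstacles are ordered for almost every time only, but the comparison of
    \<open>Y1 - Y2\<close> with \<open>Y1 - S1\<close> is needed at every time; continuity of the
    obstacles bridges this.\<close>
  have SS: "AE \<omega> in P. \<forall>s\<in>{0..T}. 0 \<le> S2 s \<omega> - S1 s \<omega>"
  proof (rule AE_all_times[OF T0])
    show "AE t in lborel. t \<in> {0..T} \<longrightarrow> (AE \<omega> in P. 0 \<le> S2 t \<omega> - S1 t \<omega>)"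
      using assms(14) by simp
  qed (intro continuous_intros cY)
  have YS: "AE \<omega> in P. S1 r \<omega> \<le> Y1 r \<omega>" "AE \<omega> in P. S2 r \<omega> \<le> Y2 r \<omega>" if "r \<in> {0..T}" for r
    by (rule rbdsde_solutionD(3)[OF sol1 that], rule rbdsde_solutionD(3)[OF sol2 that])
  \<comment> \<open>The gap \<open>Y1 - S1\<close> plays the role of \<open>U\<close>, so its
    Skorokhod condition is exactly that of the first solution; of \<open>K2\<close> only
    monotonicity enters through the sign of its term.\<close>
  interpret ito_eq P T "\<lambda>u v. w.Gfwd u" w.incr "\<lambda>u v. b.Gbwd v" b.incr
    "\<lambda>t \<omega>. Y1 t \<omega> - Y2 t \<omega>" "\<lambda>t \<omega>. Y1 t \<omega> - S1 t \<omega>" K1 K2 "\<lambda>\<omega>. D1 \<omega> + D2 \<omega>" "\<lambda>\<omega>. D1 \<omega> + DS \<omega>"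
    "\<lambda>\<omega>. \<xi>1 \<omega> - \<xi>2 \<omega>" "\<lambda>x. Z1 (fst x) (snd x) - Z2 (fst x) (snd x)"
    "\<lambda>x. g (fst x) (snd x) (Y1 (fst x) (snd x)) (Z1 (fst x) (snd x)) - g (fst x) (snd x) (Y2 (fst x) (snd x)) (Z2 (fst x) (snd x))"
    "\<lambda>x. F1 x - F2 x" "\<lambda>r \<omega>. IW1 r \<omega> - IW2 r \<omega>" "\<lambda>r \<omega>. IB1 r \<omega> - IB2 r \<omega>"
  proof
    show "0 < T" by (rule T0)
    show "continuous_on {0..T} (\<lambda>t. Y1 t \<omega> - Y2 t \<omega>)" "continuous_on {0..T} (\<lambda>t. Y1 t \<omega> - S1 t \<omega>)" if "\<omega> \<in> space P" for \<omega>
      by (rule continuous_on_diff[OF cY(1)[OF that] cY(2)[OF that]], rule continuous_on_diff[OF cY(1)[OF that] cY(3)[OF that]])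
    show "(\<lambda>\<omega>. Y1 t \<omega> - Y2 t \<omega>) \<in> borel_measurable (w.Gfwd t)" if "0 \<le> t" "t \<le> v" "v \<le> T" for t v
      using mY[of t] that by (intro borel_measurable_diff F_meas(1)) auto
    show "(\<lambda>\<omega>. Y1 t \<omega> - Y2 t \<omega>) \<in> borel_measurable (b.Gbwd t)" if "0 \<le> u" "u \<le> t" "t \<le> T" for u t
      using mY[of t] that by (intro borel_measurable_diff F_meas(2)) auto
    show "(\<lambda>\<omega>. Y1 t \<omega> - S1 t \<omega>) \<in> borel_measurable P" if "t \<in> {0..T}" for t
      using mY[OF that] by (intro borel_measurable_diff F_meas(3)) auto
    show "\<bar>Y1 t \<omega> - Y2 t \<omega>\<bar> \<le> D1 \<omega> + D2 \<omega>" "\<bar>Y1 t \<omega> - S1 t \<omega>\<bar> \<le> D1 \<omega> + DS \<omega>" if "t \<in> {0..T}" "\<omega> \<in> space P" for t \<omega>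
      using D1(2)[OF that] D2(2)[OF that] DS(2)[OF that] by linarith+
    show "sqint P (\<lambda>\<omega>. D1 \<omega> + D2 \<omega>)" "sqint P (\<lambda>\<omega>. D1 \<omega> + DS \<omega>)"
      by (rule sqint_add(1)[OF D1(1) D2(1)], rule sqint_add(1)[OF D1(1) DS(1)])
    show "wn.ITO r T (\<lambda>x. Z1 (fst x) (snd x) - Z2 (fst x) (snd x)) (\<lambda>\<omega>. IW1 r \<omega> - IW2 r \<omega>)" if "r \<in> {0..T}" for r
      by (rule wn.ITO_diff[OF _ _ I1(2)[OF that] I2(2)[OF that]]) (use that in auto)
    show "bn.ITO r T (\<lambda>x. g (fst x) (snd x) (Y1 (fst x) (snd x)) (Z1 (fst x) (snd x)) - g (fst x) (snd x) (Y2 (fst x) (snd x)) (Z2 (fst x) (snd x)))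
      (\<lambda>\<omega>. IB1 r \<omega> - IB2 r \<omega>)" if "r \<in> {0..T}" for r
      by (rule bn.ITO_diff[OF _ _ I1(1)[OF that] I2(1)[OF that]]) (use that in auto)
    show "sqint ?Q (\<lambda>x. F1 x - F2 x)" by (rule sqint_diff(1)[OF sF])
    show "continuous_on {0..T} (\<lambda>t. K1 t \<omega>) \<and> mono_on {0..T} (\<lambda>t. K1 t \<omega>)"
      "continuous_on {0..T} (\<lambda>t. K2 t \<omega>) \<and> mono_on {0..T} (\<lambda>t. K2 t \<omega>)" if "\<omega> \<in> space P" for \<omega> by (rule cK[OF that])+
    show "K1 t \<in> borel_measurable P" "K2 t \<in> borel_measurable P" if "t \<in> {0..T}" for t by (rule mK[OF that])+
    show "sqint P (\<lambda>\<omega>. K1 T \<omega> - K1 0 \<omega>)" "sqint P (\<lambda>\<omega>. K2 T \<omega> - K2 0 \<omega>)" by (rule s1(6), rule s2(6))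
    show "AE \<omega> in P. \<xi>1 \<omega> - \<xi>2 \<omega> \<le> 0" using assms(12) by simp
    show "AE \<omega> in P. Y1 r \<omega> - Y2 r \<omega> = \<xi>1 \<omega> - \<xi>2 \<omega> + (LINT s:{r..T}|lborel. F1 (s, \<omega>) - F2 (s, \<omega>)) + (IB1 r \<omega> - IB2 r \<omega>)
       + (K1 T \<omega> - K1 r \<omega>) - (K2 T \<omega> - K2 r \<omega>) - (IW1 r \<omega> - IW2 r \<omega>)" if r: "r \<in> {0..T}" for r
      using I1(3)[OF r] I2(3)[OF r] w.AE_set_integrable_timeprod[OF fint[OF sF(1)]] w.AE_set_integrable_timeprod[OF fint[OF sF(2)]]
    proof eventually_elim
      case (elim \<omega>)
      have "(LINT s:{r..T}|lborel. F1 (s, \<omega>) - F2 (s, \<omega>)) = (LINT s:{r..T}|lborel. F1 (s, \<omega>)) - (LINT s:{r..T}|lborel. F2 (s, \<omega>))"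
      proof (rule set_integral_diff(2))
        show "set_integrable lborel {r..T} (\<lambda>s. F1 (s, \<omega>))" by (rule set_integrable_subset[OF elim(3)]) (use r in auto)
        show "set_integrable lborel {r..T} (\<lambda>s. F2 (s, \<omega>))" by (rule set_integrable_subset[OF elim(4)]) (use r in auto)
      qed
      then show ?case using elim(1,2) by (simp add: F1_def F2_def)
    qed
    show "AE \<omega> in P. pp (Y1 r \<omega> - Y2 r \<omega>) \<le> Y1 r \<omega> - S1 r \<omega>" if r: "r \<in> {0..T}" for r
      using SS YS[OF r]
    proof eventually_elim
      case (elim \<omega>)
      \<comment> \<open>The chain
        \<open>S1 r \<omega> \<le> S2 r \<omega> \<le> Y2 r \<omega>\<close> bounds the difference
        by the gap, and \<open>S1 r \<omega> \<le> Y1 r \<omega>\<close> covers the case where the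
        positive part is zero.\<close>
      have "0 \<le> S2 r \<omega> - S1 r \<omega>" using elim(1) r by blast
      then show ?case using elim(2,3) by (simp add: pp_def)
    qed
    show "AE \<omega> in P. (LINT s:{0..T}|interval_measure (\<lambda>s. K1 (max 0 (min T s)) \<omega>). Y1 s \<omega> - S1 s \<omega>) = 0"
      by (rule rbdsde_solutionD(4)[OF sol1])
  qed
  have DQ: "\<bar>Y1 (fst x) (snd x)\<bar> \<le> D1 (snd x)" "\<bar>Y2 (fst x) (snd x)\<bar> \<le> D2 (snd x)" if "x \<in> space ?Q" for x
    using that by (auto intro!: D1(2) D2(2))
  have m21: "sqint ?Q (\<lambda>x. f2 (fst x) (snd x) (Y1 (fst x) (snd x)) (Z1 (fst x) (snd x)))"
    by (rule data_sqint(1)[OF H2 s1(1) s1(2) D1(1) DQ(1)])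
  have m12: "sqint ?Q (\<lambda>x. f1 (fst x) (snd x) (Y2 (fst x) (snd x)) (Z2 (fst x) (snd x)))"
    by (rule data_sqint(1)[OF H1 s2(1) s2(2) D2(1) DQ(2)])
  have Ym: "(\<lambda>x. Y1 (fst x) (snd x) - Y2 (fst x) (snd x)) \<in> borel_measurable ?Q"
    by (rule borel_measurable_diff[OF s1(1) s2(1)])
  have Gb: "AE x in ?Q. (norm (g (fst x) (snd x) (Y1 (fst x) (snd x)) (Z1 (fst x) (snd x)) - g (fst x) (snd x) (Y2 (fst x) (snd x)) (Z2 (fst x) (snd x))))\<^sup>2
     \<le> \<rho> (fst x) ((Y1 (fst x) (snd x) - Y2 (fst x) (snd x))\<^sup>2) + \<alpha> * (norm (Z1 (fst x) (snd x) - Z2 (fst x) (snd x)))\<^sup>2"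
    by (rule AE_I2) (auto intro!: lip(3))
  \<comment> \<open>Each alternative inserts one mixed value: \<open>f2\<close> at the first
    solution, or \<open>f1\<close> at the second. The hypothesis compares it with a true generator
    value, and the growth condition of \<open>f2\<close>, respectively \<open>f1\<close>, bounds the
    remaining difference.\<close>
  have "AE \<omega> in P. Y1 t \<omega> - Y2 t \<omega> \<le> 0"
    using assms(13)
  proof
    assume "AE t in lborel. t \<in> {0..T} \<longrightarrow> (AE \<omega> in P. f1 t \<omega> (Y1 t \<omega>) (Z1 t \<omega>) \<le> f2 t \<omega> (Y1 t \<omega>) (Z1 t \<omega>))"
    then have "AE x in ?Q. F1 x \<le> f2 (fst x) (snd x) (Y1 (fst x) (snd x)) (Z1 (fst x) (snd x))"
      by (intro AE_timeprod_le sqint_meas sF m21) (simp add: F1_def)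
    then have le: "AE x in ?Q. F1 x - F2 x \<le> f2 (fst x) (snd x) (Y1 (fst x) (snd x)) (Z1 (fst x) (snd x)) - F2 x" by simp
    show ?thesis
      by (rule pos_part_zero[OF A C al Ym le _ Gb t], rule AE_I2) (auto simp: F2_def intro!: lip(2))
  next
    assume "AE t in lborel. t \<in> {0..T} \<longrightarrow> (AE \<omega> in P. f1 t \<omega> (Y2 t \<omega>) (Z2 t \<omega>) \<le> f2 t \<omega> (Y2 t \<omega>) (Z2 t \<omega>))"
    then have "AE x in ?Q. f1 (fst x) (snd x) (Y2 (fst x) (snd x)) (Z2 (fst x) (snd x)) \<le> F2 x"
      by (intro AE_timeprod_le sqint_meas sF m12) (simp add: F2_def)
    then have le: "AE x in ?Q. F1 x - F2 x \<le> F1 x - f1 (fst x) (snd x) (Y2 (fst x) (snd x)) (Z2 (fst x) (snd x))" by simp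
    show ?thesis
      by (rule pos_part_zero[OF A C al Ym le _ Gb t], rule AE_I2) (auto simp: F1_def intro!: lip(1))
  qed
  then show "AE \<omega> in prodP M1 M2. Y1 t \<omega> \<le> Y2 t \<omega>" by simp
qed

end
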